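(* Let $k$ be a field, $S=k[x,y,z]$, $m=(x,y,z)$ and $d\ge 1$. For every choice of removing exactly one edge from each down triangle in the triangular complex $\Gamma$ of $m^d$, with resulting polyhedral cell complex $\Delta$, there exists a polarization $I$ of $m^d$ such that $\Delta$ (with the vertex corresponding to a monomial $u$ of degree $d$ labeled by the generator of $I$ that depolarizes to $u$) supports a minimal free cellular resolution of $I$, and therefore also (after depolarizing the labels) of $m^d$. Furthermore, every minimal free cellular resolution of $m^d$ comes from such a polarization, i.e. it is the resolution obtained by depolarizing the cellular resolution supported on $\Delta$ of such a polarization $I$, for some choice of one removed edge from each down triangle.
   Context: Polarization: Let $J$ be a monomial ideal in $k[x_1,\dots,x_n]$. A polarization of $J$ is a square-free monomial ideal $\widetilde J$ in $\widetilde S=k[x_i^{(j)} : 1\le i\le n,\ 1\le j\le r_i]$ such that the sequence $\sigma$ consisting of all $x_i^{(1)}-x_i^{(j)}$ ($1\le i\le n$, $2\le j\le r_i$) is a regular $\widetilde S/\widetilde J$-sequence and $\widetilde J\otimes \widetilde S/(\sigma)\cong J$ (that is, substituting $x_i^{(j)}\mapsto x_i$ carries $\widetilde J$ to $J$). This substitution $\widetilde J\to J$ is called depolarization. The complex $\Gamma$: its vertices are the monomials of degree $d$ in $x,y,z$ (the minimal generators of $m^d$); two vertices are joined by an edge iff their least common multiple has degree $d+1$. Drawn in the plane this is a triangular grid. Its 2-cells are the small triangles: the up triangles $\{ux,uy,uz\}$, one for each monomial $u$ of degree $d-1$, and the down triangles $\{uxy,uxz,uyz\}$, one for each monomial $u$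 of degree $d-2$. The complex $\Delta$: given a choice of one edge of each down triangle, $\Delta$ is the polyhedral cell complex whose 0- and 1-cells form the planar graph obtained from the graph of $\Gamma$ by deleting all the chosen edges, and whose 2-cells are the bounded regions of this planar graph (regarded as combinatorial polygons). Cellular resolutions: given a polyhedral cell complex $X$ with vertices labeled by monomials, each face $F$ is labeled by the lcm $\mathbf x^{\mathbf a_F}$ of its vertex labels (the empty face by $1$). The cellular free complex is $\mathcal F_X=\bigoplus_{F\in X}S(-\mathbf a_F)$ with differential $\partial(F)=\sum_{G\text{ facet of }F}\mathrm{sign}(G,F)\,\mathbf x^{\mathbf a_F-\mathbf a_G}G$. If $\mathcal F_X$ is acyclic (homology only in degree $0$), it is called a cellular resolution (of the ideal generated by the vertex labels), and $X$ is said to support it. *)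

theory Defs
  imports
    "HOL-Library.Multiset"
    "HOL-Library.Poly_Mapping"
    "HOL-Algebra.Ideal_Product"
    "HOL-Analysis.Analysis"
begin

section \<open>Polynomial rings\<close>

text \<open>A monomial is a finite multiset of variables: the product of monomials is \<open>+\<close>, divisibility is
  \<open>\<subseteq>#\<close>, the degree is \<open>size\<close>, the exponent of a variable is \<open>count\<close> and the lcm of a finite set of
  monomials is \<open>Sup\<close> (with \<open>Sup {} = {#}\<close>, the monomial 1). Polynomials are the
  monoid algebra over the free commutative monoid of monomials. The ring \<open>poly_ring A\<close> is the
  subring \<open>k[A]\<close> of those polynomials that involve only variables from \<open>A\<close>.\<close>

type_synonym ('x, 'k) mpoly = "'x multiset \<Rightarrow>\<^sub>0 'k"

definition mon :: "'x multiset \<Rightarrow> ('x, 'k::comm_ring_1) mpoly" where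
  "mon a = Poly_Mapping.single a 1"

definition poly_ring :: "'x set \<Rightarrow> ('x, 'k::comm_ring_1) mpoly ring" where
  "poly_ring A =
    \<lparr>carrier = {p. \<forall>a \<in> Poly_Mapping.keys p. set_mset a \<subseteq> A},
     monoid.mult = (*), one = 1, zero = 0, add = (+)\<rparr>"

definition irrelevant_ideal :: "'x set \<Rightarrow> ('x, 'k::comm_ring_1) mpoly set" where
  "irrelevant_ideal A = Idl\<^bsub>poly_ring A\<^esub> ((\<lambda>x. mon {#x#}) ` A)"

definition irrelevant_power :: "'x set \<Rightarrow> nat \<Rightarrow> ('x, 'k::comm_ring_1) mpoly set" where
  "irrelevant_power A d = irrelevant_ideal A [^]\<^bsub>ideals_set (poly_ring A)\<^esub> d"

definition min_gens :: "('x, 'k::comm_ring_1) mpoly set \<Rightarrow> 'x multiset set" where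
  "min_gens J = {a. mon a \<in> J \<and> (\<forall>b. mon b \<in> J \<longrightarrow> b \<subseteq># a \<longrightarrow> b = a)}"

definition squarefree_monomial_ideal :: "'x set \<Rightarrow> ('x, 'k::comm_ring_1) mpoly set \<Rightarrow> bool" where
  "squarefree_monomial_ideal A J \<longleftrightarrow>
    (\<exists>M. (\<forall>a \<in> M. set_mset a \<subseteq> A \<and> (\<forall>x. count a x \<le> 1)) \<and> J = Idl\<^bsub>poly_ring A\<^esub> (mon ` M))"

text \<open>\<open>fs\<close> is a regular \<open>R/J\<close>-sequence.\<close>

definition regular_sequence :: "('a, 'b) ring_scheme \<Rightarrow> 'a set \<Rightarrow> 'a list \<Rightarrow> bool" where
  "regular_sequence R J fs \<longleftrightarrow>
    set fs \<subseteq> carrier R \<and>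
    (\<forall>i < length fs. \<forall>p \<in> carrier R.
       fs ! i \<otimes>\<^bsub>R\<^esub> p \<in> Idl\<^bsub>R\<^esub> (J \<union> set (take i fs)) \<longrightarrow> p \<in> Idl\<^bsub>R\<^esub> (J \<union> set (take i fs))) \<and>
    Idl\<^bsub>R\<^esub> (J \<union> set fs) \<noteq> carrier R"


section \<open>Polarizations\<close>

text \<open>The pair \<open>(i, j)\<close> stands for the variable \<open>x\<^sub>i\<^sup>(\<^sup>j\<^sup>)\<close>.\<close>

definition polvars :: "('x \<Rightarrow> nat) \<Rightarrow> ('x \<times> nat) set" where
  "polvars r = {(i, j). 1 \<le> j \<and> j \<le> r i}"

definition depol_mon :: "('x \<times> nat) multiset \<Rightarrow> 'x multiset" where
  "depol_mon a = image_mset fst a"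

definition depolarize :: "('x \<times> nat, 'k::comm_ring_1) mpoly \<Rightarrow> ('x, 'k) mpoly" where
  "depolarize p = (\<Sum>a \<in> Poly_Mapping.keys p. Poly_Mapping.single (depol_mon a) (Poly_Mapping.lookup p a))"

definition pol_differences :: "('x \<Rightarrow> nat) \<Rightarrow> ('x \<times> nat, 'k::comm_ring_1) mpoly set" where
  "pol_differences r = {mon {#(i, 1)#} - mon {#(i, j)#} | i j. 2 \<le> j \<and> j \<le> r i}"

text \<open>The order of the (finitely many) differences is immaterial for regularity, since everything
  is graded; the definition asks for regularity in every order.\<close>

definition polarization ::
  "('x::finite \<Rightarrow> nat) \<Rightarrow> ('x \<times> nat, 'k::field) mpoly set \<Rightarrow> ('x, 'k) mpoly set \<Rightarrow> bool" where
  "polarization r I J \<longleftrightarrow>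
    (\<forall>i. 1 \<le> r i) \<and>
    squarefree_monomial_ideal (polvars r) I \<and>
    (\<forall>s. distinct s \<and> set s = pol_differences r \<longrightarrow> regular_sequence (poly_ring (polvars r)) I s) \<and>
    depolarize ` I = J"


section \<open>Polyhedral cell complexes and cellular resolutions\<close>

text \<open>A face is given by its set of vertices. The faces below a face \<open>F\<close> are the vertex sets of the
  faces of a convex polytope with vertex set \<open>p ` F\<close>, and two faces meet in a common face. The cells
  are only combinatorial polytopes: the realizations \<open>p\<close> of different cells are unrelated. The
  first argument is the Euclidean space in which the polytopes live.\<close>

definition polyhedral_complex :: "'a::euclidean_space itself \<Rightarrow> 'v set set \<Rightarrow> bool" where
  "polyhedral_complex _ X \<longleftrightarrow>
    finite X \<and> {} \<in> X \<and>
    (\<forall>F \<in> X. finite F \<and> (\<forall>v \<in> F. {v} \<in> X)) \<and>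
    (\<forall>F \<in> X. \<exists>p :: 'v \<Rightarrow> 'a.
       {G \<in> X. G \<subseteq> F} = {{v \<in> F. p v \<in> T} | T. T face_of (convex hull (p ` F))}) \<and>
    (\<forall>F \<in> X. \<forall>G \<in> X. F \<inter> G \<in> X)"

definition facet :: "'v set set \<Rightarrow> 'v set \<Rightarrow> 'v set \<Rightarrow> bool" where
  "facet X F G \<longleftrightarrow> F \<in> X \<and> G \<in> X \<and> G \<subset> F \<and> \<not> (\<exists>H \<in> X. G \<subset> H \<and> H \<subset> F)"

text \<open>The dimension of a face plus 1 (the empty face has dimension -1). Face lattices
  of polytopes are graded, so it is the length of a longest chain of faces properly below it.\<close>

definition hdeg :: "'v set set \<Rightarrow> 'v set \<Rightarrow> nat" where
  "hdeg X F = Max (card ` {C. C \<subseteq> {G \<in> X. G \<subset> F} \<and> chain_subset C})"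

text \<open>Incidence functions in the usual sense for regular cell complexes; \<open>\<epsilon> F G\<close> is
  \<open>sign(G, F)\<close>.\<close>

definition incidence_function :: "'v set set \<Rightarrow> ('v set \<Rightarrow> 'v set \<Rightarrow> int) \<Rightarrow> bool" where
  "incidence_function X \<epsilon> \<longleftrightarrow>
    (\<forall>F \<in> X. \<forall>G \<in> X. if facet X F G then \<epsilon> F G \<in> {1, -1} else \<epsilon> F G = 0) \<and>
    (\<forall>v. {v} \<in> X \<longrightarrow> \<epsilon> {v} {} = 1) \<and>
    (\<forall>F \<in> X. \<forall>G \<in> X. (\<Sum>H \<in> X. \<epsilon> F H * \<epsilon> H G) = 0)"

definition face_label :: "('v \<Rightarrow> 'x multiset) \<Rightarrow> 'v set \<Rightarrow> 'x multiset" where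
  "face_label lab F = Sup (lab ` F)"

text \<open>Chains in homological degree \<open>i\<close> of the cellular free complex over \<open>k[A]\<close>: the free module on
  the faces of dimension \<open>i - 1\<close>, elements being given by their coefficient functions. The
  multigrading shifts play no role for acyclicity and are left out.\<close>

definition cell_chains :: "'x set \<Rightarrow> 'v set set \<Rightarrow> nat \<Rightarrow> ('v set \<Rightarrow> ('x, 'k::comm_ring_1) mpoly) set" where
  "cell_chains A X i =
    {e. (\<forall>F. e F \<in> carrier (poly_ring A)) \<and> (\<forall>F. e F \<noteq> 0 \<longrightarrow> F \<in> X \<and> hdeg X F = i)}"

definition cell_entry ::
  "'v set set \<Rightarrow> ('v set \<Rightarrow> 'v set \<Rightarrow> int) \<Rightarrow> ('v \<Rightarrow> 'x multiset) \<Rightarrow> 'v set \<Rightarrow> 'v set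
    \<Rightarrow> ('x, 'k::comm_ring_1) mpoly" where
  "cell_entry X \<epsilon> lab F G =
    (if facet X F G then of_int (\<epsilon> F G) * mon (face_label lab F - face_label lab G) else 0)"

definition cell_boundary ::
  "'v set set \<Rightarrow> ('v set \<Rightarrow> 'v set \<Rightarrow> int) \<Rightarrow> ('v \<Rightarrow> 'x multiset)
    \<Rightarrow> ('v set \<Rightarrow> ('x, 'k::comm_ring_1) mpoly) \<Rightarrow> ('v set \<Rightarrow> ('x, 'k) mpoly)" where
  "cell_boundary X \<epsilon> lab e = (\<lambda>G. \<Sum>F \<in> X. e F * cell_entry X \<epsilon> lab F G)"

text \<open>\<open>J\<close> is the ideal of \<open>k[A]\<close> generated by the vertex labels, so that the cokernel of the
  complex in homological degree 0 (the degree of the empty face) is \<open>k[A]/J\<close>.\<close>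

definition cellular_resolution ::
  "'a::euclidean_space itself \<Rightarrow> 'x set \<Rightarrow> 'v set set \<Rightarrow> ('v set \<Rightarrow> 'v set \<Rightarrow> int)
    \<Rightarrow> ('v \<Rightarrow> 'x multiset) \<Rightarrow> ('x, 'k::field) mpoly set \<Rightarrow> bool" where
  "cellular_resolution E A X \<epsilon> lab J \<longleftrightarrow>
    polyhedral_complex E X \<and> incidence_function X \<epsilon> \<and>
    (\<forall>v \<in> \<Union>X. set_mset (lab v) \<subseteq> A) \<and>
    J = Idl\<^bsub>poly_ring A\<^esub> ((\<lambda>v. mon (lab v)) ` \<Union>X) \<and>
    (\<forall>i \<ge> 1. \<forall>e \<in> (cell_chains A X i :: ('v set \<Rightarrow> ('x, 'k) mpoly) set).
       cell_boundary X \<epsilon> lab e = (\<lambda>_. 0) \<longrightarrow>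
       (\<exists>e' \<in> cell_chains A X (i + 1). cell_boundary X \<epsilon> lab e' = e))"

text \<open>Minimality: all entries of the differentials lie in the ideal generated by the variables.\<close>

definition minimal_cellular_resolution ::
  "'a::euclidean_space itself \<Rightarrow> 'x set \<Rightarrow> 'v set set \<Rightarrow> ('v set \<Rightarrow> 'v set \<Rightarrow> int)
    \<Rightarrow> ('v \<Rightarrow> 'x multiset) \<Rightarrow> ('x, 'k::field) mpoly set \<Rightarrow> bool" where
  "minimal_cellular_resolution E A X \<epsilon> lab J \<longleftrightarrow>
    cellular_resolution E A X \<epsilon> lab J \<and>
    (\<forall>F G. (cell_entry X \<epsilon> lab F G :: ('x, 'k) mpoly) \<in> irrelevant_ideal A)"

text \<open>An isomorphism of labeled cell complexes compatible with the incidence functions; it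
  identifies the two cellular free complexes, including bases and differentials.\<close>

definition labeled_iso ::
  "'v set set \<Rightarrow> ('v set \<Rightarrow> 'v set \<Rightarrow> int) \<Rightarrow> ('v \<Rightarrow> 'x multiset)
    \<Rightarrow> 'w set set \<Rightarrow> ('w set \<Rightarrow> 'w set \<Rightarrow> int) \<Rightarrow> ('w \<Rightarrow> 'x multiset) \<Rightarrow> ('v \<Rightarrow> 'w) \<Rightarrow> bool" where
  "labeled_iso X \<epsilon> lab Y \<epsilon>' lab' \<phi> \<longleftrightarrow>
    inj_on \<phi> (\<Union>X) \<and> (\<lambda>F. \<phi> ` F) ` X = Y \<and>
    (\<forall>v \<in> \<Union>X. lab' (\<phi> v) = lab v) \<and>
    (\<forall>F \<in> X. \<forall>G \<in> X. \<epsilon>' (\<phi> ` F) (\<phi> ` G) = \<epsilon> F G)"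


section \<open>The complexes on the monomials of degree d in three variables\<close>

datatype xyz = Vx | Vy | Vz

instance xyz :: finite
proof
  have "(UNIV :: xyz set) = {Vx, Vy, Vz}"
    using xyz.exhaust by blast
  then show "finite (UNIV :: xyz set)"
    by (metis finite.emptyI finite.insertI)
qed

definition monomials :: "nat \<Rightarrow> xyz multiset set" where
  "monomials d = {a. size a = d}"

definition Gamma_edges :: "nat \<Rightarrow> xyz multiset set set" where
  "Gamma_edges d =
    {{a, b} | a b. a \<in> monomials d \<and> b \<in> monomials d \<and> size (a \<union># b) = d + 1}"

definition down_triangle :: "xyz multiset \<Rightarrow> xyz multiset set" where
  "down_triangle u = {u + {#Vx, Vy#}, u + {#Vx, Vz#}, u + {#Vy, Vz#}}"

text \<open>The down triangles of the complex in degree \<open>d\<close> are indexed by the monomials of degree \<open>d - 2\<close>;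
  there are none for \<open>d = 1\<close>. A choice assigns to each of them one of its edges.\<close>

definition edge_choice :: "nat \<Rightarrow> (xyz multiset \<Rightarrow> xyz multiset set) \<Rightarrow> bool" where
  "edge_choice d c \<longleftrightarrow> (\<forall>u. size u + 2 = d \<longrightarrow> c u \<subseteq> down_triangle u \<and> card (c u) = 2)"

definition Delta_edges :: "nat \<Rightarrow> (xyz multiset \<Rightarrow> xyz multiset set) \<Rightarrow> xyz multiset set set" where
  "Delta_edges d c = Gamma_edges d - {c u | u. size u + 2 = d}"

text \<open>The triangular grid in the plane, in affine coordinates: the third exponent is determined by
  the other two.\<close>

definition position :: "xyz multiset \<Rightarrow> real \<times> real" where
  "position a = (real (count a Vx), real (count a Vy))"

definition Delta_drawing :: "nat \<Rightarrow> (xyz multiset \<Rightarrow> xyz multiset set) \<Rightarrow> (real \<times> real) set" where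
  "Delta_drawing d c =
    position ` monomials d \<union> (\<Union>e \<in> Delta_edges d c. convex hull (position ` e))"

definition Delta_regions ::
  "nat \<Rightarrow> (xyz multiset \<Rightarrow> xyz multiset set) \<Rightarrow> (real \<times> real) set set" where
  "Delta_regions d c = {R \<in> components (- Delta_drawing d c). bounded R}"

definition Delta :: "nat \<Rightarrow> (xyz multiset \<Rightarrow> xyz multiset set) \<Rightarrow> xyz multiset set set" where
  "Delta d c =
    {{}} \<union> {{a} | a. a \<in> monomials d} \<union> Delta_edges d c \<union>
    (\<lambda>R. {a \<in> monomials d. position a \<in> frontier R}) ` Delta_regions d c"

definition generator_labeling ::
  "nat \<Rightarrow> (xyz \<times> nat, 'k::field) mpoly set \<Rightarrow> (xyz multiset \<Rightarrow> (xyz \<times> nat) multiset) \<Rightarrow> bool" where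
  "generator_labeling d I g \<longleftrightarrow>
    bij_betw g (monomials d) (min_gens I) \<and> (\<forall>a \<in> monomials d. depol_mon (g a) = a)"

end

theory Submission
  imports Defs
begin

text \<open>The labels of the cells of \<open>\<Delta>\<close> are \<open>1\<close>, the monomials of degree \<open>d\<close>, the labels \<open>u \<cdot> xy\<close>, \<open>u \<cdot> xz\<close>,
  \<open>u \<cdot> yz\<close> of the edges and the labels \<open>u \<cdot> xyz\<close> of the regions, one region for each \<open>u\<close> of degree
  \<open>d - 1\<close>: the up triangle \<open>u\<close> together with the down triangles merged into it. Acyclicity reduces to
  exactness over \<open>k\<close> of the subcomplexes of cells whose labels divide a given monomial. There a flow
  on the edges that is conserved at every vertex is a sum of boundaries of up and down triangles in
  the full grid, and vanishing on the removed edges turns it into a unique sum of region boundaries.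

  Exactness only depends on which sets of vertex labels divide a common monomial. The standard
  polarization, with \<open>x\<^sub>i\<^sup>(\<^sup>1\<^sup>) \<cdots> x\<^sub>i\<^sup>(\<^sup>a\<^sup>)\<close> in place of \<open>x\<^sub>i\<^sup>a\<close>, does not change
  this, so it serves for every choice of removed edges.

  Conversely, in a minimal resolution a cycle cannot involve a cell whose label is the bound of the
  cycle. Comparing with a chain or cycle of smaller labels, this forces the edges to be grid
  edges, exactly one edge of every down triangle to be missing, the 2-cells to have label of
  degree \<open>d + 2\<close> and to be the regions, and, regions being linearly independent, excludes cells of
  higher dimension.\<close>

section \<open>Monomial ideals\<close>

text \<open>Every grid edge borders exactly one up triangle and at most one down triangle. Hence the
  removed edge of a down triangle opens it into one up triangle and never into another down
  triangle, so a region consists of one up triangle and at most three down triangles. The values of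
  a function \<open>rm\<close> at the monomials of degree d - 2 therefore encode a choice of edges,
  and the combinatorics becomes arithmetic of exponents. As a planar set a region is convex and cut
  out by inequalities between exponents, which yields the components of the complement of the
  drawing without general facts about planar graphs. But a boundary vertex may lie in the middle of
  a straight side, so the planar shape does not realize the combinatorial polygon; points on a
  parabola do. In the converse neither the signs nor the realizations of the given resolution are
  known. The facts about flows are therefore stated for an arbitrary incidence function, with one
  sign per edge and one scalar per region.\<close>

lemma sum_single_lookup: "(\<Sum>a\<in>Poly_Mapping.keys p. Poly_Mapping.single a (Poly_Mapping.lookup p a)) = p"
  by (rule poly_mapping_eqI) (simp add: lookup_sum lookup_single when_def in_keys_iff)

lemma lookup_times_single:
  fixes p :: "('x, 'k::comm_ring_1) mpoly"
  shows "Poly_Mapping.lookup (p * Poly_Mapping.single c k) n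
    = (if c \<subseteq># n then Poly_Mapping.lookup p (n - c) * k else 0)"
proof -
  have eq: "p * Poly_Mapping.single c k
      = (\<Sum>a\<in>Poly_Mapping.keys p. Poly_Mapping.single (a + c) (Poly_Mapping.lookup p a * k))"
    by (subst sum_single_lookup[of p, symmetric]) (simp add: sum_distrib_right mult_single)
  have iff: "a + c = n \<longleftrightarrow> c \<subseteq># n \<and> a = n - c" for a
    by auto
  show ?thesis
    unfolding eq by (auto simp: lookup_sum lookup_single when_def iff in_keys_iff)
qed

lemma keys_times_subset:
  fixes p q :: "('x, 'k::comm_ring_1) mpoly"
  shows "a \<in> Poly_Mapping.keys (p * q) \<Longrightarrow> \<exists>b\<in>Poly_Mapping.keys p. \<exists>c\<in>Poly_Mapping.keys q. a = b + c"
  using keys_mult[of p q] by blast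

lemma keys_mon [simp]: "Poly_Mapping.keys (mon a :: ('x, 'k::comm_ring_1) mpoly) = {a}"
  by (simp add: mon_def)

lemma mon_empty [simp]: "(mon {#} :: ('x, 'k::comm_ring_1) mpoly) = 1"
  by (simp add: mon_def flip: single_one)

lemma mon_add: "(mon (a + b) :: ('x, 'k::comm_ring_1) mpoly) = mon a * mon b"
  by (simp add: mon_def mult_single)

lemma mon_add_mset: "(mon (add_mset x a) :: ('x, 'k::comm_ring_1) mpoly) = mon {#x#} * mon a"
  by (simp flip: mon_add)

lemma single_times_mon: "Poly_Mapping.single a k * mon b = Poly_Mapping.single (a + b) k"
  by (simp add: mon_def mult_single)

lemma sum_mem_closed:
  assumes "0 \<in> J" "\<And>p q. p \<in> J \<Longrightarrow> q \<in> J \<Longrightarrow> p + q \<in> J"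
    and "\<And>i. i \<in> S \<Longrightarrow> f i \<in> J"
  shows "sum f S \<in> J"
  using assms(3) by (induction S rule: infinite_finite_induct) (auto intro: assms)

lemma poly_mem_closed:
  fixes p :: "('x, 'k::comm_ring_1) mpoly"
  assumes "0 \<in> J" "\<And>p q. p \<in> J \<Longrightarrow> q \<in> J \<Longrightarrow> p + q \<in> J"
    and "\<And>a. a \<in> Poly_Mapping.keys p \<Longrightarrow> Poly_Mapping.single a (Poly_Mapping.lookup p a) \<in> J"
  shows "p \<in> J"
proof -
  have "(\<Sum>a\<in>Poly_Mapping.keys p. Poly_Mapping.single a (Poly_Mapping.lookup p a)) \<in> J"
    by (rule sum_mem_closed) (use assms in blast)+
  then show ?thesis by (simp only: sum_single_lookup)
qed

lemma carrier_poly_ring: "p \<in> carrier (poly_ring A) \<longleftrightarrow> (\<forall>a\<in>Poly_Mapping.keys p. set_mset a \<subseteq> A)"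
  by (simp add: poly_ring_def)

lemma poly_ring_simps [simp]:
  "monoid.mult (poly_ring A) = (*)" "one (poly_ring A) = 1" "zero (poly_ring A) = 0" "add (poly_ring A) = (+)"
  by (simp_all add: poly_ring_def)

lemma carrier_poly_ring_closed [intro]:
  "0 \<in> carrier (poly_ring A)" "1 \<in> carrier (poly_ring A)"
  "p \<in> carrier (poly_ring A) \<Longrightarrow> q \<in> carrier (poly_ring A) \<Longrightarrow> p + q \<in> carrier (poly_ring A)"
  "p \<in> carrier (poly_ring A) \<Longrightarrow> q \<in> carrier (poly_ring A) \<Longrightarrow> p * q \<in> carrier (poly_ring A)"
  "p \<in> carrier (poly_ring A) \<Longrightarrow> - p \<in> carrier (poly_ring A)"
  "p \<in> carrier (poly_ring A) \<Longrightarrow> q \<in> carrier (poly_ring A) \<Longrightarrow> p - q \<in> carrier (poly_ring A)"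
proof -
  show "0 \<in> carrier (poly_ring A)" "1 \<in> carrier (poly_ring A)"
    by (simp_all add: carrier_poly_ring)
  assume p: "p \<in> carrier (poly_ring A)"
  then show "- p \<in> carrier (poly_ring A)"
    by (simp add: carrier_poly_ring)
  assume q: "q \<in> carrier (poly_ring A)"
  show "p + q \<in> carrier (poly_ring A)" "p - q \<in> carrier (poly_ring A)"
    using p q keys_add[of p q] keys_diff[of p q] unfolding carrier_poly_ring by blast+
  show "p * q \<in> carrier (poly_ring A)"
    using p q by (fastforce simp: carrier_poly_ring dest!: keys_times_subset)
qed

lemma carrier_poly_ring_mon [simp]:
  "(mon a :: ('x, 'k::comm_ring_1) mpoly) \<in> carrier (poly_ring A) \<longleftrightarrow> set_mset a \<subseteq> A"
  by (simp add: carrier_poly_ring)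

lemma cring_poly_ring: "cring (poly_ring A :: ('x, 'k::comm_ring_1) mpoly ring)"
proof (rule cringI)
  show "abelian_group (poly_ring A :: ('x, 'k) mpoly ring)"
  proof (rule abelian_groupI, goal_cases)
    case (6 x)
    then show ?case by (intro bexI[of _ "- x"]) auto
  qed (auto simp: algebra_simps)
  show "Group.comm_monoid (poly_ring A :: ('x, 'k) mpoly ring)"
    by (rule comm_monoidI) (auto simp: algebra_simps)
qed (auto simp: algebra_simps)

lemma ring_poly_ring: "ring (poly_ring A :: ('x, 'k::comm_ring_1) mpoly ring)"
  using cring_poly_ring by (rule cring.axioms)

text \<open>Passes from the operations of the ring record to the ordinary operations on polynomials.
  Closure under negation comes from multiplication by - 1.\<close>

lemma ideal_poly_ringD:
  assumes "ideal J (poly_ring A :: ('x, 'k::comm_ring_1) mpoly ring)"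
  shows "J \<subseteq> carrier (poly_ring A)" "0 \<in> J"
    "p \<in> J \<Longrightarrow> q \<in> J \<Longrightarrow> p + q \<in> J"
    "p \<in> J \<Longrightarrow> q \<in> carrier (poly_ring A) \<Longrightarrow> p * q \<in> J"
    "p \<in> J \<Longrightarrow> q \<in> carrier (poly_ring A) \<Longrightarrow> q * p \<in> J"
    "p \<in> J \<Longrightarrow> - p \<in> J"
proof -
  interpret ideal J "poly_ring A :: ('x, 'k) mpoly ring" by fact
  show "J \<subseteq> carrier (poly_ring A)" by (rule a_subset)
  show "0 \<in> J" using additive_subgroup.zero_closed[OF is_additive_subgroup] by simp
  show "p \<in> J \<Longrightarrow> q \<in> J \<Longrightarrow> p + q \<in> J" using additive_subgroup.a_closed[OF is_additive_subgroup] by simp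
  show "p \<in> J \<Longrightarrow> q \<in> carrier (poly_ring A) \<Longrightarrow> p * q \<in> J" using I_r_closed by simp
  show l: "p \<in> J \<Longrightarrow> q \<in> carrier (poly_ring A) \<Longrightarrow> q * p \<in> J" for q using I_l_closed by simp
  show "p \<in> J \<Longrightarrow> - p \<in> J" using l[of "- 1"] by (simp add: carrier_poly_ring_closed)
qed

lemma ideal_poly_ringI:
  fixes J :: "('x, 'k::comm_ring_1) mpoly set"
  assumes "J \<subseteq> carrier (poly_ring A)" "0 \<in> J" "\<And>p q. p \<in> J \<Longrightarrow> q \<in> J \<Longrightarrow> p + q \<in> J"
    "\<And>p q. p \<in> J \<Longrightarrow> q \<in> carrier (poly_ring A) \<Longrightarrow> q * p \<in> J"
  shows "ideal J (poly_ring A)"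
proof (rule idealI)
  interpret R: ring "poly_ring A :: ('x, 'k) mpoly ring" by (rule ring_poly_ring)
  have minus: "- p \<in> J" if "p \<in> J" for p
    using assms(4)[OF that, of "- 1"] by (simp add: carrier_poly_ring_closed)
  have inv: "inv\<^bsub>add_monoid (poly_ring A)\<^esub> p = - p" if "p \<in> J" for p
  proof -
    have "\<ominus>\<^bsub>poly_ring A\<^esub> p = - p"
      using that assms(1) by (intro R.minus_equality) auto
    then show ?thesis by (simp add: a_inv_def)
  qed
  show "subgroup J (add_monoid (poly_ring A))"
    using assms inv minus by unfold_locales auto
  show "ring (poly_ring A :: ('x, 'k) mpoly ring)" by (rule ring_poly_ring)
qed (use assms in \<open>auto simp: mult.commute\<close>)

lemma genideal_poly_ring_ideal:
  "S \<subseteq> carrier (poly_ring A) \<Longrightarrow> ideal (Idl\<^bsub>poly_ring A\<^esub> S) (poly_ring A :: ('x, 'k::comm_ring_1) mpoly ring)"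
  by (rule ring.genideal_ideal[OF ring_poly_ring])

text \<open>The explicit form of a monomial ideal: membership is a condition on each monomial of the
  support separately, so questions about ideals turn into questions about supports.\<close>

definition monomial_span :: "'x set \<Rightarrow> 'x multiset set \<Rightarrow> ('x, 'k::comm_ring_1) mpoly set" where
  "monomial_span A M = {p. \<forall>a\<in>Poly_Mapping.keys p. set_mset a \<subseteq> A \<and> (\<exists>m\<in>M. m \<subseteq># a)}"

lemma ideal_monomial_span: "ideal (monomial_span A M :: ('x, 'k::comm_ring_1) mpoly set) (poly_ring A)"
proof (rule ideal_poly_ringI)
  fix p q :: "('x, 'k) mpoly"
  assume p: "p \<in> monomial_span A M"
  show "p + q \<in> monomial_span A M" if "q \<in> monomial_span A M"
    using p that keys_add[of p q] unfolding monomial_span_def by blast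
  show "q * p \<in> monomial_span A M" if "q \<in> carrier (poly_ring A)"
    unfolding monomial_span_def
  proof safe
    fix a assume "a \<in> Poly_Mapping.keys (q * p)"
    then obtain b c where bc: "b \<in> Poly_Mapping.keys q" "c \<in> Poly_Mapping.keys p" "a = b + c"
      by (blast dest: keys_times_subset)
    with p obtain m where "m \<in> M" "m \<subseteq># c" "set_mset c \<subseteq> A"
      unfolding monomial_span_def by blast
    then show "\<exists>m\<in>M. m \<subseteq># a" "\<And>x. x \<in># a \<Longrightarrow> x \<in> A"
      using bc that by (auto simp: carrier_poly_ring intro!: bexI[of _ m] subset_mset.add_increasing)
  qed
qed (auto simp: monomial_span_def carrier_poly_ring)

text \<open>A term whose monomial is divisible by a generator is a multiple of that generator, and
  the polynomials with such supports form an ideal.\<close>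

lemma genideal_monomials:
  assumes "\<And>m. m \<in> M \<Longrightarrow> set_mset m \<subseteq> A"
  shows "Idl\<^bsub>poly_ring A\<^esub> (mon ` M) = (monomial_span A M :: ('x, 'k::comm_ring_1) mpoly set)"
proof
  interpret R: ring "poly_ring A :: ('x, 'k) mpoly ring" by (rule ring_poly_ring)
  show "Idl\<^bsub>poly_ring A\<^esub> (mon ` M) \<subseteq> (monomial_span A M :: ('x, 'k) mpoly set)"
    by (rule R.genideal_minimal[OF ideal_monomial_span]) (auto simp: monomial_span_def dest: subsetD[OF assms])
  have sub: "mon ` M \<subseteq> carrier (poly_ring A :: ('x, 'k) mpoly ring)"
    by (simp add: image_subset_iff assms)
  note J = ideal_poly_ringD[OF genideal_poly_ring_ideal[OF sub]]
  show "(monomial_span A M :: ('x, 'k) mpoly set) \<subseteq> Idl\<^bsub>poly_ring A\<^esub> (mon ` M)"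
  proof
    fix p :: "('x, 'k) mpoly"
    assume p: "p \<in> monomial_span A M"
    show "p \<in> Idl\<^bsub>poly_ring A\<^esub> (mon ` M)"
    proof (rule poly_mem_closed)
      fix a assume a: "a \<in> Poly_Mapping.keys p"
      then obtain m where m: "m \<in> M" "m \<subseteq># a" and aA: "set_mset a \<subseteq> A"
        using p unfolding monomial_span_def by blast
      let ?c = "Poly_Mapping.lookup p a"
      have "Poly_Mapping.single a ?c = Poly_Mapping.single (a - m) ?c * mon m"
        using m by (simp add: single_times_mon)
      moreover have "mon m \<in> Idl\<^bsub>poly_ring A\<^esub> (mon ` M :: ('x, 'k) mpoly set)"
        using R.genideal_self[OF sub] m by auto
      moreover have "Poly_Mapping.single (a - m) ?c \<in> carrier (poly_ring A)"
        using aA by (auto simp: carrier_poly_ring dest: in_diffD)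
      ultimately show "Poly_Mapping.single a ?c \<in> Idl\<^bsub>poly_ring A\<^esub> (mon ` M)"
        using J(5) by simp
    qed (use J in auto)
  qed
qed

lemma irrelevant_ideal_eq:
  "(irrelevant_ideal A :: ('x, 'k::comm_ring_1) mpoly set) = {p. \<forall>a\<in>Poly_Mapping.keys p. set_mset a \<subseteq> A \<and> a \<noteq> {#}}"
proof -
  have "(irrelevant_ideal A :: ('x, 'k) mpoly set) = monomial_span A ((\<lambda>x. {#x#}) ` A)"
    unfolding irrelevant_ideal_def by (subst genideal_monomials[symmetric]) (auto simp: image_image)
  then show ?thesis
    by (fastforce simp: monomial_span_def dest: multi_nonempty_split)
qed

text \<open>Splitting one variable off a monomial of degree at least d + 1 leaves degree at least d,
  so each term is a product of elements of the two factors. The power with exponent 0 is the whole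
  ring.\<close>

lemma irrelevant_power_eq:
  "(irrelevant_power A d :: ('x, 'k::comm_ring_1) mpoly set)
    = {p. \<forall>a\<in>Poly_Mapping.keys p. set_mset a \<subseteq> A \<and> d \<le> size a}"
proof (induction d)
  case 0
  show ?case
    by (auto simp: irrelevant_power_def nat_pow_def ideals_set_def poly_ring_def)
next
  case (Suc d)
  let ?P = "\<lambda>d. {p :: ('x, 'k) mpoly. \<forall>a\<in>Poly_Mapping.keys p. set_mset a \<subseteq> A \<and> d \<le> size a}"
  have "irrelevant_power A (Suc d) = ideal_prod (poly_ring A) (?P d) (irrelevant_ideal A)"
    using Suc by (simp add: irrelevant_power_def nat_pow_def ideals_set_def)
  also have "\<dots> = ?P (Suc d)"
  proof
    show "ideal_prod (poly_ring A) (?P d) (irrelevant_ideal A) \<subseteq> ?P (Suc d)"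
    proof
      fix p assume "p \<in> ideal_prod (poly_ring A) (?P d) (irrelevant_ideal A)"
      then show "p \<in> ?P (Suc d)"
      proof induction
        case (prod i j)
        have "Suc d \<le> size (b + c)" if "d \<le> size b" "c \<noteq> {#}" for b c :: "'x multiset"
          using that by (cases c) auto
        then show ?case
          using prod by (auto simp: irrelevant_ideal_eq dest!: keys_times_subset) blast+
      next
        case (sum p q)
        then show ?case using keys_add[of p q] by auto
      qed
    qed
    show "?P (Suc d) \<subseteq> ideal_prod (poly_ring A) (?P d) (irrelevant_ideal A)"
    proof
      fix p :: "('x, 'k) mpoly"
      assume p: "p \<in> ?P (Suc d)"
      show "p \<in> ideal_prod (poly_ring A) (?P d) (irrelevant_ideal A)"
      proof (rule poly_mem_closed)
        have "0 * 0 \<in> ideal_prod (poly_ring A) (?P d) (irrelevant_ideal A)"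
          using ideal_prod.prod[of 0 "?P d" 0 "irrelevant_ideal A" "poly_ring A"]
          by (simp add: irrelevant_ideal_eq)
        then show "0 \<in> ideal_prod (poly_ring A) (?P d) (irrelevant_ideal A)" by simp
      next
        fix q r assume "q \<in> ideal_prod (poly_ring A) (?P d) (irrelevant_ideal A)"
          "r \<in> ideal_prod (poly_ring A) (?P d) (irrelevant_ideal A)"
        then show "q + r \<in> ideal_prod (poly_ring A) (?P d) (irrelevant_ideal A)"
          using ideal_prod.sum[of q "poly_ring A"] by simp
      next
        fix a assume "a \<in> Poly_Mapping.keys p"
        with p have a: "set_mset a \<subseteq> A" "Suc d \<le> size a" by auto
        then obtain x b where ab: "a = add_mset x b" by (metis Suc_le_D size_eq_Suc_imp_eq_union)
        let ?c = "Poly_Mapping.lookup p a"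
        have "Poly_Mapping.single b ?c * mon {#x#} \<in> ideal_prod (poly_ring A) (?P d) (irrelevant_ideal A)"
          using ideal_prod.prod[of "Poly_Mapping.single b ?c" "?P d" "mon {#x#}" "irrelevant_ideal A" "poly_ring A"] a
          by (auto simp: irrelevant_ideal_eq ab)
        then show "Poly_Mapping.single a ?c \<in> ideal_prod (poly_ring A) (?P d) (irrelevant_ideal A)"
          by (simp add: single_times_mon ab)
      qed
    qed
  qed
  finally show ?case .
qed

section \<open>Reduction to chains over the field\<close>

text \<open>The universal property of the lcm. Finiteness of the face bounds the set of labels, so
  that \<open>Sup\<close> is a least upper bound; the empty face has label 1.\<close>

lemma face_label_subset_iff:
  assumes "finite F"
  shows "face_label lab F \<subseteq># b \<longleftrightarrow> (\<forall>v\<in>F. lab v \<subseteq># b)"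
proof (cases "F = {}")
  case False
  have bdd: "subset_mset.bdd_above (lab ` F)"
    using assms by (simp add: subset_mset.bdd_above_finite)
  show ?thesis
    using False bdd unfolding face_label_def by (subst subset_mset.cSup_le_iff) auto
qed (simp add: face_label_def Sup_multiset_empty)

lemma face_label_mono: "finite F \<Longrightarrow> G \<subseteq> F \<Longrightarrow> face_label lab G \<subseteq># face_label lab F"
  using face_label_subset_iff[of F lab "face_label lab F"]
  by (subst face_label_subset_iff) (auto intro: finite_subset)

lemma face_label_upper: "finite F \<Longrightarrow> v \<in> F \<Longrightarrow> lab v \<subseteq># face_label lab F"
  using face_label_subset_iff[of F lab "face_label lab F"] by simp

text \<open>Chains over k of the subcomplex of faces whose labels divide b: the part of multidegree
  b of the cellular complex with the monomial factors dropped.\<close>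

definition chains_le ::
  "'v set set \<Rightarrow> ('v \<Rightarrow> 'x multiset) \<Rightarrow> 'x multiset \<Rightarrow> nat \<Rightarrow> ('v set \<Rightarrow> 'k::comm_ring_1) set" where
  "chains_le X lab b i = {z. \<forall>F. z F \<noteq> 0 \<longrightarrow> F \<in> X \<and> hdeg X F = i \<and> face_label lab F \<subseteq># b}"

definition bdry ::
  "'v set set \<Rightarrow> ('v set \<Rightarrow> 'v set \<Rightarrow> int) \<Rightarrow> ('v set \<Rightarrow> 'k::comm_ring_1) \<Rightarrow> ('v set \<Rightarrow> 'k)" where
  "bdry X \<epsilon> z = (\<lambda>G. \<Sum>F\<in>X. z F * (if facet X F G then of_int (\<epsilon> F G) else 0))"

text \<open>As the empty face has degree 0, exactness in degrees i >= 1 is the vanishing of the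
  reduced homology of the subcomplex below b in nonnegative dimensions. The type argument fixes the
  coefficients.\<close>

definition acyclic_le ::
  "'k::comm_ring_1 itself \<Rightarrow> 'v set set \<Rightarrow> ('v set \<Rightarrow> 'v set \<Rightarrow> int) \<Rightarrow> ('v \<Rightarrow> 'x multiset) \<Rightarrow> 'x multiset \<Rightarrow> bool" where
  "acyclic_le _ X \<epsilon> lab b \<longleftrightarrow> (\<forall>i\<ge>1. \<forall>z\<in>(chains_le X lab b i :: ('v set \<Rightarrow> 'k) set).
     bdry X \<epsilon> z = (\<lambda>_. 0) \<longrightarrow> (\<exists>w\<in>chains_le X lab b (i + 1). bdry X \<epsilon> w = z))"

text \<open>The basis element of a face F sits in the multidegree given by its label, so the
  component of multidegree b has at F the coefficient of the quotient of b by this label.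
  \<open>homogenize\<close> goes back.\<close>

definition homogeneous_part ::
  "('v \<Rightarrow> 'x multiset) \<Rightarrow> 'x multiset \<Rightarrow> ('v set \<Rightarrow> ('x, 'k::comm_ring_1) mpoly) \<Rightarrow> 'v set \<Rightarrow> 'k" where
  "homogeneous_part lab b e F =
    (if face_label lab F \<subseteq># b then Poly_Mapping.lookup (e F) (b - face_label lab F) else 0)"

definition homogenize ::
  "('v \<Rightarrow> 'x multiset) \<Rightarrow> 'x multiset \<Rightarrow> ('v set \<Rightarrow> 'k::comm_ring_1) \<Rightarrow> 'v set \<Rightarrow> ('x, 'k) mpoly" where
  "homogenize lab b z F = Poly_Mapping.single (b - face_label lab F) (z F)"

lemma homogenize_eq_0_iff: "homogenize lab b z F = 0 \<longleftrightarrow> z F = 0"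
  unfolding homogenize_def by (metis lookup_single_eq lookup_zero single_zero)

lemma homogeneous_part_nonzero:
  "homogeneous_part lab b e F \<noteq> 0 \<Longrightarrow> e F \<noteq> 0 \<and> face_label lab F \<subseteq># b"
  by (auto simp: homogeneous_part_def split: if_splits)

lemma cell_entry_single:
  "(cell_entry X \<epsilon> lab F G :: ('x, 'k::comm_ring_1) mpoly)
    = Poly_Mapping.single (face_label lab F - face_label lab G) (if facet X F G then of_int (\<epsilon> F G) else 0)"
  by (simp add: cell_entry_def mon_def mult_single flip: single_of_int)

lemma facet_label_mono:
  "\<forall>F\<in>X. finite F \<Longrightarrow> facet X F G \<Longrightarrow> face_label lab G \<subseteq># face_label lab F"
  by (auto simp: facet_def intro: face_label_mono)

text \<open>An entry of the differential is the quotient of two labels; multiplied with the quotient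
  of b by the upper label it gives the quotient of b by the lower one. The differential preserves
  multidegrees.\<close>

lemma cell_boundary_homogenize:
  assumes fin: "\<forall>F\<in>X. finite F" and z: "z \<in> chains_le X lab b i"
  shows "cell_boundary X \<epsilon> lab (homogenize lab b z :: _ \<Rightarrow> ('x, 'k::comm_ring_1) mpoly)
    = homogenize lab b (bdry X \<epsilon> z)"
proof
  fix G
  have "homogenize lab b z F * cell_entry X \<epsilon> lab F G =
      (Poly_Mapping.single (b - face_label lab G) (z F * (if facet X F G then of_int (\<epsilon> F G) else 0)) :: ('x, 'k) mpoly)" for F
  proof (cases "z F \<noteq> 0 \<and> facet X F G")
    case True
    then have "face_label lab F \<subseteq># b" "face_label lab G \<subseteq># face_label lab F"
      using z facet_label_mono[OF fin] by (auto simp: chains_le_def)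
    then have "(b - face_label lab F) + (face_label lab F - face_label lab G) = b - face_label lab G"
      by (simp add: subset_mset.add_diff_assoc2)
    then show ?thesis
      by (simp add: homogenize_def cell_entry_single mult_single)
  qed (auto simp: homogenize_def cell_entry_single)
  then show "cell_boundary X \<epsilon> lab (homogenize lab b z) G = homogenize lab b (bdry X \<epsilon> z) G"
    unfolding homogenize_def[of lab b "bdry X \<epsilon> z"]
    unfolding cell_boundary_def bdry_def
    by (intro poly_mapping_eqI) (simp add: lookup_sum lookup_single when_def)
qed

lemma bdry_homogeneous_part:
  assumes fin: "\<forall>F\<in>X. finite F"
  shows "bdry X \<epsilon> (homogeneous_part lab b e) = homogeneous_part lab b (cell_boundary X \<epsilon> lab e)"
proof
  fix G
  have "homogeneous_part lab b e F * (if facet X F G then of_int (\<epsilon> F G) else 0) =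
      (if face_label lab G \<subseteq># b then Poly_Mapping.lookup (e F * cell_entry X \<epsilon> lab F G) (b - face_label lab G) else 0)" for F
  proof (cases "facet X F G")
    case True
    then have le: "face_label lab G \<subseteq># face_label lab F"
      using facet_label_mono[OF fin] by blast
    \<comment> \<open>The coefficient of the product is read off only if the label of G divides b
      and the entry divides the quotient; together this says that the label of F divides b.\<close>
    then have "face_label lab F \<subseteq># b \<longleftrightarrow> face_label lab G \<subseteq># b \<and> face_label lab F - face_label lab G \<subseteq># b - face_label lab G"
    proof -
      have "count (face_label lab F) x \<le> count b x \<longleftrightarrow> count (face_label lab G) x \<le> count b x
          \<and> count (face_label lab F) x - count (face_label lab G) x \<le> count b x - count (face_label lab G) x" for x
        using mset_subset_eq_count[OF le, of x] by linarith
      then show ?thesis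
        unfolding subseteq_mset_def count_diff by blast
    qed
    moreover have "b - face_label lab G - (face_label lab F - face_label lab G) = b - face_label lab F"
      using le by (simp add: subset_mset.add_diff_inverse)
    ultimately show ?thesis
      using True by (auto simp: homogeneous_part_def cell_entry_single lookup_times_single)
  qed (simp add: cell_entry_def)
  then show "bdry X \<epsilon> (homogeneous_part lab b e) G = homogeneous_part lab b (cell_boundary X \<epsilon> lab e) G"
    unfolding homogeneous_part_def[of lab b "cell_boundary X \<epsilon> lab e"]
    unfolding cell_boundary_def bdry_def
    by (simp add: lookup_sum)
qed

lemma homogeneous_part_homogenize:
  "z \<in> chains_le X lab b i \<Longrightarrow> homogeneous_part lab b (homogenize lab b z) = z"
  by (rule ext) (auto simp: homogeneous_part_def homogenize_def chains_le_def)

lemma cell_boundary_sum: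
  "cell_boundary X \<epsilon> lab (\<lambda>F. \<Sum>b\<in>B. e b F) = (\<lambda>G. \<Sum>b\<in>B. cell_boundary X \<epsilon> lab (e b) G)"
proof
  fix G
  show "cell_boundary X \<epsilon> lab (\<lambda>F. \<Sum>b\<in>B. e b F) G = (\<Sum>b\<in>B. cell_boundary X \<epsilon> lab (e b) G)"
    unfolding cell_boundary_def sum_distrib_right by (rule sum.swap)
qed

text \<open>The part of multidegree b of the differential is the boundary map over k of the
  subcomplex below b. This is the criterion of Bayer and Sturmfels for cellular resolutions.\<close>

lemma exact_iff_acyclic_le:
  fixes lab :: "'v \<Rightarrow> 'x multiset"
  assumes X: "finite X" "\<forall>F\<in>X. finite F" and A: "\<forall>v\<in>\<Union>X. set_mset (lab v) \<subseteq> A"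
  shows "(\<forall>i\<ge>1. \<forall>e\<in>(cell_chains A X i :: ('v set \<Rightarrow> ('x, 'k::comm_ring_1) mpoly) set).
       cell_boundary X \<epsilon> lab e = (\<lambda>_. 0) \<longrightarrow>
       (\<exists>e'\<in>cell_chains A X (i + 1). cell_boundary X \<epsilon> lab e' = e))
    \<longleftrightarrow> (\<forall>b. set_mset b \<subseteq> A \<longrightarrow> acyclic_le TYPE('k) X \<epsilon> lab b)" (is "?L \<longleftrightarrow> ?R")
proof
  assume L: ?L
  show ?R
    unfolding acyclic_le_def
  proof (intro allI impI ballI)
    fix b i and z :: "'v set \<Rightarrow> 'k"
    assume b: "set_mset b \<subseteq> A" and i: "1 \<le> i" and z: "z \<in> chains_le X lab b i" and cyc: "bdry X \<epsilon> z = (\<lambda>_. 0)"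
    have "homogenize lab b z \<in> cell_chains A X i"
      using z b
      by (auto simp: cell_chains_def chains_le_def homogenize_eq_0_iff)
        (auto simp: homogenize_def carrier_poly_ring dest!: in_diffD)
    moreover have "cell_boundary X \<epsilon> lab (homogenize lab b z) = (\<lambda>_. 0)"
      by (subst cell_boundary_homogenize[OF X(2) z]) (simp add: cyc homogenize_def[abs_def])
    ultimately obtain e' where e': "e' \<in> cell_chains A X (i + 1)"
      "cell_boundary X \<epsilon> lab e' = homogenize lab b z"
      using L i by blast
    show "\<exists>w\<in>chains_le X lab b (i + 1). bdry X \<epsilon> w = z"
    proof (intro bexI)
      show "bdry X \<epsilon> (homogeneous_part lab b e') = z"
        using bdry_homogeneous_part[OF X(2), of \<epsilon> lab b e'] e'(2) homogeneous_part_homogenize[OF z] by simp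
      show "homogeneous_part lab b e' \<in> chains_le X lab b (i + 1)"
        using e'(1) by (auto simp: cell_chains_def chains_le_def dest!: homogeneous_part_nonzero)
    qed
  qed
next
  assume R: ?R
  show ?L
  proof (intro allI impI ballI)
    fix i and e :: "'v set \<Rightarrow> ('x, 'k) mpoly"
    assume i: "1 \<le> i" and e: "e \<in> cell_chains A X i" and cyc: "cell_boundary X \<epsilon> lab e = (\<lambda>_. 0)"
    \<comment> \<open>The finitely many multidegrees that occur in \<open>e\<close>. Each
      homogeneous part is a cycle and is filled separately; the sum of the fillings is again a chain
      of polynomials.\<close>
    define B where "B = (\<Union>F\<in>X. (\<lambda>a. a + face_label lab F) ` Poly_Mapping.keys (e F))"
    have label_A: "set_mset (face_label lab F) \<subseteq> A" if "F \<in> X" for F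
    proof -
      have bdd: "subset_mset.bdd_above (lab ` F)"
        using that X by (simp add: subset_mset.bdd_above_finite)
      show ?thesis
        using A that unfolding face_label_def by (subst set_mset_Sup[OF bdd]) blast
    qed
    have B_A: "set_mset b \<subseteq> A" if b: "b \<in> B" for b
    proof -
      obtain F a where "F \<in> X" "a \<in> Poly_Mapping.keys (e F)" "b = a + face_label lab F"
        using b by (auto simp: B_def)
      then show ?thesis
        using e label_A[of F] by (auto simp: cell_chains_def carrier_poly_ring)
    qed
    have fin_B: "finite B" using X by (auto simp: B_def)
    have part: "homogeneous_part lab b e \<in> chains_le X lab b i" for b
      using e by (auto simp: cell_chains_def chains_le_def dest!: homogeneous_part_nonzero)
    have "bdry X \<epsilon> (homogeneous_part lab b e) = (\<lambda>_. 0)" for b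
      by (subst bdry_homogeneous_part[OF X(2)]) (auto simp: cyc homogeneous_part_def[abs_def])
    then have "\<forall>b\<in>B. \<exists>w. w \<in> chains_le X lab b (i + 1) \<and> bdry X \<epsilon> w = homogeneous_part lab b e"
      using R[rule_format, OF B_A] part i unfolding acyclic_le_def by blast
    from bchoice[OF this] obtain w where w: "\<And>b. b \<in> B \<Longrightarrow> w b \<in> chains_le X lab b (i + 1)"
      "\<And>b. b \<in> B \<Longrightarrow> bdry X \<epsilon> (w b) = homogeneous_part lab b e"
      by blast
    define e' where "e' = (\<lambda>F. \<Sum>b\<in>B. homogenize lab b (w b) F)"
    show "\<exists>e'\<in>cell_chains A X (i + 1). cell_boundary X \<epsilon> lab e' = e"
    proof (intro bexI)
      have "cell_boundary X \<epsilon> lab e' = (\<lambda>G. \<Sum>b\<in>B. homogenize lab b (homogeneous_part lab b e) G)"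
        unfolding e'_def cell_boundary_sum
        by (intro ext sum.cong refl) (simp add: cell_boundary_homogenize[OF X(2) w(1)] w(2))
      also have "\<dots> = e"
      proof (rule ext, rule poly_mapping_eqI)
        fix G a
        have eq: "b - face_label lab G = a \<and> face_label lab G \<subseteq># b \<longleftrightarrow> b = a + face_label lab G" for b
          by auto
        have "Poly_Mapping.lookup (\<Sum>b\<in>B. homogenize lab b (homogeneous_part lab b e) G) a
            = (\<Sum>b\<in>B. if b = a + face_label lab G then Poly_Mapping.lookup (e G) a else 0)"
          unfolding lookup_sum homogenize_def homogeneous_part_def
          by (intro sum.cong refl) (auto simp: lookup_single when_def)
        also have "\<dots> = Poly_Mapping.lookup (e G) a"
        proof (cases "Poly_Mapping.lookup (e G) a = 0")
          case False
          then have "G \<in> X" using e by (force simp: cell_chains_def)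
          then have "a + face_label lab G \<in> B"
            using False unfolding B_def by (intro UN_I[of G] imageI) (simp_all add: in_keys_iff)
          then show ?thesis using fin_B by simp
        qed (simp cong: if_cong)
        finally show "Poly_Mapping.lookup (\<Sum>b\<in>B. homogenize lab b (homogeneous_part lab b e) G) a
            = Poly_Mapping.lookup (e G) a" .
      qed
      finally show "cell_boundary X \<epsilon> lab e' = e" .
      have "e' F \<in> carrier (poly_ring A)" for F
        unfolding e'_def
      proof (rule sum_mem_closed)
        fix b assume "b \<in> B"
        then show "homogenize lab b (w b) F \<in> carrier (poly_ring A)"
          using B_A[of b] by (auto simp: homogenize_def carrier_poly_ring dest: in_diffD)
      qed auto
      moreover have "F \<in> X \<and> hdeg X F = i + 1" if nz: "e' F \<noteq> 0" for F
      proof -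
        obtain b where "b \<in> B" "homogenize lab b (w b) F \<noteq> 0"
          using nz unfolding e'_def by (rule sum.not_neutral_contains_not_neutral)
        then show ?thesis
          using w(1)[of b] by (auto simp: chains_le_def homogenize_eq_0_iff)
      qed
      ultimately show "e' \<in> cell_chains A X (i + 1)"
        by (simp add: cell_chains_def)
    qed
  qed
qed

section \<open>Faces of polyhedral complexes\<close>

text \<open>Separated from \<open>polyhedral_complex\<close> for a single realization, so that the
  same points can serve a face and all faces below it.\<close>

definition realizes :: "'v set set \<Rightarrow> ('v \<Rightarrow> 'a::euclidean_space) \<Rightarrow> 'v set \<Rightarrow> bool" where
  "realizes X p F \<longleftrightarrow> {G \<in> X. G \<subseteq> F} = {{v \<in> F. p v \<in> T} | T. T face_of (convex hull (p ` F))}"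

context
  fixes X :: "'v set set" and p :: "'v \<Rightarrow> 'a::euclidean_space" and F :: "'v set"
  assumes real: "realizes X p F" and fin: "finite F"
begin

text \<open>A face of a polytope is the hull of the generating points that it contains, so faces
  correspond to vertex sets and inclusions to inclusions.\<close>

lemma face_of_hull_eq:
  assumes "T face_of (convex hull (p ` F))" and "G = {v \<in> F. p v \<in> T}"
  shows "T = convex hull (p ` G)"
proof
  obtain S where S: "S \<subseteq> p ` F" "T = convex hull S"
    using face_of_convex_hull_subset[OF _ assms(1)] fin by (metis finite_imageI finite_imp_compact)
  then have "S \<subseteq> p ` G"
    using hull_subset[of S convex] assms(2) by auto
  then show "T \<subseteq> convex hull (p ` G)"
    unfolding S(2) by (rule hull_mono)
  show "convex hull (p ` G) \<subseteq> T"
    using assms face_of_imp_convex by (intro hull_minimal) auto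
qed

lemma face_hull:
  assumes "G \<in> X" "G \<subseteq> F"
  shows "convex hull (p ` G) face_of convex hull (p ` F)" "G = {v \<in> F. p v \<in> convex hull (p ` G)}"
proof -
  obtain T where T: "T face_of (convex hull (p ` F))" "G = {v \<in> F. p v \<in> T}"
    using real assms unfolding realizes_def by blast
  with face_of_hull_eq[OF T] show "convex hull (p ` G) face_of convex hull (p ` F)"
    "G = {v \<in> F. p v \<in> convex hull (p ` G)}" by auto
qed

lemma face_vertices:
  assumes "T face_of (convex hull (p ` F))"
  obtains G where "G \<in> X" "G \<subseteq> F" "T = convex hull (p ` G)" "G = {v \<in> F. p v \<in> T}"
proof -
  have "{v \<in> F. p v \<in> T} \<in> {G \<in> X. G \<subseteq> F}"
    using real assms unfolding realizes_def by blast
  then show ?thesis using that face_of_hull_eq[OF assms refl] by blast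
qed

text \<open>Faces of a face are faces of the polytope, and a face of the polytope contained in
  another face is a face of the latter.\<close>

lemma realizes_face:
  assumes G: "G \<in> X" "G \<subseteq> F"
  shows "realizes X p G"
  unfolding realizes_def
proof (intro equalityI subsetI)
  fix H assume "H \<in> {H \<in> X. H \<subseteq> G}"
  then have H: "H \<in> X" "H \<subseteq> G" "H \<subseteq> F" using G by auto
  have "convex hull (p ` H) face_of convex hull (p ` G)"
    using face_hull(1)[OF H(1,3)] face_hull(1)[OF G] H(2)
    by (meson face_of_face hull_mono image_mono)
  moreover have "H = {v \<in> G. p v \<in> convex hull (p ` H)}"
    using face_hull(2)[OF H(1,3)] H(2) G(2) by blast
  ultimately show "H \<in> {{v \<in> G. p v \<in> T} | T. T face_of convex hull (p ` G)}" by blast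
next
  fix H assume "H \<in> {{v \<in> G. p v \<in> T} | T. T face_of convex hull (p ` G)}"
  then obtain T where T: "T face_of convex hull (p ` G)" "H = {v \<in> G. p v \<in> T}" by blast
  have "T face_of convex hull (p ` F)"
    using T(1) face_hull(1)[OF G] face_of_trans by blast
  then obtain H' where H': "H' \<in> X" "H' = {v \<in> F. p v \<in> T}"
    by (rule face_vertices)
  have "H' = H"
    using H'(2) T face_hull(2)[OF G] face_of_imp_subset[OF T(1)] G(2) by blast
  then show "H \<in> {H \<in> X. H \<subseteq> G}" using H' T(2) by blast
qed

lemma face_hull_proper: "G \<in> X \<Longrightarrow> G \<subset> F \<Longrightarrow> convex hull (p ` G) \<noteq> convex hull (p ` F)"
  using face_hull(2)[of G] hull_subset[of "p ` F" convex] by blast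

lemma face_hull_aff_dim:
  "G \<in> X \<Longrightarrow> G \<subset> F \<Longrightarrow> aff_dim (convex hull (p ` G)) < aff_dim (convex hull (p ` F))"
  using face_hull(1)[of G] face_hull_proper[of G] by (intro face_of_aff_dim_lt) auto

lemma facet_of_hull:
  assumes "T facet_of (convex hull (p ` F))"
  obtains G where "G \<in> X" "G \<subset> F" "T = convex hull (p ` G)"
    "aff_dim (convex hull (p ` G)) = aff_dim (convex hull (p ` F)) - 1"
proof -
  from assms have T: "T face_of (convex hull (p ` F))" "aff_dim T = aff_dim (convex hull (p ` F)) - 1"
    by (auto simp: facet_of_def)
  from face_vertices[OF T(1)] obtain G where G: "G \<in> X" "G \<subseteq> F" "T = convex hull (p ` G)" by metis
  with T(2) have "G \<noteq> F" by auto
  with G T(2) that show ?thesis by blast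
qed

end

section \<open>Dimension of a face as the length of chains of faces\<close>

lemma finite_hdeg_chains:
  "finite X \<Longrightarrow> finite (card ` {C. C \<subseteq> {G \<in> X. G \<subset> F} \<and> chain_subset C})"
  by (rule finite_imageI, rule finite_subset[of _ "Pow X"]) auto

lemma hdeg_less:
  assumes "finite X" "G \<in> X" "G \<subset> F"
  shows "hdeg X G < hdeg X F"
proof -
  have "hdeg X G \<in> card ` {C. C \<subseteq> {H \<in> X. H \<subset> G} \<and> chain_subset C}"
    unfolding hdeg_def using finite_hdeg_chains[OF assms(1)]
    by (rule Max_in) (auto intro!: exI[of _ "{}"] simp: chain_subset_def)
  then obtain C where C: "C \<subseteq> {H \<in> X. H \<subset> G}" "chain_subset C" "hdeg X G = card C" by auto
  have "finite C" using C(1) assms(1) by (auto intro: finite_subset)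
  moreover have "G \<notin> C" using C(1) by blast
  ultimately have "card (insert G C) = Suc (hdeg X G)" using C(3) by simp
  moreover have "insert G C \<subseteq> {H \<in> X. H \<subset> F}" "chain_subset (insert G C)"
    using C(1,2) assms unfolding chain_subset_def by blast+
  ultimately have "Suc (hdeg X G) \<in> card ` {C. C \<subseteq> {H \<in> X. H \<subset> F} \<and> chain_subset C}"
    by (metis (mono_tags, lifting) image_eqI mem_Collect_eq)
  then show ?thesis
    unfolding hdeg_def[of X F] using finite_hdeg_chains[OF assms(1)] by (meson Max_ge Suc_le_lessD)
qed

lemma finite_chain_subset_max:
  assumes "finite C" "C \<noteq> {}" "chain_subset C"
  shows "\<exists>M\<in>C. \<forall>G\<in>C. G \<subseteq> M"
  using assms
proof (induction rule: finite_ne_induct)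
  case (insert G C)
  have "chain_subset C" using insert.prems unfolding chain_subset_def by blast
  with insert.IH obtain M where M: "M \<in> C" "\<And>H. H \<in> C \<Longrightarrow> H \<subseteq> M" by blast
  have "G \<subseteq> M \<or> M \<subseteq> G"
    using insert.prems M(1) unfolding chain_subset_def by simp
  then show ?case
  proof
    assume "G \<subseteq> M"
    with M show ?thesis by (intro bexI[of _ M]) auto
  next
    assume "M \<subseteq> G"
    with M show ?thesis by (intro bexI[of _ G]) auto
  qed
qed auto

text \<open>In a chain below F all members but the largest lie properly below the largest one, so
  the length is at most one more than the height of that member.\<close>

lemma hdeg_le:
  assumes X: "finite X" and bound: "\<And>G. G \<in> X \<Longrightarrow> G \<subset> F \<Longrightarrow> hdeg X G < n"
  shows "hdeg X F \<le> n"
  unfolding hdeg_def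
proof (rule Max.boundedI[OF finite_hdeg_chains[OF X]])
  have "{} \<in> {C. C \<subseteq> {G \<in> X. G \<subset> F} \<and> chain_subset C}"
    by (simp add: chain_subset_def)
  then show "card ` {C. C \<subseteq> {G \<in> X. G \<subset> F} \<and> chain_subset C} \<noteq> {}" by blast
next
  fix k assume "k \<in> card ` {C. C \<subseteq> {G \<in> X. G \<subset> F} \<and> chain_subset C}"
  then obtain C where k: "k = card C" and C: "C \<subseteq> {G \<in> X. G \<subset> F}" "chain_subset C" by auto
  show "k \<le> n"
    unfolding k
  proof (cases "C = {}")
    case False
    have fin: "finite C" using C(1) X by (auto intro: finite_subset)
    obtain M where M: "M \<in> C" "\<forall>G\<in>C. G \<subseteq> M"
      using finite_chain_subset_max[OF fin False C(2)] by blast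
    have "C - {M} \<subseteq> {G \<in> X. G \<subset> M}" "chain_subset (C - {M})"
      using C M unfolding chain_subset_def by blast+
    then have "card (C - {M}) \<le> hdeg X M"
      unfolding hdeg_def using finite_hdeg_chains[OF X] by (intro Max_ge) auto
    also have "\<dots> < n" using M(1) C(1) by (intro bound) auto
    finally show "card C \<le> n" using M(1) fin by (simp add: card_Diff_singleton)
  qed simp
qed

lemma exists_facet_above:
  assumes "finite X" "F \<in> X" "G \<in> X" "G \<subset> F"
  obtains H where "facet X F H" "G \<subseteq> H"
proof -
  let ?S = "{H \<in> X. G \<subseteq> H \<and> H \<subset> F}"
  have "finite ?S" "?S \<noteq> {}" using assms by auto
  from finite_has_maximal[OF this] obtain H where H: "H \<in> ?S" and max: "\<And>K. K \<in> ?S \<Longrightarrow> H \<subseteq> K \<Longrightarrow> H = K"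
    by auto
  have "\<not> (\<exists>K\<in>X. H \<subset> K \<and> K \<subset> F)"
  proof
    assume "\<exists>K\<in>X. H \<subset> K \<and> K \<subset> F"
    then obtain K where K: "K \<in> X" "H \<subset> K" "K \<subset> F" by blast
    then have "K \<in> ?S" using H by auto
    from max[OF this] K(2) show False by auto
  qed
  with H assms(2) have "facet X F H" by (auto simp: facet_def)
  moreover have "G \<subseteq> H" using H by simp
  ultimately show ?thesis by (rule that)
qed

context
  fixes X :: "'v set set" and E :: "'a::euclidean_space itself"
  assumes poly: "polyhedral_complex E X"
begin

lemma polyhedral_finite: "finite X" "F \<in> X \<Longrightarrow> finite F" "{} \<in> X"
  "F \<in> X \<Longrightarrow> v \<in> F \<Longrightarrow> {v} \<in> X" "F \<in> X \<Longrightarrow> G \<in> X \<Longrightarrow> F \<inter> G \<in> X"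
  using poly unfolding polyhedral_complex_def by auto

lemma polyhedral_realizes: "F \<in> X \<Longrightarrow> \<exists>p :: 'v \<Rightarrow> 'a. realizes X p F"
  using poly unfolding polyhedral_complex_def realizes_def by blast

text \<open>Proper faces have smaller dimension, which bounds chains from above; a facet of the
  polytope has dimension exactly one less, which by induction provides a long enough chain.\<close>

lemma hdeg_eq_aff_dim:
  fixes p :: "'v \<Rightarrow> 'a"
  assumes "F \<in> X" "realizes X p F"
  shows "int (hdeg X F) = aff_dim (convex hull (p ` F)) + 1"
  using polyhedral_finite(2)[OF assms(1)] assms
proof (induction F rule: finite_psubset_induct)
  case (psubset F)
  note fin = psubset.hyps
  have sub: "int (hdeg X G) = aff_dim (convex hull (p ` G)) + 1" if "G \<in> X" "G \<subset> F" for G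
    using psubset.IH[OF that(2) that(1)] realizes_face[OF psubset.prems(2) fin] that by auto
  have "int (hdeg X F) \<le> aff_dim (convex hull (p ` F)) + 1"
  proof -
    have "hdeg X F \<le> nat (aff_dim (convex hull (p ` F)) + 1)"
    proof (rule hdeg_le[OF polyhedral_finite(1)])
      fix G assume G: "G \<in> X" "G \<subset> F"
      then show "hdeg X G < nat (aff_dim (convex hull (p ` F)) + 1)"
        using sub[OF G] face_hull_aff_dim[OF psubset.prems(2) fin G] by linarith
    qed
    then show ?thesis using aff_dim_geq[of "convex hull (p ` F)"] by linarith
  qed
  moreover have "aff_dim (convex hull (p ` F)) + 1 \<le> int (hdeg X F)"
  \<comment> \<open>A single point has no nonempty facet, so here the empty face of the complex
    supplies the chain.\<close>
  proof (cases "aff_dim (convex hull (p ` F)) \<le> 0")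
    case True
    show ?thesis
    proof (cases "F = {}")
      case False
      then have "hdeg X {} < hdeg X F"
        using polyhedral_finite(3) by (intro hdeg_less[OF polyhedral_finite(1)]) auto
      then show ?thesis using True by linarith
    qed simp
  next
    case False
    then obtain T where "T facet_of convex hull (p ` F)"
      using polytope_facet_exists[of "convex hull (p ` F)"] fin by (auto simp: polytope_convex_hull)
    then obtain G where G: "G \<in> X" "G \<subset> F" "aff_dim (convex hull (p ` G)) = aff_dim (convex hull (p ` F)) - 1"
      using facet_of_hull[OF psubset.prems(2) fin] by metis
    then show ?thesis
      using sub[OF G(1,2)] hdeg_less[OF polyhedral_finite(1) G(1,2)] by linarith
  qed
  ultimately show ?case by linarith
qed

lemma hdeg_empty: "hdeg X {} = 0"
  using hdeg_le[OF polyhedral_finite(1), of "{}" 0] by auto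

lemma hdeg_singleton:
  assumes "{v} \<in> X" shows "hdeg X {v} = 1"
proof -
  obtain p :: "'v \<Rightarrow> 'a" where "realizes X p {v}" using polyhedral_realizes[OF assms] by blast
  from hdeg_eq_aff_dim[OF assms this] show ?thesis by simp
qed

text \<open>A proper face of a polytope lies in a facet, so a maximal proper face is a facet and
  loses exactly one dimension. The empty face is treated apart: it is maximal only below a single
  vertex.\<close>

lemma facet_hdeg:
  assumes "facet X F G"
  shows "hdeg X F = hdeg X G + 1"
proof -
  from assms have FG: "F \<in> X" "G \<in> X" "G \<subset> F" and max: "\<And>H. H \<in> X \<Longrightarrow> G \<subset> H \<Longrightarrow> H \<subset> F \<Longrightarrow> False"
    by (auto simp: facet_def)
  show ?thesis
  proof (cases "G = {}")
    case True
    then obtain v where v: "v \<in> F" using FG by auto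
    then have "F = {v}" using max[of "{v}"] polyhedral_finite(4)[OF FG(1) v] True by blast
    then show ?thesis using True hdeg_empty hdeg_singleton FG(1) by auto
  next
    case False
    obtain p :: "'v \<Rightarrow> 'a" where p: "realizes X p F" using polyhedral_realizes[OF FG(1)] by blast
    note fin = polyhedral_finite(2)[OF FG(1)]
    have sub: "G \<subseteq> F" using FG by blast
    obtain U where U: "U facet_of convex hull (p ` F)" "convex hull (p ` G) \<subseteq> U"
      using face_of_polyhedron_subset_facet[of "convex hull (p ` F)" "convex hull (p ` G)"]
        face_hull(1)[OF p fin FG(2) sub] face_hull_proper[OF p fin FG(2,3)] False fin
      by (auto simp: polyhedron_convex_hull)
    obtain H where H: "H \<in> X" "H \<subset> F" "U = convex hull (p ` H)"
        "aff_dim (convex hull (p ` H)) = aff_dim (convex hull (p ` F)) - 1"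
      using facet_of_hull[OF p fin U(1)] by metis
    have "G \<subseteq> H"
      using face_hull(2)[OF p fin FG(2) sub] face_hull(2)[OF p fin H(1)] H(2,3) U(2) by blast
    then have "G = H" using max H(1,2) by blast
    have "int (hdeg X F) = int (hdeg X G) + 1"
      using hdeg_eq_aff_dim[OF FG(1) p] hdeg_eq_aff_dim[OF FG(2) realizes_face[OF p fin FG(2) sub]] H(4) \<open>G = H\<close>
      by simp
    then show ?thesis by linarith
  qed
qed

lemma facet_iff_hdeg: "facet X F G \<longleftrightarrow> F \<in> X \<and> G \<in> X \<and> G \<subset> F \<and> hdeg X F = hdeg X G + 1"
proof
  assume "facet X F G"
  then show "F \<in> X \<and> G \<in> X \<and> G \<subset> F \<and> hdeg X F = hdeg X G + 1"
    using facet_hdeg by (auto simp: facet_def)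
next
  assume *: "F \<in> X \<and> G \<in> X \<and> G \<subset> F \<and> hdeg X F = hdeg X G + 1"
  have "False" if "H \<in> X" "G \<subset> H" "H \<subset> F" for H
    using hdeg_less[OF polyhedral_finite(1) _ that(2)] hdeg_less[OF polyhedral_finite(1) _ that(3)] that(1) *
    by force
  with * show "facet X F G" unfolding facet_def by blast
qed

lemma hdeg_eq_0_iff: "F \<in> X \<Longrightarrow> hdeg X F = 0 \<longleftrightarrow> F = {}"
  using hdeg_empty hdeg_less[OF polyhedral_finite(1,3), of F] by (cases "F = {}") (auto simp: psubset_eq)

lemma hdeg_eq_1_iff:
  assumes F: "F \<in> X"
  shows "hdeg X F = 1 \<longleftrightarrow> (\<exists>v. F = {v})"
proof
  assume h: "hdeg X F = 1"
  then obtain v where v: "v \<in> F" using hdeg_empty by fastforce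
  have "F = {v}"
  proof (rule ccontr)
    assume "F \<noteq> {v}"
    then have "hdeg X {v} < hdeg X F"
      using v polyhedral_finite(4)[OF F v] by (intro hdeg_less[OF polyhedral_finite(1)]) auto
    then show False using h hdeg_singleton polyhedral_finite(4)[OF F v] by simp
  qed
  then show "\<exists>v. F = {v}" by blast
qed (use F hdeg_singleton in auto)

text \<open>The points of such a face span a line. Among three points of a line one lies between the
  others, but every point of the face is a vertex of its hull.\<close>

lemma hdeg_2_card:
  assumes F: "F \<in> X" and h: "hdeg X F = 2"
  shows "card F = 2"
proof -
  obtain p :: "'v \<Rightarrow> 'a" where p: "realizes X p F" using polyhedral_realizes[OF F] by blast
  note fin = polyhedral_finite(2)[OF F]
  \<comment> \<open>The second equation yields the injectivity of \<open>p\<close>, which is not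
    part of being a realization.\<close>
  have face: "{p v} face_of convex hull (p ` F)" "{v} = {w \<in> F. p w = p v}" if "v \<in> F" for v
    using face_hull[OF p fin polyhedral_finite(4)[OF F that]] that by auto
  have no_between: "p u \<notin> open_segment (p v) (p w)" if "u \<in> F" "v \<in> F" "w \<in> F" "u \<noteq> v" for u v w
  proof
    assume "p u \<in> open_segment (p v) (p w)"
    then have "p v = p u"
      using face_ofD[OF face(1)[OF that(1)], of "p u" "p v" "p w"] that hull_subset[of "p ` F" convex] by auto
    then have "v \<in> {w \<in> F. p w = p u}" using that by simp
    then show False unfolding face(2)[OF that(1), symmetric] using that by simp
  qed
  have inj: "p u \<noteq> p v" if "u \<in> F" "v \<in> F" "u \<noteq> v" for u v
  proof
    assume "p u = p v"
    then have "v \<in> {w \<in> F. p w = p u}" using that by simp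
    then show False unfolding face(2)[OF that(1), symmetric] using that by simp
  qed
  have dim: "aff_dim (p ` F) = 1"
    using hdeg_eq_aff_dim[OF F p] h by (simp add: aff_dim_convex_hull)
  have "\<not> card F \<ge> 3"
  proof
    assume "card F \<ge> 3"
    then obtain S where "S \<subseteq> F" "card S = 3" by (meson obtain_subset_with_card_n)
    then obtain u v w where uvw: "u \<in> F" "v \<in> F" "w \<in> F" "u \<noteq> v" "u \<noteq> w" "v \<noteq> w"
      by (auto simp: card_3_iff)
    have "collinear (p ` F)" using dim by (simp add: collinear_aff_dim)
    then have "collinear {p u, p v, p w}" by (rule collinear_subset) (use uvw in auto)
    then show False
      unfolding collinear_between_cases between_mem_segment closed_segment_eq_open
      using no_between uvw inj by (auto simp: eq_commute)
  qed
  moreover have "card F \<noteq> 1" using dim by (auto simp: card_1_singleton_iff)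
  moreover have "F \<noteq> {}" using dim by auto
  ultimately show ?thesis using fin by (cases "card F") auto
qed

lemma face_eq_Union_facets:
  assumes F: "F \<in> X" and h: "hdeg X F \<ge> 2"
  shows "F = \<Union>{G. facet X F G}"
proof
  show "F \<subseteq> \<Union>{G. facet X F G}"
  proof
    fix v assume v: "v \<in> F"
    have "F \<noteq> {v}" using h hdeg_singleton F by auto
    then obtain H where "facet X F H" "{v} \<subseteq> H"
      using exists_facet_above[OF polyhedral_finite(1) F polyhedral_finite(4)[OF F v]] v by blast
    then show "v \<in> \<Union>{G. facet X F G}" by blast
  qed
qed (auto simp: facet_def)

lemma exists_face_of_hdeg:
  assumes "F \<in> X" "n \<le> hdeg X F"
  shows "\<exists>G\<in>X. G \<subseteq> F \<and> hdeg X G = n"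
  using assms
proof (induction "hdeg X F" arbitrary: F)
  case 0
  then show ?case by (intro bexI[of _ F]) auto
next
  case (Suc m)
  show ?case
  proof (cases "n = Suc m")
    case True
    then show ?thesis using Suc.hyps(2) Suc.prems(1) by (intro bexI[of _ F]) auto
  next
    case False
    have "F \<noteq> {}" using Suc.hyps(2) hdeg_empty by auto
    then obtain H where H: "facet X F H"
      using exists_facet_above[OF polyhedral_finite(1) Suc.prems(1) polyhedral_finite(3)] by blast
    then have *: "H \<in> X" "H \<subseteq> F" "m = hdeg X H" using facet_hdeg[OF H] Suc.hyps(2) by (auto simp: facet_def)
    moreover have "n \<le> hdeg X H" using Suc.prems(2) Suc.hyps(2) False *(3) by simp
    ultimately obtain G where "G \<in> X" "G \<subseteq> H" "hdeg X G = n" using Suc.hyps(1) by blast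
    then show ?thesis using *(2) by blast
  qed
qed

end

section \<open>The standard polarization\<close>

definition map_vars :: "('x \<Rightarrow> 'y) \<Rightarrow> ('x, 'k::comm_ring_1) mpoly \<Rightarrow> ('y, 'k) mpoly" where
  "map_vars f p = (\<Sum>a\<in>Poly_Mapping.keys p. Poly_Mapping.single (image_mset f a) (Poly_Mapping.lookup p a))"

lemma map_vars_superset:
  "finite S \<Longrightarrow> Poly_Mapping.keys p \<subseteq> S \<Longrightarrow>
    map_vars f p = (\<Sum>a\<in>S. Poly_Mapping.single (image_mset f a) (Poly_Mapping.lookup p a))"
  unfolding map_vars_def by (rule sum.mono_neutral_left) (auto simp: in_keys_iff)

lemma map_vars_add: "map_vars f (p + q) = map_vars f p + map_vars f q"
proof -
  let ?S = "Poly_Mapping.keys p \<union> Poly_Mapping.keys q"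
  have "map_vars f r = (\<Sum>a\<in>?S. Poly_Mapping.single (image_mset f a) (Poly_Mapping.lookup r a))"
    if "r \<in> {p, q, p + q}" for r
    by (rule map_vars_superset) (use that keys_add[of p q] in auto)
  then show ?thesis
    by (simp add: lookup_add single_add sum.distrib)
qed

lemma map_vars_zero [simp]: "map_vars f 0 = 0"
  by (simp add: map_vars_def)

lemma map_vars_single [simp]: "map_vars f (Poly_Mapping.single a k) = Poly_Mapping.single (image_mset f a) k"
  by (subst map_vars_superset[of "{a}"]) simp_all

lemma map_vars_mon [simp]: "map_vars f (mon a) = mon (image_mset f a)"
  by (simp add: mon_def)

lemma map_vars_sum: "map_vars f (\<Sum>i\<in>S. p i) = (\<Sum>i\<in>S. map_vars f (p i))"
  by (induction S rule: infinite_finite_induct) (auto simp: map_vars_add)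

lemma map_vars_uminus: "map_vars f (- p) = - map_vars f p"
  by (metis add.inverse_unique add.right_inverse map_vars_add map_vars_zero)

lemma map_vars_diff: "map_vars f (p - q) = map_vars f p - map_vars f q"
  using map_vars_add[of f p "- q"] by (simp add: map_vars_uminus)

lemma map_vars_mult: "map_vars f (p * q) = map_vars f p * map_vars f q"
proof -
  have "p * q = (\<Sum>a\<in>Poly_Mapping.keys p. \<Sum>b\<in>Poly_Mapping.keys q.
      Poly_Mapping.single (a + b) (Poly_Mapping.lookup p a * Poly_Mapping.lookup q b))"
    by (subst (1 2) sum_single_lookup[symmetric]) (simp only: sum_product mult_single)
  then have "map_vars f (p * q) = (\<Sum>a\<in>Poly_Mapping.keys p. \<Sum>b\<in>Poly_Mapping.keys q.
      Poly_Mapping.single (image_mset f a + image_mset f b) (Poly_Mapping.lookup p a * Poly_Mapping.lookup q b))"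
    by (simp add: map_vars_sum)
  also have "\<dots> = map_vars f p * map_vars f q"
    by (simp only: map_vars_def sum_product mult_single)
  finally show ?thesis .
qed

lemma keys_map_vars: "Poly_Mapping.keys (map_vars f p) \<subseteq> image_mset f ` Poly_Mapping.keys p"
  using keys_sum[of "\<lambda>a. Poly_Mapping.single (image_mset f a) (Poly_Mapping.lookup p a)" "Poly_Mapping.keys p"]
  by (fastforce simp: map_vars_def split: if_splits)

lemma depolarize_eq_map_vars: "depolarize = map_vars fst"
  by (rule ext) (simp add: depolarize_def map_vars_def depol_mon_def)

lemma lookup_var_diff_times:
  fixes p :: "('x, 'k::comm_ring_1) mpoly"
  shows "Poly_Mapping.lookup ((mon {#y#} - mon {#z#}) * p) n
    = (if y \<in># n then Poly_Mapping.lookup p (n - {#y#}) else 0) - (if z \<in># n then Poly_Mapping.lookup p (n - {#z#}) else 0)"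
  by (simp add: mult.commute[of _ p] right_diff_distrib lookup_minus mon_def lookup_times_single)

text \<open>A difference of two variables is a zero divisor modulo a monomial ideal only if some monomial
  outside the ideal is multiplied into it by both variables.\<close>

lemma var_diff_nonzerodivisor:
  fixes p :: "('x, 'k::comm_ring_1) mpoly"
  assumes up: "\<And>m n. m \<in> U \<Longrightarrow> m \<subseteq># n \<Longrightarrow> n \<in> U"
    and yz: "\<And>m. add_mset y m \<in> U \<Longrightarrow> add_mset z m \<in> U \<Longrightarrow> m \<in> U" and ne: "y \<noteq> z"
    and prod: "Poly_Mapping.keys ((mon {#y#} - mon {#z#}) * p) \<subseteq> U"
  shows "Poly_Mapping.keys p \<subseteq> U"
proof (rule ccontr)
  assume "\<not> Poly_Mapping.keys p \<subseteq> U"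
  then obtain b0 where b0: "b0 \<in> Poly_Mapping.keys p \<and> b0 \<notin> U" by blast
  have coeff: "(if y \<in># n then Poly_Mapping.lookup p (n - {#y#}) else 0)
      = (if z \<in># n then Poly_Mapping.lookup p (n - {#z#}) else 0)" if "n \<notin> U" for n
  proof -
    have "Poly_Mapping.lookup ((mon {#y#} - mon {#z#}) * p) n = 0"
      using prod that by (auto simp: in_keys_iff subset_iff)
    then show ?thesis unfolding lookup_var_diff_times by simp
  qed
  \<comment> \<open>Outside U the coefficients of the product vanish. So as long as b times z is
    outside U, exchanging one y of b for a z leads to another monomial of p outside U. This lowers
    the exponent of y, hence some power of z takes b into U.\<close>
  have power: "\<exists>q. b + replicate_mset q z \<in> U" if "b \<in> Poly_Mapping.keys p" "b \<notin> U" for b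
    using that
  proof (induction "count b y" arbitrary: b rule: less_induct)
    case less
    show ?case
    proof (cases "add_mset z b \<in> U")
      case True
      then show ?thesis by (intro exI[of _ 1]) simp
    next
      case False
      from coeff[OF False] less.prems(1) ne
      have y: "y \<in># b" and b1: "add_mset z b - {#y#} \<in> Poly_Mapping.keys p"
        by (auto simp: in_keys_iff split: if_splits)
      have "add_mset z b - {#y#} \<notin> U"
        using False up diff_subset_eq_self by blast
      moreover have "count (add_mset z b - {#y#}) y < count b y"
        using y ne by simp
      ultimately obtain q where "add_mset z b - {#y#} + replicate_mset q z \<in> U"
        using less.hyps b1 by blast
      moreover have "add_mset z b - {#y#} + replicate_mset q z \<subseteq># b + replicate_mset (Suc q) z"
        using y by (auto simp: subseteq_mset_def)
      ultimately show ?thesis using up by blast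
    qed
  qed
  \<comment> \<open>Maximality of the exponent of y forces y times b into U: otherwise exchanging a
    z for a y would give a monomial of p outside U with larger exponent of y.\<close>
  define b where "b = arg_max (\<lambda>b. count b y) (\<lambda>b. b \<in> Poly_Mapping.keys p \<and> b \<notin> U)"
  have "\<forall>b. b \<in> Poly_Mapping.keys p \<and> b \<notin> U \<longrightarrow> count b y < Suc (Max ((\<lambda>b. count b y) ` Poly_Mapping.keys p))"
    by (auto simp: less_Suc_eq_le)
  from arg_max_nat_lemma[OF b0 this]
  have b: "b \<in> Poly_Mapping.keys p" "b \<notin> U"
    and b_max: "\<And>c. c \<in> Poly_Mapping.keys p \<Longrightarrow> c \<notin> U \<Longrightarrow> count c y \<le> count b y"
    by (auto simp: b_def)
  have yb: "add_mset y b \<in> U"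
  proof (rule ccontr)
    assume *: "add_mset y b \<notin> U"
    from coeff[OF this] b(1) ne
    have z: "z \<in># b" and c: "add_mset y b - {#z#} \<in> Poly_Mapping.keys p"
      by (auto simp: in_keys_iff split: if_splits)
    have "add_mset y b - {#z#} \<notin> U"
      using * up diff_subset_eq_self by blast
    from b_max[OF c this] ne show False by simp
  qed
  \<comment> \<open>The last product of b with a power of z outside U is taken into U by z, by the
    choice of q, and by y, because y times b is already in U. This contradicts
    \<open>yz\<close>.\<close>
  define q where "q = (LEAST q. b + replicate_mset q z \<in> U)"
  have q: "b + replicate_mset q z \<in> U"
    unfolding q_def by (rule LeastI_ex[OF power[OF b]])
  with b(2) obtain q' where q': "q = Suc q'" by (cases q) auto
  have nq': "b + replicate_mset q' z \<notin> U"
    using not_less_Least[of q' "\<lambda>q. b + replicate_mset q z \<in> U"] q' by (simp add: q_def)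
  have "add_mset y (b + replicate_mset q' z) \<in> U"
    by (rule up[OF yb]) simp
  moreover have "add_mset z (b + replicate_mset q' z) \<in> U"
    using q by (simp add: q')
  ultimately show False using yz nq' by blast
qed

section \<open>Polarized monomials and the ideal that they generate\<close>

definition polarize :: "'x::finite multiset \<Rightarrow> ('x \<times> nat) multiset" where
  "polarize a = mset_set {(i, j). 1 \<le> j \<and> j \<le> count a i}"

lemma finite_polarize_set: "finite {(i::'x::finite, j). Suc 0 \<le> j \<and> j \<le> count a i}"
proof -
  have "{(i, j). Suc 0 \<le> j \<and> j \<le> count a i} = (SIGMA i:UNIV. {1..count a i})" by auto
  then show ?thesis by simp
qed

lemma count_polarize: "count (polarize a) (i, j) = of_bool (1 \<le> j \<and> j \<le> count a i)"
  by (simp add: polarize_def finite_polarize_set count_mset_set')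

lemma set_mset_polarize: "set_mset (polarize a) = {(i, j). 1 \<le> j \<and> j \<le> count a i}"
  by (simp add: polarize_def finite_polarize_set)

lemma count_image_mset_set: "finite S \<Longrightarrow> count (image_mset f (mset_set S)) v = card {s \<in> S. f s = v}"
proof (induction rule: finite_induct)
  case (insert x S)
  have "{s \<in> insert x S. f s = v} = (if f x = v then insert x {s \<in> S. f s = v} else {s \<in> S. f s = v})"
    by auto
  with insert show ?case by simp
qed simp

lemma depol_mon_polarize [simp]: "depol_mon (polarize a) = a"
proof (rule multiset_eqI)
  fix i
  have "{s \<in> {(i, j). Suc 0 \<le> j \<and> j \<le> count a i}. fst s = i} = Pair i ` {1..count a i}"
    by auto
  moreover have "card (Pair i ` {1..count a i}) = count a i"
    by (simp add: card_image inj_on_def)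
  ultimately show "count (depol_mon (polarize a)) i = count a i"
    by (simp add: depol_mon_def polarize_def finite_polarize_set count_image_mset_set del: mem_Collect_eq)
qed

lemma size_polarize [simp]: "size (polarize a) = size a"
  by (metis depol_mon_def depol_mon_polarize size_image_mset)

text \<open>Exponents turn into initial segments of copies of the variables, and inclusion of
  initial segments is comparison of their lengths.\<close>

lemma polarize_subset_iff: "polarize a \<subseteq># polarize b \<longleftrightarrow> a \<subseteq># b"
proof
  assume "polarize a \<subseteq># polarize b"
  then have "depol_mon (polarize a) \<subseteq># depol_mon (polarize b)"
    unfolding depol_mon_def by (rule image_mset_subseteq_mono)
  then show "a \<subseteq># b" by simp
next
  assume ab: "a \<subseteq># b"
  then have "count (polarize a) v \<le> count (polarize b) v" for v
    using mset_subset_eq_count[OF ab, of "fst v"] by (cases v) (auto simp: count_polarize)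
  then show "polarize a \<subseteq># polarize b" by (simp add: subseteq_mset_def)
qed

lemma inj_polarize: "inj polarize"
  by (metis depol_mon_polarize injI)

lemma subset_mset_size_eq: "a \<subseteq># b \<Longrightarrow> size a = size b \<Longrightarrow> a = b"
  by (metis mset_subset_size nat_less_le subset_mset.less_le)

definition standard_polarization :: "nat \<Rightarrow> ('x::finite \<times> nat, 'k::comm_ring_1) mpoly set" where
  "standard_polarization d = monomial_span (polvars (\<lambda>_. d)) (polarize ` {a. size a = d})"

lemma polarize_polvars: "size a \<le> d \<Longrightarrow> set_mset (polarize a) \<subseteq> polvars (\<lambda>_. d)"
  using count_le_size[of a] by (fastforce simp: set_mset_polarize polvars_def intro: order_trans)

lemma standard_polarization_genideal:
  "(standard_polarization d :: ('x::finite \<times> nat, 'k::comm_ring_1) mpoly set)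
    = Idl\<^bsub>poly_ring (polvars (\<lambda>_. d))\<^esub> (mon ` polarize ` {a. size a = d})"
  unfolding standard_polarization_def
  by (rule genideal_monomials[symmetric]) (use polarize_polvars in auto)

lemma mon_in_standard_polarization:
  "(mon b :: ('x::finite \<times> nat, 'k::comm_ring_1) mpoly) \<in> standard_polarization d
    \<longleftrightarrow> set_mset b \<subseteq> polvars (\<lambda>_. d) \<and> (\<exists>a. size a = d \<and> polarize a \<subseteq># b)"
  by (auto simp: standard_polarization_def monomial_span_def)

lemma min_gens_standard_polarization:
  "min_gens (standard_polarization d :: ('x::finite \<times> nat, 'k::comm_ring_1) mpoly set) = polarize ` {a. size a = d}"
proof (intro equalityI subsetI)
  fix b assume b: "b \<in> min_gens (standard_polarization d :: ('x \<times> nat, 'k) mpoly set)"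
  then obtain a where a: "size a = d" "polarize a \<subseteq># b"
    by (auto simp: min_gens_def mon_in_standard_polarization)
  then have "(mon (polarize a) :: ('x \<times> nat, 'k) mpoly) \<in> standard_polarization d"
    using polarize_polvars[of a d] by (auto simp: mon_in_standard_polarization)
  with a b show "b \<in> polarize ` {a. size a = d}"
    by (auto simp: min_gens_def)
next
  fix b assume "b \<in> polarize ` {a :: 'x multiset. size a = d}"
  then obtain a where a: "size a = d" and b: "b = polarize a" by auto
  have "c = polarize a" if c: "(mon c :: ('x \<times> nat, 'k) mpoly) \<in> standard_polarization d" "c \<subseteq># polarize a" for c
  proof -
    obtain a' where a': "size a' = d" "polarize a' \<subseteq># c"
      using c(1) by (auto simp: mon_in_standard_polarization)
    then have "a' \<subseteq># a"
      using c(2) polarize_subset_iff subset_mset.order_trans by blast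
    then have "a' = a" using a a'(1) subset_mset_size_eq by blast
    with a'(2) c(2) show ?thesis by (simp add: subset_mset.antisym)
  qed
  then show "b \<in> min_gens (standard_polarization d :: ('x \<times> nat, 'k) mpoly set)"
    using a polarize_polvars[of a d] unfolding b min_gens_def
    by (auto simp: mon_in_standard_polarization)
qed

lemma subset_mset_of_size:
  assumes "d \<le> size m" obtains a where "a \<subseteq># m" "size a = d"
proof -
  obtain xs where xs: "mset xs = m" using ex_mset by blast
  have "mset (take d xs) \<subseteq># m"
    unfolding xs[symmetric] by (metis append_take_drop_id mset_append mset_subset_eq_add_left)
  moreover have "size (mset (take d xs)) = d"
    using assms xs by (metis length_take min.absorb2 size_mset)
  ultimately show ?thesis using that by blast
qed

lemma depolarize_standard_polarization:
  assumes d: "d \<ge> 1"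
  shows "depolarize ` standard_polarization d = (irrelevant_power UNIV d :: ('x::finite, 'k::comm_ring_1) mpoly set)"
proof (intro equalityI subsetI)
  fix p :: "('x, 'k) mpoly" assume "p \<in> depolarize ` standard_polarization d"
  then obtain q :: "('x \<times> nat, 'k) mpoly" where q: "q \<in> standard_polarization d" "p = map_vars fst q"
    by (auto simp: depolarize_eq_map_vars)
  have "d \<le> size a" if a: "a \<in> Poly_Mapping.keys p" for a
  proof -
    obtain b where b: "b \<in> Poly_Mapping.keys q" "a = image_mset fst b"
      using a keys_map_vars[of fst q] q(2) by blast
    then obtain c where "size c = d" "polarize c \<subseteq># b"
      using q(1) by (auto simp: standard_polarization_def monomial_span_def)
    then show ?thesis using b(2) size_mset_mono[of "polarize c" b] by simp
  qed
  then show "p \<in> irrelevant_power UNIV d" by (simp add: irrelevant_power_eq)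
next
  fix p :: "('x, 'k) mpoly" assume p: "p \<in> irrelevant_power UNIV d"
  have "\<forall>m :: 'x multiset. \<exists>s. d \<le> size m \<longrightarrow> image_mset fst s = m \<and> set_mset s \<subseteq> polvars (\<lambda>_. d) \<and> (\<exists>a. size a = d \<and> polarize a \<subseteq># s)"
  proof
    fix m :: "'x multiset"
    show "\<exists>s. d \<le> size m \<longrightarrow> image_mset fst s = m \<and> set_mset s \<subseteq> polvars (\<lambda>_. d) \<and> (\<exists>a. size a = d \<and> polarize a \<subseteq># s)"
    proof (cases "d \<le> size m")
      case True
      then obtain a where a: "a \<subseteq># m" "size a = d" by (rule subset_mset_of_size)
      \<comment> \<open>Lift of a monomial of degree at least d: a divisor of degree d is polarized,
        and the remaining variables become first copies, which exist since d >= 1.\<close>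
      let ?s = "polarize a + image_mset (\<lambda>i. (i, 1)) (m - a)"
      have "image_mset fst ?s = m"
        using a(1) depol_mon_polarize[of a] by (simp add: depol_mon_def image_mset.compositionality o_def)
      moreover have "set_mset ?s \<subseteq> polvars (\<lambda>_. d)"
        using polarize_polvars[of a d] a(2) d by (auto simp: polvars_def)
      ultimately show ?thesis
        using a(2) by (intro exI[of _ ?s]) auto
    qed auto
  qed
  from choice[OF this] obtain s :: "'x multiset \<Rightarrow> ('x \<times> nat) multiset" where
    s: "\<And>m. d \<le> size m \<Longrightarrow> image_mset fst (s m) = m"
    "\<And>m. d \<le> size m \<Longrightarrow> set_mset (s m) \<subseteq> polvars (\<lambda>_. d)"
    "\<And>m. d \<le> size m \<Longrightarrow> \<exists>a. size a = d \<and> polarize a \<subseteq># s m"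
    by blast
  have keys: "d \<le> size m" if "m \<in> Poly_Mapping.keys p" for m
    using p that by (simp add: irrelevant_power_eq)
  define q where "q = (\<Sum>m\<in>Poly_Mapping.keys p. Poly_Mapping.single (s m) (Poly_Mapping.lookup p m))"
  have "map_vars fst q = (\<Sum>m\<in>Poly_Mapping.keys p. Poly_Mapping.single m (Poly_Mapping.lookup p m))"
    unfolding q_def map_vars_sum by (intro sum.cong refl) (simp add: s(1)[OF keys])
  then have "map_vars fst q = p" by (simp add: sum_single_lookup)
  moreover have "q \<in> standard_polarization d"
    unfolding q_def standard_polarization_def
  proof (rule sum_mem_closed)
    fix m assume "m \<in> Poly_Mapping.keys p"
    then show "Poly_Mapping.single (s m) (Poly_Mapping.lookup p m)
        \<in> monomial_span (polvars (\<lambda>_. d)) (polarize ` {a. size a = d})"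
      using s(2,3)[OF keys] by (auto simp: monomial_span_def dest: subsetD)
  qed (use ideal_poly_ringD[OF ideal_monomial_span] in auto)
  ultimately show "p \<in> depolarize ` standard_polarization d"
    unfolding depolarize_eq_map_vars by blast
qed

section \<open>Regularity of the differences of variables\<close>

text \<open>The quotient by the differences indexed by T is computed by this substitution: the
  variables in T become first copies, the others stay.\<close>

definition merge :: "('x \<times> nat) set \<Rightarrow> 'x \<times> nat \<Rightarrow> 'x \<times> nat" where
  "merge T v = (if v \<in> T then (fst v, 1) else v)"

lemma mon_diff_merge:
  fixes J :: "('x \<times> nat, 'k::comm_ring_1) mpoly set"
  assumes J: "ideal J (poly_ring A)" and T: "\<And>i j. (i, j) \<in> T \<Longrightarrow> mon {#(i, 1)#} - mon {#(i, j)#} \<in> J"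
    and A: "merge T ` A \<subseteq> A" and "set_mset a \<subseteq> A"
  shows "mon a - mon (image_mset (merge T) a) \<in> J"
  using \<open>set_mset a \<subseteq> A\<close>
proof (induction a)
  case empty
  then show ?case using ideal_poly_ringD(2)[OF J] by simp
next
  case (add v a)
  let ?a' = "image_mset (merge T) a"
  have v: "mon {#v#} - mon {#merge T v#} \<in> J"
  proof (cases "v \<in> T")
    case True
    then have "mon {#(fst v, 1)#} - mon {#v#} \<in> J"
      using T[of "fst v" "snd v"] by simp
    from ideal_poly_ringD(6)[OF J this] show ?thesis using True by (simp add: merge_def)
  next
    case False
    then show ?thesis using ideal_poly_ringD(2)[OF J] by (simp add: merge_def)
  qed
  have "mon (add_mset v a) - mon (image_mset (merge T) (add_mset v a))
      = mon {#v#} * (mon a - mon ?a') + (mon {#v#} - mon {#merge T v#}) * mon ?a'"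
    by (simp add: mon_add_mset[of _ a] mon_add_mset[of _ ?a'] algebra_simps)
  also have "\<dots> \<in> J"
    using add.prems add.IH v A
    by (intro ideal_poly_ringD(3,4,5)[OF J]) (auto dest: subsetD)
  finally show ?case .
qed

text \<open>Modulo the chosen differences a polynomial is congruent to its image under merging, and
  merging carries the ideal into a monomial ideal. Membership in the partial ideals of the sequence
  thus becomes a condition on supports.\<close>

lemma standard_polarization_merge_iff:
  fixes p :: "('x::finite \<times> nat, 'k::comm_ring_1) mpoly"
  assumes T: "T \<subseteq> {(i, j). 2 \<le> j \<and> j \<le> d}" and d: "d \<ge> 1"
  shows "p \<in> Idl\<^bsub>poly_ring (polvars (\<lambda>_. d))\<^esub>
      (standard_polarization d \<union> (\<lambda>(i, j). mon {#(i, 1)#} - mon {#(i, j)#}) ` T)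
    \<longleftrightarrow> p \<in> carrier (poly_ring (polvars (\<lambda>_. d))) \<and>
      map_vars (merge T) p \<in> monomial_span (polvars (\<lambda>_. d)) (image_mset (merge T) ` polarize ` {a. size a = d})"
    (is "p \<in> Idl\<^bsub>?R\<^esub> ?S \<longleftrightarrow> p \<in> carrier ?R \<and> ?\<pi> p \<in> ?M")
proof -
  let ?A = "polvars (\<lambda>_ :: 'x. d)"
  interpret R: ring "?R :: ('x \<times> nat, 'k) mpoly ring" by (rule ring_poly_ring)
  have A: "merge T ` ?A \<subseteq> ?A" using d by (auto simp: merge_def polvars_def)
  have S: "?S \<subseteq> carrier ?R"
    using T d by (force simp: standard_polarization_def monomial_span_def carrier_poly_ring polvars_def
      dest: subsetD[OF keys_diff])
  note J = genideal_poly_ring_ideal[OF S]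
  have diff: "mon a - mon (image_mset (merge T) a) \<in> Idl\<^bsub>?R\<^esub> ?S" if "set_mset a \<subseteq> ?A" for a
    by (rule mon_diff_merge[OF J _ A that]) (use R.genideal_self[OF S] in auto)
  have M: "ideal ?M ?R" by (rule ideal_monomial_span)
  have \<pi>_carrier: "?\<pi> q \<in> carrier ?R" if q: "q \<in> carrier ?R" for q :: "('x \<times> nat, 'k) mpoly"
    unfolding carrier_poly_ring
  proof
    fix b assume "b \<in> Poly_Mapping.keys (?\<pi> q)"
    then obtain c where c: "c \<in> Poly_Mapping.keys q" "b = image_mset (merge T) c"
      using keys_map_vars[of "merge T" q] by blast
    with q have "set_mset c \<subseteq> ?A" by (simp add: carrier_poly_ring)
    with A c(2) show "set_mset b \<subseteq> ?A" by auto
  qed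
  have "ideal {q \<in> carrier ?R. ?\<pi> q \<in> ?M} ?R"
    using ideal_poly_ringD[OF M] \<pi>_carrier
    by (intro ideal_poly_ringI) (auto simp: map_vars_add map_vars_mult)
  moreover have "?S \<subseteq> {q \<in> carrier ?R. ?\<pi> q \<in> ?M}"
  proof
    fix q assume q: "q \<in> ?S"
    have "?\<pi> q \<in> ?M"
    proof (cases "q \<in> standard_polarization d")
      case True
      show ?thesis
        unfolding monomial_span_def
      proof (intro CollectI ballI)
        fix b assume "b \<in> Poly_Mapping.keys (?\<pi> q)"
        then obtain c where c: "c \<in> Poly_Mapping.keys q" "b = image_mset (merge T) c"
          using keys_map_vars[of "merge T" q] by blast
        with True obtain a where "set_mset c \<subseteq> ?A" "size a = d" "polarize a \<subseteq># c"
          by (auto simp: standard_polarization_def monomial_span_def)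
        then show "set_mset b \<subseteq> ?A \<and> (\<exists>m\<in>image_mset (merge T) ` polarize ` {a. size a = d}. m \<subseteq># b)"
          using A c(2) by (auto intro!: image_mset_subseteq_mono)
      qed
    next
      case False
      with q obtain i j where ij: "(i, j) \<in> T" "q = mon {#(i, 1)#} - mon {#(i, j)#}" by auto
      then show ?thesis
        using ideal_poly_ringD(2)[OF M] by (simp add: map_vars_diff merge_def)
    qed
    with q S show "q \<in> {q \<in> carrier ?R. ?\<pi> q \<in> ?M}" by auto
  qed
  ultimately have sub: "Idl\<^bsub>?R\<^esub> ?S \<subseteq> {q \<in> carrier ?R. ?\<pi> q \<in> ?M}"
    by (rule R.genideal_minimal)
  have pol: "mon (polarize a) \<in> Idl\<^bsub>?R\<^esub> ?S" if "size a = d" for a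
  proof -
    have "(mon (polarize a) :: ('x \<times> nat, 'k) mpoly) \<in> standard_polarization d"
      using that polarize_polvars[of a d] unfolding mon_in_standard_polarization by blast
    then show ?thesis using R.genideal_self[OF S] by blast
  qed
  have M_sub: "?M \<subseteq> Idl\<^bsub>?R\<^esub> ?S"
  proof (subst genideal_monomials[symmetric])
    fix m assume "m \<in> image_mset (merge T) ` polarize ` {a. size a = d}"
    then show "set_mset m \<subseteq> ?A"
      using A polarize_polvars[of _ d] by fastforce
  next
    show "Idl\<^bsub>?R\<^esub> (mon ` image_mset (merge T) ` polarize ` {a. size a = d}) \<subseteq> Idl\<^bsub>?R\<^esub> ?S"
    proof (rule R.genideal_minimal[OF J], rule subsetI)
      fix q :: "('x \<times> nat, 'k) mpoly" assume "q \<in> mon ` image_mset (merge T) ` polarize ` {a. size a = d}"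
      then obtain a where a: "size a = d" and q: "q = mon (image_mset (merge T) (polarize a))" by auto
      have "mon (polarize a) + - (mon (polarize a) - mon (image_mset (merge T) (polarize a))) \<in> Idl\<^bsub>?R\<^esub> ?S"
        using pol[of a] diff[of "polarize a"] polarize_polvars[of a d] a
        by (intro ideal_poly_ringD(3,6)[OF J]) auto
      then show "q \<in> Idl\<^bsub>?R\<^esub> ?S" by (simp add: q)
    qed
  qed
  have "p \<in> Idl\<^bsub>?R\<^esub> ?S" if p: "p \<in> carrier ?R" "?\<pi> p \<in> ?M"
  proof -
    have "p - ?\<pi> p = (\<Sum>a\<in>Poly_Mapping.keys p.
        Poly_Mapping.single {#} (Poly_Mapping.lookup p a) * (mon a - mon (image_mset (merge T) a)))"
      by (subst (1) sum_single_lookup[of p, symmetric])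
        (simp add: map_vars_def sum_subtractf right_diff_distrib single_times_mon)
    also have "\<dots> \<in> Idl\<^bsub>?R\<^esub> ?S"
    proof (rule sum_mem_closed)
      fix a assume "a \<in> Poly_Mapping.keys p"
      then show "Poly_Mapping.single {#} (Poly_Mapping.lookup p a) * (mon a - mon (image_mset (merge T) a)) \<in> Idl\<^bsub>?R\<^esub> ?S"
        using p(1) by (intro ideal_poly_ringD(5)[OF J] diff) (auto simp: carrier_poly_ring)
    qed (use ideal_poly_ringD[OF J] in auto)
    finally have "(p - ?\<pi> p) + ?\<pi> p \<in> Idl\<^bsub>?R\<^esub> ?S"
      using p(2) M_sub by (intro ideal_poly_ringD(3)[OF J]) auto
    then show ?thesis by simp
  qed
  with sub show ?thesis by auto
qed

text \<open>Suppose that neither divides m. The second monomial uses up the new factor x_i^(j), so j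
  is at most the x_i-exponent of b and m does not contain x_i^(j). Hence the x_i-exponent of a is
  less than j. After merging, the exponent of x_i^(1) grows with the x_i-exponent, so the first
  monomial fits below m at x_i^(1), the only place where it could fail.\<close>

lemma merge_polarize_cancel:
  fixes m :: "('x::finite \<times> nat) multiset"
  assumes ij: "(i, j) \<notin> T" "2 \<le> j"
    and a: "image_mset (merge T) (polarize a) \<subseteq># add_mset (i, 1) m"
    and b: "image_mset (merge T) (polarize b) \<subseteq># add_mset (i, j) m"
  shows "image_mset (merge T) (polarize a) \<subseteq># m \<or> image_mset (merge T) (polarize b) \<subseteq># m"
proof (rule ccontr)
  have cnt: "count (image_mset (merge T) (polarize c)) v
      = card {s \<in> {(k, l). 1 \<le> l \<and> l \<le> count c k}. merge T s = v}" for c v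
    by (simp add: polarize_def finite_polarize_set count_image_mset_set)
  have strict: "count n v = count m v + 1" if "n \<subseteq># add_mset v m" "\<not> n \<subseteq># m" for n v
  proof -
    obtain u where u: "count n u > count m u" using \<open>\<not> n \<subseteq># m\<close> by (auto simp: subseteq_mset_def not_le)
    then show ?thesis
      using mset_subset_eq_count[OF that(1), of u] by (auto split: if_splits)
  qed
  have "{s \<in> {(k, l). 1 \<le> l \<and> l \<le> count c k}. merge T s = (i, j)} = (if j \<le> count c i then {(i, j)} else {})" for c
    using ij by (auto simp: merge_def split: if_splits)
  then have j: "count (image_mset (merge T) (polarize c)) (i, j) = of_bool (j \<le> count c i)" for c
    by (simp add: cnt)
  assume contr: "\<not> ?thesis"
  have b': "j \<le> count b i" and m0: "count m (i, j) = 0"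
    using strict[OF b] contr unfolding j by (auto simp: of_bool_def split: if_splits)
  have "count a i < j"
    using mset_subset_eq_count[OF a, of "(i, j)"] m0 ij(2) unfolding j by (auto simp: of_bool_def split: if_splits)
  with b' have le: "count a i \<le> count b i" by simp
  have "count (image_mset (merge T) (polarize a)) (i, 1) \<le> count (image_mset (merge T) (polarize b)) (i, 1)"
    unfolding cnt
    by (rule card_mono, rule finite_subset[OF _ finite_polarize_set[of b]])
      (use le in \<open>auto simp: merge_def split: if_splits simp flip: count_greater_zero_iff\<close>)
  moreover have "count (image_mset (merge T) (polarize b)) (i, 1) \<le> count m (i, 1)"
    using mset_subset_eq_count[OF b, of "(i, 1)"] ij(2) by (auto split: if_splits)
  moreover have "count (image_mset (merge T) (polarize a)) (i, 1) = count m (i, 1) + 1"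
    using strict[OF a] contr by auto
  ultimately show False by simp
qed

lemma standard_polarization_polarization:
  assumes d: "d \<ge> 1"
  shows "polarization (\<lambda>_. d) (standard_polarization d :: ('x::finite \<times> nat, 'k::field) mpoly set) (irrelevant_power UNIV d)"
proof -
  let ?A = "polvars (\<lambda>_ :: 'x. d)"
  let ?I = "standard_polarization d :: ('x \<times> nat, 'k) mpoly set"
  let ?f = "\<lambda>(i :: 'x, j). mon {#(i, 1)#} - mon {#(i, j)#} :: ('x \<times> nat, 'k) mpoly"
  have sqfree: "squarefree_monomial_ideal ?A ?I"
    unfolding squarefree_monomial_ideal_def standard_polarization_genideal
    by (rule exI[of _ "polarize ` {a. size a = d}"])
      (use polarize_polvars[of _ d] in \<open>force simp: count_polarize\<close>)
  have regular: "regular_sequence (poly_ring ?A) ?I s" if s: "distinct s" "set s = pol_differences (\<lambda>_. d)" for s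
  proof -
    have diffs: "pol_differences (\<lambda>_ :: 'x. d) = ?f ` {(i, j). 2 \<le> j \<and> j \<le> d}"
      by (auto simp: pol_differences_def)
    have T: "set (take i s) = ?f ` {v \<in> {(i, j). 2 \<le> j \<and> j \<le> d}. ?f v \<in> set (take i s)}" for i
      using set_take_subset[of i s] unfolding s(2) diffs by auto
    have carr: "set s \<subseteq> carrier (poly_ring ?A)"
      unfolding s(2) diffs using d
      by (force simp: carrier_poly_ring polvars_def dest: subsetD[OF keys_diff])
    have "p \<in> Idl\<^bsub>poly_ring ?A\<^esub> (?I \<union> set (take i s))"
      if i: "i < length s" and p: "p \<in> carrier (poly_ring ?A)"
        and fp: "s ! i * p \<in> Idl\<^bsub>poly_ring ?A\<^esub> (?I \<union> set (take i s))" for i p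
    proof -
      \<comment> \<open>The copies already identified with first copies by the preceding
        differences. Since the sequence is distinct, the copy in the current difference is not among
        them, so merging fixes both variables of that difference.\<close>
      define T' where "T' = {v \<in> {(i, j). 2 \<le> j \<and> j \<le> d}. ?f v \<in> set (take i s)}"
      have T': "T' \<subseteq> {(i, j). 2 \<le> j \<and> j \<le> d}" by (auto simp: T'_def)
      have take: "set (take i s) = ?f ` T'" using T by (simp add: T'_def)
      have "s ! i \<in> set s" using i by simp
      then obtain k l where kl: "2 \<le> l" "l \<le> d" "s ! i = mon {#(k, 1)#} - mon {#(k, l)#}"
        unfolding s(2) diffs by auto
      have "s ! i \<notin> set (take i s)"
        using distinct_take[OF s(1), of "Suc i"] i by (simp add: take_Suc_conv_app_nth)
      then have nT: "(k, l) \<notin> T'" using kl by (auto simp: T'_def)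
      have nT1: "(k, 1) \<notin> T'" using T' by auto
      define U where "U = {m. \<exists>a::'x multiset. size a = d \<and> image_mset (merge T') (polarize a) \<subseteq># m}"
      have iff: "q \<in> Idl\<^bsub>poly_ring ?A\<^esub> (?I \<union> set (take i s)) \<longleftrightarrow> q \<in> carrier (poly_ring ?A) \<and>
          map_vars (merge T') q \<in> monomial_span ?A (image_mset (merge T') ` polarize ` {a. size a = d})" for q
        unfolding take by (rule standard_polarization_merge_iff[OF T' d])
      have fp': "map_vars (merge T') (s ! i * p) = (mon {#(k, 1)#} - mon {#(k, l)#}) * map_vars (merge T') p"
        using nT nT1 by (simp add: map_vars_mult kl(3) map_vars_diff merge_def)
      have "Poly_Mapping.keys (map_vars (merge T') p) \<subseteq> U"
      proof (rule var_diff_nonzerodivisor)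
        show "n \<in> U" if "m \<in> U" "m \<subseteq># n" for m n
          using that subset_mset.order_trans unfolding U_def by blast
        show "m \<in> U" if "add_mset (k, 1) m \<in> U" "add_mset (k, l) m \<in> U" for m
          using that merge_polarize_cancel[OF nT kl(1)] unfolding U_def by blast
        show "(k, 1) \<noteq> (k, l)" using kl by simp
        show "Poly_Mapping.keys ((mon {#(k, 1)#} - mon {#(k, l)#}) * map_vars (merge T') p) \<subseteq> U"
          using fp unfolding iff fp' monomial_span_def U_def by blast
      qed
      moreover have "set_mset b \<subseteq> ?A" if b: "b \<in> Poly_Mapping.keys (map_vars (merge T') p)" for b
      proof -
        obtain c where c: "c \<in> Poly_Mapping.keys p" "b = image_mset (merge T') c"
          using b keys_map_vars[of "merge T'" p] by blast
        with p have "set_mset c \<subseteq> ?A" by (simp add: carrier_poly_ring)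
        moreover have "merge T' v \<in> ?A" if "v \<in> ?A" for v
          using that d by (auto simp: merge_def polvars_def)
        ultimately show ?thesis unfolding c(2) by auto
      qed
      ultimately show ?thesis
        using p unfolding iff monomial_span_def U_def by blast
    qed
    moreover have "Idl\<^bsub>poly_ring ?A\<^esub> (?I \<union> set s) \<noteq> carrier (poly_ring ?A)"
    proof -
      \<comment> \<open>Merging preserves degrees, so 1 would have to be divisible by a monomial of
        degree d.\<close>
      have "1 \<notin> Idl\<^bsub>poly_ring ?A\<^esub> (?I \<union> ?f ` {(i, j). 2 \<le> j \<and> j \<le> d})"
      proof
        assume "1 \<in> Idl\<^bsub>poly_ring ?A\<^esub> (?I \<union> ?f ` {(i, j). 2 \<le> j \<and> j \<le> d})"
        then have "map_vars (merge {(i, j). 2 \<le> j \<and> j \<le> d}) (mon {#} :: ('x \<times> nat, 'k) mpoly)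
          \<in> monomial_span ?A (image_mset (merge {(i, j). 2 \<le> j \<and> j \<le> d}) ` polarize ` {a. size a = d})"
          unfolding standard_polarization_merge_iff[OF subset_refl d] mon_empty by (rule conjunct2)
        then obtain a :: "'x multiset" where "size a = d" "polarize a = {#}"
          unfolding map_vars_mon by (auto simp: monomial_span_def)
        then show False
          using d size_polarize[of a] by simp
      qed
      then show ?thesis
        unfolding s(2) diffs using carrier_poly_ring_closed(2) by blast
    qed
    ultimately show ?thesis
      using carr unfolding regular_sequence_def by simp
  qed
  show ?thesis
    unfolding polarization_def using d
    by (intro conjI allI impI sqfree regular depolarize_standard_polarization[OF d]) auto
qed

section \<open>Flows on the triangular grid\<close>

text \<open>The cyclic order of the variables. It orients all small triangles uniformly and lets a
  statement about three variables be made for one variable and its two neighbours.\<close>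

fun nx :: "xyz \<Rightarrow> xyz" where "nx Vx = Vy" | "nx Vy = Vz" | "nx Vz = Vx"

fun pv :: "xyz \<Rightarrow> xyz" where "pv Vx = Vz" | "pv Vy = Vx" | "pv Vz = Vy"

lemma nx_pv [simp]: "nx (pv t) = t" "pv (nx t) = t" "nx (nx t) = pv t" "pv (pv t) = nx t"
  "nx t \<noteq> t" "pv t \<noteq> t" "nx t \<noteq> pv t" "t \<noteq> nx t" "t \<noteq> pv t" "pv t \<noteq> nx t"
  by (cases t; simp)+

lemma xyz_cases: "s = t \<or> s = nx t \<or> s = pv t"
  by (cases s; cases t; simp)

lemma UNIV_xyz: "(UNIV :: xyz set) = {t, nx t, pv t}"
  using xyz_cases by blast

lemma all_xyz: "(\<forall>s. P s) \<longleftrightarrow> P t \<and> P (nx t) \<and> P (pv t)"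
  using xyz_cases by metis

abbreviation xyz_mon :: "xyz multiset" where "xyz_mon \<equiv> {#Vx, Vy, Vz#}"

lemma count_xyz_mon [simp]: "count xyz_mon t = 1"
  by (cases t) auto

lemma xyz_mon_eq: "xyz_mon = {#t, nx t, pv t#}"
  by (cases t) auto

lemma size_xyz: "size (a :: xyz multiset) = count a t + count a (nx t) + count a (pv t)"
proof -
  have "size a = (\<Sum>s\<in>UNIV. count a s)"
    unfolding size_multiset_overloaded_eq by (rule sum.mono_neutral_left) (auto simp: not_in_iff)
  also have "\<dots> = count a t + count a (nx t) + count a (pv t)"
    by (subst UNIV_xyz[of t]) simp
  finally show ?thesis .
qed

text \<open>The edge \<open>(u, t)\<close> joins the two multiples of \<open>u\<close> by the variables other than \<open>t\<close>, and is directed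
  from \<open>u \<cdot> nx t\<close> to \<open>u \<cdot> pv t\<close>. In this way every small triangle, up or down, is a directed
  cycle.\<close>

definition conserved :: "(xyz multiset \<Rightarrow> xyz \<Rightarrow> 'k::ab_group_add) \<Rightarrow> bool" where
  "conserved z \<longleftrightarrow> (\<forall>a. (\<Sum>s\<in>UNIV. if s \<in># a then z (a - {#s#}) (nx s) - z (a - {#s#}) (pv s) else 0) = 0)"

text \<open>Solves for the weight of the up triangle u. Across the edge \<open>(u, Vz)\<close> lies
  the down triangle u / z, and across the \<open>Vx\<close> edge of the latter the up triangle x * u
  / z, whose exponent of z is smaller by one. The \<open>nat\<close> argument is this
  exponent.\<close>

fun up_rec :: "nat \<Rightarrow> (xyz multiset \<Rightarrow> xyz \<Rightarrow> 'k::ab_group_add) \<Rightarrow> xyz multiset \<Rightarrow> 'k" where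
  "up_rec 0 z u = z u Vz"
| "up_rec (Suc n) z u = z u Vz - (z (add_mset Vx (u - {#Vz#})) Vx - up_rec n z (add_mset Vx (u - {#Vz#})))"

text \<open>The grid has no holes: f and g are circulations around the up and the down triangles.
  They are chosen so that the remainder \<open>e\<close> vanishes on the \<open>Vz\<close> edges and
  on the \<open>Vx\<close> edges with x dividing u; conservation then makes it vanish
  everywhere.\<close>

lemma conserved_potential:
  fixes z :: "xyz multiset \<Rightarrow> xyz \<Rightarrow> 'k::ab_group_add"
  assumes z: "conserved z"
  obtains f g where "\<And>u t. z u t = f u + (if t \<in># u then g (u - {#t#}) else 0)"
proof -
  define f where "f u = up_rec (count u Vz) z u" for u
  define g where "g w = z (add_mset Vx w) Vx - f (add_mset Vx w)" for w
  have f: "f u = z u Vz - (if Vz \<in># u then g (u - {#Vz#}) else 0)" for u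
  proof (cases "count u Vz")
    case 0
    then have "Vz \<notin># u" by (simp add: not_in_iff)
    with 0 show ?thesis by (simp add: f_def)
  next
    case (Suc n)
    then have "Vz \<in># u" by (simp flip: count_greater_zero_iff)
    then show ?thesis using Suc by (simp add: f_def g_def)
  qed
  define e where "e u t = z u t - f u - (if t \<in># u then g (u - {#t#}) else 0)" for u t
  have ez: "e u Vz = 0" for u by (simp add: e_def f)
  have ex: "e u Vx = 0" if "Vx \<in># u" for u using that by (simp add: e_def g_def)
  have cons: "(if Vx \<in># a then e (a - {#Vx#}) Vy - e (a - {#Vx#}) Vz else 0)
      + (if Vy \<in># a then e (a - {#Vy#}) Vz - e (a - {#Vy#}) Vx else 0)
      + (if Vz \<in># a then e (a - {#Vz#}) Vx - e (a - {#Vz#}) Vy else 0) = 0" for a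
  proof -
    have "(if Vx \<in># a then z (a - {#Vx#}) Vy - z (a - {#Vx#}) Vz else 0)
      + (if Vy \<in># a then z (a - {#Vy#}) Vz - z (a - {#Vy#}) Vx else 0)
      + (if Vz \<in># a then z (a - {#Vz#}) Vx - z (a - {#Vz#}) Vy else 0) = 0"
      using z[unfolded conserved_def, rule_format, of a]
      by (simp add: UNIV_xyz[of Vx] add.assoc cong: if_cong split del: if_split)
    then show ?thesis
      unfolding e_def
      by (auto simp: add_mset_commute algebra_simps in_diff_count split: if_splits)
  qed
  \<comment> \<open>Apart from edges already known to carry 0, conservation at the vertex x * u
    involves only the \<open>Vy\<close> edges of u and of x * u / z, and the latter has a smaller
    exponent of z.\<close>
  have ey: "e u Vy = 0" for u
  proof (induction "count u Vz" arbitrary: u rule: less_induct)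
    case less
    have "e u Vy = (if Vz \<in># u then e (add_mset Vx u - {#Vz#}) Vy else 0)"
      using cons[of "add_mset Vx u"] ez ex[of "add_mset Vx u - {#Vy#}"] ex[of "add_mset Vx u - {#Vz#}"]
      by (auto simp: in_diff_count split: if_splits)
    also have "\<dots> = 0"
      using less[of "add_mset Vx u - {#Vz#}"] by auto
    finally show ?case .
  qed
  \<comment> \<open>For u not divisible by x the same argument works at the vertex y * u.\<close>
  have "e u Vx = 0" for u
  proof (induction "count u Vz" arbitrary: u rule: less_induct)
    case less
    show ?case
    proof (cases "Vx \<in># u")
      case False
      then have "e u Vx = (if Vz \<in># u then e (add_mset Vy u - {#Vz#}) Vx else 0)"
        using cons[of "add_mset Vy u"] ez ey by (auto split: if_splits)
      also have "\<dots> = 0"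
        using less[of "add_mset Vy u - {#Vz#}"] by auto
      finally show ?thesis .
    qed (rule ex)
  qed
  with ey ez have "e u t = 0" for u t by (cases t) auto
  then have "z u t = f u + (if t \<in># u then g (u - {#t#}) else 0)" for u t
    unfolding e_def by (simp add: diff_eq_eq add.commute)
  then show ?thesis by (rule that)
qed

definition edge_label :: "xyz multiset \<Rightarrow> xyz \<Rightarrow> xyz multiset" where
  "edge_label u t = u + {#nx t, pv t#}"

lemma count_edge_label: "count (edge_label u t) s = count u s + (if s = t then 0 else 1)"
  using xyz_cases[of s t] by (auto simp: edge_label_def)

text \<open>If the label of the up triangle u exceeds b in the variable v, then so do the labels of
  the edges that separate u from u * v / nx v. The flow is 0 there, so f takes the same value at
  both. Repeating this lowers the exponent of \<open>nx v\<close> until an edge on the border of the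
  grid gives the value 0.\<close>

lemma potential_support:
  fixes f g :: "xyz multiset \<Rightarrow> 'k::ab_group_add"
  assumes zero: "\<And>u t. \<not> edge_label u t \<subseteq># b \<Longrightarrow> f u + (if t \<in># u then g (u - {#t#}) else 0) = 0"
  shows "\<not> u + xyz_mon \<subseteq># b \<Longrightarrow> f u = 0" "\<not> w + xyz_mon \<subseteq># b \<Longrightarrow> g w = 0"
proof -
  have over: "\<not> edge_label u t \<subseteq># b" if "count b v < count u v + 1" "v \<noteq> t" for u v t
    using that mset_subset_eq_count[of "edge_label u t" b v] by (auto simp: count_edge_label)
  have f_zero: "f u = 0" if "count b v < count u v + 1" for u v
    using that
  proof (induction "count u (nx v)" arbitrary: u rule: less_induct)
    case less
    have fu: "f u + (if nx v \<in># u then g (u - {#nx v#}) else 0) = 0"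
      by (rule zero, rule over[OF less.prems]) simp
    show ?case
    proof (cases "nx v \<in># u")
      case True
      let ?w = "u - {#nx v#}"
      have "count b v < count (add_mset v ?w) v + 1" "count (add_mset v ?w) (nx v) < count u (nx v)"
        using less.prems True by auto
      then have "f (add_mset v ?w) = 0" by (rule less.hyps[rotated])
      moreover have "\<not> edge_label (add_mset v ?w) v \<subseteq># b"
        using less.prems mset_subset_eq_count[of "edge_label (add_mset v ?w) v" b v] by (auto simp: count_edge_label)
      from zero[OF this] have "f (add_mset v ?w) + g ?w = 0" by simp
      ultimately show ?thesis using fu True by simp
    qed (use fu in simp)
  qed
  show f: "f u = 0" if "\<not> u + xyz_mon \<subseteq># b" for u
  proof -
    have "\<exists>v. count b v < count (u + xyz_mon) v"
      using that unfolding subseteq_mset_def not_all not_le .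
    then show ?thesis using f_zero unfolding count_union count_xyz_mon by blast
  qed
  show "g w = 0" if w: "\<not> w + xyz_mon \<subseteq># b"
  proof -
    have "edge_label (add_mset Vx w) Vx = w + xyz_mon" by (simp add: edge_label_def)
    then have "f (add_mset Vx w) + g w = 0" using zero[of "add_mset Vx w" Vx] w by simp
    moreover have "\<not> add_mset Vx w + xyz_mon \<subseteq># b"
    proof -
      have "w + xyz_mon \<subseteq># add_mset Vx w + xyz_mon" by (simp add: subseteq_mset_def)
      then show ?thesis using w subset_mset.order_trans by blast
    qed
    ultimately show ?thesis using f by simp
  qed
qed

text \<open>\<open>rm w\<close> names the removed edge \<open>(w \<cdot> rm w, rm w)\<close> of the down triangle \<open>w\<close>, which is thereby merged
  into the up triangle \<open>owner rm w\<close>; \<open>owns rm u t\<close> says that the down triangle across the edge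
  \<open>(u, t)\<close> is merged into the up triangle \<open>u\<close>, that is, that this edge is removed.\<close>

definition owner :: "(xyz multiset \<Rightarrow> xyz) \<Rightarrow> xyz multiset \<Rightarrow> xyz multiset" where
  "owner rm w = add_mset (rm w) w"

definition owns :: "(xyz multiset \<Rightarrow> xyz) \<Rightarrow> xyz multiset \<Rightarrow> xyz \<Rightarrow> bool" where
  "owns rm u t \<longleftrightarrow> t \<in># u \<and> rm (u - {#t#}) = t"

text \<open>The boundary of the region v in the standard directions: the up triangle v minus the
  down triangles merged into it. On a removed edge inside the region the two contributions
  cancel.\<close>

definition region_coeff :: "(xyz multiset \<Rightarrow> xyz) \<Rightarrow> xyz multiset \<Rightarrow> xyz multiset \<Rightarrow> xyz \<Rightarrow> int" where
  "region_coeff rm v u t = of_bool (v = u) - of_bool (t \<in># u \<and> v = owner rm (u - {#t#}))"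

text \<open>A removed edge borders one up and one down triangle. Vanishing there makes the weight of
  the down triangle the negative of that of its owner, so the triangles combine into
  regions.\<close>

lemma region_flow:
  fixes z :: "xyz multiset \<Rightarrow> xyz \<Rightarrow> 'k::ab_group_add"
  assumes cons: "conserved z" and removed: "\<And>u t. owns rm u t \<Longrightarrow> z u t = 0"
    and supp: "\<And>u t. z u t \<noteq> 0 \<Longrightarrow> edge_label u t \<subseteq># b"
  obtains f where "\<And>u. f u \<noteq> 0 \<Longrightarrow> u + xyz_mon \<subseteq># b"
    "\<And>u t. z u t = f u - (if t \<in># u then f (owner rm (u - {#t#})) else 0)"
proof -
  obtain f g where fg: "\<And>u t. z u t = f u + (if t \<in># u then g (u - {#t#}) else 0)"
    by (rule conserved_potential[OF cons]) blast
  have g: "g w = - f (owner rm w)" for w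
    using removed[of "owner rm w" "rm w"] fg[of "owner rm w" "rm w"]
    by (simp add: owns_def owner_def eq_neg_iff_add_eq_0 add.commute)
  have zero: "f u + (if t \<in># u then g (u - {#t#}) else 0) = 0" if "\<not> edge_label u t \<subseteq># b" for u t
    using supp[of u t] that unfolding fg[symmetric] by blast
  have "u + xyz_mon \<subseteq># b" if "f u \<noteq> 0" for u
    using potential_support(1)[of b f g u, OF zero] that by blast
  moreover have "z u t = f u - (if t \<in># u then f (owner rm (u - {#t#})) else 0)" for u t
    using fg[of u t] by (simp add: g)
  ultimately show ?thesis by (rule that)
qed

text \<open>The zero flow is supported below the monomial 1, which is divisible by no label of a
  triangle.\<close>

lemma region_flow_unique:
  fixes f :: "xyz multiset \<Rightarrow> 'k::ab_group_add"
  assumes "\<And>u t. f u - (if t \<in># u then f (owner rm (u - {#t#})) else 0) = 0"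
  shows "f u = 0"
proof (rule potential_support(1))
  show "f u + (if t \<in># u then - f (owner rm (u - {#t#})) else 0) = 0" for u t
    using assms[of u t] by (auto split: if_splits)
  show "\<not> u + xyz_mon \<subseteq># {#}" by simp
qed

text \<open>Exchanging a variable in which a exceeds b for one in which b exceeds a stays below m
  and shortens a - b. The relation \<open>P\<close> is left open: it is used for being joined by
  chains with different conditions on the labels.\<close>

lemma grid_connected:
  assumes refl: "\<And>a. P a a" and trans: "\<And>a b c. P a b \<Longrightarrow> P b c \<Longrightarrow> P a c"
    and step: "\<And>u s t. s \<noteq> t \<Longrightarrow> add_mset s u \<subseteq># m \<Longrightarrow> add_mset t u \<subseteq># m \<Longrightarrow> size u + 1 = d \<Longrightarrow> P (add_mset s u) (add_mset t u)"
    and "size a = d" "size b = d" "a \<subseteq># m" "b \<subseteq># (m :: xyz multiset)"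
  shows "P a b"
  using assms(4-)
proof (induction "size (a - b)" arbitrary: a rule: less_induct)
  case less
  show ?case
  proof (cases "a = b")
    case False
    have "\<not> a \<subseteq># b" "\<not> b \<subseteq># a"
      using False less.prems mset_subset_size[of a b] mset_subset_size[of b a]
      by (auto simp: subset_mset.less_le)
    then obtain p q where pq: "count b p < count a p" "count a q < count b q"
      unfolding subseteq_mset_def not_all not_le by blast
    then have p: "p \<in># a" "p \<noteq> q" by (auto simp flip: count_greater_zero_iff)
    define u where "u = a - {#p#}"
    have a: "a = add_mset p u" using p by (simp add: u_def)
    have qu: "add_mset q u \<subseteq># m"
      unfolding subseteq_mset_def
    proof
      fix s
      show "count (add_mset q u) s \<le> count m s"
        using mset_subset_eq_count[OF less.prems(3), of s] mset_subset_eq_count[OF less.prems(4), of q] pq p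
        by (auto simp: u_def)
    qed
    have "add_mset q u - b = a - b - {#p#}"
      using pq p by (intro multiset_eqI) (auto simp: u_def)
    moreover have "p \<in># a - b" using pq by (simp add: in_diff_count)
    ultimately have "size (add_mset q u - b) < size (a - b)"
      by (metis add_mset_add_single insert_DiffM2 size_add_mset lessI)
    moreover have "size (add_mset q u) = d" using less.prems(1) by (simp add: a)
    ultimately have "P (add_mset q u) b" using less.hyps less.prems qu by blast
    moreover have "P a (add_mset q u)"
      unfolding a using p less.prems qu by (intro step) (auto simp: a)
    ultimately show ?thesis using trans by blast
  qed (use refl in simp)
qed

section \<open>The regions of the drawing\<close>

definition edge :: "xyz multiset \<Rightarrow> xyz \<Rightarrow> xyz multiset set" where
  "edge u t = {add_mset (nx t) u, add_mset (pv t) u}"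

text \<open>The gcd of the two ends is u, and t is the variable by which neither end is obtained
  from u.\<close>

lemma edge_eq_iff: "edge u t = edge u' t' \<longleftrightarrow> u = u' \<and> t = t'"
proof
  assume eq: "edge u t = edge u' t'"
  have inter: "add_mset (nx s) v \<inter># add_mset (pv s) v = v" for s v
    by (rule multiset_eqI, cases s) auto
  have "add_mset (nx t) u \<inter># add_mset (pv t) u = add_mset (nx t') u' \<inter># add_mset (pv t') u'"
    using eq unfolding edge_def doubleton_eq_iff by (auto simp: inf_commute subset_mset.inf_commute)
  then have u: "u = u'" by (simp only: inter)
  with eq have "t = t'"
    unfolding edge_def doubleton_eq_iff by (cases t; cases t') auto
  with u show "u = u' \<and> t = t'" by simp
qed simp

lemma card_edge: "card (edge u t) = 2"
  by (simp add: edge_def)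

lemma edge_size: "a \<in> edge u t \<Longrightarrow> size a = size u + 1"
  by (auto simp: edge_def)

lemma mem_edge_iff: "a \<in> edge u t \<longleftrightarrow> (\<exists>s. s \<noteq> t \<and> a = add_mset s u)"
  unfolding edge_def using xyz_cases[of _ t] nx_pv(5,6)[of t] by auto

lemma edge_of_pair: "p \<noteq> q \<Longrightarrow> \<exists>t. {add_mset p u, add_mset q u} = edge u t"
  by (cases p; cases q; auto simp: edge_def insert_commute intro: exI[of _ Vx] exI[of _ Vy] exI[of _ Vz])

lemma Gamma_edges_eq: "Gamma_edges d = {edge u t | u t. size u + 1 = d}"
proof (intro equalityI subsetI)
  fix e assume "e \<in> Gamma_edges d"
  then obtain a b where ab: "e = {a, b}" "size a = d" "size b = d" "size (a \<union># b) = d + 1"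
    by (auto simp: Gamma_edges_def monomials_def)
  have "a \<union># b = a + (b - a)" "a \<union># b = b + (a - b)"
    by (rule multiset_eqI, simp)+
  then have "size (b - a) = 1" "size (a - b) = 1"
    using ab(2-4) by (metis add_diff_cancel_left' size_union)+
  then obtain p q where pq: "a - b = {#p#}" "b - a = {#q#}"
    by (metis One_nat_def size_1_singleton_mset)
  have "count (a - b) p > 0" "count (b - a) q > 0" using pq by simp_all
  then have "p \<noteq> q" by auto
  define u where "u = a \<inter># b"
  have "a = u + (a - b)" "b = u + (b - a)"
    unfolding u_def by (rule multiset_eqI, simp)+
  then have "a = add_mset p u" "b = add_mset q u" using pq by simp_all
  with edge_of_pair[OF \<open>p \<noteq> q\<close>, of u] ab show "e \<in> {edge u t | u t. size u + 1 = d}"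
    by auto
next
  fix e assume "e \<in> {edge u t | u t. size u + 1 = d}"
  then obtain u t where e: "e = edge u t" "size u + 1 = d" by blast
  have "add_mset (nx t) u \<union># add_mset (pv t) u = edge_label u t"
    by (rule multiset_eqI) (auto simp: edge_label_def)
  then have "size (add_mset (nx t) u \<union># add_mset (pv t) u) = d + 1"
    using e(2) by (simp add: edge_label_def)
  with e show "e \<in> Gamma_edges d"
    unfolding Gamma_edges_def monomials_def edge_def by (intro CollectI exI conjI) auto
qed

text \<open>The side of the down triangle w that avoids the vertex without the new factor t is the
  edge \<open>(w * t, t)\<close>, so choosing a side amounts to choosing a variable.\<close>

definition removed :: "(xyz multiset \<Rightarrow> xyz multiset set) \<Rightarrow> xyz multiset \<Rightarrow> xyz" where
  "removed c w = (SOME t. c w = edge (add_mset t w) t)"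

lemma down_triangle_eq: "down_triangle w = (\<lambda>s. w + {#nx s, pv s#}) ` UNIV"
  unfolding down_triangle_def UNIV_xyz[of Vx] by (auto simp: add_mset_commute)

lemma edge_in_down_triangle: "edge (add_mset t w) t = (\<lambda>s. w + {#nx s, pv s#}) ` {s. s \<noteq> t}"
proof -
  have "{s. s \<noteq> t} = {nx t, pv t}" using xyz_cases[of _ t] by auto
  then show ?thesis by (auto simp: edge_def add_mset_commute)
qed

lemma inj_down: "inj (\<lambda>s. w + {#nx s, pv s#})"
proof (rule injI)
  fix s t assume "w + {#nx s, pv s#} = w + {#nx t, pv t#}"
  then have "edge_label w s = edge_label w t" by (simp only: edge_label_def)
  then have "count (edge_label w s) s = count (edge_label w t) s" by (rule arg_cong)
  then show "s = t" by (simp add: count_edge_label split: if_splits)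
qed

lemma removed_edge:
  assumes "edge_choice d c" "size w + 2 = d"
  shows "c w = edge (add_mset (removed c w) w) (removed c w)"
proof -
  from assms have c: "c w \<subseteq> down_triangle w" "card (c w) = 2" by (auto simp: edge_choice_def)
  have "card (down_triangle w) = 3"
    unfolding down_triangle_eq card_image[OF inj_down] UNIV_xyz[of Vx] by simp
  moreover have fin: "finite (down_triangle w)" by (simp add: down_triangle_def)
  ultimately have "card (down_triangle w - c w) = 1"
    using c by (subst card_Diff_subset) (auto intro: finite_subset)
  then obtain v where v: "down_triangle w - c w = {v}" by (auto simp: card_1_singleton_iff)
  then obtain t where t: "v = w + {#nx t, pv t#}" by (auto simp: down_triangle_eq)
  have "c w = down_triangle w - {v}" using v c by blast
  also have "\<dots> = edge (add_mset t w) t"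
    unfolding edge_in_down_triangle down_triangle_eq t
    using inj_down[of w] by (auto dest: injD)
  finally show ?thesis unfolding removed_def by (rule someI)
qed

text \<open>The only down triangle containing the edge \<open>(u, t)\<close> is u / t, provided that
  t divides u; so the edge is removed exactly if the choice at u / t is t.\<close>

lemma Delta_edges_eq:
  assumes "edge_choice d c"
  shows "Delta_edges d c = {edge u t | u t. size u + 1 = d \<and> \<not> owns (removed c) u t}"
proof -
  have "edge u t \<in> {c w | w. size w + 2 = d} \<longleftrightarrow> owns (removed c) u t" if "size u + 1 = d" for u t
  proof
    assume "edge u t \<in> {c w | w. size w + 2 = d}"
    then obtain w where "edge u t = c w" "size w + 2 = d" by blast
    then have "edge u t = edge (add_mset (removed c w) w) (removed c w)"
      using removed_edge[OF assms] by simp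
    then show "owns (removed c) u t" by (auto simp: edge_eq_iff owns_def)
  next
    assume o: "owns (removed c) u t"
    then have u: "u = add_mset t (u - {#t#})" "removed c (u - {#t#}) = t" by (auto simp: owns_def)
    then have sz: "size (u - {#t#}) + 2 = d" using that by (metis Suc_eq_plus1 add_2_eq_Suc' size_add_mset)
    have "c (u - {#t#}) = edge u t" using removed_edge[OF assms sz] u by simp
    with sz show "edge u t \<in> {c w | w. size w + 2 = d}" by blast
  qed
  then show ?thesis
    unfolding Delta_edges_def Gamma_edges_eq by blast
qed

section \<open>Regions described by inequalities between exponents\<close>

text \<open>The lattice points of the closed region: the exponent of v may drop below that of u,
  that is, the side v may be crossed, only if the down triangle behind it is merged.\<close>

definition region :: "(xyz multiset \<Rightarrow> xyz) \<Rightarrow> xyz multiset \<Rightarrow> xyz multiset set" where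
  "region rm u = {a. size a = size u + 1 \<and>
    (\<forall>v. count a v \<le> count u v + 1 \<and> (owns rm u v \<or> count u v \<le> count a v))}"

text \<open>The three exponents as affine functions on the plane with sum d, so that conditions on
  points are symmetric in the variables.\<close>

definition coord :: "nat \<Rightarrow> xyz \<Rightarrow> real \<times> real \<Rightarrow> real" where
  "coord d v P = (case v of Vx \<Rightarrow> fst P | Vy \<Rightarrow> snd P | Vz \<Rightarrow> real d - fst P - snd P)"

lemma coord_sum: "coord d t P + coord d (nx t) P + coord d (pv t) P = real d"
  by (cases t) (auto simp: coord_def)

lemma coord_eqI: "(\<And>v. coord d v P = coord d v Q) \<Longrightarrow> P = Q"
  by (metis coord_def prod_eq_iff xyz.simps(7,8))

lemma coord_position: "size a = d \<Longrightarrow> coord d v (position a) = real (count a v)"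
  using size_xyz[of a Vx] by (cases v) (auto simp: coord_def position_def)

lemma coord_affine: "coord d v ((1 - e) *\<^sub>R P + e *\<^sub>R Q) = (1 - e) * coord d v P + e * coord d v Q"
  by (cases v) (auto simp: coord_def algebra_simps)

lemma continuous_on_coord: "continuous_on S (coord d v)"
  by (cases v) (auto simp: coord_def[abs_def] intro!: continuous_intros)



lemma hull_edge:
  assumes u: "size u + 1 = d"
  shows "convex hull (position ` edge u t) = {P. coord d t P = real (count u t) \<and>
    (\<forall>s. s \<noteq> t \<longrightarrow> real (count u s) \<le> coord d s P \<and> coord d s P \<le> real (count u s) + 1)}"
    (is "_ = ?S")
proof -
  let ?A = "position (add_mset (nx t) u)" and ?B = "position (add_mset (pv t) u)"
  have A: "coord d v ?A = real (count u v) + (if v = nx t then 1 else 0)"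
    and B: "coord d v ?B = real (count u v) + (if v = pv t then 1 else 0)" for v
    using u by (simp_all add: coord_position)
  have "convex hull (position ` edge u t) = {(1 - e) *\<^sub>R ?A + e *\<^sub>R ?B | e. 0 \<le> e \<and> e \<le> 1}"
    by (simp add: edge_def flip: segment_convex_hull) (simp add: closed_segment_def)
  also have "\<dots> = ?S"
  proof (intro equalityI subsetI)
    fix P assume "P \<in> {(1 - e) *\<^sub>R ?A + e *\<^sub>R ?B | e. 0 \<le> e \<and> e \<le> 1}"
    then obtain e where e: "0 \<le> e" "e \<le> 1" and P: "P = (1 - e) *\<^sub>R ?A + e *\<^sub>R ?B" by blast
    show "P \<in> ?S"
      unfolding P mem_Collect_eq coord_affine A B all_xyz[of _ t]
      using e by (auto simp: algebra_simps)
  next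
    fix P assume P: "P \<in> ?S"
    let ?e = "coord d (pv t) P - real (count u (pv t))"
    have "real (count u (pv t)) \<le> coord d (pv t) P \<and> coord d (pv t) P \<le> real (count u (pv t)) + 1"
      using P nx_pv(6)[of t] by blast
    moreover have "coord d t P = real (count u t)" using P by blast
    ultimately have e: "0 \<le> ?e" "?e \<le> 1" "coord d t P = real (count u t)" by linarith+
    have sum: "coord d (nx t) P = real (count u (nx t)) + 1 - ?e"
      using e(3) coord_sum[of d t P] size_xyz[of u t] u by (simp flip: u)
    have "coord d v P = coord d v ((1 - ?e) *\<^sub>R ?A + ?e *\<^sub>R ?B)" for v
      using e(3) sum xyz_cases[of v t] unfolding coord_affine A B by (auto simp: algebra_simps)
    then have "P = (1 - ?e) *\<^sub>R ?A + ?e *\<^sub>R ?B" by (rule coord_eqI)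
    with e show "P \<in> {(1 - e) *\<^sub>R ?A + e *\<^sub>R ?B | e. 0 \<le> e \<and> e \<le> 1}" by blast
  qed
  finally show ?thesis .
qed

text \<open>The strict form of the inequalities. With 0, 1, 2 or 3 merged down triangles this is a
  triangle, a parallelogram, a trapezoid or a triangle of side 2, always convex.\<close>

definition open_region :: "(xyz multiset \<Rightarrow> xyz) \<Rightarrow> xyz multiset \<Rightarrow> (real \<times> real) set" where
  "open_region rm u = {P. \<forall>v. coord (size u + 1) v P < real (count u v) + 1 \<and>
    (owns rm u v \<or> real (count u v) < coord (size u + 1) v P)}"

lemma owns_count: "owns rm u v \<Longrightarrow> 1 \<le> count u v"
  by (auto simp: owns_def)

text \<open>The sum of the coordinates is fixed, so upper bounds for two of them bound the third
  from below. It is positive because an owned side v requires v to divide u.\<close>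

lemma open_region_lower:
  assumes "P \<in> open_region rm u"
  shows "real (count u v) - 1 < coord (size u + 1) v P" "0 < coord (size u + 1) v P"
proof -
  have lt: "coord (size u + 1) s P < real (count u s) + 1" for s
    using assms by (auto simp: open_region_def)
  show *: "real (count u v) - 1 < coord (size u + 1) v P"
    using lt[of "nx v"] lt[of "pv v"] coord_sum[of "size u + 1" v P] size_xyz[of u v] by simp
  show "0 < coord (size u + 1) v P"
  proof (cases "owns rm u v")
    case True
    then show ?thesis using owns_count[OF True] * by linarith
  next
    case False
    then have "real (count u v) < coord (size u + 1) v P" using assms by (auto simp: open_region_def)
    then show ?thesis by linarith
  qed
qed

text \<open>A common point forces the exponents of u and u' to differ by at most one, and a larger
  exponent to belong to an owned side. So u = w * p and u' = w * q would both own the down triangle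
  w, which has a single owner.\<close>

lemma open_region_disjoint:
  assumes P: "P \<in> open_region rm u" "P \<in> open_region rm u'" and sz: "size u = size u'"
  shows "u = u'"
proof (rule ccontr)
  assume ne: "u \<noteq> u'"
  have le: "count v s \<le> count v' s + 1" if "P \<in> open_region rm v" "P \<in> open_region rm v'" "size v = size v'" for v v' s
  proof -
    have "real (count v s) - 1 < real (count v' s) + 1"
    proof -
      have "coord (size v' + 1) s P < real (count v' s) + 1"
        using that(2) by (simp add: open_region_def)
      then show ?thesis using open_region_lower(1)[OF that(1), of s] that(3) by simp
    qed
    then show ?thesis by linarith
  qed
  have own: "owns rm v s" if "P \<in> open_region rm v" "P \<in> open_region rm v'" "size v = size v'" "count v' s < count v s" for v v' s
  proof (rule ccontr)
    assume "\<not> owns rm v s"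
    then have "real (count v s) < coord (size v + 1) s P" "coord (size v + 1) s P < real (count v' s) + 1"
      using that by (auto simp: open_region_def)
    then show False using that(4) by linarith
  qed
  have "\<not> u \<subseteq># u'" "\<not> u' \<subseteq># u"
    using ne sz mset_subset_size[of u u'] mset_subset_size[of u' u] by (auto simp: subset_mset.less_le)
  then obtain p q where pq: "count u' p < count u p" "count u q < count u' q"
    unfolding subseteq_mset_def not_all not_le by blast
  then have pq': "count u p = count u' p + 1" "count u' q = count u q + 1" "p \<noteq> q"
    using le[OF P sz, of p] le[OF P(2,1) sz[symmetric], of q] by auto
  have op: "owns rm u p" and oq: "owns rm u' q"
    using own[OF P sz pq(1)] own[OF P(2,1) sz[symmetric] pq(2)] by auto
  have third: "count u r = count u' r" if "r \<noteq> p" "r \<noteq> q" for r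
    using pq' that size_xyz[of u r] size_xyz[of u' r] sz xyz_cases[of p r] xyz_cases[of q r] by auto
  have "u - {#p#} = u' - {#q#}"
  proof (rule multiset_eqI)
    fix r show "count (u - {#p#}) r = count (u' - {#q#}) r"
      using pq' third[of r] by auto
  qed
  with op oq pq'(3) show False by (auto simp: owns_def)
qed

lemma Delta_drawing_eq:
  assumes "edge_choice d c"
  shows "Delta_drawing d c = position ` monomials d \<union>
    (\<Union>(u, t)\<in>{(u, t). size u + 1 = d \<and> \<not> owns (removed c) u t}. convex hull (position ` edge u t))"
  unfolding Delta_drawing_def Delta_edges_eq[OF assms] by fast

text \<open>By the upper bounds a vertex inside the region would divide u, against its degree, and
  an edge through it would be a side of the up triangle u; at a side that is kept the inequality is
  strict.\<close>

lemma open_region_not_drawing: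
  assumes c: "edge_choice d c" and u: "size u + 1 = d" and P: "P \<in> open_region (removed c) u"
  shows "P \<notin> Delta_drawing d c"
proof
  have lt: "coord d v P < real (count u v) + 1" "owns (removed c) u v \<or> real (count u v) < coord d v P" for v
    using P u by (auto simp: open_region_def)
  assume "P \<in> Delta_drawing d c"
  then consider (vertex) a where "size a = d" "P = position a"
    | (edge) u' t where "size u' + 1 = d" "\<not> owns (removed c) u' t" "P \<in> convex hull (position ` edge u' t)"
    unfolding Delta_drawing_eq[OF c] by (auto simp: monomials_def)
  then show False
  proof cases
    case vertex
    then have "count a v \<le> count u v" for v
      using lt(1)[of v] by (simp add: coord_position)
    then have "a \<subseteq># u" by (simp add: subseteq_mset_def)
    then show False using size_mset_mono[of a u] vertex u by simp
  next
    case edge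
    have "count u' v \<le> count u v" for v
      using edge(3) lt(1)[of v] unfolding hull_edge[OF edge(1)] by (cases "v = t") auto
    then have "u' \<subseteq># u" by (simp add: subseteq_mset_def)
    then have "u' = u"
      using mset_subset_size[of u' u] edge(1) u by (auto simp: subset_mset.less_le)
    then show False using edge lt(2)[of t] unfolding hull_edge[OF edge(1)] by auto
  qed
qed

lemma drawing_coord_nonneg:
  assumes c: "edge_choice d c" and P: "P \<in> Delta_drawing d c"
  shows "0 \<le> coord d v P"
proof -
  from P consider (vertex) a where "size a = d" "P = position a"
    | (edge) u' t where "size u' + 1 = d" "P \<in> convex hull (position ` edge u' t)"
    unfolding Delta_drawing_eq[OF c] by (auto simp: monomials_def)
  then show ?thesis
  proof cases
    case edge
    then have "real (count u' v) \<le> coord d v P" unfolding hull_edge[OF edge(1)] by (cases "v = t") auto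
    then show ?thesis by linarith
  qed (simp add: coord_position)
qed

text \<open>Rounding the coordinates down loses less than 3 in total, so the result has degree d, d
  - 1 or d - 2. These are the cases of a vertex, of an up triangle including its sides, and of the
  interior of a down triangle, which belongs to the region of its owner.\<close>

lemma drawing_complement:
  assumes c: "edge_choice d c" and d: "d \<ge> 1" and P: "P \<notin> Delta_drawing d c" and nonneg: "\<And>v. 0 \<le> coord d v P"
  shows "\<exists>u. size u + 1 = d \<and> P \<in> open_region (removed c) u"
proof -
  let ?rm = "removed c"
  define f where "f = Abs_multiset (\<lambda>v. nat \<lfloor>coord d v P\<rfloor>)"
  have f: "real (count f v) \<le> coord d v P" "coord d v P < real (count f v) + 1" for v
  proof -
    have "count f v = nat \<lfloor>coord d v P\<rfloor>"
      unfolding f_def by (subst count_Abs_multiset) auto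
    then have "real (count f v) = of_int \<lfloor>coord d v P\<rfloor>" using nonneg[of v] by simp
    then show "real (count f v) \<le> coord d v P" "coord d v P < real (count f v) + 1"
      by linarith+
  qed
  have "real (size f) \<le> real d" "real d < real (size f) + 3"
    using f[of Vx] f[of Vy] f[of Vz] coord_sum[of d Vx P] size_xyz[of f Vx] by simp_all
  then consider "size f = d" | "size f + 1 = d" | "size f + 2 = d" by linarith
  then show ?thesis
  proof cases
    case 1
    have "coord d v P = coord d v (position f)" for v
      using f[of v] f[of "nx v"] f[of "pv v"] coord_sum[of d v P] size_xyz[of f v] 1 by (simp add: coord_position)
    then have "P = position f" by (rule coord_eqI)
    with 1 P show ?thesis unfolding Delta_drawing_def monomials_def by blast
  next
    case 2
    have "owns ?rm f v \<or> real (count f v) < coord d v P" for v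
    proof (rule ccontr)
      assume *: "\<not> ?thesis"
      then have "coord d v P = real (count f v)" using f(1)[of v] by simp
      moreover have "real (count f s) \<le> coord d s P \<and> coord d s P \<le> real (count f s) + 1" for s
        using f[of s] by simp
      ultimately have "P \<in> convex hull (position ` edge f v)"
        unfolding hull_edge[OF 2] by blast
      then show False using * 2 P unfolding Delta_drawing_eq[OF c] by blast
    qed
    then have "P \<in> open_region ?rm f" using f 2 by (auto simp: open_region_def)
    with 2 show ?thesis by blast
  next
    case 3
    define u where "u = add_mset (?rm f) f"
    have u: "size u + 1 = d" using 3 by (simp add: u_def)
    have "coord d v P < real (count u v) + 1" for v
      using f(2)[of v] by (auto simp: u_def)
    moreover have "owns ?rm u v \<or> real (count u v) < coord d v P" for v
    proof (cases "v = ?rm f")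
      case False
      have "real (count f v) < coord d v P"
        using f(2)[of "nx v"] f(2)[of "pv v"] coord_sum[of d v P] size_xyz[of f v] 3 by simp
      then show ?thesis using False by (simp add: u_def)
    qed (simp add: u_def owns_def)
    ultimately have "P \<in> open_region ?rm u" using u by (auto simp: open_region_def)
    with u show ?thesis by blast
  qed
qed

lemma open_open_region: "open (open_region rm u)"
proof -
  have "open_region rm u = (\<Inter>v. {P. coord (size u + 1) v P < real (count u v) + 1} \<inter>
      (if owns rm u v then UNIV else {P. real (count u v) < coord (size u + 1) v P}))"
    by (auto simp: open_region_def split: if_splits)
  moreover have "open {P. coord (size u + 1) v P < real (count u v) + 1}"
    "open {P. real (count u v) < coord (size u + 1) v P}" for v
    by (intro open_Collect_less continuous_on_coord continuous_on_const)+
  ultimately show ?thesis by (auto intro!: open_INT)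
qed

lemma convex_open_region: "convex (open_region rm u)"
  unfolding convex_alt
proof (intro ballI allI impI)
  fix P Q e assume P: "P \<in> open_region rm u" and Q: "Q \<in> open_region rm u" and e: "0 \<le> e \<and> e \<le> (1 :: real)"
  have lt: "(1 - e) * x + e * y < k" if "x < k" "y < k" for x y k :: real
    using e that by (smt (verit) convex_bound_lt)
  have gt: "k < (1 - e) * x + e * y" if "k < x" "k < y" for x y k :: real
    using lt[of "- x" "- k" "- y"] that by simp
  show "(1 - e) *\<^sub>R P + e *\<^sub>R Q \<in> open_region rm u"
    using P Q unfolding open_region_def mem_Collect_eq coord_affine by (blast intro: lt gt)
qed

text \<open>The centroid of the up triangle u; it lies in the region whatever is merged.\<close>

definition center :: "xyz multiset \<Rightarrow> real \<times> real" where
  "center u = (real (count u Vx) + 1/3, real (count u Vy) + 1/3)"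

lemma coord_center: "coord (size u + 1) v (center u) = real (count u v) + 1/3"
  using size_xyz[of u Vx] by (cases v) (simp_all add: coord_def center_def)

lemma center_in_open_region: "center u \<in> open_region rm u"
  unfolding open_region_def mem_Collect_eq coord_center by simp

lemma bounded_open_region: "bounded (open_region rm u)"
proof -
  let ?d = "size u + 1"
  have "open_region rm u \<subseteq> cbox (0, 0) (real ?d, real ?d)"
  proof
    fix P assume P: "P \<in> open_region rm u"
    have "0 \<le> coord ?d v P" for v using open_region_lower(2)[OF P, of v] by simp
    from this[of Vx] this[of Vy] this[of Vz] show "P \<in> cbox (0, 0) (real ?d, real ?d)"
      by (cases P) (auto simp: coord_def)
  qed
  then show ?thesis using bounded_cbox bounded_subset by blast
qed

lemma unbounded_halfplane: "\<not> bounded {P. coord d v P < 0}"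
proof
  assume "bounded {P. coord d v P < 0}"
  then obtain B where B: "\<And>P. coord d v P < 0 \<Longrightarrow> norm P \<le> B" by (auto simp: bounded_iff)
  show False
  proof (cases v)
    case Vx
    have "norm (- \<bar>B\<bar> - 1, 0 :: real) \<le> B" by (rule B) (simp add: Vx coord_def)
    then show False using norm_fst_le[of "(- \<bar>B\<bar> - 1, 0 :: real)"] by simp
  next
    case Vy
    have "norm (0 :: real, - \<bar>B\<bar> - 1) \<le> B" by (rule B) (simp add: Vy coord_def)
    then show False using norm_snd_le[of "(0 :: real, - \<bar>B\<bar> - 1)"] by simp
  next
    case Vz
    have "norm (real d + \<bar>B\<bar> + 1, 0 :: real) \<le> B" by (rule B) (simp add: Vz coord_def)
    then show False using norm_fst_le[of "(real d + \<bar>B\<bar> + 1, 0 :: real)"] by simp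
  qed
qed

lemma convex_halfplane: "convex {P. coord d v P < 0}"
  unfolding convex_alt
proof (intro ballI allI impI)
  fix P Q e assume "P \<in> {P. coord d v P < 0}" "Q \<in> {P. coord d v P < 0}" and e: "0 \<le> e \<and> e \<le> (1 :: real)"
  then show "(1 - e) *\<^sub>R P + e *\<^sub>R Q \<in> {P. coord d v P < 0}"
    unfolding mem_Collect_eq coord_affine by (smt (verit) convex_bound_lt)
qed

text \<open>The complement of the drawing is covered by the open regions and by the half planes
  where a coordinate is negative. The regions are convex, open and disjoint from all other pieces,
  hence components; any other component contains an unbounded half plane.\<close>

lemma Delta_regions_eq:
  assumes c: "edge_choice d c" and d: "d \<ge> 1"
  shows "Delta_regions d c = open_region (removed c) ` {u. size u + 1 = d}"
proof -
  let ?O = "open_region (removed c)" and ?D = "Delta_drawing d c"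
  have comp: "?O u \<in> components (- ?D)" if u: "size u + 1 = d" for u
    unfolding in_components_maximal
  proof (intro conjI allI impI)
    show "?O u \<noteq> {}" using center_in_open_region by blast
    show sub: "?O u \<subseteq> - ?D" using open_region_not_drawing[OF c u] by blast
    show "connected (?O u)" by (rule convex_connected[OF convex_open_region])
    fix S assume S: "S \<noteq> {} \<and> ?O u \<subseteq> S \<and> S \<subseteq> - ?D \<and> connected S"
    \<comment> \<open>The union of all other pieces. It is open, so a connected set outside the
      drawing that meets the region u cannot meet it.\<close>
    define W where "W = (\<Union>v. {P. coord d v P < 0}) \<union> (\<Union>u'\<in>{u'. size u' + 1 = d \<and> u' \<noteq> u}. ?O u')"
    have "open W"
      unfolding W_def by (intro open_Un open_UN ballI open_open_region open_Collect_less continuous_on_coord continuous_on_const)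
    moreover have "S \<subseteq> ?O u \<union> W"
    proof
      fix P assume "P \<in> S"
      then have P: "P \<notin> ?D" using S by blast
      show "P \<in> ?O u \<union> W"
      proof (cases "\<forall>v. 0 \<le> coord d v P")
        case True
        then show ?thesis using drawing_complement[OF c d P] by (auto simp: W_def)
      next
        case False
        then show ?thesis by (auto simp: W_def not_le)
      qed
    qed
    moreover have "?O u \<inter> W = {}"
    proof -
      have "P \<notin> W" if P: "P \<in> ?O u" for P
      proof
        assume "P \<in> W"
        then consider v where "coord d v P < 0" | u' where "size u' + 1 = d" "u' \<noteq> u" "P \<in> ?O u'"
          unfolding W_def by blast
        then show False
        proof cases
          case 1
          then show False using open_region_lower(2)[OF P, of v] u by simp
        next
          case 2
          then show False using open_region_disjoint[OF P 2(3)] u by simp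
        qed
      qed
      then show ?thesis by blast
    qed
    moreover have "?O u \<inter> S \<noteq> {}" using S center_in_open_region by blast
    ultimately have "W \<inter> S = {}"
      using connectedD[of S "?O u" W] S open_open_region by blast
    with \<open>S \<subseteq> ?O u \<union> W\<close> S show "S = ?O u" by blast
  qed
  show ?thesis
  proof (intro equalityI subsetI)
    fix R assume "R \<in> Delta_regions d c"
    then have R: "R \<in> components (- ?D)" "bounded R" by (auto simp: Delta_regions_def)
    obtain P where P: "P \<in> R" using in_components_nonempty[OF R(1)] by blast
    then have nD: "P \<notin> ?D" using in_components_subset[OF R(1)] by blast
    have "0 \<le> coord d v P" for v
    proof (rule ccontr)
      assume *: "\<not> 0 \<le> coord d v P"
      have "{P. coord d v P < 0} \<subseteq> R"
      proof (rule components_maximal[OF R(1)])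
        show "connected {P. coord d v P < 0}" by (rule convex_connected[OF convex_halfplane])
        show "{P. coord d v P < 0} \<subseteq> - ?D" using drawing_coord_nonneg[OF c, of _ v] by (auto simp: not_le[symmetric])
        show "R \<inter> {P. coord d v P < 0} \<noteq> {}" using P * by auto
      qed
      then show False using R(2) unbounded_halfplane bounded_subset by blast
    qed
    from drawing_complement[OF c d nD this] obtain u where u: "size u + 1 = d" "P \<in> ?O u" by blast
    then have "R = ?O u" using components_eq[OF R(1) comp[OF u(1)]] P by blast
    with u show "R \<in> ?O ` {u. size u + 1 = d}" by blast
  next
    fix R assume "R \<in> ?O ` {u. size u + 1 = d}"
    then show "R \<in> Delta_regions d c"
      using comp bounded_open_region by (auto simp: Delta_regions_def)
  qed
qed

text \<open>In the closure strict inequalities become weak ones. Conversely, the segment from a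
  lattice point of the closed region to the center satisfies the strict inequalities except possibly
  at its starting point.\<close>

lemma frontier_open_region:
  assumes c: "edge_choice d c" and u: "size u + 1 = d"
  shows "{a \<in> monomials d. position a \<in> frontier (open_region (removed c) u)} = region (removed c) u"
proof (intro equalityI subsetI)
  let ?rm = "removed c" and ?O = "open_region (removed c) u"
  fix a assume "a \<in> {a \<in> monomials d. position a \<in> frontier ?O}"
  then have a: "size a = d" "position a \<in> closure ?O" by (auto simp: monomials_def frontier_def)
  let ?C = "\<Inter>v. {P. coord d v P \<le> real (count u v) + 1} \<inter> (if owns ?rm u v then UNIV else {P. real (count u v) \<le> coord d v P})"
  have "closed {P. coord d v P \<le> real (count u v) + 1}" "closed {P. real (count u v) \<le> coord d v P}" for v
    by (intro closed_Collect_le continuous_on_coord continuous_on_const)+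
  then have "closed ?C" by (auto intro!: closed_INT)
  moreover have "?O \<subseteq> ?C" using u by (auto simp: open_region_def less_imp_le)
  ultimately have "position a \<in> ?C" using a(2) closure_minimal by blast
  then have "real (count a v) \<le> real (count u v) + 1 \<and> (owns ?rm u v \<or> real (count u v) \<le> real (count a v))" for v
    using a(1) by (auto simp: coord_position split: if_splits)
  then have "count a v \<le> count u v + 1 \<and> (owns ?rm u v \<or> count u v \<le> count a v)" for v
    by (metis of_nat_1 of_nat_add of_nat_le_iff)
  then show "a \<in> region ?rm u" using a u by (simp add: region_def)
next
  let ?rm = "removed c" and ?O = "open_region (removed c) u"
  fix a assume a: "a \<in> region ?rm u"
  then have sz: "size a = d" using u by (simp add: region_def)
  have "position a \<notin> ?O"
    using open_region_not_drawing[OF c u, of "position a"] sz by (auto simp: Delta_drawing_def monomials_def)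
  moreover have lt: "(1 - e) * x + e * (k + 1 / 3) < k + 1" if "0 < e" "e \<le> 1" "x \<le> k + 1" for e x k :: real
    using mult_left_mono[OF that(3), of "1 - e"] that(1,2) by (simp add: algebra_simps)
  moreover have gt: "k < (1 - e) * x + e * (k + 1 / 3)" if "0 < e" "e \<le> 1" "k \<le> x" for e x k :: real
    using mult_left_mono[OF that(3), of "1 - e"] that(1,2) by (simp add: algebra_simps)
  moreover have "position a \<in> closure ?O"
    unfolding closure_sequential
  proof (intro exI conjI allI)
    let ?e = "\<lambda>n. inverse (real (Suc n))"
    let ?Q = "\<lambda>n. (1 - ?e n) *\<^sub>R position a + ?e n *\<^sub>R center u"
    fix n
    have e: "0 < ?e n" "?e n \<le> 1" by (simp_all add: field_simps)
    show "?Q n \<in> ?O"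
      unfolding open_region_def mem_Collect_eq coord_affine coord_center
      unfolding u
    proof (intro allI conjI)
      fix v
      have av: "real (count a v) \<le> real (count u v) + 1" "owns ?rm u v \<or> real (count u v) \<le> real (count a v)"
        using a by (auto simp: region_def) (metis of_nat_Suc of_nat_le_iff add.commute)
      have co: "coord d v (position a) = real (count a v)" by (rule coord_position[OF sz])
      show "(1 - ?e n) * coord d v (position a) + ?e n * (real (count u v) + 1 / 3) < real (count u v) + 1"
        unfolding co by (rule lt[OF e av(1)])
      show "owns ?rm u v \<or> real (count u v) < (1 - ?e n) * coord d v (position a) + ?e n * (real (count u v) + 1 / 3)"
        unfolding co using av(2) gt[OF e] by blast
    qed
  next
    have "(\<lambda>n. (1 - inverse (real (Suc n))) *\<^sub>R position a + inverse (real (Suc n)) *\<^sub>R center u)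
        \<longlonglongrightarrow> (1 - 0) *\<^sub>R position a + 0 *\<^sub>R center u"
      by (intro tendsto_intros LIMSEQ_inverse_real_of_nat)
    then show "(\<lambda>n. (1 - inverse (real (Suc n))) *\<^sub>R position a + inverse (real (Suc n)) *\<^sub>R center u) \<longlonglongrightarrow> position a"
      by simp
  qed
  ultimately show "a \<in> {a \<in> monomials d. position a \<in> frontier ?O}"
    using sz open_open_region[of ?rm u] by (simp add: monomials_def frontier_def interior_open)
qed

lemma Delta_eq:
  assumes c: "edge_choice d c" and d: "d \<ge> 1"
  shows "Delta d c = {{}} \<union> {{a} | a. size a = d} \<union> {edge u t | u t. size u + 1 = d \<and> \<not> owns (removed c) u t}
    \<union> region (removed c) ` {u. size u + 1 = d}"
proof -
  have "(\<lambda>R. {a \<in> monomials d. position a \<in> frontier R}) ` Delta_regions d c = region (removed c) ` {u. size u + 1 = d}"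
    unfolding Delta_regions_eq[OF c d] image_image by (intro image_cong refl) (simp add: frontier_open_region[OF c])
  then show ?thesis
    unfolding Delta_def Delta_edges_eq[OF c] by (simp add: monomials_def)
qed

section \<open>Realization of the regions by polygons\<close>

text \<open>The indices number the vertices of a polygon in cyclic order; a side joins two
  consecutive vertices or the first and the last one.\<close>

definition convex_adjacent :: "nat set \<Rightarrow> nat \<Rightarrow> nat \<Rightarrow> bool" where
  "convex_adjacent C i j \<longleftrightarrow> i \<in> C \<and> j \<in> C \<and> i < j \<and> ((\<forall>k\<in>C. k \<le> i \<or> j \<le> k) \<or> (\<forall>k\<in>C. i \<le> k \<and> k \<le> j))"

text \<open>Every combinatorial polygon is realized by points on the parabola: a supporting line becomes a
  quadratic polynomial of constant sign at the chosen parameters, whose two roots are consecutive or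
  extreme.\<close>

lemma parabola_realizes:
  fixes \<phi> :: "nat \<Rightarrow> 'v"
  assumes fin: "finite C" and inj: "inj_on \<phi> C"
    and faces: "{G \<in> X. G \<subseteq> \<phi> ` C} = {{}, \<phi> ` C} \<union> (\<lambda>i. {\<phi> i}) ` C \<union> {{\<phi> i, \<phi> j} | i j. convex_adjacent C i j}"
  shows "\<exists>p :: 'v \<Rightarrow> real \<times> real. realizes X p (\<phi> ` C)"
proof -
  define \<tau> where "\<tau> v = real (the_inv_into C \<phi> v)" for v
  have \<tau>: "\<tau> (\<phi> i) = real i" if "i \<in> C" for i
    using that by (simp add: \<tau>_def the_inv_into_f_f[OF inj])
  define p where "p v = (\<tau> v, (\<tau> v)\<^sup>2)" for v
  let ?F = "\<phi> ` C"
  let ?S = "convex hull (p ` ?F)"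
  let ?T = "{{v \<in> ?F. p v \<in> T} | T. T face_of ?S}"
  have \<phi>_eq: "{v \<in> ?F. P v} = \<phi> ` {i \<in> C. P (\<phi> i)}" for P by blast
  have inner: "(a, b) \<bullet> p (\<phi> i) = a * real i + b * (real i)\<^sup>2" if "i \<in> C" for i a b
    using that by (simp add: p_def \<tau>)
  have in_S: "p (\<phi> i) \<in> ?S" if "i \<in> C" for i
    using that by (intro hull_inc imageI)
  \<comment> \<open>On the parabola a linear function is a quadratic polynomial in the parameter. If
    it is at most e on C, the parameters at which it equals e form a face.\<close>
  have line: "\<phi> ` {i \<in> C. a * real i + b * (real i)\<^sup>2 = e} \<in> ?T"
    if le: "\<And>i. i \<in> C \<Longrightarrow> a * real i + b * (real i)\<^sup>2 \<le> e" for a b e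
  proof -
    have "?S \<subseteq> {x. (a, b) \<bullet> x \<le> e}"
    proof (rule hull_minimal)
      show "p ` ?F \<subseteq> {x. (a, b) \<bullet> x \<le> e}" using le by (auto simp: inner)
      show "convex {x. (a, b) \<bullet> x \<le> e}" by (rule convex_halfspace_le)
    qed
    then have face: "(?S \<inter> {x. (a, b) \<bullet> x = e}) face_of ?S"
      by (intro face_of_Int_supporting_hyperplane_le convex_convex_hull) auto
    have eq: "{v \<in> ?F. p v \<in> ?S \<inter> {x. (a, b) \<bullet> x = e}} = \<phi> ` {i \<in> C. a * real i + b * (real i)\<^sup>2 = e}"
      unfolding \<phi>_eq by (intro image_cong Collect_cong refl) (auto simp: inner in_S)
    show ?thesis
      by (intro CollectI exI[of _ "?S \<inter> {x. (a, b) \<bullet> x = e}"] conjI face) (rule eq[symmetric])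
  qed
  have quad: "(real i - real j) * (real i - real k) = real i ^ 2 - (real j + real k) * real i + real j * real k" for i j k
    by (simp add: power2_eq_square algebra_simps)
  have "{{}, ?F} \<union> (\<lambda>i. {\<phi> i}) ` C \<union> {{\<phi> i, \<phi> j} | i j. convex_adjacent C i j} \<subseteq> ?T"
  proof (intro Un_least subsetI)
    fix G assume "G \<in> {{}, ?F}"
    then show "G \<in> ?T"
      using line[of 0 0 1] line[of 0 0 0] by auto
  next
    fix G assume "G \<in> (\<lambda>i. {\<phi> i}) ` C"
    then obtain j where j: "j \<in> C" "G = {\<phi> j}" by blast
    have "\<phi> ` {i \<in> C. (real j + real j) * real i + (- 1) * (real i)\<^sup>2 = real j * real j} \<in> ?T"
    proof (rule line)
      fix i
      have "0 \<le> (real i - real j) * (real i - real j)" by simp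
      then show "(real j + real j) * real i + (- 1) * (real i)\<^sup>2 \<le> real j * real j" unfolding quad by simp
    qed
    moreover have "(real j + real j) * real i + (- 1) * (real i)\<^sup>2 = real j * real j \<longleftrightarrow> i = j" for i
    proof -
      have "(real j + real j) * real i + (- 1) * (real i)\<^sup>2 = real j * real j \<longleftrightarrow> (real i - real j) * (real i - real j) = 0"
        unfolding quad by auto
      then show ?thesis by simp
    qed
    moreover have "{i \<in> C. i = j} = {j}" using j by auto
    ultimately show "G \<in> ?T" by (simp add: j(2))
  next
    fix G assume "G \<in> {{\<phi> i, \<phi> j} | i j. convex_adjacent C i j}"
    then obtain i j where G: "G = {\<phi> i, \<phi> j}" and ij: "i \<in> C" "j \<in> C" "i < j"
      and adj: "(\<forall>k\<in>C. k \<le> i \<or> j \<le> k) \<or> (\<forall>k\<in>C. i \<le> k \<and> k \<le> j)"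
      unfolding convex_adjacent_def by blast
    have zero: "(real k - real i) * (real k - real j) = 0 \<longleftrightarrow> k = i \<or> k = j" for k by simp
    from adj show "G \<in> ?T"
    proof
      assume out: "\<forall>k\<in>C. k \<le> i \<or> j \<le> k"
      \<comment> \<open>No parameter lies strictly between i and j, so the polynomial - (k - i) (k -
        j) is nowhere positive on C.\<close>
      have "\<phi> ` {k \<in> C. (real i + real j) * real k + (- 1) * (real k)\<^sup>2 = real i * real j} \<in> ?T"
      proof (rule line)
        fix k assume "k \<in> C"
        then have "0 \<le> (real k - real i) * (real k - real j)"
          using out ij(3) by (auto simp: zero_le_mult_iff)
        then show "(real i + real j) * real k + (- 1) * (real k)\<^sup>2 \<le> real i * real j" unfolding quad by simp
      qed
      moreover have "(real i + real j) * real k + (- 1) * (real k)\<^sup>2 = real i * real j \<longleftrightarrow> k = i \<or> k = j" for k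
        unfolding zero[symmetric] quad by auto
      moreover have "{k \<in> C. k = i \<or> k = j} = {i, j}" using ij by auto
      ultimately show ?thesis by (simp add: G)
    next
      assume mid: "\<forall>k\<in>C. i \<le> k \<and> k \<le> j"
      \<comment> \<open>Here all parameters lie between i and j, so the polynomial with the opposite
        sign is used.\<close>
      have "\<phi> ` {k \<in> C. - (real i + real j) * real k + 1 * (real k)\<^sup>2 = - (real i * real j)} \<in> ?T"
      proof (rule line)
        fix k assume "k \<in> C"
        then have "(real k - real i) * (real k - real j) \<le> 0"
          using mid by (auto simp: mult_le_0_iff)
        then show "- (real i + real j) * real k + 1 * (real k)\<^sup>2 \<le> - (real i * real j)" unfolding quad by (simp add: algebra_simps)
      qed
      moreover have "- (real i + real j) * real k + 1 * (real k)\<^sup>2 = - (real i * real j) \<longleftrightarrow> k = i \<or> k = j" for k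
        unfolding zero[symmetric] quad by (auto simp: algebra_simps)
      moreover have "{k \<in> C. k = i \<or> k = j} = {i, j}" using ij by auto
      ultimately show ?thesis by (simp add: G)
    qed
  qed
  moreover have "?T \<subseteq> {{}, ?F} \<union> (\<lambda>i. {\<phi> i}) ` C \<union> {{\<phi> i, \<phi> j} | i j. convex_adjacent C i j}"
  proof
    fix G assume "G \<in> ?T"
    then obtain T where T: "T face_of ?S" "G = {v \<in> ?F. p v \<in> T}" by blast
    \<comment> \<open>Faces of polytopes are exposed, so every face comes from a quadratic
      polynomial that is nonpositive on C. Its zeros in C are the vertices of the face.\<close>
    have "T exposed_face_of ?S"
      using T(1) fin exposed_face_of_polyhedron[OF polyhedron_convex_hull[of "p ` ?F"]] by simp
    then obtain y e where ye: "?S \<subseteq> {x. y \<bullet> x \<le> e}" "T = ?S \<inter> {x. y \<bullet> x = e}"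
      unfolding exposed_face_of_def by blast
    obtain a b where "y = (a, b)" by (cases y)
    with ye have abe: "?S \<subseteq> {x. (a, b) \<bullet> x \<le> e}" "T = ?S \<inter> {x. (a, b) \<bullet> x = e}" by simp_all
    let ?q = "\<lambda>i. a * real i + b * (real i)\<^sup>2 - e"
    have le: "?q i \<le> 0" if "i \<in> C" for i
    proof -
      have "p (\<phi> i) \<in> {x. (a, b) \<bullet> x \<le> e}" using in_S[OF that] abe(1) by blast
      then show ?thesis using inner[OF that] by simp
    qed
    have G: "G = \<phi> ` {i \<in> C. ?q i = 0}"
      unfolding T(2) \<phi>_eq abe(2) by (intro image_cong Collect_cong refl) (auto simp: inner in_S)
    show "G \<in> {{}, ?F} \<union> (\<lambda>i. {\<phi> i}) ` C \<union> {{\<phi> i, \<phi> j} | i j. convex_adjacent C i j}"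
    proof (cases "\<exists>i j. i \<in> C \<and> j \<in> C \<and> i < j \<and> ?q i = 0 \<and> ?q j = 0")
      case False
      then have single: "i = j" if "i \<in> C" "j \<in> C" "?q i = 0" "?q j = 0" for i j
        using that by (meson linorder_neqE_nat)
      show ?thesis
      proof (cases "\<exists>i\<in>C. ?q i = 0")
        case True
        then obtain i where "i \<in> C" "?q i = 0" by blast
        then have "{i \<in> C. ?q i = 0} = {i}" using single by blast
        then show ?thesis using \<open>i \<in> C\<close> G by auto
      next
        case False
        then have "{i \<in> C. ?q i = 0} = {}" by blast
        then show ?thesis using G by simp
      qed
    next
      case True
      then obtain i j where ij: "i \<in> C" "j \<in> C" "i < j" "?q i = 0" "?q j = 0" by blast
      have "(real j - real i) * (a + b * (real i + real j)) = ?q j - ?q i"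
        by (simp add: power2_eq_square algebra_simps)
      then have "a + b * (real i + real j) = 0" using ij(3-5) by simp
      then have a: "a = - b * (real i + real j)" by simp
      \<comment> \<open>With the roots i and j the polynomial is b (k - i) (k - j). For b = 0 it
        vanishes identically and T is the whole polygon; otherwise the sign of b decides whether the
        other indices lie outside or inside the interval from i to j.\<close>
      have q: "?q k = b * ((real k - real i) * (real k - real j))" for k
        using ij(4) unfolding a by (simp add: power2_eq_square algebra_simps)
      show ?thesis
      proof (cases "b = 0")
        case True
        then have "{i \<in> C. ?q i = 0} = C" unfolding q by simp
        then show ?thesis using G by simp
      next
        case False
        have "{i \<in> C. ?q i = 0} = {i, j}" unfolding q using False ij(1,2) by auto
        then have "G = {\<phi> i, \<phi> j}" using G by simp
        moreover have "convex_adjacent C i j"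
        proof (cases "b < 0")
          case True
          have "k \<le> i \<or> j \<le> k" if "k \<in> C" for k
          proof -
            have "0 \<le> (real k - real i) * (real k - real j)"
              using le[OF that] True unfolding q by (simp add: mult_le_0_iff)
            then show ?thesis by (auto simp: zero_le_mult_iff)
          qed
          then show ?thesis using ij by (auto simp: convex_adjacent_def)
        next
          case False
          have "i \<le> k \<and> k \<le> j" if "k \<in> C" for k
          proof -
            have "(real k - real i) * (real k - real j) \<le> 0"
              using le[OF that] False \<open>b \<noteq> 0\<close> unfolding q by (simp add: mult_le_0_iff)
            then show ?thesis using ij(3) by (auto simp: mult_le_0_iff)
          qed
          then show ?thesis using ij by (auto simp: convex_adjacent_def)
        qed
        ultimately show ?thesis by blast
      qed
    qed
  qed
  ultimately have "realizes X p ?F" unfolding realizes_def faces by blast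
  then show ?thesis by blast
qed

section \<open>Vertices, sides and cyclic order of a region\<close>

text \<open>The vertex off the common side of the down triangle across the side t of the up triangle
  u.\<close>

definition opposite :: "xyz multiset \<Rightarrow> xyz \<Rightarrow> xyz multiset" where
  "opposite u t = u - {#t#} + {#nx t, pv t#}"

lemma count_opposite: "t \<in># u \<Longrightarrow> count (opposite u t) s = (if s = t then count u t - 1 else count u s + 1)"
  using xyz_cases[of s t] by (auto simp: opposite_def)

text \<open>If a is not a multiple of u, its exponent is too small at some t. The other two
  exponents can make up for at most 2, so the deficit is exactly 1 and both others are larger by
  1.\<close>

lemma count_between:
  fixes a u :: "xyz multiset"
  assumes "size a = size u + 1" "\<And>v. count a v \<le> count u v + 1"
  shows "(\<exists>s. a = add_mset s u) \<or> (\<exists>t\<in>#u. a = opposite u t)"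
proof (cases "u \<subseteq># a")
  case True
  then have "size (a - u) = 1" using assms(1) by (simp add: size_Diff_submset)
  then obtain s where "a - u = {#s#}" by (metis One_nat_def size_1_singleton_mset)
  then have "a = add_mset s u" using True by (metis add_mset_add_single subset_mset.add_diff_inverse)
  then show ?thesis by blast
next
  case False
  then obtain t where t: "count a t < count u t" by (auto simp: subseteq_mset_def not_le)
  have sz: "count a t + count a (nx t) + count a (pv t) = count u t + count u (nx t) + count u (pv t) + 1"
    using assms(1) size_xyz[of a t] size_xyz[of u t] by simp
  have eq: "count a t = count u t - 1" "count a (nx t) = count u (nx t) + 1" "count a (pv t) = count u (pv t) + 1"
    using sz t assms(2)[of "nx t"] assms(2)[of "pv t"] by linarith+
  have tu: "t \<in># u" using t by (simp flip: count_greater_zero_iff)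
  have "a = opposite u t"
  proof (rule multiset_eqI)
    fix s show "count a s = count (opposite u t) s"
      using xyz_cases[of s t] eq by (auto simp: count_opposite[OF tu])
  qed
  with tu show ?thesis by blast
qed

lemma region_eq: "region rm u = range (\<lambda>s. add_mset s u) \<union> opposite u ` {t. owns rm u t}"
proof (intro equalityI subsetI)
  fix a assume a: "a \<in> region rm u"
  then have "(\<exists>s. a = add_mset s u) \<or> (\<exists>t\<in>#u. a = opposite u t)"
    by (intro count_between) (auto simp: region_def)
  then show "a \<in> range (\<lambda>s. add_mset s u) \<union> opposite u ` {t. owns rm u t}"
  proof (elim disjE exE bexE)
    fix t assume t: "t \<in># u" "a = opposite u t"
    have "owns rm u t \<or> count u t \<le> count a t" using a by (simp add: region_def)
    moreover obtain k where "count u t = Suc k" using t(1) by (auto simp: gr0_conv_Suc simp flip: count_greater_zero_iff)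
    ultimately have "owns rm u t" by (simp add: t(2) count_opposite[OF t(1)])
    with t show ?thesis by blast
  qed blast
next
  fix a assume "a \<in> range (\<lambda>s. add_mset s u) \<union> opposite u ` {t. owns rm u t}"
  then consider s where "a = add_mset s u" | t where "owns rm u t" "a = opposite u t" by blast
  then show "a \<in> region rm u"
  proof cases
    case 1 then show ?thesis by (auto simp: region_def)
  next
    case 2
    then have t: "t \<in># u" by (simp add: owns_def)
    have "0 < count u t" using t by simp
    then have "size a = size u + 1"
      using size_xyz[of a t] size_xyz[of u t] by (simp add: 2(2) count_opposite[OF t])
    then show ?thesis using 2 by (auto simp: region_def count_opposite[OF t])
  qed
qed

lemma finite_xyz_set [simp]: "finite (A :: xyz set)"
  by (rule finite)

lemma finite_region: "finite (region rm u)"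
  unfolding region_eq by simp

lemma region_eq_iff: "region rm u \<subseteq> region rm u' \<Longrightarrow> size u = size u' \<Longrightarrow> u = u'"
proof -
  assume sub: "region rm u \<subseteq> region rm u'" and sz: "size u = size u'"
  have "count u s \<le> count u' s" for s
  proof -
    have "add_mset s u \<in> region rm u'" using sub by (auto simp: region_eq[of rm u])
    then have "count (add_mset s u) s \<le> count u' s + 1" unfolding region_def by blast
    then show ?thesis by simp
  qed
  then have "u \<subseteq># u'" by (simp add: subseteq_mset_def)
  then show "u = u'" using sz mset_subset_size[of u u'] by (auto simp: subset_mset.less_le)
qed

lemma add_mset_left_eq_iff: "add_mset s w = add_mset t w \<longleftrightarrow> s = t"
  by (simp only: add_mset_add_single[of s w] add_mset_add_single[of t w] add_left_cancel single_eq_single)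

text \<open>The two kinds of boundary edges: the sides of the up triangle that are kept, and the two
  outer sides of each merged down triangle.\<close>

lemma region_coeff_nonzero_iff:
  "region_coeff rm u u' t' \<noteq> 0 \<longleftrightarrow>
    (u' = u \<and> \<not> owns rm u t') \<or> (\<exists>t. t \<noteq> t' \<and> owns rm u t \<and> u' = add_mset t' (u - {#t#}))" (is "_ \<longleftrightarrow> ?A \<or> ?B")
proof -
  have own: "t' \<in># u' \<and> u = owner rm (u' - {#t'#}) \<longleftrightarrow>
      (\<exists>t. owns rm u t \<and> u' = add_mset t' (u - {#t#}))"
  proof
    assume *: "t' \<in># u' \<and> u = owner rm (u' - {#t'#})"
    then have "owns rm u (rm (u' - {#t'#}))" "u' = add_mset t' (u - {#rm (u' - {#t'#})#})"
      by (auto simp: owns_def owner_def)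
    then show "\<exists>t. owns rm u t \<and> u' = add_mset t' (u - {#t#})" by blast
  next
    assume "\<exists>t. owns rm u t \<and> u' = add_mset t' (u - {#t#})"
    then obtain t where "owns rm u t" "u' = add_mset t' (u - {#t#})" by blast
    then show "t' \<in># u' \<and> u = owner rm (u' - {#t'#})"
      by (auto simp: owns_def owner_def)
  qed
  have same: "u = add_mset t' (u - {#t#}) \<longleftrightarrow> t = t'" if "owns rm u t" for t
  proof -
    have "u = add_mset t (u - {#t#})" using that by (simp add: owns_def)
    then show ?thesis using add_mset_left_eq_iff[of t "u - {#t#}" t'] by auto
  qed
  show ?thesis
    unfolding region_coeff_def own using same by auto
qed

text \<open>A kept edge with both ends in a region lies on its boundary. The ends bound all
  exponents of u' except that of t'. If u' is not u, it exceeds u by one at t', so it falls short by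
  one at a single other variable t, and membership of an end requires the side t to be
  owned.\<close>

lemma edge_subset_region_iff:
  assumes sz: "size u' = size u"
  shows "edge u' t' \<subseteq> region rm u \<and> \<not> owns rm u' t' \<longleftrightarrow> region_coeff rm u u' t' \<noteq> 0"
proof
  assume *: "edge u' t' \<subseteq> region rm u \<and> \<not> owns rm u' t'"
  have mem: "add_mset s u' \<in> region rm u" if "s \<noteq> t'" for s
    using * that by (auto simp: mem_edge_iff)
  have le: "count u' s \<le> count u s" if "s \<noteq> t'" for s
  proof -
    have "count (add_mset s u') s \<le> count u s + 1" using mem[OF that] unfolding region_def by blast
    then show ?thesis by simp
  qed
  show "region_coeff rm u u' t' \<noteq> 0"
  proof (cases "u' \<subseteq># u")
    case True
    then have "u' = u" using sz mset_subset_size[of u' u] by (auto simp: subset_mset.less_le)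
    with * show ?thesis unfolding region_coeff_nonzero_iff by blast
  next
    case False
    then obtain t0 where t0: "count u t0 < count u' t0" by (auto simp: subseteq_mset_def not_le)
    with le[of t0] have "t0 = t'" by auto
    then have gt: "count u t' < count u' t'" using t0 by simp
    have "count (add_mset (nx t') u') t' \<le> count u t' + 1" using mem[OF nx_pv(5)] unfolding region_def by blast
    then have c': "count u' t' = count u t' + 1" using gt by simp
    have sum: "count u t' + 1 + count u' (nx t') + count u' (pv t') = count u t' + count u (nx t') + count u (pv t')"
      using size_xyz[of u t'] size_xyz[of u' t'] sz c' by simp
    have "\<exists>t. t \<noteq> t' \<and> count u t = count u' t + 1 \<and> (\<forall>s. s \<noteq> t \<and> s \<noteq> t' \<longrightarrow> count u' s = count u s)"
    proof (cases "count u' (nx t') = count u (nx t')")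
      case True
      then have "count u (pv t') = count u' (pv t') + 1" using sum by simp
      moreover have "count u' s = count u s" if "s \<noteq> pv t'" "s \<noteq> t'" for s
        using xyz_cases[of s t'] that True by auto
      ultimately show ?thesis using nx_pv(6) by blast
    next
      case False
      then have "count u (nx t') = count u' (nx t') + 1 \<and> count u' (pv t') = count u (pv t')"
        using sum le[of "nx t'"] le[of "pv t'"] by simp
      moreover have "s = pv t'" if "s \<noteq> nx t'" "s \<noteq> t'" for s
        using xyz_cases[of s t'] that by auto
      ultimately show ?thesis using nx_pv(5) by metis
    qed
    then obtain t where t: "t \<noteq> t'" "count u t = count u' t + 1" "\<And>s. s \<noteq> t \<Longrightarrow> s \<noteq> t' \<Longrightarrow> count u' s = count u s" by blast
    obtain r where r: "r \<noteq> t" "r \<noteq> t'" by (cases t; cases t'; auto intro: that[of Vx] that[of Vy] that[of Vz])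
    have "owns rm u t \<or> count u t \<le> count (add_mset r u') t" using mem[OF r(2)] unfolding region_def by blast
    then have o: "owns rm u t" using r(1) t(2) by auto
    have "u' = add_mset t' (u - {#t#})"
    proof (rule multiset_eqI)
      fix s show "count u' s = count (add_mset t' (u - {#t#})) s"
        using t c' t(3)[of s] by auto
    qed
    with o t(1) show ?thesis unfolding region_coeff_nonzero_iff by blast
  qed
next
  assume "region_coeff rm u u' t' \<noteq> 0"
  then consider "u' = u" "\<not> owns rm u t'" | t where "t \<noteq> t'" "owns rm u t" "u' = add_mset t' (u - {#t#})"
    unfolding region_coeff_nonzero_iff by blast
  then show "edge u' t' \<subseteq> region rm u \<and> \<not> owns rm u' t'"
  proof cases
    case 1 then show ?thesis by (auto simp: region_eq mem_edge_iff)
  next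
    case 2
    have t: "t \<in># u" using 2(2) by (simp add: owns_def)
    have "add_mset s u' \<in> region rm u" if "s \<noteq> t'" for s
    proof (cases "s = t")
      case True
      then have "add_mset s u' = add_mset t' u" using t 2(3) by (simp add: add_mset_commute)
      then show ?thesis by (auto simp: region_eq)
    next
      case False
      have "add_mset s u' = opposite u t"
      proof (rule multiset_eqI)
        fix v show "count (add_mset s u') v = count (opposite u t) v"
          using False that 2(1,3) xyz_cases[of v t] xyz_cases[of s t] xyz_cases[of t' t] t
          by (auto simp: count_opposite[OF t])
      qed
      then show ?thesis using 2(2) by (auto simp: region_eq)
    qed
    moreover have "\<not> owns rm u' t'" using 2 by (auto simp: owns_def)
    ultimately show ?thesis by (auto simp: mem_edge_iff)
  qed
qed

lemma finite_multisets_size: "finite {a :: 'x::finite multiset. size a = n}"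
proof (induction n)
  case (Suc n)
  have "{a :: 'x multiset. size a = Suc n} = (\<Union>x. add_mset x ` {a. size a = n})"
  proof (intro equalityI subsetI)
    fix a :: "'x multiset" assume a: "a \<in> {a. size a = Suc n}"
    then obtain x b where "a = add_mset x b" using size_eq_Suc_imp_eq_union by blast
    with a show "a \<in> (\<Union>x. add_mset x ` {a. size a = n})" by auto
  qed auto
  with Suc show ?case by simp
qed simp

text \<open>Even indices are the vertices of the up triangle; the odd index between two of them is
  the outer vertex of the down triangle across the side joining them. The order of the indices is
  the cyclic order along the boundary, whichever odd ones occur.\<close>

definition hexagon :: "xyz multiset \<Rightarrow> nat \<Rightarrow> xyz multiset" where
  "hexagon u i = (if i = 0 then add_mset Vz u else if i = 1 then opposite u Vy else if i = 2 then add_mset Vx u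
    else if i = 3 then opposite u Vz else if i = 4 then add_mset Vy u else opposite u Vx)"

definition codes :: "(xyz multiset \<Rightarrow> xyz) \<Rightarrow> xyz multiset \<Rightarrow> nat set" where
  "codes rm u = {0, 2, 4} \<union> (if owns rm u Vy then {1} else {}) \<union> (if owns rm u Vz then {3} else {})
    \<union> (if owns rm u Vx then {5} else {})"

lemma region_hexagon: "region rm u = hexagon u ` codes rm u"
proof -
  have "{t. owns rm u t} = (if owns rm u Vx then {Vx} else {}) \<union> (if owns rm u Vy then {Vy} else {}) \<union> (if owns rm u Vz then {Vz} else {})"
    (is "_ = ?O")
  proof (rule Set.set_eqI)
    fix t show "t \<in> {t. owns rm u t} \<longleftrightarrow> t \<in> ?O" by (cases t) auto
  qed
  then show ?thesis
    unfolding region_eq UNIV_xyz[of Vx] by (auto simp: codes_def hexagon_def)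
qed

lemma opposite_neq:
  assumes "t \<in># u"
  shows "opposite u t \<noteq> add_mset s u" "opposite u t = opposite u t' \<Longrightarrow> t' \<in># u \<Longrightarrow> t = t'"
proof -
  obtain k where k: "count u t = Suc k" using assms by (auto simp: gr0_conv_Suc simp flip: count_greater_zero_iff)
  show "opposite u t \<noteq> add_mset s u"
  proof
    assume "opposite u t = add_mset s u"
    then have "count (opposite u t) t = count (add_mset s u) t" by simp
    then show False using k by (simp add: count_opposite[OF assms] split: if_splits)
  qed
  assume "opposite u t = opposite u t'" and t': "t' \<in># u"
  then have "count (opposite u t) t = count (opposite u t') t" by simp
  then show "t = t'" using k by (simp add: count_opposite[OF assms] count_opposite[OF t'] split: if_splits)
qed

lemma inj_hexagon: "inj_on (hexagon u) (codes rm u)"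
proof -
  have o: "opposite u t \<noteq> add_mset s u" "add_mset s u \<noteq> opposite u t" if "owns rm u t" for s t
    using opposite_neq(1)[of t u s] that by (auto simp: owns_def)
  have o': "opposite u t = opposite u t' \<longleftrightarrow> t = t'" if "owns rm u t" "owns rm u t'" for t t'
    using opposite_neq(2)[of t u t'] that by (auto simp: owns_def)
  show ?thesis
    unfolding inj_on_def codes_def hexagon_def by (auto simp: o o' add_mset_left_eq_iff split: if_splits)
qed

lemma edge_across:
  assumes t: "t \<in># u" and ne: "t' \<noteq> t"
  shows "edge (add_mset t' (u - {#t#})) t' = {add_mset t' u, opposite u t}"
proof -
  obtain w where w: "u = add_mset t w" using t by (metis insert_DiffM)
  have "t' = nx t \<or> t' = pv t" using xyz_cases[of t' t] ne by auto
  then show ?thesis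
    by (auto simp: w edge_def opposite_def add_mset_commute)
qed

lemma convex_adjacent_codes:
  "convex_adjacent (codes rm u) i j \<longleftrightarrow>
    (if owns rm u Vx then (i, j) \<in> {(4, 5), (0, 5)} else (i, j) = (0, 4)) \<or>
    (if owns rm u Vy then (i, j) \<in> {(0, 1), (1, 2)} else (i, j) = (0, 2)) \<or>
    (if owns rm u Vz then (i, j) \<in> {(2, 3), (3, 4)} else (i, j) = (2, 4))"
proof -
  have mem: "k \<in> codes rm u \<longleftrightarrow> k = 0 \<or> k = 2 \<or> k = 4 \<or> (k = 1 \<and> owns rm u Vy) \<or> (k = 3 \<and> owns rm u Vz) \<or> (k = 5 \<and> owns rm u Vx)" for k
    by (auto simp: codes_def)
  have ball: "(\<forall>k\<in>codes rm u. P k) \<longleftrightarrow> P 0 \<and> P 2 \<and> P 4 \<and> (owns rm u Vy \<longrightarrow> P 1) \<and> (owns rm u Vz \<longrightarrow> P 3) \<and> (owns rm u Vx \<longrightarrow> P 5)" for P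
  proof -
    have "(\<forall>k\<in>(if c then {a} else {}). P k) \<longleftrightarrow> (c \<longrightarrow> P a)" for c and a :: nat by simp
    then show ?thesis unfolding codes_def ball_Un by simp
  qed
  show ?thesis
  proof (cases "i \<in> {0, 1, 2, 3, 4, 5} \<and> j \<in> {0, 1, 2, 3, 4, 5}")
    case True
    then show ?thesis
      by (elim conjE insertE emptyE; simp add: convex_adjacent_def mem ball)
  next
    case False
    then have "\<not> convex_adjacent (codes rm u) i j" by (auto simp: convex_adjacent_def mem)
    with False show ?thesis by (auto split: if_splits)
  qed
qed



lemma region_edges:
  "{edge u' t' | u' t'. region_coeff rm u u' t' \<noteq> 0} = {{hexagon u i, hexagon u j} | i j. convex_adjacent (codes rm u) i j}"
proof -
  \<comment> \<open>The part of the boundary along the side t: the side itself, or the two outer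
    sides of the down triangle merged across it.\<close>
  define E where "E t = (if owns rm u t then {{add_mset (nx t) u, opposite u t}, {add_mset (pv t) u, opposite u t}}
    else {{add_mset (nx t) u, add_mset (pv t) u}})" for t
  have "{edge u' t' | u' t'. region_coeff rm u u' t' \<noteq> 0}
      = {edge u t | t. \<not> owns rm u t} \<union> {edge (add_mset t' (u - {#t#})) t' | t t'. t' \<noteq> t \<and> owns rm u t}"
  proof (intro equalityI subsetI)
    fix x assume "x \<in> {edge u' t' | u' t'. region_coeff rm u u' t' \<noteq> 0}"
    then obtain u' t' where x: "region_coeff rm u u' t' \<noteq> 0" "x = edge u' t'" by blast
    from x(1) have "(u' = u \<and> \<not> owns rm u t') \<or> (\<exists>t. t \<noteq> t' \<and> owns rm u t \<and> u' = add_mset t' (u - {#t#}))"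
      unfolding region_coeff_nonzero_iff .
    then show "x \<in> {edge u t | t. \<not> owns rm u t} \<union> {edge (add_mset t' (u - {#t#})) t' | t t'. t' \<noteq> t \<and> owns rm u t}"
    proof (elim disjE exE conjE)
      fix t assume "t \<noteq> t'" "owns rm u t" "u' = add_mset t' (u - {#t#})"
      then have "x = edge (add_mset t' (u - {#t#})) t' \<and> t' \<noteq> t \<and> owns rm u t" using x(2) by auto
      then show ?thesis by blast
    qed (use x(2) in auto)
  next
    fix x assume "x \<in> {edge u t | t. \<not> owns rm u t} \<union> {edge (add_mset t' (u - {#t#})) t' | t t'. t' \<noteq> t \<and> owns rm u t}"
    then consider t where "\<not> owns rm u t" "x = edge u t"
      | t t' where "t' \<noteq> t" "owns rm u t" "x = edge (add_mset t' (u - {#t#})) t'"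
      by blast
    then have "\<exists>u' t'. region_coeff rm u u' t' \<noteq> 0 \<and> x = edge u' t'"
    proof cases
      case 1
      then have "region_coeff rm u u t \<noteq> 0" unfolding region_coeff_nonzero_iff by simp
      with 1 show ?thesis by blast
    next
      case 2
      then have "region_coeff rm u (add_mset t' (u - {#t#})) t' \<noteq> 0" unfolding region_coeff_nonzero_iff by auto
      with 2 show ?thesis by blast
    qed
    then show "x \<in> {edge u' t' | u' t'. region_coeff rm u u' t' \<noteq> 0}" by blast
  qed
  also have "\<dots> = (\<Union>t. E t)"
  proof (intro equalityI subsetI)
    fix x assume "x \<in> {edge u t | t. \<not> owns rm u t} \<union> {edge (add_mset t' (u - {#t#})) t' | t t'. t' \<noteq> t \<and> owns rm u t}"
    then consider t where "\<not> owns rm u t" "x = edge u t"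
      | t t' where "t' \<noteq> t" "owns rm u t" "x = edge (add_mset t' (u - {#t#})) t'"
      by blast
    then show "x \<in> (\<Union>t. E t)"
    proof cases
      case 1 then show ?thesis by (auto simp: E_def edge_def)
    next
      case 2
      have t': "t' = nx t \<or> t' = pv t" using xyz_cases[of t' t] 2(1) by auto
      have "x = {add_mset t' u, opposite u t}"
        unfolding 2(3) using 2(2) by (intro edge_across 2(1)) (simp add: owns_def)
      then have "x \<in> E t" using t' 2(2) by (auto simp: E_def)
      then show ?thesis by blast
    qed
  next
    fix x assume "x \<in> (\<Union>t. E t)"
    then obtain t where t: "x \<in> E t" by blast
    show "x \<in> {edge u t | t. \<not> owns rm u t} \<union> {edge (add_mset t' (u - {#t#})) t' | t t'. t' \<noteq> t \<and> owns rm u t}"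
    proof (cases "owns rm u t")
      case True
      then have "t \<in># u" by (simp add: owns_def)
      then have "x = edge (add_mset (nx t) (u - {#t#})) (nx t) \<or> x = edge (add_mset (pv t) (u - {#t#})) (pv t)"
        using t True by (auto simp: E_def edge_across)
      then show ?thesis using True nx_pv(5,6)[of t] by blast
    next
      case False
      with t have "x = edge u t" by (simp add: E_def edge_def)
      then show ?thesis using False by blast
    qed
  qed
  also have "\<dots> = E Vx \<union> E Vy \<union> E Vz" unfolding UNIV_xyz[of Vx] by auto
  also have "\<dots> = {{hexagon u i, hexagon u j} | i j. convex_adjacent (codes rm u) i j}"
  proof -
    have pairs: "{g i j | i j. if P then (i, j) \<in> {(a, b), (a', b')} else (i, j) = (a'', b'')}
      = (if P then {g a b, g a' b'} else {g a'' b''})"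
      for g :: "nat \<Rightarrow> nat \<Rightarrow> xyz multiset set" and P and a b a' b' a'' b'' :: nat
      by (cases P) auto
    have union: "{g i j | i j. A i j \<or> B i j \<or> C i j} = {g i j | i j. A i j} \<union> {g i j | i j. B i j} \<union> {g i j | i j. C i j}"
      for g :: "nat \<Rightarrow> nat \<Rightarrow> xyz multiset set" and A B C
      by blast
    have "{{hexagon u i, hexagon u j} | i j. convex_adjacent (codes rm u) i j}
      = (if owns rm u Vx then {{hexagon u 4, hexagon u 5}, {hexagon u 0, hexagon u 5}} else {{hexagon u 0, hexagon u 4}}) \<union>
        (if owns rm u Vy then {{hexagon u 0, hexagon u 1}, {hexagon u 1, hexagon u 2}} else {{hexagon u 0, hexagon u 2}}) \<union>
        (if owns rm u Vz then {{hexagon u 2, hexagon u 3}, {hexagon u 3, hexagon u 4}} else {{hexagon u 2, hexagon u 4}})"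
      unfolding convex_adjacent_codes union pairs ..
    moreover have swap: "{hexagon u 0, hexagon u 4} = {hexagon u 4, hexagon u 0}" "{hexagon u 1, hexagon u 2} = {hexagon u 2, hexagon u 1}"
      "{hexagon u 3, hexagon u 4} = {hexagon u 4, hexagon u 3}" by blast+
    moreover have "E Vx = (if owns rm u Vx then {{hexagon u 4, hexagon u 5}, {hexagon u 0, hexagon u 5}} else {{hexagon u 4, hexagon u 0}})"
      "E Vy = (if owns rm u Vy then {{hexagon u 0, hexagon u 1}, {hexagon u 2, hexagon u 1}} else {{hexagon u 0, hexagon u 2}})"
      "E Vz = (if owns rm u Vz then {{hexagon u 2, hexagon u 3}, {hexagon u 4, hexagon u 3}} else {{hexagon u 2, hexagon u 4}})"
      by (simp_all add: E_def hexagon_def)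
    ultimately show ?thesis by (simp only:)
  qed
  finally show ?thesis .
qed

lemma card_region: "card (region rm u) \<ge> 3"
proof -
  have "card (range (\<lambda>s. add_mset s u)) = 3"
    unfolding UNIV_xyz[of Vx] by (simp add: add_mset_left_eq_iff)
  moreover have "card (range (\<lambda>s. add_mset s u)) \<le> card (region rm u)"
    by (rule card_mono[OF finite_region]) (simp add: region_eq)
  ultimately show ?thesis by simp
qed

lemma region_size: "a \<in> region rm u \<Longrightarrow> size a = size u + 1"
  by (simp add: region_def)

text \<open>Common vertices divide w * xyz, where w is the gcd of u and u'. If w has degree at least
  2 less than u, only w * xyz itself has the right degree. Otherwise both up triangles border the
  down triangle w. If one of them owns it, the intersection is the side of w on the other one; else
  it is at most the vertex common to both.\<close>

lemma region_Int:
  assumes sz: "size u = size u'" and ne: "u \<noteq> u'"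
  shows "(\<exists>a. region rm u \<inter> region rm u' \<subseteq> {a}) \<or>
    (\<exists>v t. size v = size u \<and> \<not> owns rm v t \<and> region rm u \<inter> region rm u' = edge v t)"
proof -
  define w where "w = u \<inter># u'"
  have sub: "a \<subseteq># w + xyz_mon" if "a \<in> region rm u" "a \<in> region rm u'" for a
    unfolding subseteq_mset_def
  proof
    fix v
    have "count a v \<le> count u v + 1" "count a v \<le> count u' v + 1" using that unfolding region_def by blast+
    then show "count a v \<le> count (w + xyz_mon) v" unfolding count_union count_xyz_mon by (simp add: w_def)
  qed
  have wu: "w \<subseteq># u" "w \<subseteq># u'" by (simp_all add: w_def)
  have "size w \<noteq> size u"
  proof
    assume "size w = size u"
    then have "w = u" "w = u'"
      using wu sz mset_subset_size[of w u] mset_subset_size[of w u'] by (auto simp: subset_mset.less_le)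
    with ne show False by simp
  qed
  then have less: "size w < size u" using size_mset_mono[OF wu(1)] by simp
  show ?thesis
  proof (cases "size w + 1 = size u")
    case False
    have "a = w + xyz_mon" if a: "a \<in> region rm u" "a \<in> region rm u'" for a
    proof -
      have "size a = size u + 1" using a(1) by (rule region_size)
      then show ?thesis
        using sub[OF a] mset_subset_size[of a "w + xyz_mon"] False less by (auto simp: subset_mset.less_le)
    qed
    then show ?thesis by blast
  next
    case True
    have "size (u - w) = 1" "size (u' - w) = 1"
      using True sz wu by (simp_all add: size_Diff_submset)
    then obtain p q where "u - w = {#p#}" "u' - w = {#q#}"
      using size_1_singleton_mset[of "u - w"] size_1_singleton_mset[of "u' - w"] by auto
    then have u: "u = add_mset p w" and u': "u' = add_mset q w"
      using subset_mset.add_diff_inverse[OF wu(1)] subset_mset.add_diff_inverse[OF wu(2)] by simp_all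
    then have pq: "p \<noteq> q" using ne by auto
    let ?D = "\<lambda>s. w + {#nx s, pv s#}"
    have D: "count (?D s) v = count w v + (if v = s then 0 else 1)" for s v
      using count_edge_label[of w s v] by (simp add: edge_label_def)
    have mem: "?D s \<in> region rm (add_mset r w) \<longleftrightarrow> s \<noteq> r \<or> rm w = r" for s r
    proof -
      have "(owns rm (add_mset r w) v \<or> count (add_mset r w) v \<le> count (?D s) v) \<longleftrightarrow> (v = r \<and> s = r \<longrightarrow> rm w = r)" for v
        unfolding D by (cases "v = r"; cases "s = r") (auto simp: owns_def)
      moreover have "count (?D s) v \<le> count (add_mset r w) v + 1" for v unfolding D by simp
      moreover have "size (?D s) = size (add_mset r w) + 1" by simp
      ultimately show ?thesis unfolding region_def by auto
    qed
    have "a \<in> range ?D" if a: "a \<in> region rm u" "a \<in> region rm u'" for a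
    proof -
      have "size a = size w + 2" using region_size[OF a(1)] True by simp
      then have "size (w + xyz_mon - a) = 1" using sub[OF a] by (simp add: size_Diff_submset)
      then obtain s where s: "w + xyz_mon - a = {#s#}" by (metis One_nat_def size_1_singleton_mset)
      have "w + xyz_mon = a + {#s#}"
        using subset_mset.add_diff_inverse[OF sub[OF a]] unfolding s by (rule sym)
      then have "w + xyz_mon = add_mset s a" by simp
      moreover have "w + xyz_mon = add_mset s (?D s)" unfolding xyz_mon_eq[of s] by simp
      ultimately have "a = ?D s" by simp
      then show ?thesis by blast
    qed
    with mem have inter: "region rm u \<inter> region rm u' = ?D ` {s. (s \<noteq> p \<or> rm w = p) \<and> (s \<noteq> q \<or> rm w = q)}"
    proof (intro equalityI subsetI)
      fix a assume a: "a \<in> region rm u \<inter> region rm u'"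
      then obtain s where s: "a = ?D s" using \<open>\<And>a. a \<in> region rm u \<Longrightarrow> a \<in> region rm u' \<Longrightarrow> a \<in> range ?D\<close> by blast
      have "(s \<noteq> p \<or> rm w = p) \<and> (s \<noteq> q \<or> rm w = q)"
        using a mem[of s p] mem[of s q] unfolding s u u' by simp
      then show "a \<in> ?D ` {s. (s \<noteq> p \<or> rm w = p) \<and> (s \<noteq> q \<or> rm w = q)}" unfolding s by (intro imageI CollectI)
    next
      fix a assume "a \<in> ?D ` {s. (s \<noteq> p \<or> rm w = p) \<and> (s \<noteq> q \<or> rm w = q)}"
      then obtain s where "a = ?D s" "(s \<noteq> p \<or> rm w = p) \<and> (s \<noteq> q \<or> rm w = q)" by blast
      then show "a \<in> region rm u \<inter> region rm u'"
        using mem[of s p] mem[of s q] unfolding u u' by simp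
    qed
    consider "rm w = p" | "rm w = q" | "rm w \<noteq> p" "rm w \<noteq> q" by blast
    then show ?thesis
    proof cases
      case 1
      then have "region rm u \<inter> region rm u' = edge (add_mset q w) q"
        unfolding inter edge_in_down_triangle using pq by auto
      then show ?thesis using 1 pq sz u' by (intro disjI2 exI[of _ u'] exI[of _ q]) (simp add: owns_def)
    next
      case 2
      then have "region rm u \<inter> region rm u' = edge (add_mset p w) p"
        unfolding inter edge_in_down_triangle using pq by auto
      then show ?thesis using 2 pq sz u by (intro disjI2 exI[of _ u] exI[of _ p]) (simp add: owns_def)
    next
      case 3
      define r where "r = (if q = nx p then pv p else nx p)"
      have "s = r" if "s \<noteq> p" "s \<noteq> q" for s
        unfolding r_def using that pq xyz_cases[of s p] xyz_cases[of q p] by auto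
      then have "{s. (s \<noteq> p \<or> rm w = p) \<and> (s \<noteq> q \<or> rm w = q)} \<subseteq> {r}"
        using 3 by blast
      then have "region rm u \<inter> region rm u' \<subseteq> ?D ` {r}"
        unfolding inter by (rule image_mono)
      then show ?thesis unfolding image_insert image_empty by (intro disjI1 exI[of _ "?D r"])
    qed
  qed
qed

section \<open>The cell complex belonging to a function of removed edges\<close>

text \<open>The complex \<Delta> without reference to the drawing or to a choice function; the
  converse arrives at a function \<open>rm\<close> directly.\<close>

definition cells :: "nat \<Rightarrow> (xyz multiset \<Rightarrow> xyz) \<Rightarrow> xyz multiset set set" where
  "cells d rm = {{}} \<union> {{a} | a. size a = d} \<union> {edge u t | u t. size u + 1 = d \<and> \<not> owns rm u t}
    \<union> region rm ` {u. size u + 1 = d}"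

lemma cells_cases:
  assumes "F \<in> cells d rm"
  obtains (empty) "F = {}" | (vertex) a where "size a = d" "F = {a}"
    | (edge) u t where "size u + 1 = d" "\<not> owns rm u t" "F = edge u t"
    | (region) u where "size u + 1 = d" "F = region rm u"
  using assms unfolding cells_def by blast

lemma cells_intros:
  "{} \<in> cells d rm" "size a = d \<Longrightarrow> {a} \<in> cells d rm"
  "size u + 1 = d \<Longrightarrow> \<not> owns rm u t \<Longrightarrow> edge u t \<in> cells d rm"
  "size u + 1 = d \<Longrightarrow> region rm u \<in> cells d rm"
  unfolding cells_def by blast+

lemma cells_size: "F \<in> cells d rm \<Longrightarrow> a \<in> F \<Longrightarrow> size a = d"
  by (erule cells_cases) (auto dest: region_size edge_size)

lemma finite_cells: "finite (cells d rm)"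
proof -
  have fin: "finite {u :: xyz multiset. size u + 1 = d}"
    by (rule finite_subset[OF _ finite_multisets_size[of "d - 1"]]) auto
  have "{edge u t | u t. size u + 1 = d \<and> \<not> owns rm u t} \<subseteq> (\<lambda>(u, t). edge u t) ` ({u. size u + 1 = d} \<times> UNIV)"
    by auto
  then have "finite {edge u t | u t. size u + 1 = d \<and> \<not> owns rm u t}"
    by (rule finite_subset) (use fin in auto)
  moreover have "finite {{a} | a :: xyz multiset. size a = d}"
    unfolding setcompr_eq_image by (rule finite_imageI[OF finite_multisets_size])
  ultimately show ?thesis unfolding cells_def using fin by auto
qed

lemma subset_cell_small:
  assumes "F \<in> cells d rm" "S \<subseteq> F" "S \<subseteq> {a}"
  shows "S \<in> cells d rm"
proof -
  have "S = {} \<or> S = {a} \<and> a \<in> F" using assms(2,3) by auto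
  then show ?thesis using cells_size[OF assms(1)] by (auto intro: cells_intros)
qed

lemma subset_edge:
  assumes "F \<in> cells d rm" "F = edge u t" "S \<subseteq> F"
  shows "S \<in> cells d rm"
proof -
  have "S = F \<or> (\<exists>a. S \<subseteq> {a})" using assms(2,3) unfolding edge_def by blast
  then show ?thesis using subset_cell_small assms by blast
qed

lemma cells_Int:
  assumes F: "F \<in> cells d rm" and G: "G \<in> cells d rm"
  shows "F \<inter> G \<in> cells d rm"
  using F
proof (cases rule: cells_cases)
  case empty
  then show ?thesis by (simp add: cells_intros)
next
  case (vertex a)
  then show ?thesis using subset_cell_small[OF F, of "F \<inter> G" a] by blast
next
  case (edge u t)
  then show ?thesis using subset_edge[OF F, of u t "F \<inter> G"] by blast
next
  case F': (region u)
  from G show ?thesis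
  proof (cases rule: cells_cases)
    case empty
    then show ?thesis by (simp add: cells_intros)
  next
    case (vertex a)
    then show ?thesis using subset_cell_small[OF G, of "F \<inter> G" a] by blast
  next
    case (edge u t)
    then show ?thesis using subset_edge[OF G, of u t "F \<inter> G"] by blast
  next
    case G': (region u')
    show ?thesis
    proof (cases "u = u'")
      case True
      then show ?thesis using F F' G' by simp
    next
      case False
      have "size u = size u'" using F'(1) G'(1) by simp
      from region_Int[OF this False, of rm] show ?thesis
      proof (elim disjE exE conjE)
        fix a assume "region rm u \<inter> region rm u' \<subseteq> {a}"
        then show ?thesis using subset_cell_small[OF F, of "F \<inter> G" a] F' G' by blast
      next
        fix v t assume "size v = size u" "\<not> owns rm v t" "region rm u \<inter> region rm u' = edge v t"
        then show ?thesis using F' G' cells_intros(3)[of v d rm t] by simp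
      qed
    qed
  qed
qed

lemma convex_adjacent_pair: "convex_adjacent {0, 1} i j \<longleftrightarrow> i = 0 \<and> j = 1"
  by (auto simp: convex_adjacent_def)

lemma cells_below_region:
  assumes u: "size u + 1 = d"
  shows "{G \<in> cells d rm. G \<subseteq> region rm u} = {{}, region rm u} \<union> (\<lambda>a. {a}) ` region rm u
    \<union> {edge u' t' | u' t'. region_coeff rm u u' t' \<noteq> 0}"
proof (intro equalityI subsetI)
  fix G assume "G \<in> {G \<in> cells d rm. G \<subseteq> region rm u}"
  then have G: "G \<in> cells d rm" "G \<subseteq> region rm u" by auto
  from G(1) show "G \<in> {{}, region rm u} \<union> (\<lambda>a. {a}) ` region rm u \<union> {edge u' t' | u' t'. region_coeff rm u u' t' \<noteq> 0}"
  proof (cases rule: cells_cases)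
    case (edge u' t')
    then have "region_coeff rm u u' t' \<noteq> 0"
      using edge_subset_region_iff[of u' u t' rm] G(2) u by simp
    with edge show ?thesis by blast
  next
    case (region u')
    then have "u' = u" using region_eq_iff[of rm u' u] G(2) u by simp
    with region show ?thesis by simp
  qed (use G(2) in auto)
next
  fix G assume "G \<in> {{}, region rm u} \<union> (\<lambda>a. {a}) ` region rm u \<union> {edge u' t' | u' t'. region_coeff rm u u' t' \<noteq> 0}"
  then consider "G = {}" | "G = region rm u" | a where "a \<in> region rm u" "G = {a}"
    | u' t' where "region_coeff rm u u' t' \<noteq> 0" "G = edge u' t'" by blast
  then show "G \<in> {G \<in> cells d rm. G \<subseteq> region rm u}"
  proof cases
    case 3
    then show ?thesis using region_size u by (auto intro: cells_intros)
  next
    case 4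
    have sz: "size u' = size u"
      using 4(1) unfolding region_coeff_nonzero_iff by (auto simp: owns_def size_Suc_Diff1)
    then show ?thesis
      using edge_subset_region_iff[OF sz, of t' rm] 4 u by (auto intro: cells_intros)
  qed (use u in \<open>auto intro: cells_intros\<close>)
qed

text \<open>All cells are realized on the parabola, the empty cell, points and segments with index
  sets of 0, 1 and 2 elements, the regions with \<open>codes\<close>.\<close>

lemma polyhedral_cells: "polyhedral_complex TYPE(real \<times> real) (cells d rm)"
  unfolding polyhedral_complex_def realizes_def[symmetric]
proof (intro conjI ballI)
  show "finite (cells d rm)" by (rule finite_cells)
  show "{} \<in> cells d rm" by (rule cells_intros)
  fix F assume F: "F \<in> cells d rm"
  show "finite F"
    using F by (cases rule: cells_cases) (auto simp: finite_region edge_def)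
  show "{v} \<in> cells d rm" if "v \<in> F" for v
    using cells_size[OF F that] by (rule cells_intros)
  show "F \<inter> G \<in> cells d rm" if "G \<in> cells d rm" for G
    using F that by (rule cells_Int)
  show "\<exists>p :: xyz multiset \<Rightarrow> real \<times> real. realizes (cells d rm) p F"
    using F
  proof (cases rule: cells_cases)
    case empty
    have "{G \<in> cells d rm. G \<subseteq> (\<lambda>_. {#}) ` {}} = {{}, (\<lambda>_. {#}) ` {}} \<union> (\<lambda>i. {{#}}) ` {} \<union>
        {{{#}, {#}} | i j. convex_adjacent {} i j}"
      using cells_intros(1) by (auto simp: convex_adjacent_def)
    from parabola_realizes[OF _ _ this] show ?thesis using empty by simp
  next
    case (vertex a)
    have "{G \<in> cells d rm. G \<subseteq> (\<lambda>_. a) ` {0}} = {{}, (\<lambda>_. a) ` {0}} \<union> (\<lambda>i. {a}) ` {0} \<union>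
        {{a, a} | i j. convex_adjacent {0} i j}"
      using cells_intros(1) cells_intros(2)[OF vertex(1)] by (auto simp: convex_adjacent_def)
    from parabola_realizes[OF _ _ this] show ?thesis using vertex by simp
  next
    case (edge u t)
    let ?\<phi> = "\<lambda>i :: nat. if i = 0 then add_mset (nx t) u else add_mset (pv t) u"
    have im: "?\<phi> ` {0, 1} = F" using edge by (auto simp: edge_def)
    have "{G \<in> cells d rm. G \<subseteq> F} = Pow F" using subset_edge[OF F edge(3)] by blast
    also have "\<dots> = {{}, F} \<union> (\<lambda>i. {?\<phi> i}) ` {0, 1} \<union> {{?\<phi> i, ?\<phi> j} | i j. convex_adjacent {0, 1} i j}"
      unfolding convex_adjacent_pair edge(3) edge_def Pow_insert by auto
    finally have "{G \<in> cells d rm. G \<subseteq> ?\<phi> ` {0, 1}} = {{}, ?\<phi> ` {0, 1}} \<union> (\<lambda>i. {?\<phi> i}) ` {0, 1} \<union>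
        {{?\<phi> i, ?\<phi> j} | i j. convex_adjacent {0, 1} i j}" unfolding im .
    from parabola_realizes[OF _ _ this] show ?thesis unfolding im by (simp add: inj_on_def add_mset_left_eq_iff)
  next
    case (region u)
    have "{G \<in> cells d rm. G \<subseteq> hexagon u ` codes rm u} = {{}, hexagon u ` codes rm u} \<union> (\<lambda>i. {hexagon u i}) ` codes rm u \<union>
        {{hexagon u i, hexagon u j} | i j. convex_adjacent (codes rm u) i j}"
      using cells_below_region[OF region(1), of rm] unfolding region_edges region_hexagon image_image .
    from parabola_realizes[OF _ inj_hexagon this] show ?thesis
      unfolding region region_hexagon by (simp add: codes_def)
  qed
qed

section \<open>Exactness of the grid complex\<close>

lemma bdry_add: "bdry X \<epsilon> (\<lambda>F. v F + w F) = (\<lambda>G. bdry X \<epsilon> v G + bdry X \<epsilon> w G)"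
  by (rule ext) (simp add: bdry_def distrib_right sum.distrib)

lemma bdry_scale: "bdry X \<epsilon> (\<lambda>F. k * w F) = (\<lambda>G. k * bdry X \<epsilon> w G)"
  by (rule ext) (simp add: bdry_def sum_distrib_left mult.assoc)

lemma bdry_sum: "bdry X \<epsilon> (\<lambda>F. \<Sum>i\<in>S. w i F) = (\<lambda>G. \<Sum>i\<in>S. bdry X \<epsilon> (w i) G)"
proof
  fix G show "bdry X \<epsilon> (\<lambda>F. \<Sum>i\<in>S. w i F) G = (\<Sum>i\<in>S. bdry X \<epsilon> (w i) G)"
    unfolding bdry_def sum_distrib_right by (rule sum.swap)
qed

lemma chains_le_zero: "(\<lambda>_. 0) \<in> chains_le X lab b i"
  by (simp add: chains_le_def)

lemma chains_le_add: "v \<in> chains_le X lab b i \<Longrightarrow> w \<in> chains_le X lab b i \<Longrightarrow> (\<lambda>F. v F + w F) \<in> chains_le X lab b i"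
  unfolding chains_le_def by force

lemma chains_le_scale: "w \<in> chains_le X lab b i \<Longrightarrow> (\<lambda>F. k * w F) \<in> chains_le X lab b i"
  unfolding chains_le_def by force

lemma chains_le_sum: "(\<And>j. j \<in> S \<Longrightarrow> w j \<in> chains_le X lab b i) \<Longrightarrow> (\<lambda>F. \<Sum>j\<in>S. w j F) \<in> chains_le X lab b i"
  by (induction S rule: infinite_finite_induct) (simp_all add: chains_le_zero chains_le_add)

lemma chains_le_single:
  "F \<in> X \<Longrightarrow> hdeg X F = i \<Longrightarrow> face_label lab F \<subseteq># b \<Longrightarrow> (\<lambda>G. if G = F then k else 0) \<in> chains_le X lab b i"
  by (auto simp: chains_le_def)

lemma bdry_single:
  "finite X \<Longrightarrow> F \<in> X \<Longrightarrow> bdry X \<epsilon> (\<lambda>G. if G = F then k else 0) = (\<lambda>G. k * (if facet X F G then of_int (\<epsilon> F G) else 0))"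
  by (rule ext) (simp add: bdry_def if_distrib[of "\<lambda>x. x * _"] cong: if_cong)

lemma facetD: "facet X F G \<Longrightarrow> F \<in> X" "facet X F G \<Longrightarrow> G \<in> X" "facet X F G \<Longrightarrow> G \<subset> F"
  by (simp_all add: facet_def)

lemma incidence_facet: "incidence_function X \<epsilon> \<Longrightarrow> facet X F G \<Longrightarrow> \<epsilon> F G = 1 \<or> \<epsilon> F G = - 1"
proof -
  assume inc: "incidence_function X \<epsilon>" and f: "facet X F G"
  then have "F \<in> X" "G \<in> X" by (auto dest: facetD)
  then have "if facet X F G then \<epsilon> F G \<in> {1, - 1} else \<epsilon> F G = 0"
    using inc unfolding incidence_function_def by blast
  with f show ?thesis by auto
qed

lemma incidence_nonfacet: "incidence_function X \<epsilon> \<Longrightarrow> F \<in> X \<Longrightarrow> G \<in> X \<Longrightarrow> \<not> facet X F G \<Longrightarrow> \<epsilon> F G = 0"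
proof -
  assume inc: "incidence_function X \<epsilon>" and "F \<in> X" "G \<in> X" and f: "\<not> facet X F G"
  then have "if facet X F G then \<epsilon> F G \<in> {1, - 1} else \<epsilon> F G = 0"
    unfolding incidence_function_def by blast
  with f show ?thesis by auto
qed

lemma incidence_sum: "incidence_function X \<epsilon> \<Longrightarrow> F \<in> X \<Longrightarrow> G \<in> X \<Longrightarrow> (\<Sum>H\<in>X. \<epsilon> F H * \<epsilon> H G) = 0"
  unfolding incidence_function_def by blast

lemma face_label_id_edge: "face_label id (edge u t) = edge_label u t"
proof (rule subset_mset.antisym)
  have fin: "finite (edge u t)" by (simp add: edge_def)
  show "face_label id (edge u t) \<subseteq># edge_label u t"
    unfolding face_label_subset_iff[OF fin] by (auto simp: edge_def edge_label_def)
  show "edge_label u t \<subseteq># face_label id (edge u t)"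
    unfolding subseteq_mset_def
  proof
    fix s
    have "add_mset (nx t) u \<subseteq># face_label id (edge u t)" "add_mset (pv t) u \<subseteq># face_label id (edge u t)"
      using face_label_upper[OF fin, of _ id] by (auto simp: edge_def)
    from mset_subset_eq_count[OF this(1), of s] mset_subset_eq_count[OF this(2), of s]
    show "count (edge_label u t) s \<le> count (face_label id (edge u t)) s"
      using xyz_cases[of s t] by (auto simp: count_edge_label)
  qed
qed

lemma face_label_id_region: "face_label id (region rm u) = u + xyz_mon"
proof (rule subset_mset.antisym)
  show "face_label id (region rm u) \<subseteq># u + xyz_mon"
    unfolding face_label_subset_iff[OF finite_region]
    unfolding subseteq_mset_def
  proof (intro ballI allI)
    fix a v assume "a \<in> region rm u"
    then have "count a v \<le> count u v + 1" unfolding region_def by blast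
    then show "count (id a) v \<le> count (u + xyz_mon) v" unfolding count_union count_xyz_mon by simp
  qed
  show "u + xyz_mon \<subseteq># face_label id (region rm u)"
    unfolding subseteq_mset_def
  proof
    fix s
    have "add_mset s u \<subseteq># face_label id (region rm u)"
      using face_label_upper[OF finite_region, of "add_mset s u" rm u id] by (simp add: region_eq)
    from mset_subset_eq_count[OF this, of s]
    show "count (u + xyz_mon) s \<le> count (face_label id (region rm u)) s"
      unfolding count_union count_xyz_mon by simp
  qed
qed

lemma face_label_id_singleton [simp]: "face_label id {a} = a"
  by (simp add: face_label_def)

text \<open>An edge \<open>(u, t)\<close> arrives at a if a is u * pv t and leaves it if a is u * nx
  t. Sorting the edges at a by the variable s = a / u gives the form used in
  \<open>conserved\<close>.\<close>

lemma sum_edges_at_vertex: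
  fixes z :: "xyz multiset \<Rightarrow> xyz \<Rightarrow> 'k::ab_group_add"
  assumes a: "size a = d"
  shows "(\<Sum>(u, t)\<in>{u. size u + 1 = d} \<times> UNIV. (if a = add_mset (pv t) u then z u t else 0) - (if a = add_mset (nx t) u then z u t else 0))
    = (\<Sum>s\<in>UNIV. if s \<in># a then z (a - {#s#}) (nx s) - z (a - {#s#}) (pv s) else 0)"
proof -
  let ?U = "{u :: xyz multiset. size u + 1 = d}"
  have fin: "finite ?U" by (rule finite_subset[OF _ finite_multisets_size[of "d - 1"]]) auto
  have single: "(\<Sum>u\<in>?U. if a = add_mset s u then z u t else 0) = (if s \<in># a then z (a - {#s#}) t else 0)" for s t
  proof (cases "s \<in># a")
    case True
    then have "a = add_mset s u \<longleftrightarrow> u = a - {#s#}" for u by auto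
    moreover have "a - {#s#} \<in> ?U" using True a by (simp add: size_Suc_Diff1)
    ultimately show ?thesis using True fin by simp
  next
    case False
    then have "a \<noteq> add_mset s u" for u by auto
    then show ?thesis using False by simp
  qed
  have "(\<Sum>(u, t)\<in>?U \<times> UNIV. (if a = add_mset (pv t) u then z u t else 0) - (if a = add_mset (nx t) u then z u t else 0))
    = (\<Sum>t\<in>UNIV. \<Sum>u\<in>?U. (if a = add_mset (pv t) u then z u t else 0) - (if a = add_mset (nx t) u then z u t else 0))"
    by (subst sum.cartesian_product[symmetric], subst sum.swap) simp
  also have "\<dots> = (\<Sum>t\<in>UNIV. (if pv t \<in># a then z (a - {#pv t#}) t else 0) - (if nx t \<in># a then z (a - {#nx t#}) t else 0))"
    by (simp only: sum_subtractf single)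
  also have "\<dots> = (\<Sum>s\<in>UNIV. if s \<in># a then z (a - {#s#}) (nx s) - z (a - {#s#}) (pv s) else 0)"
    unfolding UNIV_xyz[of Vx] by (simp add: algebra_simps)
  finally show ?thesis .
qed

text \<open>Only the vertices and edges of X are prescribed, and the incidence function is
  arbitrary. So the explicit complex and an unknown minimal resolution, once its edges are
  determined, share the facts about cycles of vertices and edges.\<close>

locale grid_skeleton =
  fixes d :: nat and rm :: "xyz multiset \<Rightarrow> xyz" and X :: "xyz multiset set set"
    and \<epsilon> :: "xyz multiset set \<Rightarrow> xyz multiset set \<Rightarrow> int" and E :: "'a::euclidean_space itself"
  assumes poly: "polyhedral_complex E X" and inc: "incidence_function X \<epsilon>"
    and vertices: "{F \<in> X. hdeg X F = 1} = {{a} | a. size a = d}"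
    and edges: "{F \<in> X. hdeg X F = 2} = {edge u t | u t. size u + 1 = d \<and> \<not> owns rm u t}"
begin

lemma finX: "finite X"
  using poly by (rule polyhedral_finite)

lemma vertex_cell: "size a = d \<Longrightarrow> {a} \<in> X \<and> hdeg X {a} = 1"
  using vertices by blast

lemma edge_cell: "size u + 1 = d \<Longrightarrow> \<not> owns rm u t \<Longrightarrow> edge u t \<in> X \<and> hdeg X (edge u t) = 2"
  using edges by blast

lemma hdeg1_cases: "F \<in> X \<Longrightarrow> hdeg X F = 1 \<Longrightarrow> \<exists>a. size a = d \<and> F = {a}"
  using vertices by blast

lemma hdeg2_cases: "F \<in> X \<Longrightarrow> hdeg X F = 2 \<Longrightarrow> \<exists>u t. size u + 1 = d \<and> \<not> owns rm u t \<and> F = edge u t"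
  using edges by blast

lemma facet_edge_iff:
  assumes "size u + 1 = d" "\<not> owns rm u t"
  shows "facet X (edge u t) G \<longleftrightarrow> G = {add_mset (nx t) u} \<or> G = {add_mset (pv t) u}"
proof
  assume f: "facet X (edge u t) G"
  have h: "hdeg X G = 1" using facet_hdeg[OF poly f] edge_cell[OF assms] by simp
  obtain a where a: "G = {a}" using hdeg1_cases[OF facetD(2)[OF f] h] by blast
  then have "a \<in> edge u t" using facetD(3)[OF f] by blast
  then show "G = {add_mset (nx t) u} \<or> G = {add_mset (pv t) u}"
    unfolding a edge_def by simp
next
  assume "G = {add_mset (nx t) u} \<or> G = {add_mset (pv t) u}"
  then obtain s where s: "G = {add_mset s u}" "s = nx t \<or> s = pv t" by blast
  have "add_mset s u \<in> edge u t" using s(2) by (auto simp: edge_def)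
  moreover have "G \<noteq> edge u t"
  proof
    assume "G = edge u t"
    then have "card G = 2" by (simp add: card_edge)
    then show False by (simp add: s(1))
  qed
  ultimately have "G \<subset> edge u t" unfolding s(1) by blast
  moreover have "G \<in> X \<and> hdeg X G = 1" unfolding s(1) by (rule vertex_cell) (simp add: assms(1)[symmetric])
  ultimately show "facet X (edge u t) G"
    unfolding facet_iff_hdeg[OF poly] using edge_cell[OF assms] by simp
qed

text \<open>The sign by which \<epsilon> deviates from the standard direction of the edge.\<close>

definition orient :: "xyz multiset \<Rightarrow> xyz \<Rightarrow> int" where
  "orient u t = \<epsilon> (edge u t) {add_mset (pv t) u}"

lemma orient_values:
  assumes "size u + 1 = d" "\<not> owns rm u t"
  shows "orient u t = 1 \<or> orient u t = - 1" "\<epsilon> (edge u t) {add_mset (nx t) u} = - orient u t"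
proof -
  show "orient u t = 1 \<or> orient u t = - 1"
    unfolding orient_def by (rule incidence_facet[OF inc]) (simp add: facet_edge_iff[OF assms])
  let ?A = "{add_mset (nx t) u}" and ?B = "{add_mset (pv t) u}"
  have AB: "?A \<in> X" "?B \<in> X" "?A \<noteq> ?B" using vertex_cell assms(1) by (auto simp: add_mset_left_eq_iff)
  \<comment> \<open>The incidence relation between the edge and the empty face, over which all
    vertices have sign 1.\<close>
  have "(\<Sum>H\<in>{?A, ?B}. \<epsilon> (edge u t) H * \<epsilon> H {}) = (\<Sum>H\<in>X. \<epsilon> (edge u t) H * \<epsilon> H {})"
    by (rule sum.mono_neutral_left[OF finX])
      (use AB incidence_nonfacet[OF inc] facet_edge_iff[OF assms] edge_cell[OF assms] in auto)
  also have "\<dots> = 0"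
    using incidence_sum[OF inc] edge_cell[OF assms] polyhedral_finite(3)[OF poly] by blast
  moreover have "\<epsilon> ?A {} = 1" "\<epsilon> ?B {} = 1"
    using inc AB unfolding incidence_function_def by auto
  ultimately show "\<epsilon> (edge u t) ?A = - orient u t"
    using AB(3) by (simp add: orient_def)
qed

lemma orient_squared:
  assumes "size u + 1 = d" "\<not> owns rm u t"
  shows "(of_int (orient u t) :: 'k::comm_ring_1) * of_int (orient u t) = 1"
  using orient_values(1)[OF assms] by auto

text \<open>A chain of edges rewritten in the standard directions, with value 0 on removed edges;
  being a cycle becomes the conservation law.\<close>

definition edge_flow :: "(xyz multiset set \<Rightarrow> 'k::comm_ring_1) \<Rightarrow> xyz multiset \<Rightarrow> xyz \<Rightarrow> 'k" where
  "edge_flow w u t = (if size u + 1 = d \<and> \<not> owns rm u t then of_int (orient u t) * w (edge u t) else 0)"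

lemma bdry_edge_chain:
  fixes w :: "xyz multiset set \<Rightarrow> 'k::comm_ring_1"
  assumes w: "\<And>F. w F \<noteq> 0 \<Longrightarrow> F \<in> X \<and> hdeg X F = 2" and a: "size a = d"
  shows "bdry X \<epsilon> w {a} = (\<Sum>s\<in>UNIV. if s \<in># a then edge_flow w (a - {#s#}) (nx s) - edge_flow w (a - {#s#}) (pv s) else 0)"
proof -
  let ?U = "{u :: xyz multiset. size u + 1 = d}"
  let ?P = "{(u, t). size u + 1 = d \<and> \<not> owns rm u t}"
  have "finite ?U" by (rule finite_subset[OF _ finite_multisets_size[of "d - 1"]]) auto
  then have fin: "finite (?U \<times> (UNIV :: xyz set))" by (rule finite_cartesian_product) (rule finite_xyz_set)
  have P: "?P \<subseteq> ?U \<times> UNIV" by auto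
  have inj: "inj_on (\<lambda>(u, t). edge u t) ?P" by (auto simp: inj_on_def edge_eq_iff)
  have "bdry X \<epsilon> w {a} = (\<Sum>F\<in>(\<lambda>(u, t). edge u t) ` ?P. w F * (if facet X F {a} then of_int (\<epsilon> F {a}) else 0))"
    unfolding bdry_def
  proof (rule sum.mono_neutral_right[OF finX])
    show "(\<lambda>(u, t). edge u t) ` ?P \<subseteq> X" using edge_cell by auto
    show "\<forall>F\<in>X - (\<lambda>(u, t). edge u t) ` ?P. w F * (if facet X F {a} then of_int (\<epsilon> F {a}) else 0) = 0"
    proof
      fix F assume F: "F \<in> X - (\<lambda>(u, t). edge u t) ` ?P"
      have "w F = 0"
      proof (rule ccontr)
        assume "w F \<noteq> 0"
        then obtain u t where "size u + 1 = d" "\<not> owns rm u t" "F = edge u t"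
          using w hdeg2_cases by metis
        with F show False by blast
      qed
      then show "w F * (if facet X F {a} then of_int (\<epsilon> F {a}) else 0) = 0" by simp
    qed
  qed
  also have "\<dots> = (\<Sum>(u, t)\<in>?P. (if a = add_mset (pv t) u then edge_flow w u t else 0) - (if a = add_mset (nx t) u then edge_flow w u t else 0))"
    unfolding sum.reindex[OF inj] o_def
  proof (rule sum.cong[OF refl])
    fix x assume "x \<in> ?P"
    then obtain u t where x: "x = (u, t)" and ut: "size u + 1 = d" "\<not> owns rm u t" by blast
    show "w (case x of (u, t) \<Rightarrow> edge u t) *
        (if facet X (case x of (u, t) \<Rightarrow> edge u t) {a} then of_int (\<epsilon> (case x of (u, t) \<Rightarrow> edge u t) {a}) else 0)
      = (case x of (u, t) \<Rightarrow> (if a = add_mset (pv t) u then edge_flow w u t else 0) - (if a = add_mset (nx t) u then edge_flow w u t else 0))"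
      unfolding x prod.case
      using orient_values[OF ut] ut
      by (auto simp: facet_edge_iff[OF ut] edge_flow_def add_mset_left_eq_iff orient_def mult.commute)
  qed
  also have "\<dots> = (\<Sum>(u, t)\<in>?U \<times> UNIV. (if a = add_mset (pv t) u then edge_flow w u t else 0) - (if a = add_mset (nx t) u then edge_flow w u t else 0))"
  proof (rule sum.mono_neutral_left[OF fin P], intro ballI)
    fix x assume "x \<in> ?U \<times> UNIV - ?P"
    then obtain u t where x: "x = (u, t)" "\<not> (size u + 1 = d \<and> \<not> owns rm u t)" by blast
    then have "edge_flow w u t = 0" unfolding edge_flow_def by (simp only: if_False)
    then show "(case x of (u, t) \<Rightarrow> (if a = add_mset (pv t) u then edge_flow w u t else 0) - (if a = add_mset (nx t) u then edge_flow w u t else 0)) = 0"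
      by (simp add: x(1))
  qed
  also have "\<dots> = (\<Sum>s\<in>UNIV. if s \<in># a then edge_flow w (a - {#s#}) (nx s) - edge_flow w (a - {#s#}) (pv s) else 0)"
    by (rule sum_edges_at_vertex[OF a])
  finally show ?thesis .
qed

lemma edge_cycle_iff:
  fixes w :: "xyz multiset set \<Rightarrow> 'k::comm_ring_1"
  assumes w: "\<And>F. w F \<noteq> 0 \<Longrightarrow> F \<in> X \<and> hdeg X F = 2"
  shows "bdry X \<epsilon> w = (\<lambda>_. 0) \<longleftrightarrow> conserved (edge_flow w)"
proof
  assume z: "bdry X \<epsilon> w = (\<lambda>_. 0)"
  show "conserved (edge_flow w)"
    unfolding conserved_def
  proof
    fix a
    show "(\<Sum>s\<in>UNIV. if s \<in># a then edge_flow w (a - {#s#}) (nx s) - edge_flow w (a - {#s#}) (pv s) else 0) = 0"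
    proof (cases "size a = d")
      case True
      then show ?thesis using bdry_edge_chain[of w a, OF w True] z by simp
    next
      case False
      then have "size (a - {#s#}) + 1 \<noteq> d" if "s \<in># a" for s using that by (simp add: size_Suc_Diff1)
      then show ?thesis by (intro sum.neutral) (auto simp: edge_flow_def)
    qed
  qed
next
  assume c: "conserved (edge_flow w)"
  show "bdry X \<epsilon> w = (\<lambda>_. 0)"
  proof
    fix G
    show "bdry X \<epsilon> w G = 0"
    proof (cases "\<exists>a. size a = d \<and> G = {a}")
      case True
      then obtain a where a: "size a = d" and G: "G = {a}" by blast
      have "bdry X \<epsilon> w {a} = (\<Sum>s\<in>UNIV. if s \<in># a then edge_flow w (a - {#s#}) (nx s) - edge_flow w (a - {#s#}) (pv s) else 0)"
        using w a by (rule bdry_edge_chain)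
      then show ?thesis
        unfolding G using c[unfolded conserved_def, rule_format, of a] by (rule trans)
    next
      case False
      have "w F * (if facet X F G then of_int (\<epsilon> F G) else 0) = 0" for F
      proof (rule ccontr)
        assume "w F * (if facet X F G then of_int (\<epsilon> F G) else 0) \<noteq> 0"
        then have "w F \<noteq> 0" and f: "facet X F G" by (auto split: if_splits)
        then have "hdeg X G = 1" "G \<in> X" using facet_hdeg[OF poly f] w[of F] facetD[OF f] by auto
        with False hdeg1_cases show False by blast
      qed
      then show ?thesis unfolding bdry_def by (intro sum.neutral) blast
    qed
  qed
qed

lemma edge_cycle_regions:
  fixes w :: "xyz multiset set \<Rightarrow> 'k::comm_ring_1"
  assumes w: "w \<in> chains_le X id b 2" and cyc: "bdry X \<epsilon> w = (\<lambda>_. 0)"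
  obtains f where "\<And>u. f u \<noteq> 0 \<Longrightarrow> size u + 1 = d \<and> u + xyz_mon \<subseteq># b"
    "\<And>u t. size u + 1 = d \<Longrightarrow> edge_flow w u t = f u - (if t \<in># u then f (owner rm (u - {#t#})) else 0)"
proof -
  have w': "w F \<noteq> 0 \<Longrightarrow> F \<in> X \<and> hdeg X F = 2" for F using w by (auto simp: chains_le_def)
  have cons: "conserved (edge_flow w)" using edge_cycle_iff[OF w'] cyc by blast
  have removed: "edge_flow w u t = 0" if "owns rm u t" for u t
    using that by (simp add: edge_flow_def)
  have supp: "edge_label u t \<subseteq># b" if "edge_flow w u t \<noteq> 0" for u t
  proof -
    have "w (edge u t) \<noteq> 0" using that by (auto simp: edge_flow_def split: if_splits)
    then show ?thesis using w by (auto simp: chains_le_def face_label_id_edge)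
  qed
  obtain f where f: "\<And>u. f u \<noteq> 0 \<Longrightarrow> u + xyz_mon \<subseteq># b"
    "\<And>u t. edge_flow w u t = f u - (if t \<in># u then f (owner rm (u - {#t#})) else 0)"
    by (rule region_flow[OF cons removed supp]) auto
  \<comment> \<open>Cuts the weights down to the up triangles of degree d - 1. The equation survives
    because the owner of u / t has the same degree as u.\<close>
  define f' where "f' u = (if size u + 1 = d then f u else 0)" for u
  have "size u + 1 = d \<and> u + xyz_mon \<subseteq># b" if "f' u \<noteq> 0" for u
    using that f(1)[of u] by (auto simp: f'_def split: if_splits)
  moreover have "edge_flow w u t = f' u - (if t \<in># u then f' (owner rm (u - {#t#})) else 0)" if "size u + 1 = d" for u t
    using f(2)[of u t] that by (auto simp: f'_def owner_def size_Suc_Diff1)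
  ultimately show ?thesis by (rule that)
qed

definition linked :: "'k::comm_ring_1 itself \<Rightarrow> xyz multiset \<Rightarrow> xyz multiset \<Rightarrow> xyz multiset \<Rightarrow> bool" where
  "linked _ b a a' \<longleftrightarrow> (\<exists>w\<in>chains_le X id b 2. bdry X \<epsilon> w = (\<lambda>G. (if G = {a'} then 1 else 0) - (if G = {a} then 1 else 0 :: 'k)))"

lemma linked_refl: "linked TYPE('k::comm_ring_1) b a a"
proof -
  have "bdry X \<epsilon> (\<lambda>_. 0 :: 'k) = (\<lambda>_. 0)" by (simp add: bdry_def)
  then show ?thesis unfolding linked_def by (intro bexI[OF _ chains_le_zero]) auto
qed

lemma linked_trans:
  assumes "linked TYPE('k::comm_ring_1) b a a'" "linked TYPE('k) b a' a''"
  shows "linked TYPE('k) b a a''"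
proof -
  from assms obtain v w :: "xyz multiset set \<Rightarrow> 'k" where
    "v \<in> chains_le X id b 2" "bdry X \<epsilon> v = (\<lambda>G. (if G = {a'} then 1 else 0) - (if G = {a} then 1 else 0))"
    "w \<in> chains_le X id b 2" "bdry X \<epsilon> w = (\<lambda>G. (if G = {a''} then 1 else 0) - (if G = {a'} then 1 else 0))"
    unfolding linked_def by blast
  then show ?thesis
    unfolding linked_def by (intro bexI[of _ "\<lambda>F. v F + w F"]) (auto simp: bdry_add chains_le_add)
qed

lemma linked_sym:
  assumes "linked TYPE('k::comm_ring_1) b a a'" shows "linked TYPE('k) b a' a"
proof -
  from assms obtain v :: "xyz multiset set \<Rightarrow> 'k" where
    v: "v \<in> chains_le X id b 2" "bdry X \<epsilon> v = (\<lambda>G. (if G = {a'} then 1 else 0) - (if G = {a} then 1 else 0))"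
    unfolding linked_def by blast
  have "bdry X \<epsilon> (\<lambda>F. - 1 * v F) = (\<lambda>G. (if G = {a} then 1 else 0) - (if G = {a'} then 1 else 0))"
    unfolding bdry_scale v(2) by auto
  then show ?thesis
    unfolding linked_def by (intro bexI[OF _ chains_le_scale[OF v(1), of "- 1"]])
qed

lemma linked_edge:
  assumes ut: "size u + 1 = d" "\<not> owns rm u t" and b: "edge_label u t \<subseteq># b"
  shows "linked TYPE('k::comm_ring_1) b (add_mset (nx t) u) (add_mset (pv t) u)"
proof -
  let ?k = "of_int (orient u t) :: 'k"
  note e = edge_cell[OF ut]
  have "(\<lambda>G. if G = edge u t then ?k else 0) \<in> chains_le X id b 2"
    using e b by (intro chains_le_single) (auto simp: face_label_id_edge)
  moreover have "bdry X \<epsilon> (\<lambda>G. if G = edge u t then ?k else 0)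
      = (\<lambda>G. (if G = {add_mset (pv t) u} then 1 else 0) - (if G = {add_mset (nx t) u} then 1 else 0))"
    unfolding bdry_single[OF finX conjunct1[OF e]] facet_edge_iff[OF ut]
    using orient_squared[OF ut, where 'k='k] orient_values(2)[OF ut]
    by (auto simp: orient_def add_mset_left_eq_iff)
  ultimately show ?thesis unfolding linked_def by blast
qed

lemma linked_edge':
  assumes "size u + 1 = d" "\<not> owns rm u t" "edge_label u t \<subseteq># b" "p \<noteq> t" "q \<noteq> t"
  shows "linked TYPE('k::comm_ring_1) b (add_mset p u) (add_mset q u)"
proof -
  have "p = nx t \<or> p = pv t" "q = nx t \<or> q = pv t"
    using xyz_cases[of p t] xyz_cases[of q t] assms(4,5) by auto
  then show ?thesis
    using linked_edge[OF assms(1-3), where 'k = 'k] linked_sym[OF linked_edge[OF assms(1-3)], where 'k = 'k]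
    by (elim disjE) (simp_all add: linked_refl)
qed

text \<open>Neighbours in the full grid are joined by their edge or, if it is removed, by the other
  two sides of its down triangle w. All three sides have the label w * xyz, so the detour stays
  below b.\<close>

lemma linked_vertices:
  assumes "size a = d" "size a' = d" "a \<subseteq># b" "a' \<subseteq># b"
  shows "linked TYPE('k::comm_ring_1) b a a'"
proof (rule grid_connected[where P = "linked TYPE('k) b" and d = d and m = b])
  show "linked TYPE('k) b x x" for x by (rule linked_refl)
  show "linked TYPE('k) b x z" if "linked TYPE('k) b x y" "linked TYPE('k) b y z" for x y z
    using that by (rule linked_trans)
  fix u s r assume sr: "s \<noteq> r" "add_mset s u \<subseteq># b" "add_mset r u \<subseteq># b" and u: "size u + 1 = d"
  obtain t where t: "{add_mset s u, add_mset r u} = edge u t" using edge_of_pair[OF sr(1)] by blast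
  have mem: "add_mset s u \<in> edge u t" "add_mset r u \<in> edge u t" unfolding t[symmetric] by auto
  have st: "s \<noteq> t" "r \<noteq> t"
    using mem unfolding mem_edge_iff add_mset_left_eq_iff by auto
  have cnt: "count (edge_label u t) v \<le> count b v" for v
  proof (cases "v = t")
    case True
    then show ?thesis
      using mset_subset_eq_count[OF sr(2), of v] st by (simp add: count_edge_label split: if_splits)
  next
    case False
    then have "v = s \<or> v = r" using st sr(1) xyz_cases[of v t] xyz_cases[of s t] xyz_cases[of r t] by auto
    then show ?thesis
      using mset_subset_eq_count[OF sr(2), of v] mset_subset_eq_count[OF sr(3), of v] False by (auto simp: count_edge_label)
  qed
  then have lab: "edge_label u t \<subseteq># b" by (simp add: subseteq_mset_def)
  show "linked TYPE('k) b (add_mset s u) (add_mset r u)"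
  proof (cases "owns rm u t")
    case False
    then show ?thesis using linked_edge'[OF u False lab] st by blast
  next
    case True
    define w where "w = u - {#t#}"
    have w: "u = add_mset t w" "rm w = t" using True by (auto simp: owns_def w_def)
    have step: "linked TYPE('k) b (add_mset t (add_mset p w)) (add_mset q (add_mset p w))"
      if "p \<noteq> t" "q \<noteq> p" for p q
    proof (rule linked_edge'[where t = p])
      show "\<not> owns rm (add_mset p w) p" using that w by (simp add: owns_def)
      show "size (add_mset p w) + 1 = d" using u w by simp
      have "edge_label (add_mset p w) p = edge_label u t"
        by (intro multiset_eqI) (simp add: count_edge_label w(1))
      then show "edge_label (add_mset p w) p \<subseteq># b" using lab by simp
    qed (use that in auto)
    have "linked TYPE('k) b (add_mset s (add_mset t w)) (add_mset r (add_mset s w))"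
      unfolding add_mset_commute[of s t] by (rule step) (use st sr(1) in auto)
    moreover have "linked TYPE('k) b (add_mset r (add_mset t w)) (add_mset r (add_mset s w))"
      unfolding add_mset_commute[of r t] add_mset_commute[of r s] by (rule step) (use st sr(1) in auto)
    ultimately show ?thesis
      unfolding w(1) by (rule linked_trans[OF _ linked_sym])
  qed
qed (use assms in auto)

text \<open>All vertices have sign 1 over the empty face, so the coefficients of a cycle add up to
  0. The cycle is then a combination of differences to a fixed vertex \<open>a0\<close> below b, and
  each difference is the boundary of a path.\<close>

lemma vertex_cycle_boundary:
  fixes z :: "xyz multiset set \<Rightarrow> 'k::comm_ring_1"
  assumes z: "z \<in> chains_le X id b 1" and cyc: "bdry X \<epsilon> z = (\<lambda>_. 0)"
  shows "\<exists>w\<in>chains_le X id b 2. bdry X \<epsilon> w = z"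
proof -
  let ?V = "{a :: xyz multiset. size a = d \<and> a \<subseteq># b}"
  have finV: "finite ?V" by (rule finite_subset[OF _ finite_multisets_size[of d]]) auto
  have supp: "\<exists>a\<in>?V. F = {a}" if "z F \<noteq> 0" for F
    using z that hdeg1_cases[of F] by (auto simp: chains_le_def)
  have facet0: "facet X {a} {}" if "size a = d" for a
    using vertex_cell[OF that] facet_iff_hdeg[OF poly] hdeg_empty[OF poly] polyhedral_finite(3)[OF poly] by auto
  have eps0: "\<epsilon> {a} {} = 1" if "size a = d" for a
    using inc vertex_cell[OF that] unfolding incidence_function_def by blast
  have inj: "inj_on (\<lambda>a. {a}) ?V" by (simp add: inj_on_def)
  have "(\<Sum>a\<in>?V. z {a}) = bdry X \<epsilon> z {}"
  proof -
    have "bdry X \<epsilon> z {} = (\<Sum>F\<in>(\<lambda>a. {a}) ` ?V. z F * (if facet X F {} then of_int (\<epsilon> F {}) else 0))"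
      unfolding bdry_def
    proof (rule sum.mono_neutral_right[OF finX])
      show "(\<lambda>a. {a}) ` ?V \<subseteq> X" using vertex_cell by auto
      show "\<forall>F\<in>X - (\<lambda>a. {a}) ` ?V. z F * (if facet X F {} then of_int (\<epsilon> F {}) else 0) = 0"
      proof
        fix F assume "F \<in> X - (\<lambda>a. {a}) ` ?V"
        then have "z F = 0" using supp[of F] by blast
        then show "z F * (if facet X F {} then of_int (\<epsilon> F {}) else 0) = 0" by simp
      qed
    qed
    also have "\<dots> = (\<Sum>a\<in>?V. z {a})"
      unfolding sum.reindex[OF inj] o_def by (intro sum.cong refl) (auto simp: facet0 eps0)
    finally show ?thesis by simp
  qed
  then have total: "(\<Sum>a\<in>?V. z {a}) = 0" using cyc by simp
  show ?thesis
  proof (cases "?V = {}")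
    case True
    then have "z F = 0" for F using supp[of F] by blast
    then have "z = (\<lambda>_. 0)" by (rule ext)
    then show ?thesis by (intro bexI[OF _ chains_le_zero]) (simp add: bdry_def)
  next
    case False
    then obtain a0 where a0: "size a0 = d" "a0 \<subseteq># b" by blast
    have "\<forall>a\<in>?V. \<exists>w. w \<in> chains_le X id b 2 \<and> bdry X \<epsilon> w = (\<lambda>G. (if G = {a} then 1 else 0) - (if G = {a0} then 1 else 0 :: 'k))"
    proof
      fix a assume "a \<in> ?V"
      then have "linked TYPE('k) b a0 a" using a0 by (intro linked_vertices) simp_all
      then show "\<exists>w. w \<in> chains_le X id b 2 \<and> bdry X \<epsilon> w = (\<lambda>G. (if G = {a} then 1 else 0) - (if G = {a0} then 1 else 0 :: 'k))"
        unfolding linked_def Bex_def .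
    qed
    from bchoice[OF this] obtain w :: "xyz multiset \<Rightarrow> xyz multiset set \<Rightarrow> 'k" where
      w0: "\<forall>a\<in>?V. w a \<in> chains_le X id b 2 \<and> bdry X \<epsilon> (w a) = (\<lambda>G. (if G = {a} then 1 else 0) - (if G = {a0} then 1 else 0))" ..
    have w: "w a \<in> chains_le X id b 2"
        "bdry X \<epsilon> (w a) = (\<lambda>G. (if G = {a} then 1 else 0) - (if G = {a0} then 1 else 0))" if "a \<in> ?V" for a
      using w0[rule_format, OF that] by simp_all
    have "bdry X \<epsilon> (\<lambda>F. \<Sum>a\<in>?V. z {a} * w a F) = z"
    proof
      fix G
      have "bdry X \<epsilon> (\<lambda>F. \<Sum>a\<in>?V. z {a} * w a F) G = (\<Sum>a\<in>?V. z {a} * ((if G = {a} then 1 else 0) - (if G = {a0} then 1 else 0)))"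
        unfolding bdry_sum bdry_scale by (intro sum.cong refl) (simp only: w(2))
      also have "\<dots> = (\<Sum>a\<in>?V. if G = {a} then z {a} else 0) - (\<Sum>a\<in>?V. z {a}) * (if G = {a0} then 1 else 0)"
        unfolding sum_distrib_right sum_subtractf[symmetric] by (intro sum.cong refl) auto
      also have "\<dots> = (\<Sum>a\<in>?V. if G = {a} then z {a} else 0)" using total by simp
      also have "\<dots> = z G"
      proof (cases "z G = 0")
        case True
        then show ?thesis by (intro trans[OF sum.neutral]) auto
      next
        case False
        then obtain a where "a \<in> ?V" "G = {a}" using supp by blast
        then show ?thesis using finV by (simp add: sum.delta)
      qed
      finally show "bdry X \<epsilon> (\<lambda>F. \<Sum>a\<in>?V. z {a} * w a F) G = z G" .
    qed
    moreover have "(\<lambda>F. \<Sum>a\<in>?V. z {a} * w a F) \<in> chains_le X id b 2"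
      by (intro chains_le_sum chains_le_scale w(1))
    ultimately show ?thesis by blast
  qed
qed

end

section \<open>Boundaries of regions as flows\<close>

lemma region_coeff_values: "region_coeff rm v u t \<in> {- 1, 0, 1}"
  by (simp add: region_coeff_def)

lemma region_coeff_size: "region_coeff rm v u t \<noteq> 0 \<Longrightarrow> size u = size v"
  by (auto simp: region_coeff_nonzero_iff owns_def size_Suc_Diff1)

lemma region_coeff_owns: "owns rm u t \<Longrightarrow> region_coeff rm v u t = 0"
  by (auto simp: region_coeff_def owns_def owner_def)

text \<open>Any weights of up and down triangles give a conserved flow, since the small triangles
  are directed cycles.\<close>

lemma conserved_region_coeff: "conserved (\<lambda>u t. of_int (region_coeff rm v u t) :: 'k::comm_ring_1)"
proof -
  have "conserved (\<lambda>u t. f u + (if t \<in># u then g (u - {#t#}) else 0))" for f g :: "xyz multiset \<Rightarrow> 'k"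
    unfolding conserved_def UNIV_xyz[of Vx]
    by (auto simp: add_mset_commute algebra_simps in_diff_count split: if_splits)
  moreover have "(\<lambda>u t. of_int (region_coeff rm v u t) :: 'k)
    = (\<lambda>u t. of_bool (v = u) + (if t \<in># u then - of_bool (v = owner rm (u - {#t#})) else 0))"
    by (intro ext) (simp add: region_coeff_def)
  ultimately show ?thesis by (simp only:)
qed

lemma region_coeff_exists: "\<exists>u' t'. region_coeff rm u u' t' \<noteq> 0"
proof (cases "owns rm u Vx")
  case True
  then have "region_coeff rm u (add_mset Vy (u - {#Vx#})) Vy \<noteq> 0"
    unfolding region_coeff_nonzero_iff by (intro disjI2 exI[of _ Vx]) simp
  then show ?thesis by blast
next
  case False
  then have "region_coeff rm u u Vx \<noteq> 0" unfolding region_coeff_nonzero_iff by blast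
  then show ?thesis by blast
qed

lemma sum_region_coeff:
  fixes f :: "xyz multiset \<Rightarrow> 'k::comm_ring_1"
  assumes "size u + 1 = d"
  shows "(\<Sum>v\<in>{v. size v + 1 = d}. f v * of_int (region_coeff rm v u t))
    = f u - (if t \<in># u then f (owner rm (u - {#t#})) else 0)"
proof -
  let ?U = "{v :: xyz multiset. size v + 1 = d}"
  have fin: "finite ?U" by (rule finite_subset[OF _ finite_multisets_size[of "d - 1"]]) auto
  have own: "t \<in># u \<Longrightarrow> owner rm (u - {#t#}) \<in> ?U"
    using assms by (simp add: owner_def size_Suc_Diff1)
  have "(\<Sum>v\<in>?U. f v * of_int (region_coeff rm v u t))
    = (\<Sum>v\<in>?U. (if v = u then f v else 0) - (if v = owner rm (u - {#t#}) then (if t \<in># u then f v else 0) else 0))"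
    by (intro sum.cong refl) (auto simp: region_coeff_def)
  also have "\<dots> = f u - (if t \<in># u then f (owner rm (u - {#t#})) else 0)"
    unfolding sum_subtractf using assms fin own by (auto simp: sum.delta)
  finally show ?thesis .
qed

context grid_skeleton
begin

text \<open>The assumption \<open>sign\<close> says that the boundary of the region v is \<kappa> v
  times its standard boundary. In the explicit complex \<kappa> is 1; in a given resolution it is
  some nonzero scalar.\<close>

lemma bdry_region_chain:
  fixes z :: "xyz multiset set \<Rightarrow> 'k::comm_ring_1" and \<kappa> :: "xyz multiset \<Rightarrow> 'k"
  assumes regions: "{F \<in> X. hdeg X F = 3} = region rm ` {u. size u + 1 = d}"
    and sign: "\<And>v u t. size v + 1 = d \<Longrightarrow> size u + 1 = d \<Longrightarrow> \<not> owns rm u t \<Longrightarrow>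
      of_int (\<epsilon> (region rm v) (edge u t)) * of_int (orient u t) = \<kappa> v * of_int (region_coeff rm v u t)"
    and z: "\<And>F. z F \<noteq> 0 \<Longrightarrow> F \<in> X \<and> hdeg X F = 3"
    and ut: "size u + 1 = d" "\<not> owns rm u t"
  shows "bdry X \<epsilon> z (edge u t) * of_int (orient u t)
    = \<kappa> u * z (region rm u) - (if t \<in># u then \<kappa> (owner rm (u - {#t#})) * z (region rm (owner rm (u - {#t#}))) else 0)"
proof -
  let ?U = "{v :: xyz multiset. size v + 1 = d}"
  have inj: "inj_on (region rm) ?U" by (rule inj_onI, rule region_eq_iff[of rm]) auto
  have mem: "region rm v \<in> X \<and> hdeg X (region rm v) = 3" if "v \<in> ?U" for v
    using regions that by blast
  have "bdry X \<epsilon> z (edge u t) = (\<Sum>F\<in>region rm ` ?U. z F * (if facet X F (edge u t) then of_int (\<epsilon> F (edge u t)) else 0))"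
    unfolding bdry_def
  proof (rule sum.mono_neutral_right[OF finX])
    show "region rm ` ?U \<subseteq> X" using mem by blast
    show "\<forall>F\<in>X - region rm ` ?U. z F * (if facet X F (edge u t) then of_int (\<epsilon> F (edge u t)) else 0) = 0"
    proof
      fix F assume "F \<in> X - region rm ` ?U"
      then have "z F = 0" using z[of F] regions by blast
      then show "z F * (if facet X F (edge u t) then of_int (\<epsilon> F (edge u t)) else 0) = 0" by simp
    qed
  qed
  also have "\<dots> = (\<Sum>v\<in>?U. z (region rm v) * of_int (\<epsilon> (region rm v) (edge u t)))"
    unfolding sum.reindex[OF inj] o_def
  proof (rule sum.cong[OF refl])
    fix v assume "v \<in> ?U"
    then show "z (region rm v) * (if facet X (region rm v) (edge u t) then of_int (\<epsilon> (region rm v) (edge u t)) else 0)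
      = z (region rm v) * of_int (\<epsilon> (region rm v) (edge u t))"
      using incidence_nonfacet[OF inc, of "region rm v" "edge u t"] mem edge_cell[OF ut] by auto
  qed
  finally have "bdry X \<epsilon> z (edge u t) * of_int (orient u t)
      = (\<Sum>v\<in>?U. (\<kappa> v * z (region rm v)) * of_int (region_coeff rm v u t))"
    using sign ut by (simp add: sum_distrib_right mult.assoc mult.left_commute)
  then show ?thesis unfolding sum_region_coeff[OF ut(1)] .
qed

text \<open>The weights f define a flow that vanishes on kept edges because z is a cycle and on
  removed edges because both adjacent triangles belong to the same region. By
  \<open>region_flow_unique\<close> the weights are 0.\<close>

lemma region_cycle_zero:
  fixes z :: "xyz multiset set \<Rightarrow> 'k::field" and \<kappa> :: "xyz multiset \<Rightarrow> 'k"
  assumes regions: "{F \<in> X. hdeg X F = 3} = region rm ` {u. size u + 1 = d}"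
    and sign: "\<And>v u t. size v + 1 = d \<Longrightarrow> size u + 1 = d \<Longrightarrow> \<not> owns rm u t \<Longrightarrow>
      of_int (\<epsilon> (region rm v) (edge u t)) * of_int (orient u t) = \<kappa> v * of_int (region_coeff rm v u t)"
    and \<kappa>: "\<And>v. size v + 1 = d \<Longrightarrow> \<kappa> v \<noteq> 0"
    and z: "\<And>F. z F \<noteq> 0 \<Longrightarrow> F \<in> X \<and> hdeg X F = 3" and cyc: "bdry X \<epsilon> z = (\<lambda>_. 0)"
  shows "z = (\<lambda>_. 0)"
proof -
  define f where "f u = (if size u + 1 = d then \<kappa> u * z (region rm u) else 0)" for u
  have "f u - (if t \<in># u then f (owner rm (u - {#t#})) else 0) = 0" for u t
  proof (cases "size u + 1 = d")
    case True
    have own: "f (owner rm (u - {#t#})) = \<kappa> (owner rm (u - {#t#})) * z (region rm (owner rm (u - {#t#})))" if "t \<in># u"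
      using that True by (simp add: f_def owner_def size_Suc_Diff1)
    show ?thesis
    proof (cases "owns rm u t")
      case o: True
      then have "owner rm (u - {#t#}) = u" "t \<in># u" by (auto simp: owns_def owner_def)
      then show ?thesis by simp
    next
      case False
      have "f u - (if t \<in># u then f (owner rm (u - {#t#})) else 0) = bdry X \<epsilon> z (edge u t) * of_int (orient u t)"
      proof -
        have "bdry X \<epsilon> z (edge u t) * of_int (orient u t)
          = \<kappa> u * z (region rm u) - (if t \<in># u then \<kappa> (owner rm (u - {#t#})) * z (region rm (owner rm (u - {#t#}))) else 0)"
          using regions sign z True False by (rule bdry_region_chain)
        moreover have "f u = \<kappa> u * z (region rm u)" using True by (simp add: f_def)
        ultimately show ?thesis using own by simp
      qed
      then show ?thesis using cyc by simp
    qed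
  next
    case False
    then show ?thesis by (auto simp: f_def owner_def size_Suc_Diff1)
  qed
  then have f0: "f u = 0" for u by (rule region_flow_unique)
  show ?thesis
  proof
    fix F show "z F = 0"
    proof (rule ccontr)
      assume nz: "z F \<noteq> 0"
      then obtain u where u: "size u + 1 = d" "F = region rm u" using z regions by blast
      then show False using f0[of u] \<kappa>[OF u(1)] nz by (simp add: f_def)
    qed
  qed
qed

end

section \<open>An explicit incidence function and exactness of the complex\<close>

text \<open>The signs of the standard directions. The \<open>THE\<close> is justified because among
  monomials of equal degree a region and an edge determine their parameters.\<close>

definition cell_incidence :: "(xyz multiset \<Rightarrow> xyz) \<Rightarrow> xyz multiset set \<Rightarrow> xyz multiset set \<Rightarrow> int" where
  "cell_incidence rm F G =
    (if (\<exists>a. F = {a}) \<and> G = {} then 1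
     else if \<exists>u t. F = edge u t \<and> G = {add_mset (pv t) u} then 1
     else if \<exists>u t. F = edge u t \<and> G = {add_mset (nx t) u} then - 1
     else if \<exists>v u t. F = region rm v \<and> G = edge u t \<and> size u = size v
       then THE k. \<exists>v u t. F = region rm v \<and> G = edge u t \<and> size u = size v \<and> k = region_coeff rm v u t
     else 0)"

lemma cell_shapes_neq:
  "edge u t \<noteq> {}" "edge u t \<noteq> {a}" "region rm v \<noteq> {}" "region rm v \<noteq> {a}" "region rm v \<noteq> edge u t"
  using card_edge[of u t] card_region[of rm v] by (auto simp del: card_eq_0_iff)

lemmas cell_shapes_distinct = cell_shapes_neq cell_shapes_neq[THEN not_sym]

lemma cell_incidence_simps:
  "cell_incidence rm {} G = 0"
  "cell_incidence rm {a} G = (if G = {} then 1 else 0)"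
  "cell_incidence rm (edge u t) G = (if G = {add_mset (pv t) u} then 1 else if G = {add_mset (nx t) u} then - 1 else 0)"
  "cell_incidence rm (region rm v) {} = 0" "cell_incidence rm (region rm v) {a} = 0"
  "cell_incidence rm (region rm v) (region rm v') = 0"
  by (auto simp: cell_incidence_def cell_shapes_distinct edge_eq_iff add_mset_left_eq_iff)

lemma cell_incidence_region:
  assumes "size u = size v"
  shows "cell_incidence rm (region rm v) (edge u t) = region_coeff rm v u t"
proof -
  let ?P = "\<lambda>k. \<exists>v' u' t'. region rm v = region rm v' \<and> edge u t = edge u' t' \<and> size u' = size v' \<and> k = region_coeff rm v' u' t'"
  have "(THE k. ?P k) = region_coeff rm v u t"
  proof (rule the_equality)
    show "?P (region_coeff rm v u t)" using assms by blast
    fix k assume "?P k"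
    then obtain v' where "region rm v = region rm v'" "size u = size v'" "k = region_coeff rm v' u t"
      by (auto simp: edge_eq_iff)
    then show "k = region_coeff rm v u t"
      using region_eq_iff[of rm v v'] assms by simp
  qed
  moreover have "\<exists>v' u' t'. region rm v = region rm v' \<and> edge u t = edge u' t' \<and> size u' = size v'"
    using assms by blast
  ultimately show ?thesis
    unfolding cell_incidence_def by (simp add: cell_shapes_distinct)
qed

lemma cells_hdeg_edge:
  assumes "size u + 1 = d" "\<not> owns rm u t"
  shows "hdeg (cells d rm) (edge u t) = 2"
proof -
  let ?a = "add_mset (nx t) u"
  have "facet (cells d rm) (edge u t) {?a}"
    unfolding facet_def
  proof (intro conjI)
    show "edge u t \<in> cells d rm" "{?a} \<in> cells d rm" using assms by (auto intro: cells_intros)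
    show "{?a} \<subset> edge u t" by (auto simp: edge_def add_mset_left_eq_iff)
    show "\<not> (\<exists>H\<in>cells d rm. {?a} \<subset> H \<and> H \<subset> edge u t)"
    proof
      assume "\<exists>H\<in>cells d rm. {?a} \<subset> H \<and> H \<subset> edge u t"
      then obtain H where "{?a} \<subset> H" "H \<subset> edge u t" by blast
      then have "card {?a} < card H" "card H < card (edge u t)"
        by (auto intro!: psubset_card_mono finite_subset[of H "edge u t"] simp: edge_def)
      then show False by (simp add: card_edge)
    qed
  qed
  from facet_hdeg[OF polyhedral_cells this] show ?thesis
    using hdeg_singleton[OF polyhedral_cells, of ?a d rm] assms by (simp add: cells_intros)
qed

text \<open>Every region has a boundary edge, and no cell lies between them: a cell with more than
  two vertices is a region, and regions of the complex do not contain each other.\<close>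

lemma cells_hdeg_region:
  assumes "size v + 1 = d"
  shows "hdeg (cells d rm) (region rm v) = 3"
proof -
  obtain u t where c: "region_coeff rm v u t \<noteq> 0" using region_coeff_exists by blast
  have sz: "size u = size v" by (rule region_coeff_size[OF c])
  then have e: "edge u t \<subseteq> region rm v" "\<not> owns rm u t" using c edge_subset_region_iff by blast+
  have "facet (cells d rm) (region rm v) (edge u t)"
    unfolding facet_def
  proof (intro conjI)
    show "region rm v \<in> cells d rm" "edge u t \<in> cells d rm" using assms sz e by (auto intro: cells_intros)
    show "edge u t \<subset> region rm v" using e(1) cell_shapes_neq(5)[of rm v u t] by blast
    show "\<not> (\<exists>H\<in>cells d rm. edge u t \<subset> H \<and> H \<subset> region rm v)"
    proof
      assume "\<exists>H\<in>cells d rm. edge u t \<subset> H \<and> H \<subset> region rm v"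
      then obtain H where H: "H \<in> cells d rm" "edge u t \<subset> H" "H \<subset> region rm v" by blast
      have "finite H" using H(3) finite_region[of rm v] finite_subset by blast
      then have card: "2 < card H" using psubset_card_mono[of H "edge u t"] H(2) by (simp add: card_edge)
      from H(1) show False
      proof (cases rule: cells_cases)
        case (region v')
        then show False using region_eq_iff[of rm v' v] H(3) assms by auto
      qed (use card card_edge in auto)
    qed
  qed
  from facet_hdeg[OF polyhedral_cells this] show ?thesis
    using cells_hdeg_edge[of u d rm t] sz assms e(2) by simp
qed

lemma cells_facet_cases:
  assumes "facet (cells d rm) F G"
  obtains (vertex) a where "size a = d" "F = {a}" "G = {}"
    | (edge) u t s where "size u + 1 = d" "\<not> owns rm u t" "s \<noteq> t" "F = edge u t" "G = {add_mset s u}"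
    | (region) v u t where "size v + 1 = d" "size u = size v" "region_coeff rm v u t \<noteq> 0" "F = region rm v" "G = edge u t"
proof -
  note FG = facetD[OF assms] and h = facet_hdeg[OF polyhedral_cells assms]
  note hd = hdeg_empty[OF polyhedral_cells] hdeg_singleton[OF polyhedral_cells] cells_hdeg_edge cells_hdeg_region
  from FG(1) show ?thesis
  proof (cases rule: cells_cases)
    case empty
    then show ?thesis using FG(3) by blast
  next
    case (vertex a)
    then have "G = {}" using FG(3) by auto
    with vertex that(1) show ?thesis by blast
  next
    case (edge u t)
    from FG(2) show ?thesis
    proof (cases rule: cells_cases)
      case (vertex a)
      then have "a \<in> edge u t" using FG(3) edge(3) by blast
      then obtain s where "s \<noteq> t" "a = add_mset s u" unfolding mem_edge_iff by blast
      with edge vertex that(2) show ?thesis by blast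
    qed (use h edge hd FG in auto)
  next
    case (region v)
    from FG(2) show ?thesis
    proof (cases rule: cells_cases)
      case (vertex a)
      then have False using h region hd FG(2) by simp
      then show ?thesis ..
    next
      case (edge u t)
      have "size u = size v" using edge region by simp
      moreover have "region_coeff rm v u t \<noteq> 0"
        using edge_subset_region_iff[OF \<open>size u = size v\<close>, of t rm] edge region FG(3) by blast
      ultimately show ?thesis using edge region that(3) by blast
    qed (use h region hd FG in auto)
  qed
qed

lemma cells_facet_region:
  assumes "size v + 1 = d" "size u = size v" "region_coeff rm v u t \<noteq> 0"
  shows "facet (cells d rm) (region rm v) (edge u t)"
proof -
  have e: "edge u t \<subseteq> region rm v" "\<not> owns rm u t" using edge_subset_region_iff assms by blast+
  then have "edge u t \<subset> region rm v" using cell_shapes_neq(5)[of rm v u t] by blast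
  then show ?thesis
    unfolding facet_iff_hdeg[OF polyhedral_cells]
    using assms e cells_hdeg_edge[of u d rm t] cells_hdeg_region[of v d rm] by (auto intro: cells_intros)
qed

lemma cells_incidence: "incidence_function (cells d rm) (cell_incidence rm)"
  unfolding incidence_function_def
proof (intro conjI ballI allI impI)
  fix a assume "{a} \<in> cells d rm"
  then show "cell_incidence rm {a} {} = 1" by (simp add: cell_incidence_simps)
next
  fix F G assume F: "F \<in> cells d rm" and G: "G \<in> cells d rm"
  show "if facet (cells d rm) F G then cell_incidence rm F G \<in> {1, - 1} else cell_incidence rm F G = 0"
  proof (cases "facet (cells d rm) F G")
    case True
    then have "cell_incidence rm F G \<in> {1, - 1}"
    proof (cases rule: cells_facet_cases)
      case (vertex a)
      then show ?thesis by (simp add: cell_incidence_simps)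
    next
      case (edge u t s)
      then show ?thesis using xyz_cases[of s t] by (auto simp: cell_incidence_simps)
    next
      case (region v u t)
      then show ?thesis using region_coeff_values[of rm v u t] by (auto simp: cell_incidence_region)
    qed
    with True show ?thesis by simp
  next
    case False
    have "cell_incidence rm F G = 0"
    proof (rule ccontr)
      assume nz: "cell_incidence rm F G \<noteq> 0"
      from F show False
      proof (cases rule: cells_cases)
        case empty
        then show False using nz by (simp add: cell_incidence_simps)
      next
        case (vertex a)
        then have "G = {}" using nz by (simp add: cell_incidence_simps split: if_splits)
        then show False using False F G vertex hdeg_empty[OF polyhedral_cells] hdeg_singleton[OF polyhedral_cells]
          by (auto simp: facet_iff_hdeg[OF polyhedral_cells])
      next
        case (edge u t)
        then have "G = {add_mset (pv t) u} \<or> G = {add_mset (nx t) u}"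
          using nz by (simp add: cell_incidence_simps split: if_splits)
        then have "G \<subset> F" "hdeg (cells d rm) G = 1"
          using edge G hdeg_singleton[OF polyhedral_cells] by (auto simp: edge_def add_mset_left_eq_iff)
        then show False using False F G edge cells_hdeg_edge by (auto simp: facet_iff_hdeg[OF polyhedral_cells])
      next
        case (region v)
        from G show False
        proof (cases rule: cells_cases)
          case (edge u t)
          have sz: "size u = size v" using edge region by simp
          have "region_coeff rm v u t \<noteq> 0" using nz edge region cell_incidence_region[OF sz] by simp
          then show False using False cells_facet_region[OF region(1) sz] edge region by blast
        qed (use nz region in \<open>auto simp: cell_incidence_simps\<close>)
      qed
    qed
    with False show ?thesis by simp
  qed
next
  fix F G assume F: "F \<in> cells d rm" and G: "G \<in> cells d rm"
  let ?\<epsilon> = "cell_incidence rm"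
  show "(\<Sum>H\<in>cells d rm. ?\<epsilon> F H * ?\<epsilon> H G) = 0"
    using F
  proof (cases rule: cells_cases)
    case empty
    then show ?thesis by (simp add: cell_incidence_simps)
  next
    case (vertex a)
    then have "?\<epsilon> F H * ?\<epsilon> H G = 0" for H by (simp add: cell_incidence_simps)
    then show ?thesis by (intro sum.neutral ballI)
  next
    case (edge u t)
    let ?A = "{add_mset (nx t) u}" and ?B = "{add_mset (pv t) u}"
    have "(\<Sum>H\<in>cells d rm. ?\<epsilon> F H * ?\<epsilon> H G) = (\<Sum>H\<in>{?A, ?B}. ?\<epsilon> F H * ?\<epsilon> H G)"
      by (rule sum.mono_neutral_right[OF finite_cells]) (use edge in \<open>auto simp: cell_incidence_simps intro: cells_intros\<close>)
    also have "\<dots> = 0"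
      using edge by (simp add: cell_incidence_simps add_mset_left_eq_iff)
    finally show ?thesis .
  next
    case (region v)
    let ?U = "{u :: xyz multiset. size u + 1 = d}"
    let ?P = "{(u, t). size u + 1 = d \<and> \<not> owns rm u t}"
    have finU: "finite ?U" by (rule finite_subset[OF _ finite_multisets_size[of "d - 1"]]) auto
    have inj: "inj_on (\<lambda>(u, t). edge u t) ?P" by (auto simp: inj_on_def edge_eq_iff)
    have "(\<Sum>H\<in>cells d rm. ?\<epsilon> F H * ?\<epsilon> H G) = (\<Sum>H\<in>(\<lambda>(u, t). edge u t) ` ?P. ?\<epsilon> F H * ?\<epsilon> H G)"
    proof (rule sum.mono_neutral_right[OF finite_cells])
      show "(\<lambda>(u, t). edge u t) ` ?P \<subseteq> cells d rm" by (auto intro: cells_intros)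
      show "\<forall>H\<in>cells d rm - (\<lambda>(u, t). edge u t) ` ?P. ?\<epsilon> F H * ?\<epsilon> H G = 0"
      proof
        fix H assume H: "H \<in> cells d rm - (\<lambda>(u, t). edge u t) ` ?P"
        then have "H \<in> cells d rm" by blast
        then show "?\<epsilon> F H * ?\<epsilon> H G = 0"
          by (cases rule: cells_cases) (use H region in \<open>auto simp: cell_incidence_simps\<close>)
      qed
    qed
    also have "\<dots> = (\<Sum>(u, t)\<in>?P. region_coeff rm v u t * ?\<epsilon> (edge u t) G)"
      unfolding sum.reindex[OF inj] o_def using region by (intro sum.cong refl) (auto simp: cell_incidence_region)
    also have "\<dots> = 0"
    proof (cases "\<exists>a. G = {a}")
      case True
      then obtain a where a: "G = {a}" "size a = d" using cells_size[OF G] by blast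
      \<comment> \<open>At a vertex G the sum is the conservation law for the boundary of the
        region. Removed edges may be added since their coefficient is 0.\<close>
      have "(\<Sum>(u, t)\<in>?P. region_coeff rm v u t * ?\<epsilon> (edge u t) G)
        = (\<Sum>(u, t)\<in>?U \<times> UNIV. (if a = add_mset (pv t) u then region_coeff rm v u t else 0) - (if a = add_mset (nx t) u then region_coeff rm v u t else 0))"
      proof (rule sum.mono_neutral_cong_left)
        show "finite (?U \<times> (UNIV :: xyz set))" using finU finite_xyz_set by (rule finite_cartesian_product)
        show "?P \<subseteq> ?U \<times> UNIV" by blast
        show "\<forall>x\<in>?U \<times> UNIV - ?P. (case x of (u, t) \<Rightarrow> (if a = add_mset (pv t) u then region_coeff rm v u t else 0) - (if a = add_mset (nx t) u then region_coeff rm v u t else 0)) = 0"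
        proof
          fix x assume "x \<in> ?U \<times> UNIV - ?P"
          then obtain u t where x: "x = (u, t)" "owns rm u t" by blast
          show "(case x of (u, t) \<Rightarrow> (if a = add_mset (pv t) u then region_coeff rm v u t else 0) - (if a = add_mset (nx t) u then region_coeff rm v u t else 0)) = 0"
            unfolding x(1) by (simp add: region_coeff_owns[OF x(2)])
        qed
        show "(case x of (u, t) \<Rightarrow> region_coeff rm v u t * ?\<epsilon> (edge u t) G)
          = (case x of (u, t) \<Rightarrow> (if a = add_mset (pv t) u then region_coeff rm v u t else 0) - (if a = add_mset (nx t) u then region_coeff rm v u t else 0))" for x
          by (cases x) (auto simp: a(1) cell_incidence_simps add_mset_left_eq_iff)
      qed
      also have "\<dots> = 0"
        unfolding sum_edges_at_vertex[OF a(2)]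
        by (rule conserved_region_coeff[where 'k = int, of rm v, unfolded of_int_eq_id id_apply conserved_def, rule_format])
      finally show ?thesis .
    next
      case False
      then have "?\<epsilon> (edge u t) G = 0" for u t by (auto simp: cell_incidence_simps)
      then show ?thesis by simp
    qed
    finally show ?thesis .
  qed
qed

lemma cells_hdeg_cases:
  assumes F: "F \<in> cells d rm"
  shows "hdeg (cells d rm) F = 1 \<longleftrightarrow> (\<exists>a. size a = d \<and> F = {a})" (is ?A)
    "hdeg (cells d rm) F = 2 \<longleftrightarrow> (\<exists>u t. size u + 1 = d \<and> \<not> owns rm u t \<and> F = edge u t)" (is ?B)
    "hdeg (cells d rm) F = 3 \<longleftrightarrow> (\<exists>u. size u + 1 = d \<and> F = region rm u)" (is ?C)
    "hdeg (cells d rm) F \<le> 3" (is ?D)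
proof -
  have "?A \<and> ?B \<and> ?C \<and> ?D"
    using F
  proof (cases rule: cells_cases)
    case empty
    then have h: "hdeg (cells d rm) F = 0" by (simp add: hdeg_empty[OF polyhedral_cells])
    have ?A ?B ?C ?D using h unfolding empty by (simp_all add: cell_shapes_distinct)
    then show ?thesis by (intro conjI)
  next
    case (vertex a)
    then have h: "hdeg (cells d rm) F = 1" using hdeg_singleton[OF polyhedral_cells] F by simp
    have ?A ?B ?C ?D using h unfolding vertex(2) by (simp_all add: cell_shapes_distinct vertex(1))
    then show ?thesis by (intro conjI)
  next
    case (edge u t)
    then have h: "hdeg (cells d rm) F = 2" using cells_hdeg_edge by simp
    have ?B using h edge by blast
    moreover have ?A ?C ?D using h unfolding edge(3) by (simp_all add: cell_shapes_distinct)
    ultimately show ?thesis by (intro conjI)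
  next
    case (region u)
    then have h: "hdeg (cells d rm) F = 3" using cells_hdeg_region by simp
    have ?C using h region by blast
    moreover have ?A ?B ?D using h unfolding region(2) by (simp_all add: cell_shapes_distinct)
    ultimately show ?thesis by (intro conjI)
  qed
  then show ?A ?B ?C ?D by blast+
qed

lemma cells_skeleton: "grid_skeleton d rm (cells d rm) (cell_incidence rm) TYPE(real \<times> real)"
proof
  show "polyhedral_complex TYPE(real \<times> real) (cells d rm)" by (rule polyhedral_cells)
  show "incidence_function (cells d rm) (cell_incidence rm)" by (rule cells_incidence)
  show "{F \<in> cells d rm. hdeg (cells d rm) F = 1} = {{a} | a. size a = d}"
    using cells_hdeg_cases(1) cells_intros(2) by blast
  show "{F \<in> cells d rm. hdeg (cells d rm) F = 2} = {edge u t | u t. size u + 1 = d \<and> \<not> owns rm u t}"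
    using cells_hdeg_cases(2) cells_intros(3) by blast
qed

text \<open>Cycles of vertices are filled by paths and cycles of edges by regions, within the same
  bound b. Regions carry no nonzero cycle, and there are no cells of higher dimension.\<close>

lemma cells_acyclic: "acyclic_le TYPE('k::field) (cells d rm) (cell_incidence rm) id b"
  unfolding acyclic_le_def
proof (intro allI impI ballI)
  let ?X = "cells d rm" and ?\<epsilon> = "cell_incidence rm"
  interpret grid_skeleton d rm ?X ?\<epsilon> "TYPE(real \<times> real)" by (rule cells_skeleton)
  fix i and z :: "xyz multiset set \<Rightarrow> 'k"
  assume i: "1 \<le> i" and z: "z \<in> chains_le ?X id b i" and cyc: "bdry ?X ?\<epsilon> z = (\<lambda>_. 0)"
  have regions: "{F \<in> ?X. hdeg ?X F = 3} = region rm ` {u. size u + 1 = d}"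
    using cells_hdeg_cases(3) cells_intros(4) by blast
  have orient1: "orient u t = 1" for u t
    by (simp add: orient_def cell_incidence_simps)
  have sign: "of_int (?\<epsilon> (region rm v) (edge u t)) * of_int (orient u t) = (1 :: 'k) * of_int (region_coeff rm v u t)"
    if "size v + 1 = d" "size u + 1 = d" for v u t
    using that by (simp add: orient1 cell_incidence_region)
  have triv: "z = (\<lambda>_. 0) \<Longrightarrow> \<exists>w\<in>chains_le ?X id b (i + 1). bdry ?X ?\<epsilon> w = z"
    by (intro bexI[OF _ chains_le_zero]) (simp add: bdry_def)
  consider "i = 1" | "i = 2" | "i = 3" | "i > 3" using i by linarith
  then show "\<exists>w\<in>chains_le ?X id b (i + 1). bdry ?X ?\<epsilon> w = z"
  proof cases
    case 1
    have "\<exists>w\<in>chains_le ?X id b 2. bdry ?X ?\<epsilon> w = z"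
      by (rule vertex_cycle_boundary) (use z cyc 1 in simp_all)
    then show ?thesis unfolding 1 one_add_one .
  next
    case 2
    show ?thesis
    proof (rule edge_cycle_regions[OF z[unfolded 2] cyc])
      fix f assume f: "\<And>u. f u \<noteq> 0 \<Longrightarrow> size u + 1 = d \<and> u + xyz_mon \<subseteq># b"
        "\<And>u t. size u + 1 = d \<Longrightarrow> edge_flow z u t = f u - (if t \<in># u then f (owner rm (u - {#t#})) else 0)"
      \<comment> \<open>The weights of the up triangles become coefficients of the regions. Each sum
        has at most one term, as a region determines its up triangle.\<close>
      define w where "w F = (\<Sum>u\<in>{u. size u + 1 = d}. if F = region rm u then f u else 0)" for F
      have w_chain: "w \<in> chains_le ?X id b 3"
        unfolding w_def
      proof (rule chains_le_sum)
        fix u :: "xyz multiset" assume u: "u \<in> {u. size u + 1 = d}"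
        show "(\<lambda>F. if F = region rm u then f u else 0) \<in> chains_le ?X id b 3"
        proof (cases "f u = 0")
          case True
          then show ?thesis using chains_le_zero[of ?X id b 3] by (simp cong: if_cong)
        next
          case False
          then show ?thesis
            using f(1)[of u] u by (intro chains_le_single) (auto simp: face_label_id_region cells_hdeg_region intro: cells_intros)
        qed
      qed
      have wr: "w (region rm u) = f u" if "size u + 1 = d" for u
      proof -
        have fin: "finite {u :: xyz multiset. size u + 1 = d}" by (rule finite_subset[OF _ finite_multisets_size[of "d - 1"]]) auto
        have "w (region rm u) = (\<Sum>v\<in>{u. size u + 1 = d}. if u = v then f v else 0)"
          unfolding w_def using region_eq_iff[of rm u] that by (intro sum.cong refl) auto
        then show ?thesis using fin that by simp
      qed
      have "bdry ?X ?\<epsilon> w = z"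
      proof
        fix G show "bdry ?X ?\<epsilon> w G = z G"
        proof (cases "\<exists>u t. size u + 1 = d \<and> \<not> owns rm u t \<and> G = edge u t")
          case True
          then obtain u t where ut: "size u + 1 = d" "\<not> owns rm u t" "G = edge u t" by blast
          have own: "w (region rm (owner rm (u - {#t#}))) = f (owner rm (u - {#t#}))" if "t \<in># u"
            using that ut(1) by (intro wr) (simp add: owner_def size_Suc_Diff1)
          have "bdry ?X ?\<epsilon> w (edge u t) * of_int (orient u t)
            = 1 * w (region rm u) - (if t \<in># u then 1 * w (region rm (owner rm (u - {#t#}))) else 0)"
            by (rule bdry_region_chain[where \<kappa> = "\<lambda>_. 1", OF regions sign _ ut(1,2)])
              (use w_chain in \<open>auto simp: chains_le_def\<close>)
          also have "\<dots> = edge_flow z u t" using f(2)[OF ut(1)] wr[OF ut(1)] own by simp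
          finally show ?thesis using ut by (simp add: edge_flow_def orient1)
        next
          case False
          have zG: "z G = 0"
          proof (rule ccontr)
            assume "z G \<noteq> 0"
            then have "G \<in> ?X" "hdeg ?X G = 2" using z 2 by (auto simp: chains_le_def)
            with False show False using cells_hdeg_cases(2)[of G d rm] by blast
          qed
          have "w F * (if facet ?X F G then of_int (?\<epsilon> F G) else 0) = 0" for F
          proof (rule ccontr)
            assume "w F * (if facet ?X F G then of_int (?\<epsilon> F G) else 0) \<noteq> 0"
            then have "w F \<noteq> 0" and fa: "facet ?X F G" by (auto split: if_splits)
            then have "hdeg ?X G = 2" "G \<in> ?X"
              using w_chain facet_hdeg[OF polyhedral_cells fa] facetD[OF fa] by (auto simp: chains_le_def)
            with False show False using cells_hdeg_cases(2)[of G d rm] by blast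
          qed
          then have "bdry ?X ?\<epsilon> w G = 0" unfolding bdry_def by (intro sum.neutral) blast
          then show ?thesis using zG by simp
        qed
      qed
      moreover have "i + 1 = 3" using 2 by simp
      ultimately show ?thesis using w_chain by metis
    qed
  next
    case 3
    have "z = (\<lambda>_. 0)"
      by (rule region_cycle_zero[where \<kappa> = "\<lambda>_. 1", OF regions sign]) (use z 3 cyc in \<open>auto simp: chains_le_def\<close>)
    then show ?thesis by (rule triv)
  next
    case 4
    have "z = (\<lambda>_. 0)"
    proof
      fix F show "z F = 0"
        using z 4 cells_hdeg_cases(4)[of F d rm] by (force simp: chains_le_def)
    qed
    then show ?thesis by (rule triv)
  qed
qed

section \<open>Minimality and change of labels\<close>

text \<open>A nonzero entry is a sign times a monomial, and signs are nonzero in every field; so it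
  lies outside the irrelevant ideal only if the monomial is 1, that is, if the two labels
  agree.\<close>

lemma cell_entry_irrelevant_iff:
  assumes "\<forall>F\<in>X. finite F" and inc: "incidence_function X \<epsilon>" and A: "\<forall>v\<in>\<Union>X. set_mset (lab v) \<subseteq> A"
  shows "(\<forall>F G. (cell_entry X \<epsilon> lab F G :: ('x, 'k::field) mpoly) \<in> irrelevant_ideal A)
    \<longleftrightarrow> (\<forall>F G. facet X F G \<longrightarrow> face_label lab F \<noteq> face_label lab G)"
proof -
  have "(cell_entry X \<epsilon> lab F G :: ('x, 'k) mpoly) \<in> irrelevant_ideal A
      \<longleftrightarrow> (facet X F G \<longrightarrow> face_label lab F \<noteq> face_label lab G)" for F G
  proof (cases "facet X F G")
    case True
    have ne: "(of_int (\<epsilon> F G) :: 'k) \<noteq> 0" using incidence_facet[OF inc True] by auto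
    have le: "face_label lab G \<subseteq># face_label lab F" using facet_label_mono[OF assms(1) True] .
    have F: "F \<in> X" using True by (simp add: facet_def)
    have bdd: "subset_mset.bdd_above (lab ` F)"
      using F assms(1) by (simp add: subset_mset.bdd_above_finite)
    have "set_mset (face_label lab F) \<subseteq> A"
      using A F unfolding face_label_def by (subst set_mset_Sup[OF bdd]) blast
    then have "set_mset (face_label lab F - face_label lab G) \<subseteq> A" by (meson in_diffD subset_iff)
    moreover have "face_label lab F - face_label lab G = {#} \<longleftrightarrow> face_label lab F = face_label lab G"
      using le by (metis Diff_eq_empty_iff_mset subset_mset.antisym subset_mset.order_refl)
    ultimately show ?thesis
      using True ne by (simp add: cell_entry_single irrelevant_ideal_eq)
  next
    case False
    then show ?thesis by (simp add: cell_entry_def irrelevant_ideal_eq)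
  qed
  then show ?thesis by blast
qed

lemma minimal_cellular_resolution_complex:
  assumes "minimal_cellular_resolution E A X \<epsilon> lab J"
  shows "polyhedral_complex E X" "incidence_function X \<epsilon>" "\<forall>v\<in>\<Union>X. set_mset (lab v) \<subseteq> A"
    "J = Idl\<^bsub>poly_ring A\<^esub> ((\<lambda>v. mon (lab v)) ` \<Union>X)"
  using assms unfolding minimal_cellular_resolution_def cellular_resolution_def by blast+

lemma minimal_cellular_resolution_iff:
  fixes lab :: "'v \<Rightarrow> 'x multiset" and J :: "('x, 'k::field) mpoly set"
  assumes poly: "polyhedral_complex E X" and inc: "incidence_function X \<epsilon>" and A: "\<forall>v\<in>\<Union>X. set_mset (lab v) \<subseteq> A"
  shows "minimal_cellular_resolution E A X \<epsilon> lab J \<longleftrightarrow>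
    J = Idl\<^bsub>poly_ring A\<^esub> ((\<lambda>v. mon (lab v)) ` \<Union>X) \<and>
    (\<forall>b. set_mset b \<subseteq> A \<longrightarrow> acyclic_le TYPE('k) X \<epsilon> lab b) \<and>
    (\<forall>F G. facet X F G \<longrightarrow> face_label lab F \<noteq> face_label lab G)"
proof -
  have X: "finite X" "\<forall>F\<in>X. finite F" using polyhedral_finite(1,2)[OF poly] by blast+
  show ?thesis
    unfolding minimal_cellular_resolution_def cellular_resolution_def
      exact_iff_acyclic_le[OF X A] cell_entry_irrelevant_iff[OF X(2) inc A]
    by (simp only: poly inc eqTrueI[OF A] simp_thms conj_assoc)
qed

lemma irrelevant_power_genideal:
  "irrelevant_power UNIV d = Idl\<^bsub>poly_ring UNIV\<^esub> (mon ` {a. size a = d} :: ('x, 'k::comm_ring_1) mpoly set)"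
proof -
  have "(\<exists>m\<in>{a. size a = d}. m \<subseteq># a) \<longleftrightarrow> d \<le> size a" for a :: "'x multiset"
  proof
    assume "\<exists>m\<in>{a. size a = d}. m \<subseteq># a"
    then show "d \<le> size a" using size_mset_mono by auto
  next
    assume "d \<le> size a"
    then obtain m where "m \<subseteq># a" "size m = d" by (rule subset_mset_of_size)
    then show "\<exists>m\<in>{a. size a = d}. m \<subseteq># a" by auto
  qed
  then show ?thesis
    by (subst genideal_monomials) (simp_all add: irrelevant_power_eq monomial_span_def)
qed

lemma cells_Union: "\<Union>(cells d rm) = {a. size a = d}"
  using cells_size[of _ d rm] cells_intros(2)[of _ d rm] by (intro equalityI subsetI) auto

lemma cells_minimal_resolution:
  assumes d: "d \<ge> 1"
  shows "minimal_cellular_resolution TYPE(real \<times> real) UNIV (cells d rm) (cell_incidence rm) id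
    (irrelevant_power UNIV d :: (xyz, 'k::field) mpoly set)"
proof -
  let ?X = "cells d rm"
  have neq: "face_label id F \<noteq> face_label id G" if "facet ?X F G" for F G
    using that
  proof (cases rule: cells_facet_cases)
    case (vertex a)
    then show ?thesis using d by (auto simp: face_label_def[of id "{}"] Sup_multiset_empty)
  next
    case (edge u t s)
    then have "size (face_label id F) \<noteq> size (face_label id G)"
      by (simp add: face_label_id_edge edge_label_def)
    then show ?thesis by auto
  next
    case (region v u t)
    then have "size (face_label id F) \<noteq> size (face_label id G)"
      by (simp add: face_label_id_edge edge_label_def face_label_id_region)
    then show ?thesis by auto
  qed
  have "irrelevant_power UNIV d = Idl\<^bsub>poly_ring UNIV\<^esub> ((\<lambda>v. mon (id v)) ` \<Union>?X :: (xyz, 'k) mpoly set)"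
    unfolding cells_Union irrelevant_power_genideal by simp
  moreover have "\<forall>v\<in>\<Union>?X. set_mset (id v) \<subseteq> UNIV" by simp
  ultimately show ?thesis
    by (subst minimal_cellular_resolution_iff[OF polyhedral_cells cells_incidence])
      (assumption, intro conjI allI impI cells_acyclic neq)
qed

text \<open>The vertices with polarized label dividing B are those below an ordinary monomial b: the
  exponent of x_i in b is the largest n for which x_i^(1), ..., x_i^(n) all occur in B. Bounding n
  by d loses nothing for monomials of degree d.\<close>

lemma polarize_below:
  fixes B :: "('x::finite \<times> nat) multiset"
  shows "\<exists>b. \<forall>a. size a = d \<longrightarrow> (polarize a \<subseteq># B \<longleftrightarrow> a \<subseteq># b)"
proof -
  define f where "f i = Max {n. n \<le> d \<and> (\<forall>j. 1 \<le> j \<and> j \<le> n \<longrightarrow> (i, j) \<in># B)}" for i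
  have fin: "finite {n. n \<le> d \<and> (\<forall>j. 1 \<le> j \<and> j \<le> n \<longrightarrow> (i, j) \<in># B)}" for i
    by (rule finite_subset[of _ "{..d}"]) auto
  have f_mem: "f i \<in> {n. n \<le> d \<and> (\<forall>j. 1 \<le> j \<and> j \<le> n \<longrightarrow> (i, j) \<in># B)}" for i
    unfolding f_def by (rule Max_in[OF fin]) (auto intro: exI[of _ 0])
  have f_ge: "n \<le> f i" if "n \<le> d" "\<forall>j. 1 \<le> j \<and> j \<le> n \<longrightarrow> (i, j) \<in># B" for n i
    unfolding f_def by (rule Max_ge[OF fin]) (use that in auto)
  define b where "b = Abs_multiset f"
  have b: "count b i = f i" for i
    unfolding b_def by (subst count_Abs_multiset) auto
  have "polarize a \<subseteq># B \<longleftrightarrow> a \<subseteq># b" if a: "size a = d" for a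
  proof
    assume sub: "polarize a \<subseteq># B"
    have "count a i \<le> f i" for i
    proof (rule f_ge)
      show "count a i \<le> d" using count_le_size[of a i] a by simp
      show "\<forall>j. 1 \<le> j \<and> j \<le> count a i \<longrightarrow> (i, j) \<in># B"
        using set_mset_mono[OF sub] by (auto simp: set_mset_polarize)
    qed
    then show "a \<subseteq># b" by (simp add: subseteq_mset_def b)
  next
    assume sub: "a \<subseteq># b"
    have "count (polarize a) v \<le> count B v" for v
    proof (cases v)
      case (Pair i j)
      have "count a i \<le> f i" using mset_subset_eq_count[OF sub, of i] by (simp add: b)
      then have "1 \<le> j \<and> j \<le> count a i \<longrightarrow> (i, j) \<in># B" using f_mem[of i] by auto
      then show ?thesis
        unfolding Pair count_polarize by (auto simp: Suc_le_eq simp flip: count_greater_zero_iff)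
    qed
    then show "polarize a \<subseteq># B" by (simp add: subseteq_mset_def)
  qed
  then show ?thesis by blast
qed

text \<open>Maxima of exponents correspond to unions of initial segments, so polarizing commutes
  with the lcm. Distinct face labels therefore stay distinct, which carries minimality over.\<close>

lemma depol_face_label_polarize:
  fixes F :: "'x::finite multiset set"
  assumes "finite F"
  shows "face_label polarize F = polarize (face_label id F)"
proof (rule subset_mset.antisym)
  show "face_label polarize F \<subseteq># polarize (face_label id F)"
    unfolding face_label_subset_iff[OF assms] polarize_subset_iff using face_label_upper[OF assms, of _ id] by simp
  show "polarize (face_label id F) \<subseteq># face_label polarize F"
    unfolding subseteq_mset_def
  proof
    fix v :: "'x \<times> nat"
    obtain i j where v: "v = (i, j)" by (cases v)
    show "count (polarize (face_label id F)) v \<le> count (face_label polarize F) v"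
    proof (cases "1 \<le> j \<and> j \<le> count (face_label id F) i")
      case True
      have "\<exists>a\<in>F. j \<le> count a i"
      proof (rule ccontr)
        assume "\<not> ?thesis"
        then have less: "count a i < j" if "a \<in> F" for a using that by (auto simp: not_le)
        \<comment> \<open>If every member had x_i-exponent below j, lowering this exponent of the
          lcm to j - 1 would still leave a common multiple.\<close>
        define L where "L = face_label id F - replicate_mset (count (face_label id F) i - (j - 1)) i"
        have "a \<subseteq># L" if a: "a \<in> F" for a
          unfolding subseteq_mset_def
        proof
          fix k
          have "count a k \<le> count (face_label id F) k"
            using mset_subset_eq_count[OF face_label_upper[OF assms a, of id]] by simp
          then show "count a k \<le> count L k"
            using less[OF a] True by (cases "k = i") (auto simp: L_def)
        qed
        then have "face_label id F \<subseteq># L" unfolding face_label_subset_iff[OF assms] by simp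
        then have "count (face_label id F) i \<le> count L i" by (rule mset_subset_eq_count)
        also have "\<dots> = j - 1" using True by (simp add: L_def)
        finally show False using True by linarith
      qed
      then obtain a where a: "a \<in> F" "j \<le> count a i" by blast
      have "count (polarize a) v \<le> count (face_label polarize F) v"
        by (rule mset_subset_eq_count[OF face_label_upper[OF assms a(1)]])
      then show ?thesis using a(2) True by (simp add: v count_polarize)
    next
      case False
      then have "count (polarize (face_label id F)) v = 0"
        unfolding v count_polarize by (simp only: of_bool_def if_False)
      then show ?thesis by simp
    qed
  qed
qed

text \<open>The subcomplex below a monomial is determined by the vertices that it contains, whatever
  the labels are.\<close>

lemma acyclic_le_relabel:
  assumes fin: "\<forall>F\<in>X. finite F" and iff: "\<And>v. v \<in> \<Union>X \<Longrightarrow> lab v \<subseteq># b \<longleftrightarrow> lab' v \<subseteq># b'"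
  shows "acyclic_le TYPE('k::comm_ring_1) X \<epsilon> lab b \<longleftrightarrow> acyclic_le TYPE('k) X \<epsilon> lab' b'"
proof -
  have "face_label lab F \<subseteq># b \<longleftrightarrow> face_label lab' F \<subseteq># b'" if F: "F \<in> X" for F
  proof -
    have finF: "finite F" using fin F by blast
    show ?thesis
      unfolding face_label_subset_iff[OF finF] by (intro ball_cong refl iff UnionI[OF F])
  qed
  then have "F \<in> X \<and> hdeg X F = i \<and> face_label lab F \<subseteq># b \<longleftrightarrow> F \<in> X \<and> hdeg X F = i \<and> face_label lab' F \<subseteq># b'" for F i
    by (intro conj_cong refl)
  then have "(chains_le X lab b i :: ('a set \<Rightarrow> 'k) set) = chains_le X lab' b' i" for i
    unfolding chains_le_def by (simp only:)
  then show ?thesis unfolding acyclic_le_def by (simp only:)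
qed

lemma minimal_resolution_polarize:
  fixes X :: "'x::finite multiset set set"
  assumes res: "minimal_cellular_resolution TYPE('a::euclidean_space) UNIV X \<epsilon> id (irrelevant_power UNIV d :: ('x, 'k::field) mpoly set)"
    and X: "\<Union>X = {a. size a = d}"
  shows "minimal_cellular_resolution TYPE('a) (polvars (\<lambda>_. d)) X \<epsilon> polarize (standard_polarization d :: ('x \<times> nat, 'k) mpoly set)"
proof -
  let ?A = "polvars (\<lambda>_ :: 'x. d)"
  note poly = minimal_cellular_resolution_complex(1)[OF res] and inc = minimal_cellular_resolution_complex(2)[OF res]
  have fin: "\<forall>F\<in>X. finite F" using polyhedral_finite(2)[OF poly] by blast
  have A: "\<forall>v\<in>\<Union>X. set_mset (polarize v) \<subseteq> ?A"
  proof
    fix v assume "v \<in> \<Union>X"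
    then show "set_mset (polarize v) \<subseteq> ?A" unfolding X by (intro polarize_polvars) simp
  qed
  have "\<forall>v\<in>\<Union>X. set_mset (id v) \<subseteq> UNIV" by simp
  from res[unfolded minimal_cellular_resolution_iff[OF poly inc this]]
  have acyc: "\<forall>b. acyclic_le TYPE('k) X \<epsilon> id b" and neq: "\<forall>F G. facet X F G \<longrightarrow> face_label id F \<noteq> face_label id G"
    by simp_all
  have "acyclic_le TYPE('k) X \<epsilon> polarize B" for B
  proof -
    obtain b where b: "\<forall>a. size a = d \<longrightarrow> (polarize a \<subseteq># B \<longleftrightarrow> a \<subseteq># b)" using polarize_below[of d B] by blast
    have "polarize v \<subseteq># B \<longleftrightarrow> id v \<subseteq># b" if "v \<in> \<Union>X" for v
      using that b unfolding X by simp
    from acyclic_le_relabel[of X polarize B id b, OF fin this] show ?thesis using acyc by blast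
  qed
  moreover have "face_label polarize F \<noteq> face_label polarize G" if f: "facet X F G" for F G
  proof -
    have "face_label id F \<noteq> face_label id G" using neq f by blast
    moreover have "finite F" "finite G" using f fin by (auto dest: facetD)
    ultimately show ?thesis by (simp add: depol_face_label_polarize inj_eq[OF inj_polarize])
  qed
  moreover have "standard_polarization d = Idl\<^bsub>poly_ring ?A\<^esub> ((\<lambda>v. mon (polarize v)) ` \<Union>X :: ('x \<times> nat, 'k) mpoly set)"
    unfolding X standard_polarization_genideal by (simp add: image_image)
  ultimately show ?thesis
    unfolding minimal_cellular_resolution_iff[OF poly inc A] by (intro conjI allI impI)
qed

section \<open>Transport along injective maps of vertices\<close>

lemma hdeg_iso_le:
  assumes "finite X" "finite Y" and im: "\<Phi> ` X = Y"
    and iso: "\<And>F G. F \<in> X \<Longrightarrow> G \<in> X \<Longrightarrow> \<Phi> F \<subset> \<Phi> G \<longleftrightarrow> F \<subset> G"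
  shows "F \<in> X \<Longrightarrow> hdeg Y (\<Phi> F) \<le> hdeg X F"
proof (induction "hdeg X F" arbitrary: F rule: less_induct)
  case less
  show ?case
  proof (rule hdeg_le[OF assms(2)])
    fix G' assume "G' \<in> Y" "G' \<subset> \<Phi> F"
    then obtain G where G: "G \<in> X" "G' = \<Phi> G" "G \<subset> F" using im iso less.prems by blast
    have "hdeg X G < hdeg X F" by (rule hdeg_less[OF assms(1) G(1,3)])
    with less.hyps[OF this G(1)] show "hdeg Y G' < hdeg X F" using G(2) by simp
  qed
qed

context
  fixes X :: "'v set set" and \<phi> :: "'v \<Rightarrow> 'w"
  assumes inj: "inj_on \<phi> (\<Union>X)"
begin

lemma image_subset_iff_cells: "F \<in> X \<Longrightarrow> G \<in> X \<Longrightarrow> \<phi> ` F \<subseteq> \<phi> ` G \<longleftrightarrow> F \<subseteq> G"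
  using inj_on_image_subset_iff[OF inj, of F G] by blast

lemma image_psubset_iff_cells: "F \<in> X \<Longrightarrow> G \<in> X \<Longrightarrow> \<phi> ` F \<subset> \<phi> ` G \<longleftrightarrow> F \<subset> G"
  using image_subset_iff_cells by (simp add: less_le_not_le)

lemma image_eq_iff_cells: "F \<in> X \<Longrightarrow> G \<in> X \<Longrightarrow> \<phi> ` F = \<phi> ` G \<longleftrightarrow> F = G"
  using image_subset_iff_cells by (metis subset_antisym subset_refl)

lemma inj_on_image_cells: "inj_on ((`) \<phi>) X"
  using image_eq_iff_cells by (auto simp: inj_on_def)

lemma facet_image: 
  assumes "F \<in> X" "G \<in> X" shows "facet ((`) \<phi> ` X) (\<phi> ` F) (\<phi> ` G) \<longleftrightarrow> facet X F G"
  using assms image_psubset_iff_cells unfolding facet_def by auto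

lemma hdeg_image:
  assumes "finite X" "F \<in> X"
  shows "hdeg ((`) \<phi> ` X) (\<phi> ` F) = hdeg X F"
proof (rule antisym)
  show "hdeg ((`) \<phi> ` X) (\<phi> ` F) \<le> hdeg X F"
    by (rule hdeg_iso_le[OF assms(1) _ refl]) (use assms image_psubset_iff_cells in auto)
  have inv: "inv_into X ((`) \<phi>) (\<phi> ` F) = F" if "F \<in> X" for F
    using inv_into_f_f[OF inj_on_image_cells that] .
  have "hdeg X (inv_into X ((`) \<phi>) (\<phi> ` F)) \<le> hdeg ((`) \<phi> ` X) (\<phi> ` F)"
  proof (rule hdeg_iso_le)
    show "inv_into X ((`) \<phi>) ` ((`) \<phi> ` X) = X" using inv by (force simp: image_image)
    show "inv_into X ((`) \<phi>) F' \<subset> inv_into X ((`) \<phi>) G' \<longleftrightarrow> F' \<subset> G'"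
      if "F' \<in> (`) \<phi> ` X" "G' \<in> (`) \<phi> ` X" for F' G'
    proof -
      from that obtain F G where "F \<in> X" "F' = \<phi> ` F" "G \<in> X" "G' = \<phi> ` G" by blast
      then show ?thesis using inv[of F] inv[of G] image_psubset_iff_cells[of F G] by simp
    qed
  qed (use assms in auto)
  then show "hdeg X F \<le> hdeg ((`) \<phi> ` X) (\<phi> ` F)" using inv[OF assms(2)] by simp
qed

text \<open>Composing a realization with the inverse of \<phi> leaves the polytopes
  unchanged.\<close>

lemma polyhedral_complex_image:
  assumes poly: "polyhedral_complex TYPE('a::euclidean_space) X"
  shows "polyhedral_complex TYPE('a) ((`) \<phi> ` X)"
  unfolding polyhedral_complex_def realizes_def[symmetric]
proof (intro conjI ballI)
  show "finite ((`) \<phi> ` X)" using polyhedral_finite(1)[OF poly] by simp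
  show "{} \<in> (`) \<phi> ` X" using polyhedral_finite(3)[OF poly] by force
  fix F' assume "F' \<in> (`) \<phi> ` X"
  then obtain F where F: "F \<in> X" "F' = \<phi> ` F" by blast
  show "finite F'" using polyhedral_finite(2)[OF poly F(1)] F(2) by simp
  show "{v} \<in> (`) \<phi> ` X" if "v \<in> F'" for v
    using that polyhedral_finite(4)[OF poly F(1)] F(2) by force
  show "F' \<inter> G' \<in> (`) \<phi> ` X" if "G' \<in> (`) \<phi> ` X" for G'
  proof -
    obtain G where G: "G \<in> X" "G' = \<phi> ` G" using \<open>G' \<in> (`) \<phi> ` X\<close> by blast
    have "\<phi> ` (F \<inter> G) = F' \<inter> G'"
      unfolding F(2) G(2) by (rule inj_on_image_Int[OF inj]) (use F(1) G(1) in auto)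
    then show ?thesis using polyhedral_finite(5)[OF poly F(1) G(1)] by (metis imageI)
  qed
  obtain p :: "'v \<Rightarrow> 'a" where p: "realizes X p F" using polyhedral_realizes[OF poly F(1)] by blast
  let ?\<psi> = "the_inv_into (\<Union>X) \<phi>"
  have \<psi>: "?\<psi> (\<phi> v) = v" if "v \<in> F" for v
    using that F(1) by (intro the_inv_into_f_f[OF inj]) blast
  have "realizes ((`) \<phi> ` X) (p \<circ> ?\<psi>) F'"
  proof -
    have pF: "(p \<circ> ?\<psi>) ` F' = p ` F" unfolding F(2) image_image using \<psi> by (intro image_cong) auto
    have "{G' \<in> (`) \<phi> ` X. G' \<subseteq> F'} = (`) \<phi> ` {G \<in> X. G \<subseteq> F}"
      using image_subset_iff_cells F by auto
    also have "\<dots> = (`) \<phi> ` {{v \<in> F. p v \<in> T} | T. T face_of (convex hull (p ` F))}"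
      using p unfolding realizes_def by simp
    also have "\<dots> = {{v \<in> F'. (p \<circ> ?\<psi>) v \<in> T} | T. T face_of (convex hull (p ` F))}"
    proof -
      have "\<phi> ` {v \<in> F. p v \<in> T} = {v \<in> F'. (p \<circ> ?\<psi>) v \<in> T}" for T
        unfolding F(2) using \<psi> by auto
      then show ?thesis by (simp add: setcompr_eq_image image_image)
    qed
    finally show ?thesis unfolding realizes_def pF .
  qed
  then show "\<exists>p :: 'w \<Rightarrow> 'a. realizes ((`) \<phi> ` X) p F'" by blast
qed

end

section \<open>Uniqueness of minimal resolutions\<close>

text \<open>What remains of a minimal cellular resolution after the reduction: exactness below every
  monomial, and labels that change along facets. The ideal does not appear, being determined by the
  vertex labels.\<close>

locale minimal_resolution =
  fixes E :: "'a::euclidean_space itself" and K :: "'k::field itself" and X :: "'v set set"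
    and \<epsilon> :: "'v set \<Rightarrow> 'v set \<Rightarrow> int" and lab :: "'v \<Rightarrow> 'x multiset"
  assumes poly: "polyhedral_complex E X" and inc: "incidence_function X \<epsilon>"
    and acyclic: "\<And>b. acyclic_le K X \<epsilon> lab b"
    and label_neq: "\<And>F G. facet X F G \<Longrightarrow> face_label lab F \<noteq> face_label lab G"
begin

lemma finX: "finite X" and fin: "F \<in> X \<Longrightarrow> finite F"
  using polyhedral_finite(1,2)[OF poly] by auto

lemma cycle_boundary:
  assumes "1 \<le> i" "z \<in> chains_le X lab b i" "bdry X \<epsilon> z = (\<lambda>_. 0 :: 'k)"
  obtains w where "w \<in> chains_le X lab b (i + 1)" "bdry X \<epsilon> w = z"
proof -
  from acyclic[of b, unfolded acyclic_le_def, rule_format, OF assms]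
  obtain w where "w \<in> chains_le X lab b (i + 1)" "bdry X \<epsilon> w = z" by (rule bexE)
  then show ?thesis by (rule that)
qed

text \<open>By minimality a face whose label is \<open>b\<close> is not a facet of a face with label dividing \<open>b\<close>, so it
  cannot occur in a boundary.\<close>

lemma cycle_avoids_top_label:
  assumes "1 \<le> i" "z \<in> chains_le X lab b i" "bdry X \<epsilon> z = (\<lambda>_. 0 :: 'k)" and nz: "z F \<noteq> 0"
  shows "face_label lab F \<noteq> b"
proof
  assume b: "face_label lab F = b"
  obtain w where w: "w \<in> chains_le X lab b (i + 1)" "bdry X \<epsilon> w = z"
    by (rule cycle_boundary[OF assms(1-3)])
  have "(\<Sum>H\<in>X. w H * (if facet X H F then of_int (\<epsilon> H F) else 0)) \<noteq> 0"
    using nz unfolding w(2)[symmetric] bdry_def .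
  then obtain H where H: "w H * (if facet X H F then of_int (\<epsilon> H F) else 0) \<noteq> 0"
    by (rule sum.not_neutral_contains_not_neutral)
  then have "w H \<noteq> 0" and f: "facet X H F" by (auto split: if_splits)
  then have "face_label lab H \<subseteq># b" using w(1) by (auto simp: chains_le_def)
  moreover have "face_label lab F \<subseteq># face_label lab H"
    using f fin by (intro facet_label_mono) auto
  ultimately have "face_label lab H = face_label lab F" using b by (simp add: subset_mset.antisym)
  with label_neq[OF f] show False by simp
qed

lemma facet_vertex_iff: "{v} \<in> X \<Longrightarrow> facet X {v} G \<longleftrightarrow> G = {}"
  using facet_iff_hdeg[OF poly] hdeg_singleton[OF poly] hdeg_empty[OF poly] polyhedral_finite(3)[OF poly] by auto

lemma vertex_sign: "{v} \<in> X \<Longrightarrow> \<epsilon> {v} {} = 1"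
  using inc unfolding incidence_function_def by blast

lemma bdry_vertex:
  "{v} \<in> X \<Longrightarrow> bdry X \<epsilon> (\<lambda>G. if G = {v} then k else 0) = (\<lambda>G. if G = {} then k else 0)"
  by (simp add: bdry_single[OF finX] facet_vertex_iff vertex_sign if_distrib cong: if_cong)

lemma vertex_difference:
  assumes "{v} \<in> X" "{v'} \<in> X" "lab v \<subseteq># b" "lab v' \<subseteq># b"
  shows "(\<lambda>G. (if G = {v} then 1 else 0) - (if G = {v'} then 1 else 0 :: 'k)) \<in> chains_le X lab b 1"
    "bdry X \<epsilon> (\<lambda>G. (if G = {v} then 1 else 0) - (if G = {v'} then 1 else 0 :: 'k)) = (\<lambda>_. 0)"
proof -
  have single: "face_label lab {u} = lab u" for u by (simp add: face_label_def)
  have eq: "(\<lambda>G. (if G = {v} then 1 else 0) - (if G = {v'} then 1 else 0 :: 'k))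
    = (\<lambda>G. (if G = {v} then 1 else 0) + (if G = {v'} then - 1 else 0))" by auto
  show "(\<lambda>G. (if G = {v} then 1 else 0) - (if G = {v'} then 1 else 0 :: 'k)) \<in> chains_le X lab b 1"
    unfolding eq using assms by (intro chains_le_add chains_le_single) (auto simp: single hdeg_singleton[OF poly])
  show "bdry X \<epsilon> (\<lambda>G. (if G = {v} then 1 else 0) - (if G = {v'} then 1 else 0 :: 'k)) = (\<lambda>_. 0)"
    unfolding eq bdry_add bdry_vertex[OF assms(1)] bdry_vertex[OF assms(2)] by auto
qed

text \<open>Otherwise the difference of the two vertices would be a cycle with the label of v' as
  bound, and it contains v' itself.\<close>

lemma labels_antichain:
  assumes "{v} \<in> X" "{v'} \<in> X" "lab v \<subseteq># lab v'"
  shows "v = v'"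
proof (rule ccontr)
  assume "v \<noteq> v'"
  then have "((if {v'} = {v} then 1 else 0) - (if {v'} = {v'} then 1 else 0 :: 'k)) \<noteq> 0" by simp
  from cycle_avoids_top_label[OF _ vertex_difference[OF assms(1,2,3) subset_mset.order_refl], of "{v'}", OF _ this]
  show False by (simp add: face_label_def)
qed

lemma bdry_bdry_face:
  assumes F: "F \<in> X"
  shows "bdry X \<epsilon> (bdry X \<epsilon> (\<lambda>G. if G = F then 1 else 0 :: 'k)) = (\<lambda>_. 0)"
proof
  fix G
  have eps: "(if facet X H G then of_int (\<epsilon> H G) else 0 :: 'k) = (if G \<in> X then of_int (\<epsilon> H G) else 0)" if "H \<in> X" for H G
    using incidence_nonfacet[OF inc that, of G] facetD(2)[of X H G] by auto
  show "bdry X \<epsilon> (bdry X \<epsilon> (\<lambda>G. if G = F then 1 else 0 :: 'k)) G = 0"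
  proof (cases "G \<in> X")
    case True
    have "bdry X \<epsilon> (bdry X \<epsilon> (\<lambda>G. if G = F then 1 else 0 :: 'k)) G = (\<Sum>H\<in>X. of_int (\<epsilon> F H) * of_int (\<epsilon> H G))"
      unfolding bdry_single[OF finX F] by (simp add: bdry_def eps F True)
    also have "\<dots> = of_int (\<Sum>H\<in>X. \<epsilon> F H * \<epsilon> H G)" by simp
    also have "\<dots> = 0" using incidence_sum[OF inc F True] by simp
    finally show ?thesis .
  next
    case False
    then have "\<not> facet X H G" for H using facetD(2) by blast
    then show ?thesis by (simp add: bdry_def)
  qed
qed

lemma bdry_face_chain:
  assumes F: "F \<in> X" "hdeg X F = i + 1" "face_label lab F \<subseteq># b"
  shows "bdry X \<epsilon> (\<lambda>G. if G = F then 1 else 0 :: 'k) \<in> chains_le X lab b i"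
  unfolding chains_le_def bdry_single[OF finX F(1)]
proof (intro CollectI allI impI)
  fix G assume "1 * (if facet X F G then of_int (\<epsilon> F G) else 0 :: 'k) \<noteq> 0"
  then have f: "facet X F G" by (auto split: if_splits)
  have "face_label lab G \<subseteq># face_label lab F" by (rule facet_label_mono[OF _ f]) (use fin in auto)
  then show "G \<in> X \<and> hdeg X G = i \<and> face_label lab G \<subseteq># b"
    using facetD[OF f] facet_hdeg[OF poly f] F by auto
qed

end

lemma minimal_resolutionI:
  fixes lab :: "'v \<Rightarrow> 'x multiset" and J :: "('x, 'k::field) mpoly set"
  assumes res: "minimal_cellular_resolution TYPE('a::euclidean_space) UNIV X \<epsilon> lab J"
  shows "minimal_resolution TYPE('a) TYPE('k) X \<epsilon> lab"
proof -
  note poly = minimal_cellular_resolution_complex(1)[OF res] and inc = minimal_cellular_resolution_complex(2)[OF res]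
  have "\<forall>v\<in>\<Union>X. set_mset (lab v) \<subseteq> UNIV" by simp
  from res[unfolded minimal_cellular_resolution_iff[OF poly inc this]]
  have "\<forall>b. acyclic_le TYPE('k) X \<epsilon> lab b" "\<forall>F G. facet X F G \<longrightarrow> face_label lab F \<noteq> face_label lab G"
    by simp_all
  then show ?thesis using poly inc unfolding minimal_resolution_def by blast
qed

text \<open>Distinct vertices have distinct labels, so vertices can be replaced by their labels,
  after which the label function is the identity. Chains are carried back and forth along the
  bijection of faces.\<close>

lemma minimal_resolution_image:
  fixes lab :: "'v \<Rightarrow> 'x multiset"
  assumes "minimal_resolution TYPE('a::euclidean_space) TYPE('k::field) X \<epsilon> lab" and inj: "inj_on lab (\<Union>X)"
    and \<epsilon>': "\<And>F G. F \<in> X \<Longrightarrow> G \<in> X \<Longrightarrow> \<epsilon>' (lab ` F) (lab ` G) = \<epsilon> F G"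
  shows "minimal_resolution TYPE('a) TYPE('k) ((`) lab ` X) \<epsilon>' id"
proof -
  interpret minimal_resolution "TYPE('a)" "TYPE('k)" X \<epsilon> lab by fact
  let ?Y = "(`) lab ` X"
  note injX = inj_on_image_cells[OF inj]
  note facet_eq = facet_image[OF inj]
  have label: "face_label id (lab ` F) = face_label lab F" for F by (simp add: face_label_def)
  have sum_Y: "(\<Sum>H\<in>?Y. f H) = (\<Sum>H\<in>X. f (lab ` H))" for f :: "'x multiset set \<Rightarrow> 'c::comm_monoid_add"
    using sum.reindex[OF injX, of f] by (simp add: o_def)
  have bdry_Y: "bdry ?Y \<epsilon>' z (lab ` G) = bdry X \<epsilon> (\<lambda>F. z (lab ` F)) G" if "G \<in> X" for z :: "_ \<Rightarrow> 'k" and G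
    unfolding bdry_def sum_Y using that by (intro sum.cong refl) (auto simp: facet_eq \<epsilon>')
  show ?thesis
  proof
    show "polyhedral_complex TYPE('a) ?Y" by (rule polyhedral_complex_image[OF inj poly])
    show "incidence_function ?Y \<epsilon>'"
      unfolding incidence_function_def
    proof (intro conjI ballI allI impI)
      fix F' G' assume "F' \<in> ?Y" "G' \<in> ?Y"
      then obtain F G where F: "F \<in> X" "F' = lab ` F" and G: "G \<in> X" "G' = lab ` G" by blast
      show "if facet ?Y F' G' then \<epsilon>' F' G' \<in> {1, - 1} else \<epsilon>' F' G' = 0"
        using incidence_facet[OF inc, of F G] incidence_nonfacet[OF inc F(1) G(1)]
        unfolding F(2) G(2) facet_eq[OF F(1) G(1)] \<epsilon>'[OF F(1) G(1)] by auto
      have "(\<Sum>H\<in>?Y. \<epsilon>' F' H * \<epsilon>' H G') = (\<Sum>H\<in>X. \<epsilon> F H * \<epsilon> H G)"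
        unfolding sum_Y F(2) G(2) using F(1) G(1) by (intro sum.cong refl) (simp add: \<epsilon>')
      then show "(\<Sum>H\<in>?Y. \<epsilon>' F' H * \<epsilon>' H G') = 0" using incidence_sum[OF inc F(1) G(1)] by simp
    next
      fix a assume "{a} \<in> ?Y"
      then obtain F where F: "F \<in> X" "{a} = lab ` F" by blast
      then obtain v where v: "v \<in> F" "a = lab v" by blast
      have vX: "{v} \<in> X" by (rule polyhedral_finite(4)[OF poly F(1) v(1)])
      have "\<epsilon>' (lab ` {v}) (lab ` {}) = 1"
        using vertex_sign[OF vX] \<epsilon>'[OF vX polyhedral_finite(3)[OF poly]] by simp
      then show "\<epsilon>' {a} {} = 1" using v(2) by simp
    qed
    show "face_label id F' \<noteq> face_label id G'" if f: "facet ?Y F' G'" for F' G'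
    proof -
      obtain F G where "F \<in> X" "F' = lab ` F" "G \<in> X" "G' = lab ` G"
        using facetD(1,2)[OF f] by blast
      then show ?thesis using f facet_eq label_neq label by metis
    qed
    fix b
    show "acyclic_le TYPE('k) ?Y \<epsilon>' id b"
      unfolding acyclic_le_def
    proof (intro allI impI ballI)
      fix i and z :: "'x multiset set \<Rightarrow> 'k"
      assume i: "1 \<le> i" and z: "z \<in> chains_le ?Y id b i" and cyc: "bdry ?Y \<epsilon>' z = (\<lambda>_. 0)"
      define z' where "z' F = (if F \<in> X then z (lab ` F) else 0)" for F
      have "z' \<in> chains_le X lab b i"
        unfolding chains_le_def
      proof (intro CollectI allI impI)
        fix F assume "z' F \<noteq> 0"
        then have F: "F \<in> X" "z (lab ` F) \<noteq> 0" by (auto simp: z'_def split: if_splits)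
        then show "F \<in> X \<and> hdeg X F = i \<and> face_label lab F \<subseteq># b"
        proof -
          have "hdeg ?Y (lab ` F) = i \<and> face_label id (lab ` F) \<subseteq># b"
            using z F(2) unfolding chains_le_def by blast
          then show ?thesis using F(1) hdeg_image[OF inj finX F(1)] label[of F] by simp
        qed
      qed
      moreover have "bdry X \<epsilon> z' = (\<lambda>_. 0)"
      proof
        fix G
        show "bdry X \<epsilon> z' G = 0"
        proof (cases "G \<in> X")
          case True
          have "bdry X \<epsilon> z' G = bdry X \<epsilon> (\<lambda>F. z (lab ` F)) G"
            unfolding bdry_def z'_def by (intro sum.cong refl) simp
          then show ?thesis using bdry_Y[OF True, of z] cyc by simp
        next
          case False
          then show ?thesis by (simp add: bdry_def facet_def)
        qed
      qed
      ultimately obtain w where w: "w \<in> chains_le X lab b (i + 1)" "bdry X \<epsilon> w = z'"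
        by (rule cycle_boundary[OF i])
      define w' where "w' F' = (if F' \<in> ?Y then w (inv_into X ((`) lab) F') else 0)" for F'
      have w'w: "w' (lab ` F) = w F" if "F \<in> X" for F
        using that inv_into_f_f[OF injX that] by (simp add: w'_def)
      have "w' \<in> chains_le ?Y id b (i + 1)"
        unfolding chains_le_def
      proof (intro CollectI allI impI)
        fix F' assume nz: "w' F' \<noteq> 0"
        then obtain F where F: "F \<in> X" "F' = lab ` F" by (auto simp: w'_def split: if_splits)
        then have "w F \<noteq> 0" using nz w'w by simp
        then show "F' \<in> ?Y \<and> hdeg ?Y F' = i + 1 \<and> face_label id F' \<subseteq># b"
          using w(1) F hdeg_image[OF inj finX F(1)] by (auto simp: chains_le_def label)
      qed
      moreover have "bdry ?Y \<epsilon>' w' = z"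
      proof
        fix G'
        show "bdry ?Y \<epsilon>' w' G' = z G'"
        proof (cases "G' \<in> ?Y")
          case True
          then obtain G where G: "G \<in> X" "G' = lab ` G" by blast
          have "bdry ?Y \<epsilon>' w' G' = bdry X \<epsilon> (\<lambda>F. w' (lab ` F)) G" unfolding G(2) by (rule bdry_Y[OF G(1)])
          also have "\<dots> = bdry X \<epsilon> w G" unfolding bdry_def by (intro sum.cong refl) (simp add: w'w)
          also have "\<dots> = z G'" using w(2) G by (simp add: z'_def)
          finally show ?thesis .
        next
          case False
          then have "z G' = 0" using z by (auto simp: chains_le_def)
          then show ?thesis using False by (simp add: bdry_def facet_def)
        qed
      qed
      ultimately show "\<exists>w\<in>chains_le ?Y id b (i + 1). bdry ?Y \<epsilon>' w = z" by blast
    qed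
  qed
qed

section \<open>The edges forced by minimality\<close>

locale monomial_resolution = minimal_resolution E K Y \<epsilon> "id :: xyz multiset \<Rightarrow> xyz multiset"
  for E :: "'a::euclidean_space itself" and K :: "'k::field itself" and Y \<epsilon> +
  fixes d :: nat
  assumes Union: "\<Union>Y = {a. size a = d}"
begin

lemma vertex_mem: "{a} \<in> Y \<longleftrightarrow> size a = d"
  using Union polyhedral_finite(4)[OF poly] by blast

text \<open>The difference of a and a' is a boundary within the subcomplex below b, and some edge of
  the bounding chain must end at a.\<close>

lemma vertex_edge:
  assumes ab: "size a = d" "size a' = d" "a \<noteq> a'" "a \<subseteq># b" "a' \<subseteq># b"
  shows "\<exists>F\<in>Y. hdeg Y F = 2 \<and> a \<in> F \<and> face_label id F \<subseteq># b"
proof -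
  have v: "{a} \<in> Y" "{a'} \<in> Y" using ab vertex_mem by auto
  have le: "id a \<subseteq># b" "id a' \<subseteq># b" using ab by auto
  obtain w where w: "w \<in> chains_le Y id b (1 + 1)"
    "bdry Y \<epsilon> w = (\<lambda>G. (if G = {a} then 1 else 0) - (if G = {a'} then 1 else 0 :: 'k))"
    by (rule cycle_boundary[OF order_refl vertex_difference[OF v le]])
  have "bdry Y \<epsilon> w {a} \<noteq> 0" unfolding w(2) using ab(3) by simp
  then obtain F where "w F * (if facet Y F {a} then of_int (\<epsilon> F {a}) else 0) \<noteq> 0"
    unfolding bdry_def by (rule sum.not_neutral_contains_not_neutral)
  then have "w F \<noteq> 0" "facet Y F {a}" by (auto split: if_splits)
  then show ?thesis using w(1) facetD(3)[of Y F "{a}"] by (auto simp: chains_le_def)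
qed

lemma edge_pair:
  assumes "F \<in> Y" "hdeg Y F = 2"
  obtains p q where "F = {p, q}" "p \<noteq> q" "size p = d" "size q = d"
proof -
  obtain p q where "F = {p, q}" "p \<noteq> q" using hdeg_2_card[OF poly assms] by (auto simp: card_2_iff)
  moreover then have "size p = d" "size q = d" using assms(1) Union by auto
  ultimately show ?thesis by (rule that)
qed

lemma edge_facet:
  assumes "F \<in> Y" "hdeg Y F = 2" "a \<in> F"
  shows "facet Y F {a}"
proof -
  have "{a} \<in> Y" using polyhedral_finite(4)[OF poly assms(1,3)] .
  moreover have "{a} \<subset> F" using assms hdeg_singleton[OF poly \<open>{a} \<in> Y\<close>] by auto
  ultimately show ?thesis
    unfolding facet_iff_hdeg[OF poly] using assms hdeg_singleton[OF poly \<open>{a} \<in> Y\<close>] by simp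
qed

lemma edge_signs:
  assumes F: "F \<in> Y" "hdeg Y F = 2" "F = {p, q}" "p \<noteq> q"
  shows "\<epsilon> F {p} = - \<epsilon> F {q}"
proof -
  have pq: "{p} \<in> Y" "{q} \<in> Y" using polyhedral_finite(4)[OF poly F(1)] F(3) by auto
  have "(\<Sum>H\<in>{{p}, {q}}. \<epsilon> F H * \<epsilon> H {}) = (\<Sum>H\<in>Y. \<epsilon> F H * \<epsilon> H {})"
  proof (rule sum.mono_neutral_left[OF finX])
    show "\<forall>H\<in>Y - {{p}, {q}}. \<epsilon> F H * \<epsilon> H {} = 0"
    proof
      fix H assume H: "H \<in> Y - {{p}, {q}}"
      have "\<not> facet Y F H"
      proof
        assume f: "facet Y F H"
        then have "hdeg Y H = 1" "H \<subseteq> F" using facet_hdeg[OF poly f] F(2) facetD[OF f] by auto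
        then show False using H hdeg_eq_1_iff[OF poly, of H] F(3) by auto
      qed
      then show "\<epsilon> F H * \<epsilon> H {} = 0" using incidence_nonfacet[OF inc F(1), of H] H by simp
    qed
  qed (use pq in auto)
  then have "\<epsilon> F {p} * \<epsilon> {p} {} + \<epsilon> F {q} * \<epsilon> {q} {} = 0"
    using incidence_sum[OF inc F(1) polyhedral_finite(3)[OF poly]] F(4) by simp
  then show ?thesis using vertex_sign pq by simp
qed

lemma edge_boundary:
  assumes F: "F \<in> Y" "hdeg Y F = 2" "F = {p, q}" "p \<noteq> q"
  shows "bdry Y \<epsilon> (\<lambda>G. if G = F then of_int (\<epsilon> F {q}) else 0 :: 'k)
    = (\<lambda>G. (if G = {q} then 1 else 0) - (if G = {p} then 1 else 0))"
proof
  fix G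
  have sq: "of_int (\<epsilon> F {q}) * of_int (\<epsilon> F {q}) = (1 :: 'k)"
    using incidence_facet[OF inc edge_facet[OF F(1,2), of q]] F(3) by auto
  have "facet Y F G \<longleftrightarrow> G = {p} \<or> G = {q}"
  proof
    assume f: "facet Y F G"
    then have "hdeg Y G = 1" "G \<subseteq> F" "G \<in> Y" using facet_hdeg[OF poly f] F(2) facetD[OF f] by auto
    then show "G = {p} \<or> G = {q}" using hdeg_eq_1_iff[OF poly, of G] F(3) by auto
  qed (use edge_facet[OF F(1,2)] F(3) in auto)
  then show "bdry Y \<epsilon> (\<lambda>G. if G = F then of_int (\<epsilon> F {q}) else 0 :: 'k) G
    = (if G = {q} then 1 else 0) - (if G = {p} then 1 else 0)"
    unfolding bdry_single[OF finX F(1)] using edge_signs[OF F] sq F(4) by auto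
qed

text \<open>Neighbours in the grid have an lcm of degree d + 1, and exactness below it joins them by
  edges whose labels divide it. A path in the grid from a to a' can be kept below b.\<close>

lemma linear_path:
  assumes "size a = d" "size a' = d" "a \<subseteq># b" "a' \<subseteq># b"
  shows "\<exists>w\<in>chains_le Y id b 2. (\<forall>F. w F \<noteq> 0 \<longrightarrow> size (face_label id F) \<le> d + 1) \<and>
    bdry Y \<epsilon> w = (\<lambda>G. (if G = {a'} then 1 else 0) - (if G = {a} then 1 else 0 :: 'k))"
    (is "?P a a'")
proof (rule grid_connected[where P = ?P and d = d and m = b])
  show "?P x x" for x
    by (rule bexI[of _ "\<lambda>_. 0"]) (auto simp: chains_le_zero bdry_def)
  fix x y z assume P: "?P x y" "?P y z"
  obtain v where v: "v \<in> chains_le Y id b 2" "\<forall>F. v F \<noteq> 0 \<longrightarrow> size (face_label id F) \<le> d + 1"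
    "bdry Y \<epsilon> v = (\<lambda>G. (if G = {y} then 1 else 0) - (if G = {x} then 1 else 0 :: 'k))"
    using P(1) by (elim bexE conjE)
  obtain w where w: "w \<in> chains_le Y id b 2" "\<forall>F. w F \<noteq> 0 \<longrightarrow> size (face_label id F) \<le> d + 1"
    "bdry Y \<epsilon> w = (\<lambda>G. (if G = {z} then 1 else 0) - (if G = {y} then 1 else 0 :: 'k))"
    using P(2) by (elim bexE conjE)
  show "?P x z"
  proof (intro bexI[of _ "\<lambda>F. v F + w F"] conjI allI impI)
    fix F assume "v F + w F \<noteq> 0"
    then have "v F \<noteq> 0 \<or> w F \<noteq> 0" by auto
    then show "size (face_label id F) \<le> d + 1" using v(2) w(2) by blast
  next
    show "bdry Y \<epsilon> (\<lambda>F. v F + w F) = (\<lambda>G. (if G = {z} then 1 else 0) - (if G = {x} then 1 else 0 :: 'k))"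
      unfolding bdry_add v(3) w(3) by auto
  qed (rule chains_le_add[OF v(1) w(1)])
next
  fix u s t assume st: "s \<noteq> t" "add_mset s u \<subseteq># b" "add_mset t u \<subseteq># b" and u: "size u + 1 = d"
  define m where "m = add_mset s (add_mset t u)"
  have mb: "m \<subseteq># b"
    unfolding subseteq_mset_def
  proof
    fix v show "count m v \<le> count b v"
      using mset_subset_eq_count[OF st(2), of v] mset_subset_eq_count[OF st(3), of v] st(1) by (auto simp: m_def)
  qed
  have v: "{add_mset t u} \<in> Y" "{add_mset s u} \<in> Y" using u vertex_mem by auto
  have le: "id (add_mset t u) \<subseteq># m" "id (add_mset s u) \<subseteq># m" by (auto simp: m_def)
  obtain w where w: "w \<in> chains_le Y id m (1 + 1)"
    "bdry Y \<epsilon> w = (\<lambda>G. (if G = {add_mset t u} then 1 else 0) - (if G = {add_mset s u} then 1 else 0 :: 'k))"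
    by (rule cycle_boundary[OF order_refl vertex_difference[OF v le]])
  have "size (face_label id F) \<le> d + 1" if "w F \<noteq> 0" for F
  proof -
    have "face_label id F \<subseteq># m" using w(1) that by (auto simp: chains_le_def)
    from size_mset_mono[OF this] show ?thesis using u by (simp add: m_def)
  qed
  moreover have "w \<in> chains_le Y id b 2"
    using w(1) mb subset_mset.order_trans by (fastforce simp: chains_le_def)
  ultimately show "?P (add_mset s u) (add_mset t u)" using w(2) by blast
qed (use assms in auto)

text \<open>An edge whose label has larger degree could be closed to a cycle by edges with labels of
  degree at most d + 1. This cycle would contain the edge with the bound itself as its
  label.\<close>

lemma edge_label_size:
  assumes F: "F \<in> Y" "hdeg Y F = 2"
  shows "size (face_label id F) = d + 1"
proof (rule ccontr)
  assume ne: "size (face_label id F) \<noteq> d + 1"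
  let ?b = "face_label id F"
  obtain p q where pq: "F = {p, q}" "p \<noteq> q" "size p = d" "size q = d" by (rule edge_pair[OF F])
  have le: "p \<subseteq># ?b" "q \<subseteq># ?b" using face_label_upper[OF fin[OF F(1)], of _ id] pq(1) by auto
  have "p \<noteq> ?b"
  proof
    assume "p = ?b"
    then have "q \<subseteq># p" using le by simp
    then show False using pq subset_mset_size_eq by metis
  qed
  then have "d < size ?b" using le(1) mset_subset_size[of p ?b] pq(3) by (simp add: subset_mset.less_le)
  then have big: "d + 1 < size ?b" using ne by simp
  obtain w where w: "w \<in> chains_le Y id ?b 2" "\<forall>F. w F \<noteq> 0 \<longrightarrow> size (face_label id F) \<le> d + 1"
    "bdry Y \<epsilon> w = (\<lambda>G. (if G = {q} then 1 else 0) - (if G = {p} then 1 else 0 :: 'k))"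
    using linear_path[OF pq(3,4) le] by (elim bexE conjE)
  let ?e = "\<lambda>G. if G = F then of_int (\<epsilon> F {q}) else 0 :: 'k"
  let ?z = "\<lambda>G. ?e G + (- 1) * w G"
  have "?z \<in> chains_le Y id ?b 2"
    using F w(1) by (intro chains_le_add chains_le_scale chains_le_single) auto
  moreover have "bdry Y \<epsilon> ?z = (\<lambda>_. 0)"
    unfolding bdry_add bdry_scale edge_boundary[OF F pq(1,2)] w(3) by auto
  moreover have "?z F \<noteq> 0"
  proof -
    have "w F = 0" using w(2)[rule_format, of F] big by auto
    then show ?thesis using incidence_facet[OF inc edge_facet[OF F, of q]] pq(1) by auto
  qed
  ultimately show False using cycle_avoids_top_label[of 2 ?z ?b F] by simp
qed

lemma edge_is_grid_edge:
  assumes F: "F \<in> Y" "hdeg Y F = 2"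
  shows "\<exists>u t. size u + 1 = d \<and> F = edge u t"
proof -
  obtain p q where pq: "F = {p, q}" "p \<noteq> q" "size p = d" "size q = d" by (rule edge_pair[OF F])
  have "p \<union># q \<subseteq># face_label id F"
    using face_label_upper[OF fin[OF F(1)], of _ id] pq(1) by simp
  then have le: "size (p \<union># q) \<le> d + 1" using size_mset_mono edge_label_size[OF F] by metis
  have "p \<noteq> p \<union># q"
  proof
    assume eq: "p = p \<union># q"
    have "q \<subseteq># p \<union># q" by simp
    then have "q \<subseteq># p" by (simp only: eq[symmetric])
    then have "q = p" by (rule subset_mset_size_eq) (simp add: pq)
    then show False using pq(2) by simp
  qed
  moreover have "p \<subseteq># p \<union># q" by simp
  ultimately have "d < size (p \<union># q)" using mset_subset_size[of p "p \<union># q"] pq(3) by (simp add: subset_mset.less_le)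
  then have "size (p \<union># q) = d + 1" using le by linarith
  moreover have "p \<in> monomials d" "q \<in> monomials d" using pq by (simp_all add: monomials_def)
  ultimately have "F \<in> Gamma_edges d"
    unfolding Gamma_edges_def by (intro CollectI exI conjI) (rule pq(1))
  then obtain u t where "F = edge u t" "size u + 1 = d"
    unfolding Gamma_edges_eq mem_Collect_eq by (elim exE conjE)
  then show ?thesis by (intro exI conjI)
qed

text \<open>An edge at a with label dividing b has a label of degree d + 1, the degree of b, and
  hence the label b.\<close>

lemma edge_through_vertex:
  assumes a: "size a = d" "size a' = d" "a \<noteq> a'" "a \<subseteq># b" "a' \<subseteq># b" and b: "size b = d + 1"
  shows "\<exists>u t. size u + 1 = d \<and> edge u t \<in> Y \<and> a \<in> edge u t \<and> edge_label u t = b"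
proof -
  obtain F where F: "F \<in> Y" "hdeg Y F = 2" "a \<in> F" "face_label id F \<subseteq># b"
    using vertex_edge[OF a] by blast
  obtain u t where ut: "size u + 1 = d" "F = edge u t" using edge_is_grid_edge[OF F(1,2)] by blast
  have "edge_label u t = b"
    using F(4) b ut edge_label_size[OF F(1,2)] by (intro subset_mset_size_eq) (auto simp: face_label_id_edge)
  then show ?thesis using F ut by blast
qed

lemma edge_mem_hdeg:
  assumes "edge u t \<in> Y" "size u + 1 = d" shows "hdeg Y (edge u t) = 2"
proof -
  let ?a = "add_mset (nx t) u"
  have "facet Y (edge u t) {?a}"
    unfolding facet_def
  proof (intro conjI)
    show "{?a} \<in> Y" using assms vertex_mem by simp
    show "{?a} \<subset> edge u t" by (auto simp: edge_def add_mset_left_eq_iff)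
    show "\<not> (\<exists>H\<in>Y. {?a} \<subset> H \<and> H \<subset> edge u t)" by (auto simp: edge_def)
  qed (use assms in auto)
  from facet_hdeg[OF poly this] show ?thesis
    using hdeg_singleton[OF poly, of ?a] vertex_mem assms by simp
qed

text \<open>Exactness below the label requires an edge with this label at one of the two ends. As t
  has exponent 0 in the label, that edge can only be \<open>(u, t)\<close>.\<close>

lemma boundary_edge_mem:
  assumes u: "size u + 1 = d" and t: "t \<notin># u"
  shows "edge u t \<in> Y"
proof -
  have "\<exists>u' t'. size u' + 1 = d \<and> edge u' t' \<in> Y \<and> add_mset (nx t) u \<in> edge u' t' \<and> edge_label u' t' = edge_label u t"
    by (rule edge_through_vertex[where a' = "add_mset (pv t) u"]) (use u in \<open>auto simp: edge_label_def add_mset_left_eq_iff\<close>)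
  then obtain u' t' where ut': "edge u' t' \<in> Y" "edge_label u' t' = edge_label u t" by blast
  have "count (edge_label u' t') t = 0" unfolding ut'(2) using t by (simp add: count_edge_label not_in_iff)
  then have "t' = t" by (simp add: count_edge_label split: if_splits)
  with ut' show ?thesis by (simp add: edge_label_def)
qed

text \<open>The sides s and t of the down triangle w meet in the vertex w * s * t, which the third
  side avoids. With both missing, no edge below w * xyz would end at this vertex, although other
  vertices lie below w * xyz.\<close>

lemma down_edge_missing_unique:
  assumes w: "size w + 2 = d" and miss: "edge (add_mset s w) s \<notin> Y" "edge (add_mset t w) t \<notin> Y"
  shows "s = t"
proof (rule ccontr)
  assume st: "s \<noteq> t"
  obtain r where r: "r \<noteq> s" "r \<noteq> t"
    by (cases s; cases t; auto intro: that[of Vx] that[of Vy] that[of Vz])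
  let ?a = "add_mset s (add_mset t w)" and ?a' = "add_mset s (add_mset r w)"
  have b: "w + xyz_mon = add_mset s (add_mset t (add_mset r w))"
    using xyz_mon_eq[of s] xyz_cases[of t s] xyz_cases[of r s] st r by (auto simp: add_mset_commute)
  have ne: "?a \<noteq> ?a'" using r by (simp add: add_mset_left_eq_iff)
  have le: "?a \<subseteq># w + xyz_mon" "?a' \<subseteq># w + xyz_mon" unfolding b by simp_all
  have "\<exists>u v. size u + 1 = d \<and> edge u v \<in> Y \<and> ?a \<in> edge u v \<and> edge_label u v = w + xyz_mon"
    by (rule edge_through_vertex[OF _ _ ne le]) (use w in simp_all)
  then obtain u v where uv: "size u + 1 = d" "edge u v \<in> Y" "?a \<in> edge u v" "edge_label u v = w + xyz_mon" by blast
  have u: "u = add_mset v w"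
    using uv(4) unfolding xyz_mon_eq[of v] edge_label_def by (simp add: add_mset_commute)
  obtain k where k: "k \<noteq> v" "?a = add_mset k u" using uv(3) unfolding mem_edge_iff by blast
  have "count ?a v = count (add_mset k (add_mset v w)) v" by (simp only: k(2) u)
  then have "v \<noteq> r" using r by (auto split: if_splits)
  then have "v = s \<or> v = t" using st r xyz_cases[of v s] xyz_cases[of t s] xyz_cases[of r s] by auto
  then show False using miss uv(2) u by auto
qed

text \<open>All three sides of w have the label w * xyz, so the cycle around w would consist of
  edges whose label is the bound.\<close>

lemma down_edge_missing:
  assumes w: "size w + 2 = d"
  shows "\<exists>t. edge (add_mset t w) t \<notin> Y"
proof (rule ccontr)
  assume "\<not> ?thesis"
  then have e: "edge (add_mset t w) t \<in> Y" "hdeg Y (edge (add_mset t w) t) = 2" for t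
    using edge_mem_hdeg[of "add_mset t w" t] w by auto
  let ?e = "\<lambda>t. edge (add_mset t w) t"
  let ?h = "\<lambda>t. add_mset (pv t) (add_mset t w)" and ?l = "\<lambda>t. add_mset (nx t) (add_mset t w)"
  have pair: "?e t = {?l t, ?h t}" "?l t \<noteq> ?h t" for t by (auto simp: edge_def add_mset_left_eq_iff)
  \<comment> \<open>The coefficients make each side run in its standard direction, so the ends
    cancel around the triangle.\<close>
  let ?z = "\<lambda>G. \<Sum>t\<in>UNIV. (if G = ?e t then of_int (\<epsilon> (?e t) {?h t}) else 0 :: 'k)"
  have label: "face_label id (?e t) = w + xyz_mon" for t
    unfolding face_label_id_edge xyz_mon_eq[of t] edge_label_def by simp
  have "?z \<in> chains_le Y id (w + xyz_mon) 2"
    using e label by (intro chains_le_sum chains_le_single) auto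
  moreover have "bdry Y \<epsilon> ?z = (\<lambda>_. 0)"
  proof
    fix G
    have "bdry Y \<epsilon> ?z G = (\<Sum>t\<in>UNIV. (if G = {?h t} then 1 else 0) - (if G = {?l t} then 1 else 0))"
      unfolding bdry_sum by (intro sum.cong refl) (simp only: edge_boundary[OF e pair])
    also have "\<dots> = 0" unfolding UNIV_xyz[of Vx] by (simp add: add_mset_commute)
    finally show "bdry Y \<epsilon> ?z G = 0" .
  qed
  moreover have "?z (?e Vx) \<noteq> 0"
  proof -
    have eq: "?z (?e Vx) = of_int (\<epsilon> (?e Vx) {?h Vx})"
      unfolding UNIV_xyz[of Vx] by (simp add: edge_eq_iff)
    have "?h Vx \<in> ?e Vx" unfolding pair(1) by simp
    from incidence_facet[OF inc edge_facet[OF e this]]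
    have "of_int (\<epsilon> (?e Vx) {?h Vx}) \<noteq> (0 :: 'k)" by auto
    then show ?thesis unfolding eq .
  qed
  ultimately show False using cycle_avoids_top_label[of 2 ?z "w + xyz_mon" "?e Vx"] label by simp
qed

text \<open>The removed edges read off from the resolution; at a monomial of degree d - 2 exactly
  one variable qualifies, so the \<open>SOME\<close> is no real choice there.\<close>

definition missing :: "xyz multiset \<Rightarrow> xyz" where
  "missing w = (SOME t. edge (add_mset t w) t \<notin> Y)"

lemma edge_mem_iff:
  assumes u: "size u + 1 = d"
  shows "edge u t \<in> Y \<longleftrightarrow> \<not> owns missing u t"
proof (cases "t \<in># u")
  case True
  define w where "w = u - {#t#}"
  have uw: "u = add_mset t w" and w: "size w + 2 = d" using True u by (auto simp: w_def size_Suc_Diff1)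
  have m: "edge (add_mset (missing w) w) (missing w) \<notin> Y"
    unfolding missing_def by (rule someI_ex[OF down_edge_missing[OF w]])
  have "edge u t \<notin> Y \<longleftrightarrow> missing w = t"
    using m down_edge_missing_unique[OF w m] uw by blast
  moreover have "owns missing u t \<longleftrightarrow> missing w = t" by (simp add: owns_def uw)
  ultimately show ?thesis by blast
next
  case False
  then show ?thesis using boundary_edge_mem[OF u] by (simp add: owns_def)
qed

sublocale grid_skeleton d missing Y \<epsilon> E
proof
  show "polyhedral_complex E Y" by (rule poly)
  show "incidence_function Y \<epsilon>" by (rule inc)
  show "{F \<in> Y. hdeg Y F = 1} = {{a} | a. size a = d}"
    using hdeg_eq_1_iff[OF poly] vertex_mem hdeg_singleton[OF poly] by auto
  show "{F \<in> Y. hdeg Y F = 2} = {edge u t | u t. size u + 1 = d \<and> \<not> owns missing u t}"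
    using edge_is_grid_edge edge_mem_iff edge_mem_hdeg by blast
qed

section \<open>The regions forced by minimality\<close>

text \<open>The boundary of the region v as a chain in the signs of the given \<epsilon>, formed
  before the region is known to be a cell. The sum over all edges merely looks up the parameters of
  F.\<close>

definition region_boundary :: "xyz multiset \<Rightarrow> xyz multiset set \<Rightarrow> 'k" where
  "region_boundary v F = (\<Sum>(u, t)\<in>{u. size u + 1 = d} \<times> UNIV.
     if F = edge u t \<and> \<not> owns missing u t then of_int (orient u t * region_coeff missing v u t) else 0)"

lemma region_boundary_edge:
  assumes "size u + 1 = d" "\<not> owns missing u t"
  shows "region_boundary v (edge u t) = of_int (orient u t * region_coeff missing v u t)"
proof -
  let ?S = "{u :: xyz multiset. size u + 1 = d} \<times> (UNIV :: xyz set)"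
  have "finite {u :: xyz multiset. size u + 1 = d}" by (rule finite_subset[OF _ finite_multisets_size[of "d - 1"]]) auto
  then have fin: "finite ?S" by (rule finite_cartesian_product) (rule finite_xyz_set)
  have "region_boundary v (edge u t) = (\<Sum>x\<in>?S. if x = (u, t) then of_int (orient u t * region_coeff missing v u t) else 0)"
    unfolding region_boundary_def
  proof (intro sum.cong refl)
    fix x :: "xyz multiset \<times> xyz"
    obtain a b where x: "x = (a, b)" by (cases x)
    show "(case x of (u', t') \<Rightarrow> if edge u t = edge u' t' \<and> \<not> owns missing u' t'
        then of_int (orient u' t' * region_coeff missing v u' t') else 0)
      = (if x = (u, t) then of_int (orient u t * region_coeff missing v u t) else (0 :: 'k))"
      unfolding x prod.case edge_eq_iff using assms(2) by auto
  qed
  then show ?thesis using fin assms by simp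
qed

lemma region_boundary_nonzeroE:
  assumes "region_boundary v F \<noteq> 0"
  obtains u t where "size u + 1 = d" "\<not> owns missing u t" "F = edge u t"
proof -
  obtain x where "x \<in> {u :: xyz multiset. size u + 1 = d} \<times> (UNIV :: xyz set)"
    "(case x of (u, t) \<Rightarrow> if F = edge u t \<and> \<not> owns missing u t then of_int (orient u t * region_coeff missing v u t) else 0) \<noteq> (0 :: 'k)"
    using assms unfolding region_boundary_def by (rule sum.not_neutral_contains_not_neutral)
  then show ?thesis using that[of "fst x" "snd x"] by (auto split: if_splits)
qed

lemma region_boundary_chain:
  assumes v: "size v + 1 = d"
  shows "region_boundary v \<in> chains_le Y id (v + xyz_mon) 2"
  unfolding chains_le_def
proof (intro CollectI allI impI)
  fix F assume nz: "region_boundary v F \<noteq> 0"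
  obtain u t where ut: "size u + 1 = d" "\<not> owns missing u t" "F = edge u t"
    by (rule region_boundary_nonzeroE[OF nz])
  then have "region_coeff missing v u t \<noteq> 0" using nz region_boundary_edge[OF ut(1,2), of v] by auto
  then have "edge u t \<subseteq> region missing v" using edge_subset_region_iff[of u v t missing] ut(1) v by simp
  then have "face_label id (edge u t) \<subseteq># face_label id (region missing v)"
    by (rule face_label_mono[OF finite_region])
  then show "F \<in> Y \<and> hdeg Y F = 2 \<and> face_label id F \<subseteq># v + xyz_mon"
    using edge_cell[OF ut(1,2)] ut(3) by (simp add: face_label_id_region)
qed

lemma region_boundary_flow:
  assumes "size v + 1 = d"
  shows "edge_flow (region_boundary v) = (\<lambda>u t. of_int (region_coeff missing v u t))"
proof (intro ext)
  fix u t
  show "edge_flow (region_boundary v) u t = of_int (region_coeff missing v u t)"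
  proof (cases "size u + 1 = d \<and> \<not> owns missing u t")
    case True
    then show ?thesis
      using orient_squared[of u t, where 'k = 'k] by (simp add: edge_flow_def region_boundary_edge flip: mult.assoc)
  next
    case False
    then have "region_coeff missing v u t = 0"
      using region_coeff_size[of missing v u t] region_coeff_owns[of missing u t v] assms by auto
    moreover have "edge_flow (region_boundary v) u t = 0"
      unfolding edge_flow_def using False by (simp only: if_False)
    ultimately show ?thesis by simp
  qed
qed

lemma region_boundary_cycle:
  assumes v: "size v + 1 = d"
  shows "bdry Y \<epsilon> (region_boundary v) = (\<lambda>_. 0)"
proof (subst edge_cycle_iff)
  show "region_boundary v F \<noteq> 0 \<Longrightarrow> F \<in> Y \<and> hdeg Y F = 2" for F
    using region_boundary_chain[OF v] by (auto simp: chains_le_def)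
  show "conserved (edge_flow (region_boundary v))"
    unfolding region_boundary_flow[OF v] by (rule conserved_region_coeff)
qed

lemma edge_chain_eqI:
  fixes y z :: "xyz multiset set \<Rightarrow> 'k"
  assumes y: "\<And>F. y F \<noteq> 0 \<Longrightarrow> F \<in> Y \<and> hdeg Y F = 2" and z: "\<And>F. z F \<noteq> 0 \<Longrightarrow> F \<in> Y \<and> hdeg Y F = 2"
    and eq: "\<And>u t. size u + 1 = d \<Longrightarrow> edge_flow y u t = edge_flow z u t"
  shows "y = z"
proof
  fix F show "y F = z F"
  proof (cases "F \<in> Y \<and> hdeg Y F = 2")
    case True
    then obtain u t where ut: "size u + 1 = d" "\<not> owns missing u t" "F = edge u t" using hdeg2_cases by blast
    have "of_int (orient u t) * y F = of_int (orient u t) * z F"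
      using eq[OF ut(1), of t] ut by (simp add: edge_flow_def)
    then show ?thesis using orient_values(1)[OF ut(1,2)] by auto
  next
    case False
    then show ?thesis using y z by metis
  qed
qed

text \<open>The boundary of a 2-cell is a cycle of edges, and by the analysis of flows such a cycle
  is a combination of region boundaries below the label of the cell.\<close>

lemma region_face_boundary:
  assumes F: "F \<in> Y" "hdeg Y F = 3"
  shows "\<exists>f. (\<forall>u. f u \<noteq> 0 \<longrightarrow> size u + 1 = d \<and> u + xyz_mon \<subseteq># face_label id F) \<and>
    bdry Y \<epsilon> (\<lambda>G. if G = F then 1 else 0 :: 'k) = (\<lambda>G. \<Sum>u\<in>{u. size u + 1 = d}. f u * region_boundary u G)"
proof -
  let ?z = "bdry Y \<epsilon> (\<lambda>G. if G = F then 1 else 0 :: 'k)"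
  let ?U = "{u :: xyz multiset. size u + 1 = d}"
  have z: "?z \<in> chains_le Y id (face_label id F) 2"
    using F by (intro bdry_face_chain) auto
  show ?thesis
  proof (rule edge_cycle_regions[OF z bdry_bdry_face[OF F(1)]])
    fix f assume f: "\<And>u. f u \<noteq> 0 \<Longrightarrow> size u + 1 = d \<and> u + xyz_mon \<subseteq># face_label id F"
      "\<And>u t. size u + 1 = d \<Longrightarrow> edge_flow ?z u t = f u - (if t \<in># u then f (owner missing (u - {#t#})) else 0)"
    have "?z = (\<lambda>G. \<Sum>u\<in>?U. f u * region_boundary u G)"
    proof (rule edge_chain_eqI)
      show "?z G \<noteq> 0 \<Longrightarrow> G \<in> Y \<and> hdeg Y G = 2" for G using z by (auto simp: chains_le_def)
      show "G \<in> Y \<and> hdeg Y G = 2" if "(\<Sum>u\<in>?U. f u * region_boundary u G) \<noteq> 0" for G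
      proof -
        obtain u where "u \<in> ?U" "f u * region_boundary u G \<noteq> 0"
          using \<open>(\<Sum>u\<in>?U. f u * region_boundary u G) \<noteq> 0\<close> by (rule sum.not_neutral_contains_not_neutral)
        then show ?thesis using region_boundary_chain[of u] by (auto simp: chains_le_def)
      qed
      fix u :: "xyz multiset" and t assume u: "size u + 1 = d"
      have "edge_flow (\<lambda>G. \<Sum>v\<in>?U. f v * region_boundary v G) u t = (\<Sum>v\<in>?U. f v * edge_flow (region_boundary v) u t)"
      proof (cases "size u + 1 = d \<and> \<not> owns missing u t")
        case True
        then have "edge_flow y u t = of_int (orient u t) * y (edge u t)" for y :: "xyz multiset set \<Rightarrow> 'k"
          by (simp add: edge_flow_def)
        then show ?thesis by (simp add: sum_distrib_left mult.left_commute)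
      next
        case False
        have "edge_flow y u t = 0" for y :: "xyz multiset set \<Rightarrow> 'k"
          unfolding edge_flow_def using False by (simp only: if_False)
        then show ?thesis by simp
      qed
      also have "\<dots> = (\<Sum>v\<in>?U. f v * of_int (region_coeff missing v u t))"
        by (intro sum.cong refl) (simp add: region_boundary_flow)
      also have "\<dots> = f u - (if t \<in># u then f (owner missing (u - {#t#})) else 0)"
        by (rule sum_region_coeff[OF u])
      finally show "edge_flow ?z u t = edge_flow (\<lambda>G. \<Sum>v\<in>?U. f v * region_boundary v G) u t"
        using f(2)[OF u] by simp
    qed
    with f(1) show ?thesis by blast
  qed
qed

text \<open>As for edges: each region boundary that occurs in the boundary of F has a filling with
  labels of degree at most d + 2. If the label of F were larger, F minus these fillings would be a
  cycle containing F with the bound as its label.\<close>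

lemma region_face_label_size:
  assumes F: "F \<in> Y" "hdeg Y F = 3"
  shows "size (face_label id F) = d + 2"
proof -
  let ?b = "face_label id F" and ?U = "{u :: xyz multiset. size u + 1 = d}"
  have "F \<noteq> {}" using F(2) hdeg_empty[OF poly] by auto
  then obtain G where f: "facet Y F G"
    using exists_facet_above[OF finX F(1) polyhedral_finite(3)[OF poly]] by blast
  have "hdeg Y G = 2" "G \<in> Y" using facet_hdeg[OF poly f] F(2) facetD[OF f] by auto
  then have "size (face_label id G) = d + 1" by (intro edge_label_size)
  moreover have "face_label id G \<subseteq># ?b" by (rule facet_label_mono[OF _ f]) (use fin in auto)
  ultimately have ge: "d + 2 \<le> size ?b"
    using label_neq[OF f] mset_subset_size[of "face_label id G" ?b] by (simp add: subset_mset.less_le)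
  show ?thesis
  proof (rule ccontr)
    assume "size ?b \<noteq> d + 2"
    with ge have big: "d + 2 < size ?b" by simp
    obtain f where f: "\<forall>u. f u \<noteq> 0 \<longrightarrow> size u + 1 = d \<and> u + xyz_mon \<subseteq># ?b"
      "bdry Y \<epsilon> (\<lambda>G. if G = F then 1 else 0 :: 'k) = (\<lambda>G. \<Sum>u\<in>?U. f u * region_boundary u G)"
      using region_face_boundary[OF F] by (elim exE conjE)
    have "\<forall>u\<in>?U. \<exists>y. y \<in> chains_le Y id (u + xyz_mon) 3 \<and> bdry Y \<epsilon> y = region_boundary u"
    proof
      fix u :: "xyz multiset" assume "u \<in> ?U"
      then have u: "size u + 1 = d" by simp
      obtain y where "y \<in> chains_le Y id (u + xyz_mon) (2 + 1)" "bdry Y \<epsilon> y = region_boundary u"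
        by (rule cycle_boundary[OF _ region_boundary_chain[OF u] region_boundary_cycle[OF u]]) auto
      then show "\<exists>y. y \<in> chains_le Y id (u + xyz_mon) 3 \<and> bdry Y \<epsilon> y = region_boundary u"
        by (intro exI[of _ y]) simp
    qed
    from bchoice[OF this] obtain y where y0: "\<forall>u\<in>?U. y u \<in> chains_le Y id (u + xyz_mon) 3 \<and> bdry Y \<epsilon> (y u) = region_boundary u" ..
    have y: "y u \<in> chains_le Y id (u + xyz_mon) 3" "bdry Y \<epsilon> (y u) = region_boundary u" if "u \<in> ?U" for u
      using y0[rule_format, OF that] by simp_all
    let ?z = "\<lambda>G. (if G = F then 1 else 0) + - 1 * (\<Sum>u\<in>?U. f u * y u G)"
    have fy: "(\<lambda>G. f u * y u G) \<in> chains_le Y id ?b 3" if u: "u \<in> ?U" for u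
    proof (cases "f u = 0")
      case True
      then show ?thesis using chains_le_zero[of Y id ?b 3] by simp
    next
      case False
      then have "u + xyz_mon \<subseteq># ?b" using f(1) by blast
      then have "y u \<in> chains_le Y id ?b 3"
        using y(1)[OF u] unfolding chains_le_def by (auto intro: subset_mset.order_trans)
      then show ?thesis by (rule chains_le_scale)
    qed
    have "(\<lambda>G. \<Sum>u\<in>?U. f u * y u G) \<in> chains_le Y id ?b 3" by (rule chains_le_sum) (rule fy)
    moreover have "(\<lambda>G. if G = F then 1 else 0 :: 'k) \<in> chains_le Y id ?b 3"
      by (rule chains_le_single[OF F]) simp
    ultimately have "?z \<in> chains_le Y id ?b 3" by (intro chains_le_add chains_le_scale)
    moreover have "bdry Y \<epsilon> ?z = (\<lambda>_. 0)"
    proof -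
      have "(\<Sum>u\<in>?U. f u * bdry Y \<epsilon> (y u) G) = (\<Sum>u\<in>?U. f u * region_boundary u G)" for G
        by (intro sum.cong refl) (simp add: y(2))
      then show ?thesis
        unfolding bdry_add bdry_scale bdry_sum f(2) by simp
    qed
    moreover have "?z F \<noteq> 0"
    proof -
      have "f u * y u F = 0" if u: "u \<in> ?U" for u
      proof -
        have "y u F = 0"
        proof (rule ccontr)
          assume "y u F \<noteq> 0"
          then have "?b \<subseteq># u + xyz_mon" using y(1)[OF u] by (auto simp: chains_le_def)
          from size_mset_mono[OF this] show False using big u by simp
        qed
        then show ?thesis by simp
      qed
      then have "(\<Sum>u\<in>?U. f u * y u F) = 0" by (intro sum.neutral ballI)
      then show ?thesis by simp
    qed
    ultimately show False using cycle_avoids_top_label[of 3 ?z ?b F] by simp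
  qed
qed

text \<open>The label of F has degree d + 2, so only the v with v * xyz equal to it can contribute
  to the boundary of F, and \<kappa> is its coefficient. The facets of F are then the boundary edges
  of the region v, and a polygon is the union of its sides.\<close>

lemma region_face:
  assumes F: "F \<in> Y" "hdeg Y F = 3"
  shows "\<exists>v \<kappa>. size v + 1 = d \<and> \<kappa> \<noteq> (0 :: 'k) \<and> F = region missing v \<and> (\<forall>u t. size u + 1 = d \<and> \<not> owns missing u t \<longrightarrow>
    of_int (\<epsilon> F (edge u t)) * of_int (orient u t) = \<kappa> * of_int (region_coeff missing v u t))"
proof -
  let ?U = "{u :: xyz multiset. size u + 1 = d}"
  have finU: "finite ?U" by (rule finite_subset[OF _ finite_multisets_size[of "d - 1"]]) auto
  obtain f where f: "\<forall>u. f u \<noteq> 0 \<longrightarrow> size u + 1 = d \<and> u + xyz_mon \<subseteq># face_label id F"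
    "bdry Y \<epsilon> (\<lambda>G. if G = F then 1 else 0 :: 'k) = (\<lambda>G. \<Sum>u\<in>?U. f u * region_boundary u G)"
    using region_face_boundary[OF F] by (elim exE conjE)
  have label: "u + xyz_mon = face_label id F" if "f u \<noteq> 0" for u
    using f(1)[rule_format, OF that] region_face_label_size[OF F] by (intro subset_mset_size_eq) auto
  have "F \<noteq> {}" using F(2) hdeg_empty[OF poly] by auto
  then obtain G where G: "facet Y F G"
    using exists_facet_above[OF finX F(1) polyhedral_finite(3)[OF poly]] by blast
  have "bdry Y \<epsilon> (\<lambda>G. if G = F then 1 else 0 :: 'k) G \<noteq> 0"
    unfolding bdry_single[OF finX F(1)] using G incidence_facet[OF inc G] by auto
  then obtain v where v: "v \<in> ?U" "f v * region_boundary v G \<noteq> 0"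
    unfolding f(2) by (rule sum.not_neutral_contains_not_neutral)
  then have fv: "f v \<noteq> 0" "size v + 1 = d" by auto
  have other: "f u = 0" if "u \<noteq> v" for u
  proof (rule ccontr)
    assume "f u \<noteq> 0"
    from label[OF this] label[OF fv(1), symmetric] have "u + xyz_mon = v + xyz_mon" by (rule trans)
    then show False using that by (simp only: add_right_cancel)
  qed
  have bd: "(if facet Y F H then of_int (\<epsilon> F H) else 0) = f v * region_boundary v H" for H
  proof -
    have "bdry Y \<epsilon> (\<lambda>G. if G = F then 1 else 0 :: 'k) H = (\<Sum>u\<in>?U. if u = v then f v * region_boundary v H else 0)"
      unfolding f(2) by (intro sum.cong refl) (use other in auto)
    then show ?thesis unfolding bdry_single[OF finX F(1)] using finU fv(2) by simp
  qed
  have facet_iff: "facet Y F H \<longleftrightarrow> region_boundary v H \<noteq> 0" for H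
    using bd[of H] fv(1) incidence_facet[OF inc, of F H] by (cases "facet Y F H") auto
  have facets: "{H. facet Y F H} = {edge u t | u t. region_coeff missing v u t \<noteq> 0}"
  proof (intro equalityI subsetI)
    fix H assume "H \<in> {H. facet Y F H}"
    then have nz: "region_boundary v H \<noteq> 0" using facet_iff by simp
    obtain u t where ut: "size u + 1 = d" "\<not> owns missing u t" "H = edge u t"
      by (rule region_boundary_nonzeroE[OF nz])
    then have "region_coeff missing v u t \<noteq> 0" using nz region_boundary_edge[OF ut(1,2), of v] by auto
    with ut show "H \<in> {edge u t | u t. region_coeff missing v u t \<noteq> 0}" by blast
  next
    fix H assume "H \<in> {edge u t | u t. region_coeff missing v u t \<noteq> 0}"
    then obtain u t where ut: "region_coeff missing v u t \<noteq> 0" "H = edge u t" by blast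
    then have u: "size u + 1 = d" "\<not> owns missing u t"
      using region_coeff_size[OF ut(1)] region_coeff_owns[of missing u t v] fv(2) by auto
    have "region_boundary v H \<noteq> 0"
      unfolding ut(2) region_boundary_edge[OF u]
      using ut(1) orient_values(1)[OF u] region_coeff_values[of missing v u t] by auto
    then show "H \<in> {H. facet Y F H}" using facet_iff by simp
  qed
  have "F = \<Union>{H. facet Y F H}" by (rule face_eq_Union_facets[OF poly F(1)]) (use F(2) in simp)
  \<comment> \<open>That the region is the union of its boundary edges is taken from the explicit
    complex, in which it is known to be a polygon.\<close>
  moreover have "region missing v = \<Union>{edge u t | u t. region_coeff missing v u t \<noteq> 0}"
  proof -
    have "region missing v = \<Union>{H. facet (cells d missing) (region missing v) H}"
      by (rule face_eq_Union_facets[OF polyhedral_cells])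
        (use fv(2) cells_hdeg_region[OF fv(2), of missing] in \<open>auto intro: cells_intros\<close>)
    also have "{H. facet (cells d missing) (region missing v) H} = {edge u t | u t. region_coeff missing v u t \<noteq> 0}"
    proof (intro equalityI subsetI)
      fix H assume "H \<in> {H. facet (cells d missing) (region missing v) H}"
      then have "facet (cells d missing) (region missing v) H" by simp
      then show "H \<in> {edge u t | u t. region_coeff missing v u t \<noteq> 0}"
      proof (cases rule: cells_facet_cases)
        case (region v' u t)
        then have "v = v'" using region_eq_iff[of missing v v'] fv(2) by simp
        with region show ?thesis by blast
      qed (auto simp: cell_shapes_distinct)
    next
      fix H assume "H \<in> {edge u t | u t. region_coeff missing v u t \<noteq> 0}"
      then show "H \<in> {H. facet (cells d missing) (region missing v) H}"
        using cells_facet_region[OF fv(2)] region_coeff_size by blast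
    qed
    finally show ?thesis .
  qed
  ultimately have "F = region missing v" using facets by simp
  moreover have "of_int (\<epsilon> F (edge u t)) * of_int (orient u t) = f v * of_int (region_coeff missing v u t)"
    if ut: "size u + 1 = d" "\<not> owns missing u t" for u t
  proof -
    have "(of_int (\<epsilon> F (edge u t)) :: 'k) = f v * region_boundary v (edge u t)"
    proof (cases "facet Y F (edge u t)")
      case True
      then show ?thesis using bd[of "edge u t"] by simp
    next
      case False
      then have "\<epsilon> F (edge u t) = 0" using incidence_nonfacet[OF inc F(1)] edge_cell[OF ut] by blast
      then show ?thesis using bd[of "edge u t"] False by simp
    qed
    then show ?thesis
      using orient_squared[OF ut, where 'k = 'k] by (simp add: region_boundary_edge[OF ut] mult.assoc mult.left_commute)
  qed
  ultimately show ?thesis using fv by (intro exI[of _ v] exI[of _ "f v"] conjI allI impI) simp_all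
qed

text \<open>The region boundary is filled below v * xyz. A 2-cell of the filling is a region v'
  whose label divides v * xyz, and equal degrees give v' = v.\<close>

lemma region_mem:
  assumes v: "size v + 1 = d"
  shows "region missing v \<in> Y \<and> hdeg Y (region missing v) = 3"
proof -
  obtain y where y: "y \<in> chains_le Y id (v + xyz_mon) (2 + 1)" "bdry Y \<epsilon> y = region_boundary v"
    by (rule cycle_boundary[OF _ region_boundary_chain[OF v] region_boundary_cycle[OF v]]) auto
  obtain u t where c: "region_coeff missing v u t \<noteq> 0" using region_coeff_exists by blast
  then have u: "size u + 1 = d" "\<not> owns missing u t"
    using region_coeff_size[OF c] region_coeff_owns[of missing u t v] v by auto
  have "bdry Y \<epsilon> y (edge u t) \<noteq> 0"
    unfolding y(2) region_boundary_edge[OF u]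
    using c orient_values(1)[OF u] region_coeff_values[of missing v u t] by auto
  then obtain F where "y F * (if facet Y F (edge u t) then of_int (\<epsilon> F (edge u t)) else 0) \<noteq> 0"
    unfolding bdry_def by (rule sum.not_neutral_contains_not_neutral)
  then have "y F \<noteq> 0" by auto
  then have F: "F \<in> Y" "hdeg Y F = 3" "face_label id F \<subseteq># v + xyz_mon"
    using y(1) by (auto simp: chains_le_def)
  obtain v' where v': "size v' + 1 = d" "F = region missing v'" using region_face[OF F(1,2)] by (elim exE conjE)
  have "v' \<subseteq># v" using F(3) unfolding v'(2) face_label_id_region by simp
  then have "v' = v" using v v'(1) by (intro subset_mset_size_eq) auto
  with F v' show ?thesis by simp
qed

lemma regions_eq: "{F \<in> Y. hdeg Y F = 3} = region missing ` {u. size u + 1 = d}"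
proof (intro equalityI subsetI)
  fix F assume "F \<in> {F \<in> Y. hdeg Y F = 3}"
  then have F: "F \<in> Y" "hdeg Y F = 3" by simp_all
  obtain v where "size v + 1 = d" "F = region missing v" using region_face[OF F] by (elim exE conjE)
  then show "F \<in> region missing ` {u. size u + 1 = d}" by blast
qed (use region_mem in auto)

text \<open>A cell of higher dimension has a face of dimension 3, whose boundary is a cycle of
  regions and hence 0. But a face has a nonzero sign on each of its facets.\<close>

lemma hdeg_le_3:
  assumes F: "F \<in> Y"
  shows "hdeg Y F \<le> 3"
proof (rule ccontr)
  assume "\<not> hdeg Y F \<le> 3"
  then obtain H where H: "H \<in> Y" "hdeg Y H = 4"
    using exists_face_of_hdeg[OF poly F, of 4] by auto
  let ?z = "bdry Y \<epsilon> (\<lambda>G. if G = H then 1 else 0 :: 'k)"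
  have z: "?z \<in> chains_le Y id (face_label id H) 3" using H by (intro bdry_face_chain) auto
  have "\<forall>v\<in>{v. size v + 1 = d}. \<exists>\<kappa>. \<kappa> \<noteq> (0 :: 'k) \<and> (\<forall>u t. size u + 1 = d \<and> \<not> owns missing u t \<longrightarrow>
    of_int (\<epsilon> (region missing v) (edge u t)) * of_int (orient u t) = \<kappa> * of_int (region_coeff missing v u t))"
  proof
    fix v assume "v \<in> {v :: xyz multiset. size v + 1 = d}"
    then have v: "size v + 1 = d" by simp
    note m = region_mem[OF v]
    obtain v' \<kappa> where *: "size v' + 1 = d" "\<kappa> \<noteq> (0 :: 'k)" "region missing v = region missing v'"
      "\<forall>u t. size u + 1 = d \<and> \<not> owns missing u t \<longrightarrow>
        of_int (\<epsilon> (region missing v) (edge u t)) * of_int (orient u t) = \<kappa> * of_int (region_coeff missing v' u t)"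
      using region_face[OF conjunct1[OF m] conjunct2[OF m]] by (elim exE conjE)
    have "v' = v" using region_eq_iff[of missing v v'] * v by simp
    then show "\<exists>\<kappa>. \<kappa> \<noteq> (0 :: 'k) \<and> (\<forall>u t. size u + 1 = d \<and> \<not> owns missing u t \<longrightarrow>
      of_int (\<epsilon> (region missing v) (edge u t)) * of_int (orient u t) = \<kappa> * of_int (region_coeff missing v u t))"
      using *(2,4) by (intro exI[of _ \<kappa>]) (simp only: simp_thms)
  qed
  from bchoice[OF this] obtain \<kappa> :: "xyz multiset \<Rightarrow> 'k" where
    \<kappa>0: "\<forall>v\<in>{v. size v + 1 = d}. \<kappa> v \<noteq> 0 \<and> (\<forall>u t. size u + 1 = d \<and> \<not> owns missing u t \<longrightarrow>
      of_int (\<epsilon> (region missing v) (edge u t)) * of_int (orient u t) = \<kappa> v * of_int (region_coeff missing v u t))" ..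
  have \<kappa>1: "\<kappa> v \<noteq> 0" if "size v + 1 = d" for v
    using \<kappa>0[THEN bspec, OF CollectI, OF that] by (rule conjunct1)
  have \<kappa>2: "of_int (\<epsilon> (region missing v) (edge u t)) * of_int (orient u t) = \<kappa> v * of_int (region_coeff missing v u t)"
    if "size v + 1 = d" "size u + 1 = d" "\<not> owns missing u t" for v u t
    using \<kappa>0[THEN bspec, OF CollectI, OF that(1), THEN conjunct2, rule_format, OF conjI, OF that(2,3)] .
  have "?z = (\<lambda>_. 0)"
  proof (rule region_cycle_zero[where \<kappa> = \<kappa>])
    show "{F \<in> Y. hdeg Y F = 3} = region missing ` {u. size u + 1 = d}" by (rule regions_eq)
    show "of_int (\<epsilon> (region missing v) (edge u t)) * of_int (orient u t) = \<kappa> v * of_int (region_coeff missing v u t)"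
      if "size v + 1 = d" "size u + 1 = d" "\<not> owns missing u t" for v u t
      using that by (rule \<kappa>2)
    show "\<kappa> v \<noteq> 0" if "size v + 1 = d" for v using that by (rule \<kappa>1)
    show "F \<in> Y \<and> hdeg Y F = 3" if "?z F \<noteq> 0" for F
      using z that unfolding chains_le_def by blast
    show "bdry Y \<epsilon> ?z = (\<lambda>_. 0)" by (rule bdry_bdry_face[OF H(1)])
  qed
  moreover have "H \<noteq> {}" using H(2) hdeg_empty[OF poly] by auto
  then obtain G where G: "facet Y H G"
    using exists_facet_above[OF finX H(1) polyhedral_finite(3)[OF poly]] by blast
  moreover have "?z G \<noteq> 0"
    unfolding bdry_single[OF finX H(1)] using G incidence_facet[OF inc G] by auto
  ultimately show False by simp
qed

lemma cells_eq: "Y = cells d missing"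
proof (intro equalityI subsetI)
  fix F assume F: "F \<in> Y"
  consider "hdeg Y F = 0" | "hdeg Y F = 1" | "hdeg Y F = 2" | "hdeg Y F = 3"
    using hdeg_le_3[OF F] by linarith
  then show "F \<in> cells d missing"
  proof cases
    case 1
    then have "F = {}" using hdeg_eq_0_iff[OF poly F] by blast
    then show ?thesis by (simp add: cells_intros)
  next
    case 2
    then show ?thesis using hdeg1_cases[OF F] by (auto intro: cells_intros)
  next
    case 3
    then show ?thesis using hdeg2_cases[OF F] by (auto intro: cells_intros)
  next
    case 4
    then have "F \<in> {F \<in> Y. hdeg Y F = 3}" using F by simp
    then obtain u where "size u + 1 = d" "F = region missing u" unfolding regions_eq by blast
    then show ?thesis using cells_intros(4)[of u d missing] by (simp only:)
  qed
next
  fix F assume "F \<in> cells d missing"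
  then show "F \<in> Y"
  proof (cases rule: cells_cases)
    case empty
    then show ?thesis using polyhedral_finite(3)[OF poly] by simp
  next
    case (vertex a)
    then show ?thesis using vertex_mem by simp
  next
    case (edge u t)
    then show ?thesis using edge_cell by simp
  next
    case (region u)
    then show ?thesis using region_mem by simp
  qed
qed

end

section \<open>Minimal resolutions and edge choices\<close>

lemma Delta_cells: "edge_choice d c \<Longrightarrow> d \<ge> 1 \<Longrightarrow> Delta d c = cells d (removed c)"
  unfolding cells_def by (rule Delta_eq)

text \<open>Only the values of \<open>rm\<close> at monomials of degree d - 2 enter; this bridges
  functions that agree just there, such as \<open>removed c\<close> for a choice built from
  \<open>rm\<close>.\<close>

lemma cells_cong:
  assumes "\<And>u t. size u + 1 = d \<Longrightarrow> owns rm u t \<longleftrightarrow> owns rm' u t"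
  shows "cells d rm = cells d rm'"
proof -
  have "region rm u = region rm' u" if "size u + 1 = d" for u
    using assms[OF that] by (simp add: region_def)
  then have "region rm ` {u. size u + 1 = d} = region rm' ` {u. size u + 1 = d}"
    by (intro image_cong) auto
  moreover have "{edge u t | u t. size u + 1 = d \<and> \<not> owns rm u t} = {edge u t | u t. size u + 1 = d \<and> \<not> owns rm' u t}"
  proof -
    have "size u + 1 = d \<and> \<not> owns rm u t \<longleftrightarrow> size u + 1 = d \<and> \<not> owns rm' u t" for u t
      using assms[of u t] by blast
    then show ?thesis by (simp only:)
  qed
  ultimately show ?thesis unfolding cells_def by (simp only:)
qed

lemma cells_eq_Delta:
  assumes d: "d \<ge> 1"
  shows "\<exists>c. edge_choice d c \<and> Delta d c = cells d rm"
proof -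
  define c where "c w = edge (add_mset (rm w) w) (rm w)" for w
  have "c w \<subseteq> down_triangle w" for w
    unfolding c_def edge_in_down_triangle down_triangle_eq by blast
  then have c: "edge_choice d c"
    by (simp add: edge_choice_def c_def card_edge)
  have "removed c w = rm w" if "size w + 2 = d" for w
    using removed_edge[OF c that] by (simp add: c_def edge_eq_iff)
  then have "owns (removed c) u t \<longleftrightarrow> owns rm u t" if "size u + 1 = d" for u t
    using that by (auto simp: owns_def size_Suc_Diff1)
  then have "cells d (removed c) = cells d rm" by (rule cells_cong)
  then show ?thesis using c Delta_cells[OF c d] by auto
qed

lemma standard_generator_labeling:
  "generator_labeling d (standard_polarization d :: (xyz \<times> nat, 'k::field) mpoly set) polarize"
  unfolding generator_labeling_def min_gens_standard_polarization monomials_def bij_betw_def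
  by (intro conjI ballI inj_on_subset[OF inj_polarize] refl) simp_all

lemma minimal_resolutionD:
  fixes lab :: "'v \<Rightarrow> 'x multiset" and J :: "('x, 'k::field) mpoly set"
  assumes "minimal_resolution TYPE('a::euclidean_space) TYPE('k) X \<epsilon> lab"
    and J: "J = Idl\<^bsub>poly_ring UNIV\<^esub> ((\<lambda>v. mon (lab v)) ` \<Union>X)"
  shows "minimal_cellular_resolution TYPE('a) UNIV X \<epsilon> lab J"
proof -
  interpret minimal_resolution "TYPE('a)" "TYPE('k)" X \<epsilon> lab by fact
  have A: "\<forall>v\<in>\<Union>X. set_mset (lab v) \<subseteq> UNIV" by simp
  show ?thesis
    unfolding minimal_cellular_resolution_iff[OF poly inc A] by (intro conjI allI impI J acyclic label_neq)
qed

text \<open>The labels generate the power of the maximal ideal and form an antichain, so each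
  minimal generator is a label and no label is a proper multiple of one.\<close>

lemma minimal_resolution_labels:
  fixes lab :: "'v \<Rightarrow> 'x multiset"
  assumes res: "minimal_cellular_resolution TYPE('a::euclidean_space) UNIV X \<epsilon> lab (irrelevant_power UNIV d :: ('x, 'k::field) mpoly set)"
  shows "bij_betw lab (\<Union>X) {a. size a = d}"
proof -
  interpret minimal_resolution "TYPE('a)" "TYPE('k)" X \<epsilon> lab by (rule minimal_resolutionI[OF res])
  have "(irrelevant_power UNIV d :: ('x, 'k) mpoly set) = Idl\<^bsub>poly_ring UNIV\<^esub> ((\<lambda>v. mon (lab v)) ` \<Union>X)"
    by (rule minimal_cellular_resolution_complex(4)[OF res])
  also have "\<dots> = monomial_span UNIV (lab ` \<Union>X)"
    by (subst genideal_monomials[symmetric]) (simp_all add: image_image)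
  finally have "(mon a :: ('x, 'k) mpoly) \<in> irrelevant_power UNIV d \<longleftrightarrow> (mon a :: ('x, 'k) mpoly) \<in> monomial_span UNIV (lab ` \<Union>X)" for a
    by simp
  then have mem: "d \<le> size a \<longleftrightarrow> (\<exists>v\<in>\<Union>X. lab v \<subseteq># a)" for a
    by (simp add: irrelevant_power_eq monomial_span_def)
  have single: "{v} \<in> X" if "v \<in> \<Union>X" for v using that polyhedral_finite(4)[OF poly] by blast
  have anti: "v = v'" if "v \<in> \<Union>X" "v' \<in> \<Union>X" "lab v \<subseteq># lab v'" for v v'
    by (rule labels_antichain[OF single[OF that(1)] single[OF that(2)] that(3)])
  have size: "size (lab v) = d" if v: "v \<in> \<Union>X" for v
  proof -
    have "d \<le> size (lab v)" using mem v by blast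
    then obtain a where a: "a \<subseteq># lab v" "size a = d" by (rule subset_mset_of_size)
    then obtain v' where v': "v' \<in> \<Union>X" "lab v' \<subseteq># a" using mem[of a] by auto
    then have "v' = v" using anti[OF v'(1) v] a(1) subset_mset.order_trans by blast
    then have "lab v = a" using v'(2) a(1) by (simp add: subset_mset.antisym)
    then show ?thesis using a(2) by simp
  qed
  have "lab ` \<Union>X = {a. size a = d}"
  proof (intro equalityI subsetI)
    fix a :: "'x multiset" assume "a \<in> {a. size a = d}"
    then obtain v where v: "v \<in> \<Union>X" "lab v \<subseteq># a" using mem[of a] by auto
    then have "lab v = a" using size[OF v(1)] \<open>a \<in> {a. size a = d}\<close> by (intro subset_mset_size_eq) auto
    with v(1) show "a \<in> lab ` \<Union>X" by blast
  qed (use size in auto)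
  moreover have "inj_on lab (\<Union>X)" using anti by (auto simp: inj_on_def)
  ultimately show ?thesis by (simp add: bij_betw_def)
qed

lemma minimal_resolution_is_Delta:
  fixes lab :: "'v \<Rightarrow> xyz multiset"
  assumes d: "d \<ge> 1"
    and res: "minimal_cellular_resolution TYPE('a::euclidean_space) UNIV X \<epsilon> lab (irrelevant_power UNIV d :: (xyz, 'k::field) mpoly set)"
  shows "\<exists>c \<epsilon>'. edge_choice d c \<and>
    minimal_cellular_resolution TYPE(real \<times> real) UNIV (Delta d c) \<epsilon>' id (irrelevant_power UNIV d :: (xyz, 'k) mpoly set) \<and>
    labeled_iso X \<epsilon> lab (Delta d c) \<epsilon>' id lab"
proof -
  have R: "minimal_resolution TYPE('a) TYPE('k) X \<epsilon> lab" by (rule minimal_resolutionI[OF res])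
  from minimal_resolution_labels[OF res] have inj: "inj_on lab (\<Union>X)" and im: "lab ` \<Union>X = {a. size a = d}"
    by (auto simp: bij_betw_def)
  define Y where "Y = (`) lab ` X"
  define \<epsilon>' where "\<epsilon>' F G = \<epsilon> (inv_into X ((`) lab) F) (inv_into X ((`) lab) G)" for F G
  have \<epsilon>': "\<epsilon>' (lab ` F) (lab ` G) = \<epsilon> F G" if "F \<in> X" "G \<in> X" for F G
    using inv_into_f_f[OF inj_on_image_cells[OF inj]] that by (simp add: \<epsilon>'_def)
  have RY: "minimal_resolution TYPE('a) TYPE('k) Y \<epsilon>' id"
    unfolding Y_def by (rule minimal_resolution_image[OF R inj \<epsilon>'])
  have UY: "\<Union>Y = {a. size a = d}" unfolding Y_def im[symmetric] by (rule image_Union[symmetric])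
  interpret monomial_resolution "TYPE('a)" "TYPE('k)" Y \<epsilon>' d
    by (rule monomial_resolution.intro[OF RY]) (unfold_locales, rule UY)
  obtain c where c: "edge_choice d c" "Delta d c = Y" 
    using cells_eq_Delta[OF d, of missing] unfolding cells_eq[symmetric] by (elim exE conjE)
  \<comment> \<open>The given realizations live in an arbitrary Euclidean space. As the faces are
    those of \<open>cells\<close>, polygons in the plane can replace them.\<close>
  have poly2: "polyhedral_complex TYPE(real \<times> real) Y"
    using polyhedral_cells[of d missing] unfolding cells_eq[symmetric] .
  have "minimal_resolution TYPE(real \<times> real) TYPE('k) Y \<epsilon>' id"
    by (rule minimal_resolution.intro[OF poly2 inc acyclic label_neq])
  then have "minimal_cellular_resolution TYPE(real \<times> real) UNIV Y \<epsilon>' id (irrelevant_power UNIV d :: (xyz, 'k) mpoly set)"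
    by (rule minimal_resolutionD) (simp add: UY irrelevant_power_genideal)
  moreover have "labeled_iso X \<epsilon> lab Y \<epsilon>' id lab"
    unfolding labeled_iso_def using inj \<epsilon>' by (auto simp: Y_def)
  ultimately show ?thesis using c(1) unfolding c(2)[symmetric] by (intro exI[of _ c] exI[of _ \<epsilon>'] conjI)
qed

theorem theorem2p1:
  fixes d :: nat
  assumes "d \<ge> 1"
  shows "(\<forall>c. edge_choice d c \<longrightarrow>
      (\<exists>r (I :: (xyz \<times> nat, 'k::field) mpoly set) g \<epsilon>.
        polarization r I (irrelevant_power UNIV d) \<and>
        generator_labeling d I g \<and>
        minimal_cellular_resolution TYPE(real \<times> real) (polvars r) (Delta d c) \<epsilon> g I \<and>
        minimal_cellular_resolution TYPE(real \<times> real) UNIV (Delta d c) \<epsilon> (\<lambda>u. depol_mon (g u))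
          (irrelevant_power UNIV d :: (xyz, 'k) mpoly set)))
    \<and> (\<forall>(X :: 'v set set) \<epsilon> lab.
        minimal_cellular_resolution TYPE('a::euclidean_space) UNIV X \<epsilon> lab
          (irrelevant_power UNIV d :: (xyz, 'k) mpoly set) \<longrightarrow>
        (\<exists>c r (I :: (xyz \<times> nat, 'k) mpoly set) g \<epsilon>' \<phi>.
          edge_choice d c \<and>
          polarization r I (irrelevant_power UNIV d) \<and>
          generator_labeling d I g \<and>
          minimal_cellular_resolution TYPE(real \<times> real) (polvars r) (Delta d c) \<epsilon>' g I \<and>
          labeled_iso X \<epsilon> lab (Delta d c) \<epsilon>' (\<lambda>u. depol_mon (g u)) \<phi>))"
proof -
  let ?I = "standard_polarization d :: (xyz \<times> nat, 'k) mpoly set"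
  let ?r = "\<lambda>_ :: xyz. d"
  have id: "(\<lambda>u :: xyz multiset. depol_mon (polarize u)) = id" by (rule ext) simp
  note pol = standard_polarization_polarization[OF assms, where 'x = xyz and 'k = 'k] standard_generator_labeling[of d, where 'k = 'k]
  \<comment> \<open>Polarizing changes the labels only: the cells and the incidence function are the
    same on both sides, so one lemma serves both directions.\<close>
  have polarized: "minimal_cellular_resolution TYPE(real \<times> real) (polvars ?r) (Delta d c) \<epsilon> polarize ?I"
    if "edge_choice d c" "minimal_cellular_resolution TYPE(real \<times> real) UNIV (Delta d c) \<epsilon> id (irrelevant_power UNIV d :: (xyz, 'k) mpoly set)" for c \<epsilon>
    by (rule minimal_resolution_polarize[OF that(2)]) (simp add: Delta_cells[OF that(1) assms] cells_Union)
  show ?thesis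
  proof (intro conjI allI impI)
    fix c assume c: "edge_choice d c"
    have res: "minimal_cellular_resolution TYPE(real \<times> real) UNIV (Delta d c) (cell_incidence (removed c)) id (irrelevant_power UNIV d :: (xyz, 'k) mpoly set)"
      unfolding Delta_cells[OF c assms] by (rule cells_minimal_resolution[OF assms])
    show "\<exists>r (I :: (xyz \<times> nat, 'k) mpoly set) g \<epsilon>.
        polarization r I (irrelevant_power UNIV d) \<and> generator_labeling d I g \<and>
        minimal_cellular_resolution TYPE(real \<times> real) (polvars r) (Delta d c) \<epsilon> g I \<and>
        minimal_cellular_resolution TYPE(real \<times> real) UNIV (Delta d c) \<epsilon> (\<lambda>u. depol_mon (g u))
          (irrelevant_power UNIV d :: (xyz, 'k) mpoly set)"
      by (intro exI[of _ ?r] exI[of _ ?I] exI[of _ polarize] exI[of _ "cell_incidence (removed c)"] conjI pol polarized[OF c res])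
        (simp only: id res)
  next
    fix X :: "'v set set" and \<epsilon> lab
    assume "minimal_cellular_resolution TYPE('a) UNIV X \<epsilon> lab (irrelevant_power UNIV d :: (xyz, 'k) mpoly set)"
    from minimal_resolution_is_Delta[OF assms this] obtain c \<epsilon>' where
      c: "edge_choice d c" and res: "minimal_cellular_resolution TYPE(real \<times> real) UNIV (Delta d c) \<epsilon>' id (irrelevant_power UNIV d :: (xyz, 'k) mpoly set)"
        "labeled_iso X \<epsilon> lab (Delta d c) \<epsilon>' id lab"
      by blast
    show "\<exists>c r (I :: (xyz \<times> nat, 'k) mpoly set) g \<epsilon>' \<phi>.
          edge_choice d c \<and> polarization r I (irrelevant_power UNIV d) \<and> generator_labeling d I g \<and>
          minimal_cellular_resolution TYPE(real \<times> real) (polvars r) (Delta d c) \<epsilon>' g I \<and>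
          labeled_iso X \<epsilon> lab (Delta d c) \<epsilon>' (\<lambda>u. depol_mon (g u)) \<phi>"
      by (intro exI[of _ c] exI[of _ ?r] exI[of _ ?I] exI[of _ polarize] exI[of _ \<epsilon>'] exI[of _ lab] conjI c pol polarized[OF c res(1)])
        (simp only: id res(2))
  qed
qed

end
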